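(* Consider the Weighted Recursive Tree with vertex-weights $(W_i)_{i\in\mathbb{N}}$ that are i.i.d. copies of a random variable $W$ with a $\mathrm{Beta}(\alpha,\beta)$ distribution for some $\alpha,\beta>0$, i.e. $\mathbb{P}(W\ge x)=\int_x^1\frac{\Gamma(\alpha+\beta)}{\Gamma(\alpha)\Gamma(\beta)}s^{\alpha-1}(1-s)^{\beta-1}\,\mathrm{d}s$ for $x\in[0,1]$. Let $\theta:=1+\mathbb{E}[W]$, $\mu:=1-(\theta-1)/(\theta\log\theta)$, $\sigma^2:=1-(\theta-1)^2/(\theta^2\log\theta)$ and $c_{\alpha,\beta,\theta}:=\frac{\Gamma(\alpha+\beta)}{\Gamma(\alpha)}(1-\theta^{-1})^{-\beta}$. Let $v^1,\dots,v^n$ be the vertices of the tree $\mathcal{G}_n$ in decreasing order of in-degree (ties split uniformly at random), and let $d_n^i$ and $\ell_n^i$ denote the in-degree and label of $v^i$, respectively. Fix $\varepsilon\in[0,1]$, let $$\varepsilon_n:=(\log_\theta n-\beta\log_\theta\log_\theta n)-\lfloor\log_\theta n-\beta\log_\theta\log_\theta n\rfloor,$$ and let $(n_j)_{j\in\mathbb{N}}$ be a positive, diverging integer sequence such that $\varepsilon_{n_j}\to\varepsilon$ as $j\to\infty$. Let $(P_i)_{i\in\mathbb{N}}$ be the points, in decreasing order, of a Poisson point process $\mathcal{P}$ on $\mathbb{R}$ with intensity measure $c_{\alpha,\beta,\theta}\theta^{-x}\log\theta\,\mathrm{d}x$, and let $(M_i)_{i\in\mathbb{N}}$ be a sequence of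 i.i.d. standard normal random variables (independent of $\mathcal{P}$). Then, as $j\to\infty$, $$\Big(d_{n_j}^i-\lfloor\log_\theta n_j-\beta\log_\theta\log_\theta n_j\rfloor,\ \frac{\log(\ell_{n_j}^i)-\mu\log n_j}{\sqrt{(1-\sigma^2)\log n_j}}\Big)_{i\in[n_j]}\ \longrightarrow\ \big(\lfloor P_i+\varepsilon\rfloor,\ M_i\big)_{i\in\mathbb{N}}\quad\text{in distribution.}$$
   Context: Notation: $[n]=\{1,\dots,n\}$. Weighted Recursive Tree (WRT): let $(W_i)_{i\ge1}$ be i.i.d. copies of $W$, $\mathbb{P}(W>0)=1$, and $S_n:=\sum_{i=1}^nW_i$. $\mathcal{G}_1$ is a single vertex $1$ (the root) with weight $W_1$. For $n\ge1$, a new vertex $n+1$ with weight $W_{n+1}$ is added and, conditionally on $\mathcal{G}_n$ (and the weights), is connected by one directed edge to a vertex $i\in[n]$ chosen with probability $W_i/S_n$; the result is $\mathcal{G}_{n+1}$. Vertex labels are the integers $1,\dots,n$. Convergence in distribution of the (finite but growing) sequences to an infinite sequence is understood as convergence in distribution of the first $K$ entries, jointly, for every fixed $K\in\mathbb{N}$. *)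

theory Defs
  imports "HOL-Probability.Probability" "Graph_Theory.Digraph"
begin

section \<open>Weighted recursive trees\<close>

text \<open>
  A realisation of the tree process is described by the function \<open>pa\<close>, where \<open>pa m\<close> is
  the vertex to which the vertex \<open>m \<ge> 2\<close> is attached. The edge created together with vertex
  \<open>m\<close> points from \<open>m\<close> to \<open>pa m\<close> and is itself named \<open>m\<close>, so that the in-degree of a vertex
  is the number of its children.
\<close>

definition wrt_graph :: "(nat \<Rightarrow> nat) \<Rightarrow> nat \<Rightarrow> (nat, nat) pre_digraph" where
  "wrt_graph pa n = \<lparr> verts = {1..n}, arcs = {2..n}, tail = (\<lambda>m. m), head = pa \<rparr>"

text \<open>
  The sigma-algebra \<open>wrt_history M W pa n\<close> is generated by all
  weights (including those of vertices added later) and by the tree on \<open>n\<close> vertices.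
  Conditioning on all weights makes the attachment of vertex \<open>n + 1\<close> independent of
  the weights of the vertices \<open>n + 1, n + 2, \<dots>\<close>.
\<close>

definition wrt_history ::
    "'a measure \<Rightarrow> (nat \<Rightarrow> 'a \<Rightarrow> real) \<Rightarrow> (nat \<Rightarrow> 'a \<Rightarrow> nat) \<Rightarrow> nat \<Rightarrow> 'a measure" where
  "wrt_history M W pa n =
     vimage_algebra (space M) (\<lambda>\<omega>. (\<lambda>k\<in>{1..}. W k \<omega>, \<lambda>m\<in>{2..n}. pa m \<omega>))
       ((\<Pi>\<^sub>M k\<in>{1..}. (borel :: real measure)) \<Otimes>\<^sub>M (\<Pi>\<^sub>M m\<in>{2..n}. count_space (UNIV :: nat set)))"

locale weighted_recursive_tree = prob_space M
  for M :: "'a measure" +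
  fixes D :: "real measure" and W :: "nat \<Rightarrow> 'a \<Rightarrow> real" and pa :: "nat \<Rightarrow> 'a \<Rightarrow> nat"
  assumes weight_pos: "AE w in D. 0 < w"
    and weights_indep: "indep_vars (\<lambda>_. borel) W {1..}"
    and weight_law: "1 \<le> i \<Longrightarrow> distr M borel (W i) = D"
    and parent_measurable: "2 \<le> m \<Longrightarrow> pa m \<in> measurable M (count_space UNIV)"
    and attachment: "i \<in> {1..n} \<Longrightarrow>
      AE \<omega> in M. real_cond_exp M (wrt_history M W pa n)
                   (indicator {\<omega> \<in> space M. pa (Suc n) \<omega> = i}) \<omega>
                 = W i \<omega> / (\<Sum>k=1..n. W k \<omega>)"

text \<open>The enumerations of the vertices of a finite digraph in decreasing order of in-degree.\<close>

definition degree_orderings :: "('v, 'e) pre_digraph \<Rightarrow> (nat \<Rightarrow> 'v) set" where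
  "degree_orderings G =
     {p \<in> extensional {1..card (verts G)}.
        bij_betw p {1..card (verts G)} (verts G) \<and>
        (\<forall>i\<in>{1..card (verts G)}. \<forall>j\<in>{1..card (verts G)}.
           i \<le> j \<longrightarrow> in_degree G (p j) \<le> in_degree G (p i))}"

text \<open>
  \<open>v n i\<close> is the vertex of rank \<open>i\<close> in the tree on \<open>n\<close> vertices. Splitting ties uniformly at
  random means that, given the weighted tree, all orderings of the vertices by
  decreasing in-degree are equally likely.
\<close>

locale degree_ordered_wrt = weighted_recursive_tree M D W pa
  for M :: "'a measure" and D W pa +
  fixes v :: "nat \<Rightarrow> nat \<Rightarrow> 'a \<Rightarrow> nat"
  assumes ordering_measurable: "i \<in> {1..n} \<Longrightarrow> v n i \<in> measurable M (count_space UNIV)"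
    and ordering_uniform: "p \<in> extensional {1..n} \<Longrightarrow>
      AE \<omega> in M. real_cond_exp M (wrt_history M W pa n)
                   (indicator {\<omega> \<in> space M. (\<lambda>i\<in>{1..n}. v n i \<omega>) = p}) \<omega>
                 = indicator (degree_orderings (wrt_graph (\<lambda>m. pa m \<omega>) n)) p
                   / card (degree_orderings (wrt_graph (\<lambda>m. pa m \<omega>) n))"

definition beta_distribution :: "real \<Rightarrow> real \<Rightarrow> real measure" where
  "beta_distribution \<alpha> \<beta> = density lborel (\<lambda>s. ennreal (indicator {0<..<1} s *
     (Gamma (\<alpha> + \<beta>) / (Gamma \<alpha> * Gamma \<beta>) * s powr (\<alpha> - 1) * (1 - s) powr (\<beta> - 1))))"


section \<open>Poisson point processes\<close>

definition poisson_point_process :: "'b measure \<Rightarrow> 'c measure \<Rightarrow> ('b \<Rightarrow> 'c measure) \<Rightarrow> bool" where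
  "poisson_point_process R \<nu> N \<longleftrightarrow>
     (\<forall>\<omega>\<in>space R. sets (N \<omega>) = sets \<nu>) \<and>
     (\<forall>A\<in>sets \<nu>. (\<lambda>\<omega>. emeasure (N \<omega>) A) \<in> borel_measurable R) \<and>
     (\<forall>A\<in>sets \<nu>. emeasure \<nu> A < \<infinity> \<longrightarrow>
        (\<forall>k::nat. measure R {\<omega> \<in> space R. emeasure (N \<omega>) A = of_nat k}
                 = exp (- measure \<nu> A) * measure \<nu> A ^ k / fact k)) \<and>
     (\<forall>A\<in>sets \<nu>. emeasure \<nu> A = \<infinity> \<longrightarrow> (AE \<omega> in R. emeasure (N \<omega>) A = \<infinity>)) \<and>
     (\<forall>A. \<forall>I::nat set. finite I \<longrightarrow> A ` I \<subseteq> sets \<nu> \<longrightarrow> disjoint_family_on A I \<longrightarrow>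
        prob_space.indep_vars R (\<lambda>_. borel) (\<lambda>i \<omega>. emeasure (N \<omega>) (A i)) I)"

text \<open>
  \<open>p 1 \<ge> p 2 \<ge> \<dots>\<close> are the points, with multiplicity, of the counting measure \<open>\<xi>\<close>,
  i.e. \<open>\<xi>\<close> is the sum of the Dirac measures at the \<open>p i\<close>, \<open>i \<ge> 1\<close>.
\<close>

definition points_in_decreasing_order :: "real measure \<Rightarrow> (nat \<Rightarrow> real) \<Rightarrow> bool" where
  "points_in_decreasing_order \<xi> p \<longleftrightarrow>
     antimono_on {1..} p \<and> \<xi> = distr (count_space {1..}) borel p"


section \<open>Convergence in distribution in a topological space\<close>

text \<open>The library has this notion (\<open>weak_conv_m\<close>) only for real-valued random variables.\<close>

definition converges_in_distribution ::
    "'c topology \<Rightarrow> 'a measure \<Rightarrow> (nat \<Rightarrow> 'a \<Rightarrow> 'c) \<Rightarrow> 'b measure \<Rightarrow> ('b \<Rightarrow> 'c) \<Rightarrow> bool" where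
  "converges_in_distribution T M X R Y \<longleftrightarrow>
     (\<forall>f. continuous_map T euclideanreal f \<and> bounded (f ` topspace T) \<longrightarrow>
        (\<lambda>j. \<integral>\<omega>. f (X j \<omega>) \<partial>M) \<longlonglongrightarrow> (\<integral>\<omega>. f (Y \<omega>) \<partial>R))"

text \<open>
  Sequences are indexed from 1: the first \<open>K\<close> entries converge jointly, for every \<open>K\<close>.
\<close>

definition sequence_converges_in_distribution ::
    "'a measure \<Rightarrow> (nat \<Rightarrow> nat \<Rightarrow> 'a \<Rightarrow> 'c::topological_space) \<Rightarrow>
     'b measure \<Rightarrow> (nat \<Rightarrow> 'b \<Rightarrow> 'c) \<Rightarrow> bool" where
  "sequence_converges_in_distribution M X R Y \<longleftrightarrow>
     (\<forall>K::nat. converges_in_distribution (product_topology (\<lambda>_. euclidean) {1..K})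
        M (\<lambda>j \<omega>. \<lambda>i\<in>{1..K}. X j i \<omega>) R (\<lambda>\<omega>. \<lambda>i\<in>{1..K}. Y i \<omega>))"


section \<open>Consistency checks\<close>

lemma prob_space_beta_distribution:
  assumes "\<alpha> > 0" "\<beta> > 0"
  shows "prob_space (beta_distribution \<alpha> \<beta>)"
proof
  define C where "C = Gamma (\<alpha> + \<beta>) / (Gamma \<alpha> * Gamma \<beta>)"
  have C: "C > 0" "C * Beta \<alpha> \<beta> = 1"
    using Gamma_real_pos[OF assms(1)] Gamma_real_pos[OF assms(2)]
      Gamma_real_pos[of "\<alpha> + \<beta>"] assms
    by (simp_all add: C_def Beta_def less_imp_neq[symmetric])
  let ?g = "\<lambda>s::real. C * (s powr (\<alpha> - 1) * (1 - s) powr (\<beta> - 1))"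
  have "((\<lambda>s. s powr (\<alpha> - 1) * (1 - s) powr (\<beta> - 1)) has_integral Beta \<alpha> \<beta>) {0<..<1}"
    using has_integral_Beta_real[OF assms] by (simp add: has_integral_Icc_iff_Ioo)
  hence "(?g has_integral C * Beta \<alpha> \<beta>) {0<..<1}"
    by (rule has_integral_mult_right)
  hence I: "(?g has_integral 1) {0<..<1}" by (simp add: C)
  have "(\<integral>\<^sup>+s. ennreal (?g s) * indicator {0<..<1} s \<partial>lborel) = ennreal 1"
    using C by (intro nn_integral_has_integral_lebesgue'[OF _ I]) auto
  moreover have "emeasure (beta_distribution \<alpha> \<beta>) (space (beta_distribution \<alpha> \<beta>))
     = (\<integral>\<^sup>+s. ennreal (?g s) * indicator {0<..<1} s \<partial>lborel)"
    unfolding beta_distribution_def C_def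
    by (subst emeasure_density, simp, simp)
       (auto intro!: nn_integral_cong simp: indicator_def mult_ac)
  ultimately show "emeasure (beta_distribution \<alpha> \<beta>) (space (beta_distribution \<alpha> \<beta>)) = 1"
    by simp
qed

context weighted_recursive_tree
begin

lemma weight_measurable: "1 \<le> k \<Longrightarrow> W k \<in> borel_measurable M"
  using weights_indep by (auto simp: indep_vars_def)

lemma subalgebra_history: "subalgebra M (wrt_history M W pa n)"
proof -
  have "(\<lambda>\<omega>. (\<lambda>k\<in>{1..}. W k \<omega>, \<lambda>m\<in>{2..n}. pa m \<omega>)) \<in>
      measurable M ((\<Pi>\<^sub>M k\<in>{1..}. (borel :: real measure)) \<Otimes>\<^sub>M
                    (\<Pi>\<^sub>M m\<in>{2..n}. count_space (UNIV :: nat set)))"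
    using weight_measurable parent_measurable
    by (intro measurable_Pair measurable_restrict) auto
  thus ?thesis
    unfolding wrt_history_def subalgebra_def
    by (auto simp: sets_vimage_algebra intro!: sets.sigma_sets_subset measurable_sets)
qed

lemma parent_in_range: "AE \<omega> in M. \<forall>n\<ge>1. pa (Suc n) \<omega> \<in> {1..n}"
proof -
  have "AE \<omega> in M. pa (Suc n) \<omega> \<in> {1..n}" if n: "n \<ge> 1" for n
  proof -
    interpret H: finite_measure_subalgebra M "wrt_history M W pa n"
      by unfold_locales (rule subalgebra_history)
    define E where "E i = {\<omega> \<in> space M. pa (Suc n) \<omega> = i}" for i
    have E: "E i \<in> events" for i
      using measurable_sets[OF parent_measurable[of "Suc n"], of "{i}"] n
      by (simp add: E_def vimage_def Int_def conj_commute)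
    have int: "integrable M (indicator (E i) :: 'a \<Rightarrow> real)" for i
      using E by (simp add: emeasure_eq_measure)
    let ?r = "\<lambda>i. real_cond_exp M (wrt_history M W pa n) (indicator (E i))"
    have pos: "AE \<omega> in M. 0 < W i \<omega>" if "i \<ge> 1" for i
    proof -
      have "AE w in distr M borel (W i). 0 < w"
        unfolding weight_law[OF that] by (rule weight_pos)
      thus ?thesis using weight_measurable[OF that] by (simp add: AE_distr_iff)
    qed
    have pos': "AE \<omega> in M. \<forall>i\<in>{1..n}. 0 < W i \<omega>"
      using pos by (intro AE_finite_allI) auto
    have att: "AE \<omega> in M. \<forall>i\<in>{1..n}. ?r i \<omega> = W i \<omega> / (\<Sum>k=1..n. W k \<omega>)"
      using attachment by (intro AE_finite_allI) (auto simp: E_def)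
    have one: "AE \<omega> in M. (\<Sum>i=1..n. ?r i \<omega>) = 1"
      using pos' att
    proof eventually_elim
      case (elim \<omega>)
      have "0 < (\<Sum>k=1..n. W k \<omega>)" using elim n by (intro sum_pos) auto
      thus ?case using elim by (simp flip: sum_divide_distrib)
    qed
    have "(\<Sum>i=1..n. prob (E i)) = (\<Sum>i=1..n. \<integral>\<omega>. ?r i \<omega> \<partial>M)"
      using H.real_cond_exp_int(2)[OF int] E by (simp add: Int_absorb1 sets.sets_into_space)
    also have "\<dots> = (\<integral>\<omega>. (\<Sum>i=1..n. ?r i \<omega>) \<partial>M)"
      using H.real_cond_exp_int(1)[OF int] by simp
    also have "\<dots> = (\<integral>\<omega>. 1 \<partial>M)"
      using one H.real_cond_exp_int(1)[OF int] by (intro integral_cong_AE) auto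
    finally have "(\<Sum>i=1..n. prob (E i)) = 1" by (simp add: prob_space)
    moreover have "prob (\<Union>i\<in>{1..n}. E i) = (\<Sum>i=1..n. prob (E i))"
      using E by (intro finite_measure_finite_Union) (auto simp: disjoint_family_on_def E_def)
    ultimately have "prob (\<Union>i\<in>{1..n}. E i) = 1" by simp
    hence "AE \<omega> in M. \<omega> \<in> (\<Union>i\<in>{1..n}. E i)"
      using E by (subst (asm) prob_eq_1) auto
    thus ?thesis by eventually_elim (auto simp: E_def)
  qed
  thus ?thesis by (auto simp: AE_all_countable)
qed

end

end

theory Submission
  imports Defs "HOL-Real_Asymp.Real_Asymp"
begin

text \<open>
  Given all weights the parents of the vertices are independent, so the in-degree of vertex \<open>i\<close> is
  a sum of independent indicators. A Lindeberg argument, which exchanges the attachment steps one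
  after the other, replaces these degrees by independent Poisson variables with means
  \<open>lam * W i * ln (n / i)\<close>, where \<open>1 / lam\<close> is the mean weight. The Beta tail of \<open>W\<close> near \<open>1\<close> and the
  central limit theorem for the Erlang distribution then give the limit of the expected number of
  vertices with degree at least \<open>\<lfloor>a (n j)\<rfloor> + m\<close> whose normalised label lies in a given interval, hence
  the limit of the generating functional of the counts over all levels and all cells of a finite grid
  of labels. The Poisson process with independent normal marks has the same functional.

  The pattern formed by the levels and cells of the \<open>K\<close> top vertices is, given the tree, a uniformly
  chosen injective tuple with prescribed levels, so its probability is the expectation of one fixed
  bounded function of the counts; the same function appears for the Poisson process. Therefore all pattern
  probabilities converge, and refining the grid gives convergence in distribution.
\<close>

section \<open>Poisson tails\<close>

text \<open>The natural variable is the age \<open>ln (n / i)\<close>: for a uniform label it is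
  nearly a standard exponential time, and a Poisson process of rate \<open>c\<close> has
  \<open>k\<close> points before such a time with probability \<open>(c / (1 + c)) ^ k\<close>. At
  the maximal weight \<open>c = lam\<close> this is \<open>\<theta> powr (- k)\<close>; weights
  within order \<open>1 / k\<close> of 1 carry the mass and cost a factor
  \<open>k powr (- \<beta>)\<close>. The two factors dictate the centring \<open>a\<close>. The
  \<open>k\<close>-th of these points is then a Gamma variable of shape \<open>k\<close> and rate
  about \<open>1 + lam\<close>, which is where the constants of the label limit come from. The
  obstacle is that exchanging the attachment step at time \<open>m\<close> costs an error with
  factor \<open>1 / m ^ 2\<close>, so the exchange may only start at a positive power of
  \<open>n\<close>. Labels below this cutoff are excluded by exponential moments and a union bound,
  and the cutoff must stay below the labels of the top vertices. The functional uses the numbers of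
  vertices at or above each level. It is thus a decreasing step function of each degree, and its
  Poisson mean is monotone in the parameter; this allows random means to be sandwiched between
  deterministic multiples of the weights.\<close>

definition ptail :: "nat \<Rightarrow> real \<Rightarrow> real" where
  "ptail r L = 1 - (\<Sum>j<r. exp (- L) * L ^ j / fact j)"

lemma ptail_0 [simp]: "ptail 0 L = 1"
  by (simp add: ptail_def)

lemma ptail_Suc: "ptail (Suc r) L = ptail r L - exp (- L) * L ^ r / fact r"
  by (simp add: ptail_def)

lemma ptail_at_0: "r > 0 \<Longrightarrow> ptail r 0 = 0"
  by (induction r rule: nat_induct_non_zero) (auto simp: ptail_Suc)

text \<open>The Poisson masses add up to 1, so removing the first \<open>r\<close> of them leaves
  this series: \<open>ptail r L\<close> is the probability that a Poisson variable of mean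
  \<open>L\<close> is at least \<open>r\<close>.\<close>

lemma ptail_sums: "(\<lambda>j. exp (- L) * L ^ (j + r) / fact (j + r)) sums ptail r L"
proof -
  have "(\<lambda>j. exp (- L) * (L ^ j / fact j)) sums (exp (- L) * exp L)"
    using exp_converges[of L] by (intro sums_mult) (simp add: field_simps scaleR_conv_of_real)
  hence "(\<lambda>j. exp (- L) * L ^ j / fact j) sums 1" by (simp add: exp_minus)
  from sums_split_initial_segment[OF this, of r] show ?thesis
    by (simp add: ptail_def)
qed

lemma ptail_nonneg: "L \<ge> 0 \<Longrightarrow> ptail r L \<ge> 0"
  by (rule sums_le[OF _ sums_zero ptail_sums]) auto

lemma ptail_le_1: "L \<ge> 0 \<Longrightarrow> ptail r L \<le> 1"
  unfolding ptail_def by (simp add: sum_nonneg)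

lemma ptail_antimono:
  assumes "L \<ge> 0" "r \<le> s"
  shows "ptail s L \<le> ptail r L"
  using assms(2) by (rule lift_Suc_antimono_le[rotated]) (use assms in \<open>auto simp: ptail_Suc\<close>)

lemma ptail_deriv:
  "(ptail r has_real_derivative (if r = 0 then 0 else exp (- L) * L ^ (r - 1) / fact (r - 1))) (at L)"
proof (induction r)
  case 0
  have "ptail 0 = (\<lambda>_. 1)" by (rule ext) simp
  then show ?case by simp
next
  case (Suc r)
  have eq: "ptail (Suc r) = (\<lambda>L. ptail r L - exp (- L) * L ^ r / fact r)"
    by (rule ext) (simp add: ptail_Suc)
  show ?case unfolding eq
  proof (rule DERIV_cong[OF DERIV_diff[OF Suc.IH]])
    show "((\<lambda>L. exp (- L) * L ^ r / fact r) has_real_derivative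
           (exp (-L) * (real r * L ^ (r - 1)) / fact r - exp (- L) * L ^ r / fact r)) (at L)"
      by (auto intro!: derivative_eq_intros simp: field_simps)
    show "(if r = 0 then 0 else exp (- L) * L ^ (r - 1) / fact (r - 1)) -
          (exp (-L) * (real r * L ^ (r - 1)) / fact r - exp (- L) * L ^ r / fact r) =
          (if Suc r = 0 then 0 else exp (- L) * L ^ (Suc r - 1) / fact (Suc r - 1))"
    proof (cases r)
      case (Suc q)
      have "exp (- L) * (real (Suc q) * L ^ q) / fact (Suc q) = exp (- L) * L ^ q / fact q"
        by (simp del: of_nat_Suc)
      thus ?thesis using Suc by (simp del: of_nat_Suc fact_Suc)
    qed auto
  qed
qed

text \<open>The derivative is the Poisson mass at \<open>r - 1\<close>. As a difference of tails it
  also covers \<open>r = 0\<close>, where natural subtraction makes the two terms equal.\<close>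

lemma ptail_deriv_diff: "(ptail r has_real_derivative (ptail (r - 1) L - ptail r L)) (at L)"
  using ptail_deriv[of r L] by (cases r) (auto simp: ptail_Suc)

lemma isCont_ptail [continuous_intros]: "isCont (ptail r) L"
  using ptail_deriv DERIV_isCont by blast

lemma continuous_on_ptail: "continuous_on A (ptail r)"
  using isCont_ptail continuous_at_imp_continuous_on by blast

lemma measurable_ptail [measurable]: "ptail r \<in> borel_measurable borel"
  by (intro borel_measurable_continuous_onI continuous_on_ptail)

lemma measurable_ptail_comp [measurable (raw)]:
  "f \<in> borel_measurable M \<Longrightarrow> (\<lambda>x. ptail r (f x)) \<in> borel_measurable M"
  by (rule measurable_compose[OF _ measurable_ptail])

lemma ptail_mono:
  assumes "0 \<le> L" "L \<le> L'"
  shows "ptail r L \<le> ptail r L'"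
  using assms(2)
proof (rule DERIV_nonneg_imp_nondecreasing)
  fix x assume "L \<le> x"
  thus "\<exists>y. (ptail r has_real_derivative y) (at x) \<and> 0 \<le> y"
    using assms by (intro exI[of _ "if r = 0 then 0 else exp (- x) * x ^ (r - 1) / fact (r - 1)"] conjI)
      (use ptail_deriv[of r x] in auto)
qed

text \<open>Markov's inequality for \<open>x\<close> to the power of a Poisson variable, carried out
  term by term in the series.\<close>

lemma ptail_chernoff:
  assumes "L \<ge> 0" "x \<ge> 1"
  shows "x ^ r * ptail r L \<le> exp ((x - 1) * L)"
proof -
  have s1: "(\<lambda>j. x ^ r * (exp (- L) * L ^ (j + r) / fact (j + r))) sums (x ^ r * ptail r L)"
    by (intro sums_mult ptail_sums)
  have "(\<lambda>j. exp (- L) * ((x * L) ^ j / fact j)) sums (exp (- L) * exp (x * L))"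
    using exp_converges[of "x * L"] by (intro sums_mult) (simp add: field_simps scaleR_conv_of_real)
  hence s2: "(\<lambda>j. exp (- L) * ((x * L) ^ j / fact j)) sums exp ((x - 1) * L)"
    by (simp add: exp_add[symmetric] algebra_simps)
  hence s3: "(\<lambda>j. exp (- L) * ((x * L) ^ (j + r) / fact (j + r))) sums
         (exp ((x - 1) * L) - (\<Sum>i<r. exp (- L) * ((x * L) ^ i / fact i)))"
    by (rule sums_split_initial_segment)
  have "x ^ r * ptail r L \<le> exp ((x - 1) * L) - (\<Sum>i<r. exp (- L) * ((x * L) ^ i / fact i))"
  proof (rule sums_le[OF _ s1 s3])
    fix j
    have "x ^ r \<le> x ^ (j + r)" using assms by (intro power_increasing) auto
    hence "exp (- L) * L ^ (j + r) / fact (j + r) * x ^ r \<le> exp (- L) * L ^ (j + r) / fact (j + r) * x ^ (j + r)"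
      using assms by (intro mult_left_mono) auto
    thus "x ^ r * (exp (- L) * L ^ (j + r) / fact (j + r)) \<le> exp (- L) * ((x * L) ^ (j + r) / fact (j + r))"
      by (simp add: power_mult_distrib mult_ac)
  qed
  also have "\<dots> \<le> exp ((x - 1) * L)" using assms by (simp add: sum_nonneg)
  finally show ?thesis .
qed

section \<open>Poisson tails at an exponentially distributed age\<close>

text \<open>Let E be a standard exponential time, independent of a Poisson process of rate
  \<open>c\<close>. This is the probability that E exceeds \<open>T\<close> and that at least
  \<open>k\<close> points precede E, i.e. the integral of \<open>exp (- t) * ptail k (c * t)\<close>
  over t > \<open>T\<close>. The first summand is the case of \<open>k\<close> points by time
  \<open>T\<close>. Otherwise the \<open>k\<close>-th point lies after \<open>T\<close> and before
  E: probability \<open>(c / (1 + c)) ^ k\<close> times that of a Gamma variable of shape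
  \<open>k\<close> and rate \<open>1 + c\<close> exceeding \<open>T\<close>.\<close>

definition ltail :: "nat \<Rightarrow> real \<Rightarrow> real \<Rightarrow> real" where
  "ltail k c T = exp (- T) * ptail k (c * T) + (c / (1 + c)) ^ k * (1 - ptail k ((1 + c) * T))"

lemma ltail_deriv:
  assumes "c > 0"
  shows "(ltail k c has_real_derivative - exp (- T) * ptail k (c * T)) (at T)"
proof -
  let ?d = "\<lambda>L. if k = 0 then 0 else exp (- L) * L ^ (k - 1) / fact (k - 1) :: real"
  have "(ltail k c has_real_derivative
     - exp (- T) * ptail k (c * T) + exp (- T) * (?d (c * T) * c)
     - (c / (1 + c)) ^ k * (?d ((1 + c) * T) * (1 + c))) (at T)"
    unfolding ltail_def[abs_def]
    by (rule derivative_eq_intros DERIV_chain2[OF ptail_deriv] refl | simp)+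
  \<comment> \<open>For positive \<open>k\<close> both sides are
    \<open>exp (- (1 + c) * T) * c ^ k * T ^ (k - 1) / fact (k - 1)\<close>, so these contributions
    of the two summands cancel.\<close>
  moreover have "exp (- T) * (?d (c * T) * c) = (c / (1 + c)) ^ k * (?d ((1 + c) * T) * (1 + c))"
  proof (cases k)
    case (Suc r)
    have ring: "Q * (E * X / F * d) = E / F * (Q * (X * d))" for Q E X F d :: real by simp
    have "(c / (1 + c)) ^ Suc r * (((1 + c) * T) ^ r * (1 + c)) = (c * T) ^ r * c"
    proof -
      have "(c / (1 + c)) ^ r * ((1 + c) * T) ^ r = (c * T) ^ r"
        using assms by (simp flip: power_mult_distrib)
      moreover have "(c / (1 + c)) * (1 + c) = c" using assms by simp
      ultimately show ?thesis by (metis (no_types) mult.commute mult.left_commute power_Suc)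
    qed
    hence "(c / (1 + c)) ^ Suc r * (exp (- ((1 + c) * T)) * ((1 + c) * T) ^ r / fact r * (1 + c))
       = exp (- ((1 + c) * T)) / fact r * ((c * T) ^ r * c)"
      by (simp only: ring)
    also have "\<dots> = exp (- T) * (exp (- (c * T)) * (c * T) ^ r / fact r * c)"
    proof -
      have "exp (- ((1 + c) * T)) = exp (- T) * exp (- (c * T))"
        by (simp add: exp_add[symmetric] algebra_simps)
      thus ?thesis by simp
    qed
    finally show ?thesis unfolding Suc by (simp only: nat.distinct if_False diff_Suc_1)
  qed simp
  ultimately show ?thesis by simp
qed

text \<open>The difference is the integral of \<open>exp (- t) * ptail k (c * t)\<close> from
  \<open>A\<close> to \<open>B\<close>, and the second factor increases in t. These bounds on a
  single cell later make sums over labels telescope.\<close>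

lemma ltail_diff_bounds:
  assumes "c > 0" "0 \<le> A" "A \<le> B"
  shows "ptail k (c * A) * (exp (- A) - exp (- B)) \<le> ltail k c A - ltail k c B"
    and "ltail k c A - ltail k c B \<le> ptail k (c * B) * (exp (- A) - exp (- B))"
proof -
  have "ptail k (c * A) * (exp (- A) - exp (- A)) + ltail k c A \<ge>
        ptail k (c * A) * (exp (- A) - exp (- B)) + ltail k c B"
    using assms(3)
  proof (rule DERIV_nonpos_imp_nonincreasing)
    fix x assume x: "A \<le> x"
    have "((\<lambda>x. ptail k (c * A) * (exp (- A) - exp (- x)) + ltail k c x) has_real_derivative
       ptail k (c * A) * exp (- x) + (- exp (- x) * ptail k (c * x))) (at x)"
      by (rule derivative_eq_intros ltail_deriv assms refl | simp)+
    moreover have "ptail k (c * A) \<le> ptail k (c * x)"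
      using x assms by (intro ptail_mono) auto
    hence "exp (- x) * ptail k (c * A) \<le> exp (- x) * ptail k (c * x)"
      by (intro mult_left_mono) auto
    ultimately show "\<exists>y. ((\<lambda>x. ptail k (c * A) * (exp (- A) - exp (- x)) + ltail k c x) has_real_derivative y) (at x) \<and> y \<le> 0"
      by (intro exI conjI) (auto simp: mult_ac)
  qed
  thus "ptail k (c * A) * (exp (- A) - exp (- B)) \<le> ltail k c A - ltail k c B" by simp
  have "ptail k (c * B) * (exp (- B) - exp (- B)) - ltail k c B \<le>
        ptail k (c * B) * (exp (- A) - exp (- B)) - ltail k c A"
    using assms(3)
  proof (rule DERIV_nonpos_imp_nonincreasing)
    fix x assume x: "A \<le> x" "x \<le> B"
    have "((\<lambda>x. ptail k (c * B) * (exp (- x) - exp (- B)) - ltail k c x) has_real_derivative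
       ptail k (c * B) * (- exp (- x)) - (- exp (- x) * ptail k (c * x))) (at x)"
      by (rule derivative_eq_intros ltail_deriv assms refl | simp)+
    moreover have "ptail k (c * x) \<le> ptail k (c * B)"
      using x assms by (intro ptail_mono) auto
    hence "exp (- x) * ptail k (c * x) \<le> exp (- x) * ptail k (c * B)"
      by (intro mult_left_mono) auto
    ultimately show "\<exists>y. ((\<lambda>x. ptail k (c * B) * (exp (- x) - exp (- B)) - ltail k c x) has_real_derivative y) (at x) \<and> y \<le> 0"
      by (intro exI conjI) (auto simp: mult_ac)
  qed
  thus "ltail k c A - ltail k c B \<le> ptail k (c * B) * (exp (- A) - exp (- B))" by simp
qed

text \<open>If the \<open>k\<close>-th point comes before \<open>A\<close>, the exponential time
  must still survive from \<open>A\<close> to \<open>T\<close>, which costs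
  \<open>exp (A - T)\<close>. If it comes after \<open>A\<close>, only the Gamma part of the tail at
  \<open>A\<close> remains. This disposes of the summand \<open>exp (- T) * ptail k (c * T)\<close>
  of \<open>ltail\<close>.\<close>

lemma ltail_boundary:
  assumes "c > 0" "0 \<le> A" "A \<le> T"
  shows "ltail k c T \<le> exp (A - T) * (c / (1 + c)) ^ k + (c / (1 + c)) ^ k * (1 - ptail k ((1 + c) * A))"
proof -
  define q where "q = (c / (1 + c)) ^ k"
  define II where "II = (\<lambda>t. q * (1 - ptail k ((1 + c) * t)))"
  have q: "q \<ge> 0" using assms by (simp add: q_def)
  have eq: "exp (- t) * ptail k (c * t) = ltail k c t - II t" for t
    by (simp add: ltail_def II_def q_def)
  let ?d = "\<lambda>L. if k = 0 then 0 else exp (- L) * L ^ (k - 1) / fact (k - 1) :: real"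
  have d: "(II has_real_derivative - q * (?d ((1 + c) * x) * (1 + c))) (at x)" for x
    unfolding II_def by (rule derivative_eq_intros DERIV_chain2[OF ptail_deriv] refl | simp)+
  \<comment> \<open>Here \<open>exp x * (ltail k c x - II x)\<close> is
    \<open>ptail k (c * x)\<close>, with derivative \<open>- exp x\<close> times that of
    \<open>II\<close>. The derivative of the whole expression is therefore
    \<open>exp T - exp x\<close> times that of the decreasing function \<open>II\<close>, hence at
    most 0.\<close>
  have "exp T * (ltail k c T - II T) + exp T * II T \<le> exp A * (ltail k c A - II A) + exp T * II A"
    using assms(3)
  proof (rule DERIV_nonpos_imp_nonincreasing)
    fix x assume x: "A \<le> x" "x \<le> T"
    let ?D = "- q * (?d ((1 + c) * x) * (1 + c))"
    have "((\<lambda>x. exp x * (ltail k c x - II x) + exp T * II x) has_real_derivative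
        exp x * (ltail k c x - II x) + exp x * (- exp (- x) * ptail k (c * x) - ?D) + exp T * ?D) (at x)"
      by (rule derivative_eq_intros ltail_deriv d assms refl | simp)+
    also have "exp x * (ltail k c x - II x) + exp x * (- exp (- x) * ptail k (c * x) - ?D) + exp T * ?D
       = (exp T - exp x) * ?D"
      unfolding eq[symmetric] by (simp add: algebra_simps exp_minus)
    finally have D: "((\<lambda>x. exp x * (ltail k c x - II x) + exp T * II x) has_real_derivative
        (exp T - exp x) * ?D) (at x)" .
    have "0 \<le> (exp T - exp x) * (q * (?d ((1 + c) * x) * (1 + c)))"
      using x assms q by (intro mult_nonneg_nonneg) auto
    hence "(exp T - exp x) * ?D \<le> 0" by simp
    with D show "\<exists>y. ((\<lambda>x. exp x * (ltail k c x - II x) + exp T * II x) has_real_derivative y) (at x) \<and> y \<le> 0"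
      by blast
  qed
  hence "exp T * ltail k c T \<le> exp A * (ltail k c A - II A) + exp T * II A"
    by (simp add: algebra_simps)
  also have "ltail k c A - II A = ltail k c A - q * (1 - ptail k ((1 + c) * A))" by (simp add: II_def)
  also have "\<dots> \<le> q"
  proof -
    have "ltail k c A \<le> ltail k c 0"
      using ltail_diff_bounds(1)[of c 0 A k] assms ptail_nonneg[of 0 k]
      by (smt (verit, best) exp_le_cancel_iff mult_nonneg_nonneg mult_zero_right)
    also have "ltail k c 0 \<le> q" if "k > 0"
      using that by (simp add: ltail_def q_def ptail_at_0)
    finally have "k > 0 \<Longrightarrow> ltail k c A \<le> q" .
    moreover have "ptail k ((1 + c) * A) \<le> 1" using assms by (intro ptail_le_1) auto
    hence "0 \<le> q * (1 - ptail k ((1 + c) * A))" using q by simp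
    moreover have "ltail k c A \<le> q" if "k = 0" using that assms by (simp add: ltail_def q_def)
    ultimately show ?thesis using q by (cases "k = 0") auto
  qed
  finally have "exp T * ltail k c T \<le> exp A * q + exp T * II A" by simp
  hence "exp (- T) * (exp T * ltail k c T) \<le> exp (- T) * (exp A * q + exp T * II A)"
    by (intro mult_left_mono) auto
  thus ?thesis by (simp add: q_def II_def algebra_simps exp_diff exp_minus field_simps)
qed

section \<open>Normal limit of Poisson tails\<close>

interpretation std_normal: real_distribution std_normal_distribution
  by (rule real_dist_normal_dist)

abbreviation Phi :: "real \<Rightarrow> real" where "Phi \<equiv> cdf std_normal_distribution"

lemma isCont_Phi: "isCont Phi y"
proof -
  have "emeasure std_normal_distribution {y} = 0"
    by (subst emeasure_density) (auto intro!: nn_integral_null_set)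
  thus ?thesis by (simp add: std_normal.isCont_cdf measure_def)
qed

text \<open>By the duality of Poisson counts and waiting times, \<open>ptail k L\<close> is the
  probability that \<open>k\<close> independent standard exponential variables have sum at most
  \<open>L\<close>; the central limit theorem applies to these sums.\<close>

lemma ptail_clt_fixed:
  "(\<lambda>k. 1 - ptail k (real k + y * sqrt (real k))) \<longlonglongrightarrow> 1 - Phi y"
proof -
  define E where "E = density lborel (exponential_density 1)"
  interpret E: prob_space E unfolding E_def by (rule prob_space_exponential_density) simp
  define M where "M = (\<Pi>\<^sub>M i\<in>(UNIV::nat set). E)"
  interpret P: product_prob_space "\<lambda>_. E" "UNIV :: nat set" by unfold_locales
  interpret M: prob_space M unfolding M_def by (rule P.P.prob_space_axioms)
  define X where "X = (\<lambda>(i::nat) (f :: nat \<Rightarrow> real). f i)"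
  have setsE: "sets E = sets borel" by (simp add: E_def)
  have distrE: "distr M E (X i) = E" for i
    unfolding M_def X_def by (rule P.PiM_component) auto
  have distr: "distr M borel (X i) = E" for i
  proof -
    have "distr M borel (X i) = distr M E (X i)" by (rule distr_cong) (simp_all add: setsE)
    thus ?thesis by (simp only: distrE)
  qed
  have X [measurable]: "X i \<in> borel_measurable M" for i
    unfolding M_def X_def measurable_cong_sets[OF refl setsE, symmetric] by measurable
  have ind: "M.indep_vars (\<lambda>_. borel) X UNIV"
  proof -
    have "M.indep_vars (\<lambda>_. E) X UNIV"
    proof (subst M.indep_vars_iff_distr_eq_PiM)
      show "X i \<in> measurable M E" for i unfolding measurable_cong_sets[OF refl setsE] by (rule X)
      have "distr M (\<Pi>\<^sub>M i\<in>UNIV. E) (\<lambda>x. \<lambda>i\<in>UNIV. X i x) = distr M M (\<lambda>x. x)"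
        by (simp add: M_def X_def restrict_UNIV)
      also have "\<dots> = M" by (rule distr_id)
      also have "\<dots> = (\<Pi>\<^sub>M i\<in>UNIV. distr M E (X i))" unfolding distrE by (rule M_def)
      finally show "distr M (\<Pi>\<^sub>M i\<in>UNIV. E) (\<lambda>x. \<lambda>i\<in>UNIV. X i x) = (\<Pi>\<^sub>M i\<in>UNIV. distr M E (X i))" .
    qed auto
    thus ?thesis unfolding M.indep_vars_def setsE measurable_cong_sets[OF refl setsE] .
  qed
  have D: "distributed M lborel (X i) (exponential_density 1)" for i
  proof -
    have "distr M lborel (X i) = distr M borel (X i)" by (rule distr_cong) simp_all
    also have "\<dots> = density lborel (exponential_density 1)" by (simp only: distr E_def)
    finally show ?thesis unfolding distributed_def using X[of i] by simp
  qed
  have "weak_conv_m (\<lambda>n. distr M borel (\<lambda>x. (\<Sum>i<n. X i x - 1) / sqrt (real n * 1\<^sup>2))) std_normal_distribution"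
  proof (rule M.central_limit_theorem[OF ind _ _ _ _ distr])
    fix i
    show "M.expectation (X i) = 1" using M.exponential_distributed_expectation[OF _ D[of i]] by simp
    show "M.variance (X i) = 1\<^sup>2" using M.exponential_distributed_variance[OF _ D[of i]] by simp
    show "integrable M (\<lambda>x. (X i x)\<^sup>2)" by (rule M.erlang_ith_moment_integrable[OF _ D]) simp
  qed simp
  hence lim: "(\<lambda>n. cdf (distr M borel (\<lambda>x. (\<Sum>i<n. X i x - 1) / sqrt (real n * 1\<^sup>2))) y) \<longlonglongrightarrow> Phi y"
    by (auto simp: weak_conv_m_def weak_conv_def isCont_Phi)
  have "eventually (\<lambda>n. cdf (distr M borel (\<lambda>x. (\<Sum>i<n. X i x - 1) / sqrt (real n * 1\<^sup>2))) y
          = ptail n (real n + y * sqrt (real n))) sequentially"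
  proof -
    have "eventually (\<lambda>n::nat. real n + y * sqrt (real n) \<ge> 0) sequentially" by real_asymp
    with eventually_gt_at_top[of 0] show ?thesis
    proof eventually_elim
      case (elim n)
      have S: "distributed M lborel (\<lambda>x. \<Sum>i<n. X i x) (erlang_density (n - 1) 1)"
        using M.exponential_distributed_sum[of "{..<n}" 1 X] D elim M.indep_vars_subset[OF ind, of "{..<n}"] by auto
      have "cdf (distr M borel (\<lambda>x. (\<Sum>i<n. X i x - 1) / sqrt (real n * 1\<^sup>2))) y =
            measure M {x \<in> space M. (\<Sum>i<n. X i x - 1) / sqrt (real n * 1\<^sup>2) \<le> y}"
        unfolding cdf_def2 by (subst measure_distr) (auto simp: vimage_def Int_def intro!: arg_cong[where f="measure M"])
      also have "{x \<in> space M. (\<Sum>i<n. X i x - 1) / sqrt (real n * 1\<^sup>2) \<le> y} = {x \<in> space M. (\<Sum>i<n. X i x) \<le> real n + y * sqrt (real n)}"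
        using elim by (auto simp: sum_subtractf field_simps)
      also have "measure M \<dots> = erlang_CDF (n - 1) 1 (real n + y * sqrt (real n))"
        by (rule M.erlang_distributed_le[OF S]) (use elim in auto)
      also have "\<dots> = ptail n (real n + y * sqrt (real n))"
      proof -
        have "{..n - 1} = {..<n}" using elim by auto
        thus ?thesis using elim by (simp add: erlang_CDF_def ptail_def mult_ac)
      qed
      finally show ?case .
    qed
  qed
  from tendsto_cong[OF this] lim have "(\<lambda>n. ptail n (real n + y * sqrt (real n))) \<longlonglongrightarrow> Phi y" by simp
  thus ?thesis by (rule tendsto_diff[OF tendsto_const])
qed

text \<open>\<open>ptail k\<close> is monotone and \<open>Phi\<close> is continuous, so a convergent
  normalised mean can be trapped between constant ones on either side of \<open>y\<close>.\<close>

lemma ptail_clt: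
  fixes k :: "nat \<Rightarrow> nat" and L :: "nat \<Rightarrow> real"
  assumes k: "filterlim k at_top sequentially"
    and L: "(\<lambda>j. (L j - real (k j)) / sqrt (real (k j))) \<longlonglongrightarrow> y"
  shows "(\<lambda>j. 1 - ptail (k j) (L j)) \<longlonglongrightarrow> 1 - Phi y"
proof -
  have lim: "(\<lambda>j. ptail (k j) (real (k j) + z * sqrt (real (k j)))) \<longlonglongrightarrow> Phi z" for z
    using tendsto_diff[OF tendsto_const[of 1] filterlim_compose[OF ptail_clt_fixed[of z] k]] by simp
  have nn: "eventually (\<lambda>j. real (k j) + z * sqrt (real (k j)) \<ge> 0) sequentially" for z
  proof -
    have "eventually (\<lambda>n::nat. real n + z * sqrt (real n) \<ge> 0) sequentially" by real_asymp
    thus ?thesis using k by (rule eventually_compose_filterlim)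
  qed
  have kpos: "eventually (\<lambda>j. k j > 0) sequentially"
    using eventually_gt_at_top[of 0] k by (rule eventually_compose_filterlim)
  have "(\<lambda>j. ptail (k j) (L j)) \<longlonglongrightarrow> Phi y"
  proof (rule order_tendstoI)
    fix a assume a: "a < Phi y"
    have "(Phi \<longlongrightarrow> Phi y) (at_left y)"
      using isCont_Phi[of y] unfolding isCont_def filterlim_at_split by (rule conjunct1)
    hence "eventually (\<lambda>z. a < Phi z) (at_left y)" using a by (rule order_tendstoD(1))
    moreover have "eventually (\<lambda>z. z < y) (at_left y)" by (simp add: eventually_at_filter)
    ultimately obtain z where z: "a < Phi z" "z < y"
      using eventually_happens'[OF trivial_limit_at_left_real eventually_conj] by blast
    show "eventually (\<lambda>j. a < ptail (k j) (L j)) sequentially"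
      using order_tendstoD(1)[OF lim z(1)] order_tendstoD(1)[OF L z(2)] nn[of z] kpos
    proof eventually_elim
      case (elim j)
      have "real (k j) + z * sqrt (real (k j)) \<le> L j" using elim by (simp add: field_simps)
      with elim(3) have "ptail (k j) (real (k j) + z * sqrt (real (k j))) \<le> ptail (k j) (L j)"
        by (rule ptail_mono)
      with elim(1) show ?case by (rule less_le_trans)
    qed
  next
    fix a assume a: "Phi y < a"
    have "(Phi \<longlongrightarrow> Phi y) (at_right y)"
      using isCont_Phi[of y] unfolding isCont_def filterlim_at_split by (rule conjunct2)
    hence "eventually (\<lambda>z. Phi z < a) (at_right y)" using a by (rule order_tendstoD(2))
    moreover have "eventually (\<lambda>z. y < z) (at_right y)" by (simp add: eventually_at_filter)
    ultimately obtain z where z: "Phi z < a" "y < z"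
      using eventually_happens'[OF trivial_limit_at_right_real eventually_conj] by blast
    \<comment> \<open>The value \<open>z'\<close> serves only to make \<open>L j\<close> eventually
      nonnegative, as \<open>ptail_mono\<close> requires.\<close>
    obtain z' where z': "z' < y" using lt_ex by blast
    show "eventually (\<lambda>j. ptail (k j) (L j) < a) sequentially"
      using order_tendstoD(2)[OF lim z(1)] order_tendstoD(2)[OF L z(2)] order_tendstoD(1)[OF L z'] nn[of z'] kpos
    proof eventually_elim
      case (elim j)
      have "L j \<le> real (k j) + z * sqrt (real (k j))" using elim by (simp add: field_simps)
      moreover have "0 \<le> L j" using elim by (simp add: field_simps)
      ultimately have "ptail (k j) (L j) \<le> ptail (k j) (real (k j) + z * sqrt (real (k j)))"
        by (intro ptail_mono)
      also note elim(1)
      finally show ?case .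
    qed
  qed
  thus ?thesis by (rule tendsto_diff[OF tendsto_const])
qed

section \<open>Beta weights\<close>

lemma has_bochner_integral_Gamma_rate:
  fixes s c :: real
  assumes "s > 0" "c > 0"
  shows "has_bochner_integral lborel (\<lambda>u. indicator {0<..} u * (u powr (s - 1) * exp (- c * u)))
           (Gamma s * c powr (- s))"
proof -
  have "has_bochner_integral lborel (\<lambda>t. indicator {0..} t * t powr (s - 1) / exp t) (Gamma s)"
    using Gamma_conv_nn_integral_real[OF assms(1)] Gamma_real_pos[OF assms(1)]
    by (intro has_bochner_integral_nn_integral) (auto intro!: AE_I2 simp: indicator_def)
  hence "has_bochner_integral lborel (\<lambda>t. indicator {0..} (0 + c * t) * (0 + c * t) powr (s - 1) / exp (0 + c * t))
           (Gamma s /\<^sub>R \<bar>c\<bar>)"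
    using assms by (subst (asm) lborel_has_bochner_integral_real_affine_iff[of c _ _ 0]) auto
  hence "has_bochner_integral lborel (\<lambda>t. c powr (1 - s) * (indicator {0..} (0 + c * t) * (0 + c * t) powr (s - 1) / exp (0 + c * t)))
           (c powr (1 - s) * (Gamma s /\<^sub>R \<bar>c\<bar>))"
    by (rule has_bochner_integral_mult_right)
  also have "c powr (1 - s) * (Gamma s /\<^sub>R \<bar>c\<bar>) = Gamma s * c powr (- s)"
    using assms by (simp add: powr_diff powr_minus field_simps)
  finally show ?thesis
  proof (rule has_bochner_integral_cong[THEN iffD1, rotated -1])
    fix u
    show "c powr (1 - s) * (indicator {0..} (0 + c * u) * (0 + c * u) powr (s - 1) / exp (0 + c * u)) =
       indicator {0<..} u * (u powr (s - 1) * exp (- c * u))"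
      using assms by (cases "u > 0") (auto simp: indicator_def zero_le_mult_iff powr_mult exp_minus field_simps
           powr_add[symmetric] intro: )
  qed auto
qed

text \<open>The integral concentrates at distance of order \<open>1 / k\<close> from the endpoint 1.
  With w = 1 - u / k the normalised power tends to exp (- u / (1 + lam)), and the Beta density times
  dw contributes u powr (\<beta> - 1) and the factor k powr (- \<beta>). What remains is a Gamma
  integral of rate 1 / (1 + lam): it yields \<open>(1 + lam) powr \<beta>\<close>, and its
  \<open>Gamma \<beta>\<close> cancels against the density constant.\<close>

lemma beta_scaling_limit:
  fixes \<alpha> \<beta> lam \<gamma> :: real and k :: "nat \<Rightarrow> nat" and g :: "nat \<Rightarrow> real \<Rightarrow> real"
  assumes ab: "\<alpha> > 0" "\<beta> > 0" and l: "lam > 0"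
    and k: "filterlim k at_top sequentially"
    and gm [measurable]: "\<And>j. g j \<in> borel_measurable borel"
    and gb: "\<And>j w. 0 < w \<Longrightarrow> w < 1 \<Longrightarrow> \<bar>g j w\<bar> \<le> 1"
    and gl: "\<And>u. u > 0 \<Longrightarrow> (\<lambda>j. g j (1 - u / real (k j))) \<longlonglongrightarrow> \<gamma>"
  shows "(\<lambda>j. real (k j) powr \<beta> * ((1 + lam) / lam) ^ k j *
             (\<integral>w. (w * lam / (1 + w * lam)) ^ k j * g j w \<partial>beta_distribution \<alpha> \<beta>))
         \<longlonglongrightarrow> Gamma (\<alpha> + \<beta>) / Gamma \<alpha> * (1 + lam) powr \<beta> * \<gamma>"
proof -
  define C where "C = Gamma (\<alpha> + \<beta>) / (Gamma \<alpha> * Gamma \<beta>)"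
  have C: "C > 0" using ab Gamma_real_pos by (simp add: C_def)
  define r where "r = (\<lambda>w. w * (1 + lam) / (1 + w * lam))"
  define s where "s = (\<lambda>j u. indicator {0<..<real (k j)} u *
     (C * (1 - u / k j) powr (\<alpha> - 1) * u powr (\<beta> - 1) * r (1 - u / k j) ^ k j * g j (1 - u / k j)))"
  define f where "f = (\<lambda>u. \<gamma> * C * (indicator {0<..} u * (u powr (\<beta> - 1) * exp (- (1 / (1 + lam)) * u))))"
  define dom where "dom = (\<lambda>u. C * (1 + lam) * (indicator {0<..} u * (u powr (\<beta> - 1) * exp (- (1 / (2 * (1 + lam))) * u))))"
  have [measurable]: "r \<in> borel_measurable borel" unfolding r_def by measurable
  have eq: "real (k j) powr \<beta> * ((1 + lam) / lam) ^ k j *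
             (\<integral>w. (w * lam / (1 + w * lam)) ^ k j * g j w \<partial>beta_distribution \<alpha> \<beta>) = (\<integral>u. s j u \<partial>lborel)"
    if kj: "k j > 0" for j
  proof -
    define K where "K = real (k j)"
    have K: "K > 0" using kj by (simp add: K_def)
    let ?h = "\<lambda>w. (w * lam / (1 + w * lam)) ^ k j * g j w"
    let ?d = "\<lambda>w. indicator {0<..<1} w * (C * w powr (\<alpha> - 1) * (1 - w) powr (\<beta> - 1))"
    have "(\<integral>w. ?h w \<partial>beta_distribution \<alpha> \<beta>) = (\<integral>w. ?d w *\<^sub>R ?h w \<partial>lborel)"
      unfolding beta_distribution_def C_def[symmetric]
      using C by (intro integral_density) (auto intro!: AE_I2)
    also have "\<dots> = \<bar>-1 / K\<bar> *\<^sub>R (\<integral>u. ?d (1 + (-1/K) * u) *\<^sub>R ?h (1 + (-1/K) * u) \<partial>lborel)"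
      using K by (intro lborel_integral_real_affine) auto
    finally have i1: "(\<integral>w. ?h w \<partial>beta_distribution \<alpha> \<beta>) = \<bar>-1 / K\<bar> *\<^sub>R (\<integral>u. ?d (1 + (-1/K) * u) *\<^sub>R ?h (1 + (-1/K) * u) \<partial>lborel)" .
    have "K powr \<beta> * ((1 + lam) / lam) ^ k j * (\<integral>w. ?h w \<partial>beta_distribution \<alpha> \<beta>) =
       (\<integral>u. K powr \<beta> * ((1 + lam) / lam) ^ k j * \<bar>-1 / K\<bar> * (?d (1 + (-1/K) * u) *\<^sub>R ?h (1 + (-1/K) * u)) \<partial>lborel)"
      unfolding i1 by (simp add: mult.assoc)
    also have "\<dots> = (\<integral>u. s j u \<partial>lborel)"
    proof (rule Bochner_Integration.integral_cong[OF refl])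
      fix u :: real
      have ind: "indicator {0<..<1} (1 + (-1/K) * u) = (indicator {0<..<K} u :: real)"
      proof -
        have "1 + (-1/K) * u = 1 - u / K" by simp
        moreover have "u / K < 1 \<longleftrightarrow> u < K" "0 < u / K \<longleftrightarrow> 0 < u"
          using K by (simp_all add: divide_less_eq zero_less_divide_iff)
        ultimately show ?thesis unfolding indicator_def by (simp only: greaterThanLessThan_iff) auto
      qed
      show "K powr \<beta> * ((1 + lam) / lam) ^ k j * \<bar>-1 / K\<bar> * (?d (1 + (-1/K) * u) *\<^sub>R ?h (1 + (-1/K) * u)) = s j u"
      proof (cases "u \<in> {0<..<K}")
        case True
        define w where "w = 1 - u / K"
        have w: "1 + (-1/K) * u = w" "1 - w = u / K" by (simp_all add: w_def)
        have p: "K powr \<beta> * \<bar>-1 / K\<bar> * (u / K) powr (\<beta> - 1) = u powr (\<beta> - 1)"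
          using True K by (simp add: powr_divide powr_diff field_simps)
        have q: "((1 + lam) / lam) ^ k j * (w * lam / (1 + w * lam)) ^ k j = r w ^ k j"
          using l by (simp add: power_mult_distrib[symmetric] r_def mult_ac)
        have "K powr \<beta> * ((1 + lam) / lam) ^ k j * \<bar>-1 / K\<bar> * (?d w *\<^sub>R ?h w) =
           indicator {0<..<K} u * (C * w powr (\<alpha> - 1) * (K powr \<beta> * \<bar>-1 / K\<bar> * (u / K) powr (\<beta> - 1)) *
             (((1 + lam) / lam) ^ k j * (w * lam / (1 + w * lam)) ^ k j) * g j w)"
          using ind unfolding w by simp
        thus ?thesis unfolding p q w(1) s_def K_def[symmetric] w_def[symmetric] .
      next
        case False
        have "indicator {0<..<1} (1 + (-1/K) * u) = (0 :: real)" using ind False by simp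
        thus ?thesis unfolding s_def K_def[symmetric] using False by simp
      qed
    qed
    finally show ?thesis by (simp add: K_def)
  qed
  have ev2: "eventually (\<lambda>j. k j \<ge> 2) sequentially"
    using eventually_ge_at_top[of 2] k by (rule eventually_compose_filterlim)
  have rb: "0 \<le> r w \<and> r w \<le> exp (- (1 - w) / (1 + lam)) \<and> r w \<le> w * (1 + lam)" if "0 < w" "w < 1" for w
  proof -
    have pos: "1 + w * lam > 0" using that l by (intro add_pos_pos mult_pos_pos) auto
    have "r w = 1 - (1 - w) / (1 + w * lam)" using pos by (simp add: r_def field_simps)
    also have "\<dots> \<le> 1 - (1 - w) / (1 + lam)"
      using that l pos by (intro diff_left_mono divide_left_mono) auto
    also have "\<dots> \<le> exp (- (1 - w) / (1 + lam))"
      using exp_ge_add_one_self[of "- (1 - w) / (1 + lam)"] by (simp only: minus_divide_left)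
    finally have "r w \<le> exp (- (1 - w) / (1 + lam))" .
    moreover have "r w \<le> w * (1 + lam) / 1"
      unfolding r_def using that l pos by (intro divide_left_mono) auto
    moreover have "0 \<le> r w" using that l by (simp add: r_def)
    ultimately show ?thesis by simp
  qed
  have lim_r: "(\<lambda>j. r (1 - u / real (k j)) ^ k j) \<longlonglongrightarrow> exp (- (1 / (1 + lam)) * u)" if "u > 0" for u
  proof -
    have "((\<lambda>n::nat. r (1 - u / real n) ^ n) \<longlonglongrightarrow> exp (- (1 / (1 + lam)) * u))"
    proof -
      have "1 + (lam * lam + lam * 2) = (1 + lam) * (1 + lam)" "- u - lam * u = - u * (1 + lam)"
        "lam * u + lam * (lam * u) = lam * u * (1 + lam)" by algebra+
      hence "(- u - lam * u) / (1 + lam) + (lam * u + lam * (lam * u)) / (1 + (lam * lam + lam * 2)) = - u + lam * u / (1 + lam)"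
        using l by simp
      also have "\<dots> = - (1 / (1 + lam)) * u" using l by (simp add: field_simps)
      finally have "(- u - lam * u) / (1 + lam) + (lam * u + lam * (lam * u)) / (1 + (lam * lam + lam * 2)) = - (1 / (1 + lam)) * u" .
      moreover have "1 + lam \<noteq> 0" using l by simp
      ultimately show ?thesis unfolding r_def using l that by (real_asymp simp: field_simps)
    qed
    thus ?thesis by (rule filterlim_compose[OF _ k])
  qed
  have f_int: "integral\<^sup>L lborel f = Gamma (\<alpha> + \<beta>) / Gamma \<alpha> * (1 + lam) powr \<beta> * \<gamma>"
  proof -
    have "has_bochner_integral lborel f (\<gamma> * C * (Gamma \<beta> * (1 / (1 + lam)) powr (- \<beta>)))"
      unfolding f_def using ab l by (intro has_bochner_integral_mult_right has_bochner_integral_Gamma_rate) auto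
    thus ?thesis using ab l Gamma_real_pos[OF ab(2)]
      by (simp add: has_bochner_integral_iff C_def powr_divide powr_minus field_simps)
  qed
  have "(\<lambda>j. integral\<^sup>L lborel (s j)) \<longlonglongrightarrow> integral\<^sup>L lborel f"
  proof -
    obtain j0 where j0: "\<And>j. j \<ge> j0 \<Longrightarrow> k j \<ge> 2" using ev2 by (auto simp: eventually_sequentially)
    have "(\<lambda>j. integral\<^sup>L lborel (s (j + j0))) \<longlonglongrightarrow> integral\<^sup>L lborel f"
    proof (rule integral_dominated_convergence[where w = dom])
      show "f \<in> borel_measurable lborel" unfolding f_def by measurable
      show "s (j + j0) \<in> borel_measurable lborel" for j unfolding s_def by measurable
      show "integrable lborel dom"
        unfolding dom_def using has_bochner_integral_Gamma_rate[OF ab(2), of "1 / (2 * (1 + lam))"] l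
        by (intro integrable_mult_right) (auto simp: has_bochner_integral_iff)
      show "AE u in lborel. (\<lambda>j. s (j + j0) u) \<longlonglongrightarrow> f u"
      proof (rule AE_I2)
        fix u :: real
        show "(\<lambda>j. s (j + j0) u) \<longlonglongrightarrow> f u"
        proof (cases "u > 0")
          case False
          thus ?thesis by (simp add: s_def f_def)
        next
          case True
          have ind: "eventually (\<lambda>j. indicator {0<..<real (k j)} u = (1::real)) sequentially"
          proof -
            have "eventually (\<lambda>n::nat. u < real n) sequentially" by real_asymp
            hence "eventually (\<lambda>j. u < real (k j)) sequentially" using k by (rule eventually_compose_filterlim)
            thus ?thesis by eventually_elim (use True in auto)
          qed
          have a: "(\<lambda>j. (1 - u / real (k j)) powr (\<alpha> - 1)) \<longlonglongrightarrow> 1"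
          proof -
            have "(\<lambda>n::nat. (1 - u / real n) powr (\<alpha> - 1)) \<longlonglongrightarrow> 1" by real_asymp
            thus ?thesis by (rule filterlim_compose[OF _ k])
          qed
          have "(\<lambda>j. s j u) \<longlonglongrightarrow> 1 * (C * 1 * u powr (\<beta> - 1) * exp (- (1 / (1 + lam)) * u) * \<gamma>)"
            unfolding s_def by (intro tendsto_intros a lim_r gl True tendsto_eventually[OF ind])
          also have "1 * (C * 1 * u powr (\<beta> - 1) * exp (- (1 / (1 + lam)) * u) * \<gamma>) = f u"
            using True by (simp add: f_def)
          finally show ?thesis by (rule LIMSEQ_ignore_initial_segment)
        qed
      qed
      show "AE u in lborel. norm (s (j + j0) u) \<le> dom u" for j
      proof (rule AE_I2)
        fix u :: real
        let ?k = "k (j + j0)"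
        have k2: "?k \<ge> 2" using j0 by simp
        show "norm (s (j + j0) u) \<le> dom u"
        proof (cases "u \<in> {0<..<real ?k}")
          case False
          thus ?thesis using C l by (auto simp: s_def dom_def indicator_def)
        next
          case True
          define w where "w = 1 - u / real ?k"
          have w: "0 < w" "w < 1" "1 - w = u / real ?k" using True k2 by (auto simp: w_def field_simps)
          note rbw = rb[OF w(1,2)]
          \<comment> \<open>One factor \<open>r w\<close> is set aside to absorb the singularity of
            \<open>w powr (\<alpha> - 1)\<close> at 0 when \<alpha> < 1. Since k is at least 2, the
            remaining exponent is at least half of it, which explains the halved rate in
            \<open>dom\<close>.\<close>
          have "r w ^ ?k = r w * r w ^ (?k - 1)" using k2 by (cases ?k) auto
          also have "r w ^ (?k - 1) \<le> exp (- (1 / (2 * (1 + lam))) * u)"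
          proof -
            have "r w ^ (?k - 1) \<le> exp (- (1 - w) / (1 + lam)) ^ (?k - 1)"
              using rbw by (intro power_mono) auto
            also have "\<dots> = exp (- (u * ((real ?k - 1) / real ?k)) / (1 + lam))"
              using k2 unfolding w by (simp add: exp_of_nat_mult[symmetric] of_nat_diff)
            also have "\<dots> \<le> exp (- (1 / (2 * (1 + lam))) * u)"
            proof -
              have "u * (1/2) \<le> u * ((real ?k - 1) / real ?k)"
                using True k2 by (intro mult_left_mono) (auto simp: field_simps)
              hence "u * (1/2) / (1 + lam) \<le> u * ((real ?k - 1) / real ?k) / (1 + lam)"
                using l by (intro divide_right_mono) auto
              thus ?thesis by (simp add: field_simps)
            qed
            finally show ?thesis .
          qed
          finally have 1: "r w ^ ?k \<le> r w * exp (- (1 / (2 * (1 + lam))) * u)" using rbw by (simp add: mult_left_mono)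
          have 2: "w powr (\<alpha> - 1) * r w \<le> 1 + lam"
          proof -
            have "w powr (\<alpha> - 1) * r w \<le> w powr (\<alpha> - 1) * (w * (1 + lam))" using rbw by (intro mult_left_mono) auto
            also have "\<dots> = w powr \<alpha> * (1 + lam)" using w by (simp add: powr_diff)
            also have "\<dots> \<le> 1 * (1 + lam)" using w ab l by (intro mult_right_mono powr_le1) auto
            finally show ?thesis by simp
          qed
          have "norm (s (j + j0) u) = C * w powr (\<alpha> - 1) * u powr (\<beta> - 1) * r w ^ ?k * \<bar>g (j + j0) w\<bar>"
            using True C rbw by (simp add: s_def abs_mult flip: w_def)
          also have "\<dots> \<le> C * w powr (\<alpha> - 1) * u powr (\<beta> - 1) * (r w * exp (- (1 / (2 * (1 + lam))) * u)) * 1"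
            using C gb[OF w(1,2)] rbw 1 by (intro mult_mono mult_nonneg_nonneg) auto
          also have "\<dots> = C * u powr (\<beta> - 1) * exp (- (1 / (2 * (1 + lam))) * u) * (w powr (\<alpha> - 1) * r w)" by simp
          also have "\<dots> \<le> C * u powr (\<beta> - 1) * exp (- (1 / (2 * (1 + lam))) * u) * (1 + lam)"
            using C 2 by (intro mult_left_mono) auto
          also have "\<dots> = dom u" using True by (simp add: dom_def)
          finally show ?thesis .
        qed
      qed
    qed
    thus ?thesis by (rule LIMSEQ_offset)
  qed
  moreover have "eventually (\<lambda>j. integral\<^sup>L lborel (s j) = real (k j) powr \<beta> * ((1 + lam) / lam) ^ k j *
             (\<integral>w. (w * lam / (1 + w * lam)) ^ k j * g j w \<partial>beta_distribution \<alpha> \<beta>)) sequentially"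
    using ev2 by eventually_elim (simp add: eq)
  ultimately show ?thesis unfolding f_int by (rule Lim_transform_eventually)
qed

section \<open>Vertices of high degree\<close>

locale beta_tree_setting =
  fixes \<alpha> \<beta> \<theta> lam \<epsilon> :: real and a :: "nat \<Rightarrow> real" and n :: "nat \<Rightarrow> nat"
  assumes ab: "\<alpha> > 0" "\<beta> > 0"
    and theta_eq: "\<theta> = 1 + (\<integral>w. w \<partial>beta_distribution \<alpha> \<beta>)"
    and lam_eq: "lam = 1 / (\<theta> - 1)"
    and a_eq: "\<And>m. a m = log \<theta> (real m) - \<beta> * log \<theta> (log \<theta> (real m))"
    and n_lim: "filterlim n at_top sequentially"
    and frac_lim: "(\<lambda>j. a (n j) - \<lfloor>a (n j)\<rfloor>) \<longlonglongrightarrow> \<epsilon>"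
begin

sublocale B: prob_space "beta_distribution \<alpha> \<beta>"
  using ab by (rule prob_space_beta_distribution)

lemma sets_beta [simp, measurable_cong]: "sets (beta_distribution \<alpha> \<beta>) = sets borel"
  by (simp add: beta_distribution_def)

lemma space_beta [simp]: "space (beta_distribution \<alpha> \<beta>) = UNIV"
  by (simp add: beta_distribution_def)

lemma AE_beta: "AE w in beta_distribution \<alpha> \<beta>. 0 < w \<and> w < 1"
proof -
  have "AE s in lborel. ennreal (indicator {0<..<1} s *
     (Gamma (\<alpha> + \<beta>) / (Gamma \<alpha> * Gamma \<beta>) * s powr (\<alpha> - 1) * (1 - s) powr (\<beta> - 1))) > 0 \<longrightarrow> 0 < s \<and> s < 1"
    by (rule AE_I2) (auto simp: indicator_def)
  thus ?thesis unfolding beta_distribution_def by (subst AE_density) auto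
qed

lemma integrable_beta_bounded:
  fixes f :: "real \<Rightarrow> real"
  assumes [measurable]: "f \<in> borel_measurable borel" and "\<And>w. 0 < w \<Longrightarrow> w < 1 \<Longrightarrow> \<bar>f w\<bar> \<le> C"
  shows "integrable (beta_distribution \<alpha> \<beta>) f"
proof (rule B.integrable_const_bound[of _ C])
  show "AE w in beta_distribution \<alpha> \<beta>. norm (f w) \<le> C"
    using AE_beta by eventually_elim (use assms(2) in auto)
qed measurable

lemma theta: "1 < \<theta>" "\<theta> < 2"
proof -
  have int: "integrable (beta_distribution \<alpha> \<beta>) (\<lambda>w. w)"
    by (rule integrable_beta_bounded[of _ 1]) auto
  have "(\<integral>w. 0 \<partial>beta_distribution \<alpha> \<beta>) < (\<integral>w. w \<partial>beta_distribution \<alpha> \<beta>)"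
  proof (rule B.integral_less_AE_space)
    show "AE w in beta_distribution \<alpha> \<beta>. 0 < w" using AE_beta by eventually_elim auto
  qed (use int B.emeasure_space_1 in auto)
  moreover have "(\<integral>w. w \<partial>beta_distribution \<alpha> \<beta>) < (\<integral>w. 1 \<partial>beta_distribution \<alpha> \<beta>)"
  proof (rule B.integral_less_AE_space)
    show "AE w in beta_distribution \<alpha> \<beta>. w < 1" using AE_beta by eventually_elim auto
  qed (use int B.emeasure_space_1 in auto)
  ultimately show "1 < \<theta>" "\<theta> < 2" using B.prob_space by (auto simp: theta_eq)
qed

text \<open>At weight 1 the geometric tail \<open>(lam / (1 + lam)) ^ k\<close> becomes
  \<open>\<theta> powr (- k)\<close>; for this reason degrees live on the scale of logarithms to
  base \<open>\<theta>\<close>.\<close>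

lemma lam: "lam > 1" "(1 + lam) / lam = \<theta>" "1 / lam = \<theta> - 1" "1 / (1 + lam) = (\<theta> - 1) / \<theta>"
  "1 / (1 + lam) = 1 - inverse \<theta>"
  using theta by (auto simp: lam_eq field_simps)

lemma lam_pos: "lam > 0" using lam(1) by simp

section \<open>Logarithmic scale, levels, and ages in the Gaussian window\<close>

definition lg :: "nat \<Rightarrow> real" where "lg j = log \<theta> (real (n j))"

text \<open>The truncation by \<open>nat\<close> affects only finitely many \<open>j\<close>, by
  \<open>floor_a_lim\<close>.\<close>

definition level :: "int \<Rightarrow> nat \<Rightarrow> nat" where "level m j = nat (\<lfloor>a (n j)\<rfloor> + m)"

lemma real_n_lim: "filterlim (\<lambda>j. real (n j)) at_top sequentially"
  using filterlim_compose[OF filterlim_real_sequentially n_lim] .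

lemma lg_ln: "lg j = ln (real (n j)) / ln \<theta>"
  by (simp add: lg_def log_def)

lemma lg_lim: "filterlim lg at_top sequentially"
proof -
  have "filterlim (\<lambda>j. (1 / ln \<theta>) * ln (real (n j))) at_top sequentially"
    using theta by (intro filterlim_tendsto_pos_mult_at_top[OF tendsto_const] filterlim_compose[OF ln_at_top real_n_lim]) auto
  moreover have "lg = (\<lambda>j. (1 / ln \<theta>) * ln (real (n j)))" by (rule ext) (simp add: lg_ln)
  ultimately show ?thesis by simp
qed

lemma a_lg: "a (n j) = lg j - \<beta> * log \<theta> (lg j)"
  by (simp add: a_eq lg_def)

lemma lg_asymp:
  "filterlim (\<lambda>j. lg j - \<beta> * log \<theta> (lg j)) at_top sequentially"
  "(\<lambda>j. (lg j - \<beta> * log \<theta> (lg j)) / lg j) \<longlonglongrightarrow> 1"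
  "(\<lambda>j. log \<theta> (lg j) / sqrt (lg j)) \<longlonglongrightarrow> 0"
proof -
  have t: "ln \<theta> > 0" using theta by simp
  have 1: "filterlim (\<lambda>x::real. x - \<beta> * (ln x / ln \<theta>)) at_top at_top" using t ab by real_asymp
  have 2: "((\<lambda>x::real. (x - \<beta> * (ln x / ln \<theta>)) / x) \<longlongrightarrow> 1) at_top" using t ab by real_asymp
  have 3: "((\<lambda>x::real. (ln x / ln \<theta>) / sqrt x) \<longlongrightarrow> 0) at_top" using t ab by real_asymp
  show "filterlim (\<lambda>j. lg j - \<beta> * log \<theta> (lg j)) at_top sequentially"
    using filterlim_compose[OF 1 lg_lim] by (simp add: log_def)
  show "(\<lambda>j. (lg j - \<beta> * log \<theta> (lg j)) / lg j) \<longlonglongrightarrow> 1"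
    using filterlim_compose[OF 2 lg_lim] by (simp add: log_def)
  show "(\<lambda>j. log \<theta> (lg j) / sqrt (lg j)) \<longlonglongrightarrow> 0"
    using filterlim_compose[OF 3 lg_lim] by (simp add: log_def)
qed

lemma floor_a_lim: "eventually (\<lambda>j. \<lfloor>a (n j)\<rfloor> \<ge> z) sequentially"
proof -
  have "eventually (\<lambda>j. a (n j) \<ge> real_of_int z) sequentially"
    using lg_asymp(1) unfolding a_lg filterlim_at_top by blast
  thus ?thesis by eventually_elim (simp add: le_floor_iff)
qed

lemma level_real: "eventually (\<lambda>j. real (level m j) = a (n j) - (a (n j) - \<lfloor>a (n j)\<rfloor>) + m) sequentially"
  using floor_a_lim[of "- m"] by eventually_elim (simp add: level_def)

lemma level_bounds: "eventually (\<lambda>j. \<bar>real (level m j) - (lg j - \<beta> * log \<theta> (lg j))\<bar> \<le> 1 + \<bar>m\<bar>) sequentially"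
  using level_real[of m]
proof eventually_elim
  case (elim j)
  have "0 \<le> a (n j) - \<lfloor>a (n j)\<rfloor>" "a (n j) - \<lfloor>a (n j)\<rfloor> \<le> 1" by linarith+
  with elim show ?case unfolding a_lg by linarith
qed

lemma level_lim: "filterlim (level m) at_top sequentially"
  unfolding filterlim_at_top
proof
  fix Z :: nat
  show "eventually (\<lambda>j. Z \<le> level m j) sequentially"
    using floor_a_lim[of "int Z - m"] by eventually_elim (simp add: level_def)
qed

lemma level_over_lg: "(\<lambda>j. real (level m j) / lg j) \<longlonglongrightarrow> 1"
proof -
  have 0: "(\<lambda>j. (1 + \<bar>real_of_int m\<bar>) / lg j) \<longlonglongrightarrow> 0"
    using lg_lim by (intro tendsto_divide_0[OF tendsto_const] filterlim_at_top_imp_at_infinity)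
  have "(\<lambda>j. (real (level m j) - (lg j - \<beta> * log \<theta> (lg j))) / lg j) \<longlonglongrightarrow> 0"
  proof (rule Lim_null_comparison[OF _ 0])
    have "eventually (\<lambda>j. lg j > 0) sequentially" using lg_lim by (simp add: filterlim_at_top_dense)
    thus "eventually (\<lambda>j. norm ((real (level m j) - (lg j - \<beta> * log \<theta> (lg j))) / lg j) \<le> (1 + \<bar>real_of_int m\<bar>) / lg j) sequentially"
      using level_bounds[of m] by eventually_elim (simp add: divide_right_mono)
  qed
  from tendsto_add[OF this lg_asymp(2)] show ?thesis by (simp add: diff_divide_distrib)
qed

text \<open>The centring is made for this: \<open>\<theta> powr a (n j)\<close> equals
  \<open>n j / lg j powr \<beta>\<close>, the polynomial factor matches the loss in
  \<open>beta_scaling_limit\<close>, and \<open>level m j\<close> differs from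
  \<open>a (n j)\<close> only by the fractional part and \<open>m\<close>.\<close>

lemma mass_lim:
  "(\<lambda>j. real (n j) / (real (level m j) powr \<beta> * \<theta> ^ level m j)) \<longlonglongrightarrow> \<theta> powr (\<epsilon> - m)"
proof -
  have "(\<lambda>j. \<theta> powr ((a (n j) - \<lfloor>a (n j)\<rfloor>) - m) * (real (level m j) / lg j) powr (- \<beta>)) \<longlonglongrightarrow> \<theta> powr (\<epsilon> - m) * 1 powr (- \<beta>)"
    using theta by (intro tendsto_intros frac_lim level_over_lg) auto
  moreover have "eventually (\<lambda>j. \<theta> powr ((a (n j) - \<lfloor>a (n j)\<rfloor>) - m) * (real (level m j) / lg j) powr (- \<beta>)
      = real (n j) / (real (level m j) powr \<beta> * \<theta> ^ level m j)) sequentially"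
  proof -
    have "eventually (\<lambda>j. lg j > 0) sequentially" using lg_lim by (simp add: filterlim_at_top_dense)
    moreover have "eventually (\<lambda>j. real (n j) > 0) sequentially" using real_n_lim unfolding filterlim_at_top_dense by blast
    moreover have "eventually (\<lambda>j. level m j > 0) sequentially"
      using eventually_gt_at_top[of 0] level_lim by (rule eventually_compose_filterlim)
    ultimately show ?thesis using level_real[of m]
    proof eventually_elim
      case (elim j)
      have "\<theta> ^ level m j = \<theta> powr real (level m j)" using theta by (simp add: powr_realpow)
      also have "\<dots> = \<theta> powr (lg j) * (\<theta> powr (log \<theta> (lg j))) powr (- \<beta>) * \<theta> powr (- ((a (n j) - \<lfloor>a (n j)\<rfloor>) - m))"
        unfolding elim(4) a_lg powr_powr by (simp add: powr_add[symmetric] algebra_simps)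
      also have "\<theta> powr (lg j) = real (n j)" using elim theta by (simp add: lg_def)
      also have "\<theta> powr (log \<theta> (lg j)) = lg j" using elim theta by simp
      finally have e: "\<theta> ^ level m j = real (n j) * lg j powr (- \<beta>) * \<theta> powr (- ((a (n j) - \<lfloor>a (n j)\<rfloor>) - m))" .
      have "\<theta> powr s * (real (level m j) / lg j) powr (- \<beta>) =
          real (n j) / (real (level m j) powr \<beta> * (real (n j) * lg j powr (- \<beta>) * \<theta> powr (- s)))" for s
        using elim(1-3) theta by (simp add: powr_minus powr_divide field_simps)
      thus ?case unfolding e .
    qed
  qed
  ultimately show ?thesis by (simp add: Lim_transform_eventually)
qed

lemma sqrt_level_lim: "filterlim (\<lambda>j. sqrt (real (level m j))) at_top sequentially"
  by (rule filterlim_compose[OF sqrt_at_top filterlim_compose[OF filterlim_real_sequentially level_lim]])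

lemma bounded_over_sqrt_level:
  assumes "eventually (\<lambda>j. \<bar>f j\<bar> \<le> C) sequentially"
  shows "(\<lambda>j. f j / sqrt (real (level m j))) \<longlonglongrightarrow> 0"
proof (rule Lim_null_comparison)
  show "eventually (\<lambda>j. norm (f j / sqrt (real (level m j))) \<le> C / sqrt (real (level m j))) sequentially"
    using assms by eventually_elim (simp add: divide_right_mono)
  show "(\<lambda>j. C / sqrt (real (level m j))) \<longlonglongrightarrow> 0"
    by (intro tendsto_divide_0[OF tendsto_const] filterlim_at_top_imp_at_infinity sqrt_level_lim)
qed

lemma level_pos: "eventually (\<lambda>j. level m j > 0) sequentially"
  using eventually_gt_at_top[of 0] level_lim by (rule eventually_compose_filterlim)

lemma lg_pos: "eventually (\<lambda>j. lg j > 0) sequentially"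
  using lg_lim by (simp add: filterlim_at_top_dense)

lemma lg_over_level: "(\<lambda>j. lg j / real (level m j)) \<longlonglongrightarrow> 1"
  using tendsto_inverse[OF level_over_lg[of m]] by (simp add: field_simps)

lemma sqrt_lg_over_level: "(\<lambda>j. sqrt (lg j) / sqrt (real (level m j))) \<longlonglongrightarrow> 1"
  using tendsto_real_sqrt[OF lg_over_level[of m]] by (simp add: real_sqrt_divide)

text \<open>The level lags behind \<open>lg j\<close> by a multiple of its logarithm and a bounded
  term, both negligible on the square-root scale. Hence \<open>lg\<close> may replace the level in
  the centring of the normal limit.\<close>

lemma lg_minus_level: "(\<lambda>j. (lg j - real (level m j)) / sqrt (real (level m j))) \<longlonglongrightarrow> 0"
proof -
  have "(\<lambda>j. \<beta> * (log \<theta> (lg j) / sqrt (lg j)) * (sqrt (lg j) / sqrt (real (level m j)))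
          - (real (level m j) - (lg j - \<beta> * log \<theta> (lg j))) / sqrt (real (level m j))) \<longlonglongrightarrow> \<beta> * 0 * 1 - 0"
    by (intro tendsto_intros lg_asymp sqrt_lg_over_level bounded_over_sqrt_level[OF level_bounds])
  moreover have "eventually (\<lambda>j. \<beta> * (log \<theta> (lg j) / sqrt (lg j)) * (sqrt (lg j) / sqrt (real (level m j)))
          - (real (level m j) - (lg j - \<beta> * log \<theta> (lg j))) / sqrt (real (level m j)) =
          (lg j - real (level m j)) / sqrt (real (level m j))) sequentially"
    using lg_pos level_pos[of m] by eventually_elim (simp add: field_simps)
  ultimately show ?thesis by (simp add: Lim_transform_eventually)
qed

text \<open>A vertex of weight near 1 and degree near \<open>lg j\<close> has age about
  \<open>lg j / (1 + lam)\<close>, with fluctuations of order \<open>sqrt (lg j)\<close>;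
  \<open>y\<close> is the position in that window. The bounded slack makes the class stable under
  the constant shifts needed below.\<close>

definition near_time :: "real \<Rightarrow> (nat \<Rightarrow> real) \<Rightarrow> bool" where
  "near_time y T \<longleftrightarrow> (\<exists>C. eventually (\<lambda>j. \<bar>T j - (lg j + y * sqrt (lg j)) / (1 + lam)\<bar> \<le> C) sequentially)"

lemma near_time_shift:
  assumes "near_time y T" shows "near_time y (\<lambda>j. T j + s)"
proof -
  obtain C where "eventually (\<lambda>j. \<bar>T j - (lg j + y * sqrt (lg j)) / (1 + lam)\<bar> \<le> C) sequentially"
    using assms by (auto simp: near_time_def)
  hence "eventually (\<lambda>j. \<bar>T j + s - (lg j + y * sqrt (lg j)) / (1 + lam)\<bar> \<le> C + \<bar>s\<bar>) sequentially"
    by eventually_elim linarith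
  thus ?thesis unfolding near_time_def by blast
qed

lemma near_time_over_level:
  assumes "near_time y T"
  shows "(\<lambda>j. T j / real (level m j)) \<longlonglongrightarrow> 1 / (1 + lam)"
proof -
  let ?s = "\<lambda>j. sqrt (real (level m j))"
  obtain C where C: "eventually (\<lambda>j. \<bar>T j - (lg j + y * sqrt (lg j)) / (1 + lam)\<bar> \<le> C) sequentially"
    using assms by (auto simp: near_time_def)
  have 1: "(\<lambda>j. 1 / ?s j) \<longlonglongrightarrow> 0" by (rule bounded_over_sqrt_level[of _ 1]) simp
  have "(\<lambda>j. (T j - (lg j + y * sqrt (lg j)) / (1 + lam)) / ?s j * (1 / ?s j) +
      (lg j / real (level m j) + y * (sqrt (lg j) / ?s j) * (1 / ?s j)) * (1 / (1 + lam))) \<longlonglongrightarrow>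
      0 * 0 + (1 + y * 1 * 0) * (1 / (1 + lam))"
    by (intro tendsto_add tendsto_mult tendsto_const 1 lg_over_level sqrt_lg_over_level bounded_over_sqrt_level[OF C])
  moreover have "eventually (\<lambda>j. (T j - (lg j + y * sqrt (lg j)) / (1 + lam)) / ?s j * (1 / ?s j) +
      (lg j / real (level m j) + y * (sqrt (lg j) / ?s j) * (1 / ?s j)) * (1 / (1 + lam)) = T j / real (level m j)) sequentially"
    using lg_pos level_pos[of m]
  proof eventually_elim
    case (elim j)
    have "?s j * ?s j = real (level m j)" by simp
    hence e: "x / ?s j * (1 / ?s j) = x / real (level m j)" for x by simp
    have e2: "y * (sqrt (lg j) / ?s j) * (1 / ?s j) = y * sqrt (lg j) / real (level m j)"
      using e[of "y * sqrt (lg j)"] by simp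
    show ?case unfolding e e2 by (simp add: diff_divide_distrib add_divide_distrib)
  qed
  ultimately show ?thesis by (simp add: Lim_transform_eventually)
qed

text \<open>The age is of the order of the level, so lowering the weight by \<open>u\<close> over
  the level moves the Poisson mean by a bounded amount only, which is invisible after division by
  the square root.\<close>

lemma near_time_clt:
  assumes "near_time y T"
  shows "(\<lambda>j. ((1 + (1 - u / real (level m j)) * lam) * T j - real (level m j)) / sqrt (real (level m j))) \<longlonglongrightarrow> y"
proof -
  let ?s = "\<lambda>j. sqrt (real (level m j))"
  obtain C where C: "eventually (\<lambda>j. \<bar>T j - (lg j + y * sqrt (lg j)) / (1 + lam)\<bar> \<le> C) sequentially"
    using assms by (auto simp: near_time_def)
  have 1: "(\<lambda>j. 1 / ?s j) \<longlonglongrightarrow> 0" by (rule bounded_over_sqrt_level[of _ 1]) simp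
  have "(\<lambda>j. y * (sqrt (lg j) / ?s j) + (1 + lam) * ((T j - (lg j + y * sqrt (lg j)) / (1 + lam)) / ?s j)
     + (lg j - real (level m j)) / ?s j - u * lam * (T j / real (level m j)) * (1 / ?s j)) \<longlonglongrightarrow>
     y * 1 + (1 + lam) * 0 + 0 - u * lam * (1 / (1 + lam)) * 0"
    by (intro tendsto_add tendsto_diff tendsto_mult tendsto_const 1 sqrt_lg_over_level lg_minus_level
       near_time_over_level[OF assms] bounded_over_sqrt_level[OF C])
  moreover have "eventually (\<lambda>j. y * (sqrt (lg j) / ?s j) + (1 + lam) * ((T j - (lg j + y * sqrt (lg j)) / (1 + lam)) / ?s j)
     + (lg j - real (level m j)) / ?s j - u * lam * (T j / real (level m j)) * (1 / ?s j)
     = ((1 + (1 - u / real (level m j)) * lam) * T j - real (level m j)) / ?s j) sequentially"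
    using level_pos[of m]
  proof eventually_elim
    case (elim j)
    have "?s j > 0" using elim by simp
    have "(1 + lam) * ((lg j + y * sqrt (lg j)) / (1 + lam)) = lg j + y * sqrt (lg j)" using lam by simp
    hence "(1 + lam) * ((T j - (lg j + y * sqrt (lg j)) / (1 + lam)) / ?s j) = ((1 + lam) * T j - (lg j + y * sqrt (lg j))) / ?s j"
      by (simp only: times_divide_eq_right right_diff_distrib)
    moreover have "(1 - u / real (level m j)) * lam = lam - u * lam / real (level m j)" by (simp add: left_diff_distrib)
    ultimately show ?case by (simp add: diff_divide_distrib add_divide_distrib algebra_simps)
  qed
  ultimately show ?thesis by (simp add: Lim_transform_eventually)
qed

lemma near_time_pos: 
  assumes "near_time y T"
  shows "eventually (\<lambda>j. T j > 0) sequentially"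
proof -
  have "eventually (\<lambda>j. T j / real (level 0 j) > 0) sequentially"
    using order_tendstoD(1)[OF near_time_over_level[OF assms, of 0], of 0] lam_pos by simp
  thus ?thesis using level_pos[of 0] by eventually_elim (simp add: zero_less_divide_iff)
qed

section \<open>Beta averages of the age integrals\<close>

text \<open>This is the constant of the limiting intensity, because \<open>1 / (1 + lam)\<close>
  equals \<open>1 - inverse \<theta>\<close>.\<close>

definition clim :: real where "clim = Gamma (\<alpha> + \<beta>) / Gamma \<alpha> * (1 + lam) powr \<beta>"

lemma scaled_beta_integral:
  assumes gm [measurable]: "\<And>j. g j \<in> borel_measurable borel"
    and gb: "\<And>j w. 0 < w \<Longrightarrow> w < 1 \<Longrightarrow> \<bar>g j w\<bar> \<le> 1"
    and gl: "\<And>u. u > 0 \<Longrightarrow> (\<lambda>j. g j (1 - u / real (level m j))) \<longlonglongrightarrow> \<gamma>"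
  shows "(\<lambda>j. n j * (\<integral>w. (w * lam / (1 + w * lam)) ^ level m j * g j w \<partial>beta_distribution \<alpha> \<beta>))
         \<longlonglongrightarrow> clim * \<theta> powr (\<epsilon> - m) * \<gamma>"
proof -
  let ?I = "\<lambda>j. \<integral>w. (w * lam / (1 + w * lam)) ^ level m j * g j w \<partial>beta_distribution \<alpha> \<beta>"
  have "(\<lambda>j. real (n j) / (real (level m j) powr \<beta> * \<theta> ^ level m j) *
     (real (level m j) powr \<beta> * ((1 + lam) / lam) ^ level m j * ?I j))
     \<longlonglongrightarrow> \<theta> powr (\<epsilon> - m) * (Gamma (\<alpha> + \<beta>) / Gamma \<alpha> * (1 + lam) powr \<beta> * \<gamma>)"
    by (intro tendsto_mult mass_lim beta_scaling_limit ab lam_pos level_lim gm gb gl)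
  moreover have "eventually (\<lambda>j. real (n j) / (real (level m j) powr \<beta> * \<theta> ^ level m j) *
     (real (level m j) powr \<beta> * ((1 + lam) / lam) ^ level m j * ?I j) = n j * ?I j) sequentially"
    using level_pos[of m] by eventually_elim (use theta in \<open>simp add: lam(2)\<close>)
  ultimately show ?thesis by (simp add: Lim_transform_eventually clim_def mult_ac)
qed

lemma power_ratio_bounds: 
  assumes "0 < w" "w < (1::real)"
  shows "0 \<le> (w * lam / (1 + w * lam)) ^ k" "(w * lam / (1 + w * lam)) ^ k \<le> 1"
proof -
  have "w * lam > 0" using assms lam_pos by simp
  thus "0 \<le> (w * lam / (1 + w * lam)) ^ k" "(w * lam / (1 + w * lam)) ^ k \<le> 1"
    by (auto intro!: power_le_one simp: divide_le_eq)
qed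

lemma bulk_lim:
  assumes T: "near_time y T"
  shows "(\<lambda>j. n j * (\<integral>w. (w * lam / (1 + w * lam)) ^ level m j * (1 - ptail (level m j) ((1 + w * lam) * T j)) \<partial>beta_distribution \<alpha> \<beta>))
         \<longlonglongrightarrow> clim * \<theta> powr (\<epsilon> - m) * (1 - Phi y)"
proof -
  \<comment> \<open>Clipping at 0 gives the bound by 1 for every \<open>j\<close>; it is inactive as
    soon as \<open>T j > 0\<close> and the weight lies between 0 and 1.\<close>
  define g where "g = (\<lambda>j w. 1 - ptail (level m j) (max 0 ((1 + w * lam) * T j)))"
  have "(\<lambda>j. n j * (\<integral>w. (w * lam / (1 + w * lam)) ^ level m j * g j w \<partial>beta_distribution \<alpha> \<beta>))
         \<longlonglongrightarrow> clim * \<theta> powr (\<epsilon> - m) * (1 - Phi y)"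
  proof (rule scaled_beta_integral)
    show "g j \<in> borel_measurable borel" for j unfolding g_def by measurable
    show "\<bar>g j w\<bar> \<le> 1" for j w using ptail_nonneg ptail_le_1 by (simp add: g_def)
    fix u :: real assume u: "u > 0"
    have "(\<lambda>j. 1 - ptail (level m j) ((1 + (1 - u / real (level m j)) * lam) * T j)) \<longlonglongrightarrow> 1 - Phi y"
      by (intro ptail_clt level_lim near_time_clt T)
    moreover have "eventually (\<lambda>j. 1 - ptail (level m j) ((1 + (1 - u / real (level m j)) * lam) * T j) = g j (1 - u / real (level m j))) sequentially"
    proof -
      have "eventually (\<lambda>j. level m j > nat \<lceil>u\<rceil>) sequentially"
        using eventually_gt_at_top level_lim by (rule eventually_compose_filterlim)
      thus ?thesis using near_time_pos[OF T]
      proof eventually_elim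
        case (elim j)
        have "u < real (level m j)" using elim by linarith
        hence "0 \<le> 1 - u / real (level m j)" using u by simp
        hence "0 \<le> (1 + (1 - u / real (level m j)) * lam) * T j" using elim lam_pos by simp
        thus ?case by (simp add: g_def)
      qed
    qed
    ultimately show "(\<lambda>j. g j (1 - u / real (level m j))) \<longlonglongrightarrow> 1 - Phi y" by (rule Lim_transform_eventually)
  qed
  moreover have "eventually (\<lambda>j. n j * (\<integral>w. (w * lam / (1 + w * lam)) ^ level m j * g j w \<partial>beta_distribution \<alpha> \<beta>)
     = n j * (\<integral>w. (w * lam / (1 + w * lam)) ^ level m j * (1 - ptail (level m j) ((1 + w * lam) * T j)) \<partial>beta_distribution \<alpha> \<beta>)) sequentially"
    using near_time_pos[OF T]
  proof eventually_elim
    case (elim j)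
    show ?case
    proof (intro arg_cong[where f = "\<lambda>x. real (n j) * x"] integral_cong_AE)
      show "AE w in beta_distribution \<alpha> \<beta>. (w * lam / (1 + w * lam)) ^ level m j * g j w =
          (w * lam / (1 + w * lam)) ^ level m j * (1 - ptail (level m j) ((1 + w * lam) * T j))"
        using AE_beta by eventually_elim (use elim lam_pos in \<open>simp add: g_def\<close>)
    qed (unfold g_def, measurable)
  qed
  ultimately show ?thesis by (rule Lim_transform_eventually)
qed

lemma measurable_ltail [measurable (raw)]:
  assumes [measurable]: "f \<in> borel_measurable M" "g \<in> borel_measurable M"
  shows "(\<lambda>x. ltail k (f x) (g x)) \<in> borel_measurable M"
  unfolding ltail_def by measurable

lemma ltail_bounds:
  assumes "0 < w" "w < (1::real)" "T \<ge> 0"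
  shows "0 \<le> ltail k (w * lam) T" "ltail k (w * lam) T \<le> 2"
proof -
  have p: "0 \<le> ptail k (w * lam * T)" "ptail k (w * lam * T) \<le> 1" 
    "0 \<le> ptail k ((1 + w * lam) * T)" "ptail k ((1 + w * lam) * T) \<le> 1"
    using assms lam_pos by (auto intro!: ptail_nonneg ptail_le_1)
  show "0 \<le> ltail k (w * lam) T" unfolding ltail_def using p power_ratio_bounds[OF assms(1,2)] by auto
  have "exp (- T) * ptail k (w * lam * T) \<le> 1 * 1" using p assms by (intro mult_mono) auto
  moreover have "(w * lam / (1 + w * lam)) ^ k * (1 - ptail k ((1 + w * lam) * T)) \<le> 1 * 1"
    using p power_ratio_bounds[OF assms(1,2)] by (intro mult_mono) auto
  ultimately show "ltail k (w * lam) T \<le> 2" unfolding ltail_def by simp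
qed

definition ltail_mean :: "nat \<Rightarrow> real \<Rightarrow> real" where
  "ltail_mean k T = (\<integral>w. ltail k (w * lam) T \<partial>beta_distribution \<alpha> \<beta>)"

definition ptail_mean :: "nat \<Rightarrow> real \<Rightarrow> real" where
  "ptail_mean k t = (\<integral>w. ptail k (w * lam * t) \<partial>beta_distribution \<alpha> \<beta>)"

lemma integrable_ltail: "T \<ge> 0 \<Longrightarrow> integrable (beta_distribution \<alpha> \<beta>) (\<lambda>w. ltail k (w * lam) T)"
  using ltail_bounds by (intro integrable_beta_bounded[of _ 2]) (auto simp: abs_le_iff intro: order_trans[of _ 0])

lemma integrable_ptail: "t \<ge> 0 \<Longrightarrow> integrable (beta_distribution \<alpha> \<beta>) (\<lambda>w. ptail k (w * lam * t))"
  using ptail_nonneg ptail_le_1 lam_pos by (intro integrable_beta_bounded[of _ 1]) auto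

lemma ltail_mean_total_lim:
  "(\<lambda>j. n j * ltail_mean (level m j) 0) \<longlonglongrightarrow> clim * \<theta> powr (\<epsilon> - m)"
proof -
  have "(\<lambda>j. n j * (\<integral>w. (w * lam / (1 + w * lam)) ^ level m j * (\<lambda>_. 1) w \<partial>beta_distribution \<alpha> \<beta>))
         \<longlonglongrightarrow> clim * \<theta> powr (\<epsilon> - m) * 1"
    by (rule scaled_beta_integral) auto
  moreover have "eventually (\<lambda>j. n j * (\<integral>w. (w * lam / (1 + w * lam)) ^ level m j * (\<lambda>_. 1) w \<partial>beta_distribution \<alpha> \<beta>)
      = n j * ltail_mean (level m j) 0) sequentially"
    using level_pos[of m] by eventually_elim (simp add: ltail_mean_def ltail_def ptail_at_0)
  ultimately show ?thesis by (simp add: Lim_transform_eventually)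
qed

text \<open>The Gamma part alone is a lower bound. For an upper bound, \<open>ltail_boundary\<close>
  is started at \<open>T j - s\<close>: a constant shift does not change the limit of the Gamma
  part, and the error, \<open>exp (- s)\<close> times the total mass, disappears as \<open>s\<close>
  grows.\<close>

lemma ltail_mean_lim:
  assumes T: "near_time y T"
  shows "(\<lambda>j. n j * ltail_mean (level m j) (T j)) \<longlonglongrightarrow> clim * \<theta> powr (\<epsilon> - m) * (1 - Phi y)"
proof -
  let ?q = "\<lambda>j w. (w * lam / (1 + w * lam)) ^ level m j"
  let ?II = "\<lambda>j T. (\<integral>w. ?q j w * (1 - ptail (level m j) ((1 + w * lam) * T)) \<partial>beta_distribution \<alpha> \<beta>)"
  define L where "L = clim * \<theta> powr (\<epsilon> - m)"
  have intII: "integrable (beta_distribution \<alpha> \<beta>) (\<lambda>w. ?q j w * (1 - ptail (level m j) ((1 + w * lam) * t)))" if "t \<ge> 0" for t j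
  proof (rule integrable_beta_bounded[of _ "1 * 1"])
    fix w :: real assume w: "0 < w" "w < 1"
    show "\<bar>?q j w * (1 - ptail (level m j) ((1 + w * lam) * t))\<bar> \<le> 1 * 1"
      unfolding abs_mult using power_ratio_bounds[OF w] ptail_nonneg ptail_le_1 w that lam_pos
      by (intro mult_mono) auto
  qed measurable
  have intq: "integrable (beta_distribution \<alpha> \<beta>) (\<lambda>w. ?q j w)" for j
    using power_ratio_bounds by (intro integrable_beta_bounded[of _ 1]) auto
  have lower: "eventually (\<lambda>j. n j * ?II j (T j) \<le> n j * ltail_mean (level m j) (T j)) sequentially"
    using near_time_pos[OF T]
  proof eventually_elim
    case (elim j)
    have "?II j (T j) \<le> ltail_mean (level m j) (T j)"
      unfolding ltail_mean_def
    proof (rule integral_mono_AE)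
      show "AE w in beta_distribution \<alpha> \<beta>. ?q j w * (1 - ptail (level m j) ((1 + w * lam) * T j)) \<le> ltail (level m j) (w * lam) (T j)"
        using AE_beta by eventually_elim (use elim lam_pos in \<open>simp add: ltail_def ptail_nonneg\<close>)
    qed (use intII integrable_ltail elim in auto)
    thus ?case by (simp add: mult_left_mono)
  qed
  have upper: "eventually (\<lambda>j. n j * ltail_mean (level m j) (T j) \<le>
     exp (- s) * (n j * ltail_mean (level m j) 0) + n j * ?II j (T j - s)) sequentially" if s: "s > 0" for s
    using near_time_pos[OF T] near_time_pos[OF near_time_shift[OF T, of "- s"]] level_pos[of m]
  proof eventually_elim
    case (elim j)
    have "ltail_mean (level m j) (T j) \<le> (\<integral>w. exp (- s) * ltail (level m j) (w * lam) 0 + ?q j w * (1 - ptail (level m j) ((1 + w * lam) * (T j - s))) \<partial>beta_distribution \<alpha> \<beta>)"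
      unfolding ltail_mean_def
    proof (rule integral_mono_AE)
      show "AE w in beta_distribution \<alpha> \<beta>. ltail (level m j) (w * lam) (T j) \<le>
         exp (- s) * ltail (level m j) (w * lam) 0 + ?q j w * (1 - ptail (level m j) ((1 + w * lam) * (T j - s)))"
        using AE_beta
      proof eventually_elim
        case (elim w)
        have "ltail (level m j) (w * lam) 0 = ?q j w" using \<open>0 < level m j\<close> by (simp add: ltail_def ptail_at_0)
        thus ?case using ltail_boundary[of "w * lam" "T j - s" "T j" "level m j"] elim lam_pos s \<open>0 < T j + - s\<close> by simp
      qed
      show "integrable (beta_distribution \<alpha> \<beta>) (\<lambda>w. exp (- s) * ltail (level m j) (w * lam) 0 + ?q j w * (1 - ptail (level m j) ((1 + w * lam) * (T j - s))))"
        using elim by (intro Bochner_Integration.integrable_add integrable_mult_right integrable_ltail intII) auto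
    qed (use integrable_ltail elim in auto)
    also have "\<dots> = exp (- s) * ltail_mean (level m j) 0 + ?II j (T j - s)"
      unfolding ltail_mean_def using elim
      by (subst Bochner_Integration.integral_add) (auto intro!: integrable_ltail intII)
    finally have "n j * ltail_mean (level m j) (T j) \<le> n j * (exp (- s) * ltail_mean (level m j) 0 + ?II j (T j - s))"
      by (rule mult_left_mono) simp
    thus ?case by (simp only: distrib_left mult.left_commute)
  qed
  have liml: "(\<lambda>j. n j * ?II j (T j)) \<longlonglongrightarrow> L * (1 - Phi y)"
    unfolding L_def by (rule bulk_lim[OF T])
  have limu: "(\<lambda>j. exp (- s) * (n j * ltail_mean (level m j) 0) + n j * ?II j (T j - s)) \<longlonglongrightarrow> exp (- s) * L + L * (1 - Phi y)" for s
    unfolding L_def using near_time_shift[OF T, of "- s"]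
    by (intro tendsto_add tendsto_mult tendsto_const ltail_mean_total_lim bulk_lim) auto
  show ?thesis unfolding L_def[symmetric]
  proof (rule order_tendstoI)
    fix x assume "x < L * (1 - Phi y)"
    from order_tendstoD(1)[OF liml this] lower
    show "eventually (\<lambda>j. x < n j * ltail_mean (level m j) (T j)) sequentially" by eventually_elim linarith
  next
    fix x assume x: "L * (1 - Phi y) < x"
    have "((\<lambda>s. exp (- s) * L + L * (1 - Phi y)) \<longlongrightarrow> 0 * L + L * (1 - Phi y)) at_top"
      by (intro tendsto_intros filterlim_compose[OF exp_at_bot] filterlim_uminus_at_bot_at_top)
    hence "eventually (\<lambda>s. exp (- s) * L + L * (1 - Phi y) < x) at_top" using x by (intro order_tendstoD(2)) auto
    moreover have "eventually (\<lambda>s::real. s > 0) at_top" by (rule eventually_gt_at_top)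
    ultimately have "eventually (\<lambda>s. exp (- s) * L + L * (1 - Phi y) < x \<and> s > 0) at_top" by eventually_elim auto
    then obtain s where s: "exp (- s) * L + L * (1 - Phi y) < x" "s > 0"
      using eventually_happens' trivial_limit_at_top_linorder by blast
    from order_tendstoD(2)[OF limu s(1)] upper[OF s(2)]
    show "eventually (\<lambda>j. n j * ltail_mean (level m j) (T j) < x) sequentially" by eventually_elim linarith
  qed
qed

end

lemma Phi_uminus: "Phi (- x) = 1 - Phi x"
proof -
  have "emeasure std_normal_distribution {..- x} = (\<integral>\<^sup>+t. ennreal (std_normal_density t) * indicator {..- x} t \<partial>lborel)"
    by (subst emeasure_density) auto
  also have "\<dots> = (\<integral>\<^sup>+t. ennreal (std_normal_density (- t)) * indicator {..- x} (- t) \<partial>lborel)"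
    by (subst nn_integral_real_affine[where c = "-1" and t = 0]) auto
  also have "\<dots> = (\<integral>\<^sup>+t. ennreal (std_normal_density t) * indicator {x..} t \<partial>lborel)"
    by (intro nn_integral_cong) (auto simp: indicator_def normal_density_def)
  also have "\<dots> = emeasure std_normal_distribution {x..}"
    by (subst emeasure_density) auto
  finally have "Phi (- x) = measure std_normal_distribution {x..}" by (simp add: cdf_def2 measure_def)
  also have "\<dots> = 1 - measure std_normal_distribution {..<x}"
    using std_normal.prob_compl[of "{..<x}"] by (simp add: Compl_eq_Diff_UNIV[symmetric] not_less Compl_lessThan)
  also have "measure std_normal_distribution {..<x} = Phi x"
  proof -
    have "measure std_normal_distribution {x} = 0"
      using isCont_Phi[of x] by (simp add: std_normal.isCont_cdf)
    moreover have "{..x} = {..<x} \<union> {x}" by auto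
    ultimately show ?thesis unfolding cdf_def2
      by (subst \<open>{..x} = _\<close>, subst std_normal.finite_measure_Union) auto
  qed
  finally show ?thesis .
qed

section \<open>Riemann sums over labels\<close>

context beta_tree_setting
begin

lemma ptail_mean_mono: "0 \<le> s \<Longrightarrow> s \<le> t \<Longrightarrow> ptail_mean k s \<le> ptail_mean k t"
  unfolding ptail_mean_def
proof (rule integral_mono_AE)
  assume *: "0 \<le> s" "s \<le> t"
  show "AE w in beta_distribution \<alpha> \<beta>. ptail k (w * lam * s) \<le> ptail k (w * lam * t)"
    using AE_beta by eventually_elim (use * lam_pos in \<open>auto intro!: ptail_mono mult_left_mono\<close>)
qed (auto intro: integrable_ptail)

lemma ptail_mean_nonneg: "0 \<le> t \<Longrightarrow> 0 \<le> ptail_mean k t"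
  unfolding ptail_mean_def
proof (rule integral_nonneg_AE)
  assume *: "0 \<le> t"
  show "AE w in beta_distribution \<alpha> \<beta>. 0 \<le> ptail k (w * lam * t)"
    using AE_beta by eventually_elim (use * lam_pos in \<open>auto intro!: ptail_nonneg\<close>)
qed

lemma ltail_mean_nonneg: "0 \<le> T \<Longrightarrow> 0 \<le> ltail_mean k T"
  unfolding ltail_mean_def
proof (rule integral_nonneg_AE)
  assume *: "0 \<le> T"
  show "AE w in beta_distribution \<alpha> \<beta>. 0 \<le> ltail k (w * lam) T"
    using AE_beta by eventually_elim (use * ltail_bounds in auto)
qed

lemma ltail_mean_diff_bounds:
  assumes "0 \<le> A" "A \<le> B"
  shows "ptail_mean k A * (exp (- A) - exp (- B)) \<le> ltail_mean k A - ltail_mean k B"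
    and "ltail_mean k A - ltail_mean k B \<le> ptail_mean k B * (exp (- A) - exp (- B))"
proof -
  have e: "ltail_mean k A - ltail_mean k B = (\<integral>w. ltail k (w * lam) A - ltail k (w * lam) B \<partial>beta_distribution \<alpha> \<beta>)"
    unfolding ltail_mean_def using assms by (subst Bochner_Integration.integral_diff) (auto intro: integrable_ltail)
  have e2: "ptail_mean k C * D = (\<integral>w. ptail k (w * lam * C) * D \<partial>beta_distribution \<alpha> \<beta>)" for C D
    unfolding ptail_mean_def by simp
  show "ptail_mean k A * (exp (- A) - exp (- B)) \<le> ltail_mean k A - ltail_mean k B"
    unfolding e e2
  proof (rule integral_mono_AE)
    show "AE w in beta_distribution \<alpha> \<beta>. ptail k (w * lam * A) * (exp (- A) - exp (- B)) \<le> ltail k (w * lam) A - ltail k (w * lam) B"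
      using AE_beta by eventually_elim (use assms lam_pos ltail_diff_bounds(1) in auto)
  qed (use assms in \<open>auto intro!: integrable_ptail integrable_ltail\<close>)
  show "ltail_mean k A - ltail_mean k B \<le> ptail_mean k B * (exp (- A) - exp (- B))"
    unfolding e e2
  proof (rule integral_mono_AE)
    show "AE w in beta_distribution \<alpha> \<beta>. ltail k (w * lam) A - ltail k (w * lam) B \<le> ptail k (w * lam * B) * (exp (- A) - exp (- B))"
      using AE_beta by eventually_elim (use assms lam_pos ltail_diff_bounds(2) in auto)
  qed (use assms in \<open>auto intro!: integrable_ptail integrable_ltail\<close>)
qed

lemma ltail_mean_antimono: "0 \<le> A \<Longrightarrow> A \<le> B \<Longrightarrow> ltail_mean k B \<le> ltail_mean k A"
  using ltail_mean_diff_bounds(1)[of A B k] ptail_mean_nonneg[of A k]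
  by (smt (verit, best) exp_le_cancel_iff mult_nonneg_nonneg)

text \<open>The numbers \<open>exp (- (ln (nn / i) + r))\<close> are equally spaced in
  \<open>i\<close>, with gap \<open>exp (- r) / nn\<close>. Each summand times this gap is at most
  the increment of \<open>ltail_mean\<close> between the ages of \<open>i\<close> and
  \<open>i - 1\<close>, so the sum telescopes. Starting at 2 or later keeps \<open>i - 1\<close>
  positive.\<close>

lemma sum_ptail_mean_upper:
  fixes nn N k :: nat
  assumes "2 \<le> N" "0 \<le> r" "0 \<le> T" "N \<le> nn"
  shows "(\<Sum>i\<in>{i\<in>{N..nn}. T \<le> ln (real nn / real i)}. ptail_mean k (ln (real nn / real i) + r))
          \<le> exp r * (real nn * ltail_mean k (T + r))"
proof -
  define A where "A = (\<lambda>i::nat. ln (real nn / real i) + r)"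
  \<comment> \<open>Clamping at \<open>T + r\<close> lets the telescoping sum run over all labels
    and still end exactly at \<open>ltail_mean k (T + r)\<close>, whichever label is the last one of
    age at least \<open>T\<close>.\<close>
  define G where "G = (\<lambda>i. ltail_mean k (max (A i) (T + r)))"
  have Amono: "A i \<le> A (i - 1)" if "i \<in> {N..nn}" for i
  proof -
    have "real nn / real i \<le> real nn / real (i - 1)" using that assms by (intro divide_left_mono) auto
    thus ?thesis unfolding A_def using that assms by simp
  qed
  have Apos: "0 \<le> A i" if "i \<in> {N..nn}" for i
    unfolding A_def using that assms by simp
  have diff: "exp (- A i) - exp (- A (i - 1)) = exp (- r) / real nn" if "i \<in> {N..nn}" for i
  proof -
    have e: "exp (- A l) = exp (- r) * (real l / real nn)" if "l > 0" for l :: nat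
      using that assms unfolding A_def by (simp add: exp_add exp_diff exp_minus field_simps)
    have "exp (- A i) - exp (- A (i - 1)) = exp (- r) * (real i / real nn) - exp (- r) * (real (i - 1) / real nn)"
      using that assms by (subst (1 2) e) auto
    also have "\<dots> = exp (- r) * ((real i - real (i - 1)) / real nn)" by (simp add: right_diff_distrib diff_divide_distrib)
    also have "real i - real (i - 1) = 1" using that assms by (simp add: of_nat_diff)
    finally show ?thesis by simp
  qed
  have bnd: "ptail_mean k (A i) * (exp (- r) / real nn) \<le> G i - G (i - 1)"
    if "i \<in> {N..nn}" "T \<le> ln (real nn / real i)" for i
  proof -
    have "T + r \<le> A i" using that by (simp add: A_def)
    hence "G i = ltail_mean k (A i)" "G (i - 1) = ltail_mean k (A (i - 1))"
      using Amono[OF that(1)] by (simp_all add: G_def max.absorb1)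
    thus ?thesis using ltail_mean_diff_bounds(1)[OF Apos[OF that(1)] Amono[OF that(1)], of k] diff[OF that(1)] by simp
  qed
  have nonneg: "0 \<le> G i - G (i - 1)" if "i \<in> {N..nn}" for i
    unfolding G_def using Amono[OF that] assms by (auto intro!: ltail_mean_antimono)
  have "(\<Sum>i\<in>{i\<in>{N..nn}. T \<le> ln (real nn / real i)}. ptail_mean k (A i)) * (exp (- r) / real nn)
      = (\<Sum>i\<in>{i\<in>{N..nn}. T \<le> ln (real nn / real i)}. ptail_mean k (A i) * (exp (- r) / real nn))"
    by (rule sum_distrib_right)
  also have "\<dots> \<le> (\<Sum>i\<in>{i\<in>{N..nn}. T \<le> ln (real nn / real i)}. G i - G (i - 1))"
    using bnd by (intro sum_mono) auto
  also have "\<dots> \<le> (\<Sum>i\<in>{N..nn}. G i - G (i - 1))"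
    using nonneg by (intro sum_mono2) auto
  also have "\<dots> = G nn - G (N - 1)"
    using assms(4) by (induction rule: dec_induct) (auto simp: sum.cl_ivl_Suc)
  also have "\<dots> \<le> G nn"
    unfolding G_def using ltail_mean_nonneg assms by (auto simp: le_max_iff_disj)
  also have "G nn = ltail_mean k (T + r)" using assms by (simp add: G_def A_def max_def)
  finally have "(\<Sum>i\<in>{i\<in>{N..nn}. T \<le> ln (real nn / real i)}. ptail_mean k (A i)) * (exp (- r) / real nn) \<le> ltail_mean k (T + r)" .
  thus ?thesis using assms unfolding A_def by (simp add: exp_minus field_simps)
qed

text \<open>Here the cell of \<open>i\<close> reaches to \<open>Suc i\<close>. For the clipped ages,
  \<open>exp (- A l)\<close> is \<open>min 1 (exp r * l / nn)\<close>, whose increments are at most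
  \<open>exp r / nn\<close>. Labels below \<open>N\<close> are missing from the sum, hence the
  subtracted tail at the age of \<open>N\<close>.\<close>

lemma sum_ptail_mean_lower:
  fixes nn N k :: nat
  assumes "2 \<le> N" "0 \<le> r" "0 \<le> T" "N \<le> nn" "r \<le> ln (real nn / real N)"
  shows "exp (- r) * (real nn * (ltail_mean k (max 0 (T - r)) - ltail_mean k (ln (real nn / real N) - r))) \<le>
    (\<Sum>i\<in>{i\<in>{N..nn}. T \<le> ln (real nn / real i)}. ptail_mean k (max 0 (ln (real nn / real i) - r)))"
proof -
  define A where "A = (\<lambda>i::nat. max 0 (ln (real nn / real i) - r))"
  define T' where "T' = max 0 (T - r)"
  define G where "G = (\<lambda>i. ltail_mean k (max (A i) T'))"
  have Amono: "A (Suc i) \<le> A i" if "i \<in> {N..nn}" for i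
  proof -
    have "real nn / real (Suc i) \<le> real nn / real i" using that assms by (intro divide_left_mono) auto
    hence "ln (real nn / real (Suc i)) \<le> ln (real nn / real i)" using that assms by simp
    thus ?thesis unfolding A_def by simp
  qed
  have A0: "0 \<le> A i" for i by (simp add: A_def)
  have eA: "exp (- A l) = min 1 (exp r * (real l / real nn))" if "l > 0" for l :: nat
  proof -
    have "exp (- (ln (real nn / real l) - r)) = exp r * (real l / real nn)"
      using that assms by (simp add: exp_add exp_diff exp_minus field_simps)
    moreover have "exp (- A l) = min 1 (exp (- (ln (real nn / real l) - r)))"
      unfolding A_def by (simp add: max_def min_def)
    ultimately show ?thesis by simp
  qed
  have diff: "exp (- A (Suc i)) - exp (- A i) \<le> exp r / real nn" if "i \<in> {N..nn}" for i
  proof -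
    have "exp (- A (Suc i)) - exp (- A i) = min 1 (exp r * (real (Suc i) / real nn)) - min 1 (exp r * (real i / real nn))"
      using that assms by (subst (1 2) eA) auto
    also have "exp r * (real (Suc i) / real nn) = exp r * (real i / real nn) + exp r / real nn"
      by (simp add: add_divide_distrib distrib_left)
    also have "min 1 (exp r * (real i / real nn) + exp r / real nn) - min 1 (exp r * (real i / real nn)) \<le> exp r / real nn"
    proof -
      have "min 1 (x + d) - min 1 x \<le> d" if "d \<ge> 0" for x d :: real using that by (simp add: min_def)
      thus ?thesis by simp
    qed
    finally show ?thesis .
  qed
  have bnd: "G (Suc i) - G i \<le> (if T \<le> ln (real nn / real i) then ptail_mean k (A i) * (exp r / real nn) else 0)"
    if i: "i \<in> {N..nn}" for i
  proof (cases "T \<le> ln (real nn / real i)")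
    case False
    hence "A i \<le> T'" "A (Suc i) \<le> T'" using Amono[OF i] by (auto simp: A_def T'_def)
    thus ?thesis using False by (simp add: G_def max_def)
  next
    case True
    have "T' \<le> A i" using True by (auto simp: T'_def A_def)
    hence "G i = ltail_mean k (A i)" by (simp add: G_def max_def)
    moreover have "G (Suc i) \<le> ltail_mean k (A (Suc i))"
      unfolding G_def using A0 by (intro ltail_mean_antimono) auto
    ultimately have "G (Suc i) - G i \<le> ltail_mean k (A (Suc i)) - ltail_mean k (A i)" by simp
    also have "\<dots> \<le> ptail_mean k (A i) * (exp (- A (Suc i)) - exp (- A i))"
      by (rule ltail_mean_diff_bounds(2)[OF A0 Amono[OF i]])
    also have "\<dots> \<le> ptail_mean k (A i) * (exp r / real nn)"
      by (intro mult_left_mono diff i ptail_mean_nonneg A0)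
    finally show ?thesis using True by simp
  qed
  have "ltail_mean k T' - ltail_mean k (A N) \<le> G (Suc nn) - G N"
  proof -
    have "ln (real nn / real (Suc nn)) \<le> 0" using assms by simp
    hence "ln (real nn / real (Suc nn)) - r \<le> 0" using assms by linarith
    hence "A (Suc nn) = 0" unfolding A_def by (rule max_absorb1)
    moreover have "T' \<ge> 0" by (simp add: T'_def)
    ultimately have "G (Suc nn) = ltail_mean k T'" by (simp add: G_def max_def)
    moreover have "G N \<le> ltail_mean k (A N)" unfolding G_def using A0 by (intro ltail_mean_antimono) auto
    ultimately show ?thesis by simp
  qed
  also have "\<dots> = (\<Sum>i\<in>{N..nn}. G (Suc i) - G i)"
    using assms by (subst sum_Suc_diff) auto
  also have "\<dots> \<le> (\<Sum>i\<in>{N..nn}. if T \<le> ln (real nn / real i) then ptail_mean k (A i) * (exp r / real nn) else 0)"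
    by (intro sum_mono bnd)
  also have "\<dots> = (\<Sum>i\<in>{i\<in>{N..nn}. T \<le> ln (real nn / real i)}. ptail_mean k (A i)) * (exp r / real nn)"
    unfolding sum_distrib_right by (rule sum.inter_filter[symmetric]) simp
  finally have "ltail_mean k T' - ltail_mean k (A N) \<le> (\<Sum>i\<in>{i\<in>{N..nn}. T \<le> ln (real nn / real i)}. ptail_mean k (A i)) * (exp r / real nn)" .
  moreover have "A N = ln (real nn / real N) - r" using assms by (simp add: A_def)
  ultimately show ?thesis using assms unfolding T'_def A_def by (simp add: exp_minus field_simps)
qed

text \<open>The limiting ratio of the age of a top vertex to \<open>lg j\<close>.\<close>

definition log_spread :: real where "log_spread = 1 / (1 + lam)"

text \<open>Ages of at least \<open>\<kappa> * lg j - C\<close> eventually pass every Gaussian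
  window, and the limit at window \<open>y\<close> is proportional to \<open>1 - Phi y\<close>,
  which is arbitrarily small.\<close>

lemma far_tail_lim:
  assumes "\<kappa> > log_spread" "eventually (\<lambda>j. S j \<ge> \<kappa> * lg j - C) sequentially"
  shows "(\<lambda>j. n j * ltail_mean (level m j) (S j)) \<longlonglongrightarrow> 0"
proof -
  define L where "L = clim * \<theta> powr (\<epsilon> - m)"
  have ev: "eventually (\<lambda>j. 0 \<le> n j * ltail_mean (level m j) (S j) \<and> n j * ltail_mean (level m j) (S j) \<le>
      n j * ltail_mean (level m j) ((lg j + y * sqrt (lg j)) / (1 + lam))) sequentially" if y: "y \<ge> 0" for y
  proof -
    have k: "\<kappa> - 1 / (1 + lam) > 0" using assms(1) by (simp add: log_spread_def)
    have "eventually (\<lambda>x::real. (\<kappa> - 1 / (1 + lam)) * x - C - (y / (1 + lam)) * sqrt x > 0) at_top"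
      using k by real_asymp
    hence "eventually (\<lambda>j. (\<kappa> - 1 / (1 + lam)) * lg j - C - (y / (1 + lam)) * sqrt (lg j) > 0) sequentially"
      using lg_lim by (rule eventually_compose_filterlim)
    thus ?thesis using assms(2) lg_pos
    proof eventually_elim
      case (elim j)
      have "(lg j + y * sqrt (lg j)) / (1 + lam) \<le> S j"
        using elim by (simp add: left_diff_distrib add_divide_distrib)
      moreover have "0 \<le> (lg j + y * sqrt (lg j)) / (1 + lam)" using elim y lam_pos by simp
      ultimately show ?case using ltail_mean_antimono ltail_mean_nonneg[of "S j" "level m j"] by (auto intro!: mult_left_mono)
    qed
  qed
  have lim: "(\<lambda>j. n j * ltail_mean (level m j) ((lg j + y * sqrt (lg j)) / (1 + lam))) \<longlonglongrightarrow> L * (1 - Phi y)" for y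
    unfolding L_def by (rule ltail_mean_lim) (auto simp: near_time_def intro!: exI[of _ 0])
  show ?thesis
  proof (rule order_tendstoI)
    fix x :: real assume "x < 0"
    thus "eventually (\<lambda>j. x < n j * ltail_mean (level m j) (S j)) sequentially"
      using ev[of 0] by (auto elim: eventually_mono)
  next
    fix x :: real assume x: "0 < x"
    have "((\<lambda>y. L * (1 - Phi y)) \<longlongrightarrow> L * (1 - 1)) at_top"
      by (intro tendsto_intros std_normal.cdf_lim_at_top_prob)
    hence "eventually (\<lambda>y. L * (1 - Phi y) < x) at_top" using x by (intro order_tendstoD(2)) auto
    moreover have "eventually (\<lambda>y::real. y \<ge> 0) at_top" by (rule eventually_ge_at_top)
    ultimately have "eventually (\<lambda>y. L * (1 - Phi y) < x \<and> y \<ge> 0) at_top" by eventually_elim auto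
    then obtain y where y: "L * (1 - Phi y) < x" "y \<ge> 0"
      using eventually_happens' trivial_limit_at_top_linorder by blast
    from order_tendstoD(2)[OF lim y(1)] ev[OF y(2)]
    show "eventually (\<lambda>j. n j * ltail_mean (level m j) (S j) < x) sequentially" by eventually_elim linarith
  qed
qed

text \<open>The shift \<open>r j\<close> stands for the error with which the weights determine the
  mean degrees, so raised and lowered ages must give the same limit. The majorant \<open>Y\<close>
  is a separate sequence for the sake of the cell containing all labels: there
  \<open>T j = 0\<close> is outside every window, but the shifted mass is bounded by the total
  mass.\<close>

lemma sum_ptail_mean_squeeze:
  assumes N: "eventually (\<lambda>j. 2 \<le> N j \<and> N j \<le> n j) sequentially"
    and kappa: "\<kappa> > log_spread" "eventually (\<lambda>j. ln (real (n j) / real (N j)) \<ge> \<kappa> * lg j - C) sequentially"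
    and r: "\<And>j. 0 \<le> r j" "r \<longlonglongrightarrow> 0"
    and T: "eventually (\<lambda>j. 0 \<le> T j) sequentially"
    and up: "eventually (\<lambda>j. n j * ltail_mean (level m j) (T j + r j) \<le> Y j) sequentially" "Y \<longlonglongrightarrow> X"
    and lo: "(\<lambda>j. n j * ltail_mean (level m j) (max 0 (T j - r j))) \<longlonglongrightarrow> X"
  shows "(\<lambda>j. \<Sum>i\<in>{i\<in>{N j..n j}. T j \<le> ln (real (n j) / real i)}. ptail_mean (level m j) (ln (real (n j) / real i) + r j)) \<longlonglongrightarrow> X"
    and "(\<lambda>j. \<Sum>i\<in>{i\<in>{N j..n j}. T j \<le> ln (real (n j) / real i)}. ptail_mean (level m j) (max 0 (ln (real (n j) / real i) - r j))) \<longlonglongrightarrow> X"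
proof -
  let ?U = "\<lambda>j. \<Sum>i\<in>{i\<in>{N j..n j}. T j \<le> ln (real (n j) / real i)}. ptail_mean (level m j) (ln (real (n j) / real i) + r j)"
  let ?D = "\<lambda>j. \<Sum>i\<in>{i\<in>{N j..n j}. T j \<le> ln (real (n j) / real i)}. ptail_mean (level m j) (max 0 (ln (real (n j) / real i) - r j))"
  have r1: "eventually (\<lambda>j. r j < 1) sequentially" using order_tendstoD(2)[OF r(2), of 1] by simp
  have "eventually (\<lambda>x::real. \<kappa> * x - C > 1) at_top"
  proof -
    have "\<kappa> > 0" using kappa(1) lam_pos by (simp add: log_spread_def) (smt (verit) divide_pos_pos)
    thus ?thesis by real_asymp
  qed
  hence big: "eventually (\<lambda>j. \<kappa> * lg j - C > 1) sequentially"
    using lg_lim by (rule eventually_compose_filterlim)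
  \<comment> \<open>This is the share of the integral belonging to labels below \<open>N j\<close>,
    which are not summed.\<close>
  have far: "(\<lambda>j. n j * ltail_mean (level m j) (ln (real (n j) / real (N j)) - r j)) \<longlonglongrightarrow> 0"
  proof (rule far_tail_lim[OF kappa(1)])
    show "eventually (\<lambda>j. \<kappa> * lg j - (C + 1) \<le> ln (real (n j) / real (N j)) - r j) sequentially"
      using kappa(2) r1 by eventually_elim linarith
  qed
  have UD: "eventually (\<lambda>j. ?D j \<le> ?U j) sequentially"
    using N
  proof eventually_elim
    case (elim j)
    show ?case
    proof (rule sum_mono)
      fix i assume i: "i \<in> {i \<in> {N j..n j}. T j \<le> ln (real (n j) / real i)}"
      hence "0 \<le> ln (real (n j) / real i)" using elim by simp
      thus "ptail_mean (level m j) (max 0 (ln (real (n j) / real i) - r j)) \<le> ptail_mean (level m j) (ln (real (n j) / real i) + r j)"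
        using r(1)[of j] by (intro ptail_mean_mono) auto
    qed
  qed
  have U: "eventually (\<lambda>j. ?U j \<le> exp (r j) * Y j) sequentially"
    using N T up(1)
  proof eventually_elim
    case (elim j)
    have "?U j \<le> exp (r j) * (n j * ltail_mean (level m j) (T j + r j))"
      using elim r by (intro sum_ptail_mean_upper) auto
    also have "\<dots> \<le> exp (r j) * Y j" using elim by (intro mult_left_mono) auto
    finally show ?case .
  qed
  have D: "eventually (\<lambda>j. exp (- r j) * (n j * ltail_mean (level m j) (max 0 (T j - r j)) - n j * ltail_mean (level m j) (ln (real (n j) / real (N j)) - r j)) \<le> ?D j) sequentially"
    using N T r1 big kappa(2)
  proof eventually_elim
    case (elim j)
    have "r j \<le> ln (real (n j) / real (N j))" using elim by linarith
    from sum_ptail_mean_lower[of "N j" "r j" "T j" "n j" "level m j", OF _ _ _ _ this] elim r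
    show ?case by (simp only: right_diff_distrib)
  qed
  have limU: "(\<lambda>j. exp (r j) * Y j) \<longlonglongrightarrow> exp 0 * X"
    by (intro tendsto_intros r up)
  have limD: "(\<lambda>j. exp (- r j) * (n j * ltail_mean (level m j) (max 0 (T j - r j)) - n j * ltail_mean (level m j) (ln (real (n j) / real (N j)) - r j))) \<longlonglongrightarrow> exp (- 0) * (X - 0)"
    by (intro tendsto_intros r lo far)
  show "?U \<longlonglongrightarrow> X"
  proof (rule tendsto_sandwich[OF _ U])
    show "eventually (\<lambda>j. exp (- r j) * (n j * ltail_mean (level m j) (max 0 (T j - r j)) - n j * ltail_mean (level m j) (ln (real (n j) / real (N j)) - r j)) \<le> ?U j) sequentially"
      using D UD by eventually_elim linarith
  qed (use limU limD in auto)
  show "?D \<longlonglongrightarrow> X"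
  proof (rule tendsto_sandwich[OF D])
    show "eventually (\<lambda>j. ?D j \<le> exp (r j) * Y j) sequentially"
      using U UD by eventually_elim linarith
  qed (use limU limD in auto)
qed

section \<open>Intensities of cells of normalised labels\<close>

definition label_z :: "nat \<Rightarrow> nat \<Rightarrow> real" where
  "label_z j i = (ln (real i) - (1 - (\<theta> - 1) / (\<theta> * ln \<theta>)) * ln (real (n j))) /
     sqrt ((1 - (1 - (\<theta> - 1)\<^sup>2 / (\<theta>\<^sup>2 * ln \<theta>))) * ln (real (n j)))"

text \<open>With b = (\<theta> - 1) / \<theta> = 1 / (1 + lam), the label is centred at
  \<open>ln (n j) - b * lg j\<close> and scaled by \<open>b * sqrt (lg j)\<close>. Small labels are
  large ages, so the threshold appears as \<open>- x\<close>; the symmetry \<open>Phi_uminus\<close>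
  undoes this later.\<close>

lemma label_z_le_iff:
  assumes "lg j > 0" "i > 0" "n j > 0"
  shows "label_z j i \<le> x \<longleftrightarrow> (lg j + (- x) * sqrt (lg j)) / (1 + lam) \<le> ln (real (n j) / real i)"
proof -
  have t: "ln \<theta> > 0" "\<theta> > 1" using theta by auto
  have ln_n: "ln (real (n j)) = lg j * ln \<theta>" using t by (simp add: lg_ln)
  define b where "b = (\<theta> - 1) / \<theta>"
  have b: "b > 0" "1 / (1 + lam) = b" using t lam(4) by (auto simp: b_def)
  have "(1 - (1 - (\<theta> - 1)\<^sup>2 / (\<theta>\<^sup>2 * ln \<theta>))) * ln (real (n j)) = b\<^sup>2 * lg j"
    using t unfolding ln_n by (simp add: b_def power_divide)
  hence s: "sqrt ((1 - (1 - (\<theta> - 1)\<^sup>2 / (\<theta>\<^sup>2 * ln \<theta>))) * ln (real (n j))) = b * sqrt (lg j)"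
    using b by (simp add: real_sqrt_mult)
  have m: "(1 - (\<theta> - 1) / (\<theta> * ln \<theta>)) * ln (real (n j)) = ln (real (n j)) - b * lg j"
  proof -
    have "(\<theta> - 1) / (\<theta> * ln \<theta>) * (lg j * ln \<theta>) = b * lg j"
      unfolding b_def using t by simp
    thus ?thesis unfolding ln_n by (simp only: left_diff_distrib mult_1)
  qed
  have "label_z j i \<le> x \<longleftrightarrow> ln (real i) - (ln (real (n j)) - b * lg j) \<le> x * (b * sqrt (lg j))"
    unfolding label_z_def s m using assms b by (simp add: divide_le_eq)
  also have "\<dots> \<longleftrightarrow> b * (lg j + (- x) * sqrt (lg j)) \<le> ln (real (n j) / real i)"
    using assms by (auto simp: ln_div algebra_simps)
  also have "b * (lg j + (- x) * sqrt (lg j)) = (lg j + (- x) * sqrt (lg j)) / (1 + lam)"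
    unfolding b(2)[symmetric] by simp
  finally show ?thesis .
qed

text \<open>The age is clipped at 0 because lowering it by an error term would make it negative for
  labels close to \<open>n j\<close>.\<close>

definition ptail_shift :: "nat \<Rightarrow> real \<Rightarrow> nat \<Rightarrow> nat \<Rightarrow> real" where
  "ptail_shift j s k i = ptail_mean k (max 0 (ln (real (n j) / real i) + s))"

text \<open>A lower tail of normalised labels is an upper tail of ages. A finite endpoint gives ages
  in a Gaussian window; an infinite one means all ages, whose mass comes from
  \<open>ltail_mean_total_lim\<close> instead.\<close>

lemma cumulative_intensity:
  fixes hi :: ereal
  assumes N: "eventually (\<lambda>j. 2 \<le> N j \<and> N j \<le> n j) sequentially"
    and kappa: "\<kappa> > log_spread" "eventually (\<lambda>j. ln (real (n j) / real (N j)) \<ge> \<kappa> * lg j - C) sequentially"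
    and r: "\<And>j. 0 \<le> r j" "r \<longlonglongrightarrow> 0" and sg: "s = r \<or> s = (\<lambda>j. - r j)"
  shows "(\<lambda>j. \<Sum>i\<in>{i\<in>{N j..n j}. ereal (label_z j i) \<le> hi}. ptail_shift j (s j) (level m j) i)
     \<longlonglongrightarrow> clim * \<theta> powr (\<epsilon> - m) * measure std_normal_distribution {z. ereal z \<le> hi}"
proof -
  define X where "X = clim * \<theta> powr (\<epsilon> - m)"
  have main: "(\<lambda>j. \<Sum>i\<in>{i\<in>{N j..n j}. T j \<le> ln (real (n j) / real i)}. ptail_shift j (s j) (level m j) i) \<longlonglongrightarrow> Z"
    if T: "eventually (\<lambda>j. 0 \<le> T j) sequentially"
    and up: "eventually (\<lambda>j. n j * ltail_mean (level m j) (T j + r j) \<le> Y j) sequentially" "Y \<longlonglongrightarrow> Z"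
    and lo: "(\<lambda>j. n j * ltail_mean (level m j) (max 0 (T j - r j))) \<longlonglongrightarrow> Z" for T Z Y
  proof -
    note sq = sum_ptail_mean_squeeze[OF N kappa r T up lo]
    have "eventually (\<lambda>j. (\<Sum>i\<in>{i\<in>{N j..n j}. T j \<le> ln (real (n j) / real i)}. ptail_mean (level m j) (ln (real (n j) / real i) + r j)) =
       (\<Sum>i\<in>{i\<in>{N j..n j}. T j \<le> ln (real (n j) / real i)}. ptail_shift j (r j) (level m j) i)) sequentially"
      using T N
    proof eventually_elim
      case (elim j)
      show ?case
        unfolding ptail_shift_def using elim r(1)[of j]
        by (intro sum.cong refl arg_cong[where f = "ptail_mean _"]) auto
    qed
    from Lim_transform_eventually[OF sq(1) this] sq(2) sg show ?thesis unfolding ptail_shift_def by auto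
  qed
  have r1: "eventually (\<lambda>j. r j < 1) sequentially" using order_tendstoD(2)[OF r(2), of 1] by simp
  show ?thesis
  proof (cases hi)
    case MInf
    thus ?thesis by simp
  next
    case PInf
    have "(\<lambda>j. \<Sum>i\<in>{i\<in>{N j..n j}. 0 \<le> ln (real (n j) / real i)}. ptail_shift j (s j) (level m j) i) \<longlonglongrightarrow> X"
    proof (rule main)
      show "(\<lambda>j. n j * ltail_mean (level m j) 0) \<longlonglongrightarrow> X" unfolding X_def by (rule ltail_mean_total_lim)
      show "eventually (\<lambda>j. n j * ltail_mean (level m j) (0 + r j) \<le> n j * ltail_mean (level m j) 0) sequentially"
        using r by (intro always_eventually allI mult_left_mono ltail_mean_antimono) auto
      show "(\<lambda>j. n j * ltail_mean (level m j) (max 0 (0 - r j))) \<longlonglongrightarrow> X"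
        using ltail_mean_total_lim r(1) by (simp add: X_def max_absorb1)
    qed simp
    moreover have "eventually (\<lambda>j. (\<Sum>i\<in>{i\<in>{N j..n j}. 0 \<le> ln (real (n j) / real i)}. ptail_shift j (s j) (level m j) i)
       = (\<Sum>i\<in>{i\<in>{N j..n j}. ereal (label_z j i) \<le> hi}. ptail_shift j (s j) (level m j) i)) sequentially"
      using N by eventually_elim (rule sum.cong, auto simp: PInf)
    moreover have "measure std_normal_distribution {z. ereal z \<le> hi} = 1"
      using std_normal.prob_space by (simp add: PInf)
    ultimately show ?thesis by (simp add: Lim_transform_eventually X_def)
  next
    case (real x)
    define T where "T = (\<lambda>j. (lg j + (- x) * sqrt (lg j)) / (1 + lam))"
    have nt: "near_time (- x) T" unfolding T_def near_time_def by (intro exI[of _ 0]) simp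
    have nt1: "near_time (- x) (\<lambda>j. T j + r j)"
      unfolding near_time_def using r1
      by (intro exI[of _ 1]) (auto elim!: eventually_mono simp: T_def r)
    have nt2': "near_time (- x) (\<lambda>j. T j - r j)"
      unfolding near_time_def using r1
      by (intro exI[of _ 1]) (auto elim!: eventually_mono simp: T_def r)
    have nt2: "near_time (- x) (\<lambda>j. max 0 (T j - r j))"
    proof -
      have "eventually (\<lambda>j. \<bar>max 0 (T j - r j) - (lg j + (- x) * sqrt (lg j)) / (1 + lam)\<bar> \<le> 1) sequentially"
        using near_time_pos[OF nt2'] r1 by eventually_elim (use r in \<open>auto simp: T_def\<close>)
      thus ?thesis unfolding near_time_def by blast
    qed
    have "(\<lambda>j. \<Sum>i\<in>{i\<in>{N j..n j}. T j \<le> ln (real (n j) / real i)}. ptail_shift j (s j) (level m j) i) \<longlonglongrightarrow> X * (1 - Phi (- x))"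
    proof (rule main)
      show "eventually (\<lambda>j. 0 \<le> T j) sequentially" using near_time_pos[OF nt] by eventually_elim simp
      show "(\<lambda>j. n j * ltail_mean (level m j) (T j + r j)) \<longlonglongrightarrow> X * (1 - Phi (- x))"
        unfolding X_def by (rule ltail_mean_lim[OF nt1])
      show "(\<lambda>j. n j * ltail_mean (level m j) (max 0 (T j - r j))) \<longlonglongrightarrow> X * (1 - Phi (- x))"
        unfolding X_def by (rule ltail_mean_lim[OF nt2])
    qed simp
    moreover have "eventually (\<lambda>j. (\<Sum>i\<in>{i\<in>{N j..n j}. T j \<le> ln (real (n j) / real i)}. ptail_shift j (s j) (level m j) i)
       = (\<Sum>i\<in>{i\<in>{N j..n j}. ereal (label_z j i) \<le> hi}. ptail_shift j (s j) (level m j) i)) sequentially"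
      using N lg_pos
    proof eventually_elim
      case (elim j)
      show ?case
      proof (rule sum.cong)
        have "label_z j i \<le> x \<longleftrightarrow> T j \<le> ln (real (n j) / real i)" if "i \<in> {N j..n j}" for i
          unfolding T_def using that elim by (intro label_z_le_iff) auto
        thus "{i \<in> {N j..n j}. T j \<le> ln (real (n j) / real i)} = {i \<in> {N j..n j}. ereal (label_z j i) \<le> hi}"
          by (auto simp: real)
      qed simp
    qed
    moreover have "measure std_normal_distribution {z. ereal z \<le> hi} = 1 - Phi (- x)"
      unfolding Phi_uminus by (simp add: real cdf_def2 atMost_def)
    ultimately show ?thesis by (simp add: Lim_transform_eventually X_def)
  qed
qed

lemma cell_intensity:
  fixes lo hi :: ereal
  assumes N: "eventually (\<lambda>j. 2 \<le> N j \<and> N j \<le> n j) sequentially"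
    and kappa: "\<kappa> > log_spread" "eventually (\<lambda>j. ln (real (n j) / real (N j)) \<ge> \<kappa> * lg j - C) sequentially"
    and r: "\<And>j. 0 \<le> r j" "r \<longlonglongrightarrow> 0" and sg: "s = r \<or> s = (\<lambda>j. - r j)"
  shows "(\<lambda>j. \<Sum>i\<in>{i\<in>{N j..n j}. lo < label_z j i \<and> ereal (label_z j i) \<le> hi}. ptail_shift j (s j) (level m j) i)
     \<longlonglongrightarrow> clim * \<theta> powr (\<epsilon> - m) * measure std_normal_distribution {z. lo < ereal z \<and> ereal z \<le> hi}"
proof (cases "lo \<le> hi")
  case False
  hence "{i\<in>A. lo < ereal (f i) \<and> ereal (f i) \<le> hi} = {}" for A :: "'b set" and f by (auto simp: not_le dest: order_less_trans order_le_less_trans)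
  moreover have "{z. lo < ereal z \<and> ereal z \<le> hi} = {}" using False by (auto dest: order_less_le_trans)
  ultimately have e: "{i\<in>{N j..n j}. lo < label_z j i \<and> ereal (label_z j i) \<le> hi} = {}" "{z. lo < ereal z \<and> ereal z \<le> hi} = {}" for j
    using False by (auto dest: order_less_le_trans)
  show ?thesis unfolding e by simp
next
  case True
  have "measure std_normal_distribution {z. lo < ereal z \<and> ereal z \<le> hi} =
     measure std_normal_distribution ({z. ereal z \<le> hi} - {z. ereal z \<le> lo})"
    by (rule arg_cong[where f = "measure _"]) auto
  also have "\<dots> = measure std_normal_distribution {z. ereal z \<le> hi} - measure std_normal_distribution {z. ereal z \<le> lo}"
    using True by (intro std_normal.finite_measure_Diff) (auto intro: order_trans)
  finally have e1: "measure std_normal_distribution {z. lo < ereal z \<and> ereal z \<le> hi} =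
     measure std_normal_distribution {z. ereal z \<le> hi} - measure std_normal_distribution {z. ereal z \<le> lo}" .
  have e2: "(\<Sum>i\<in>{i\<in>{N j..n j}. lo < label_z j i \<and> ereal (label_z j i) \<le> hi}. f i) =
     (\<Sum>i\<in>{i\<in>{N j..n j}. ereal (label_z j i) \<le> hi}. f i) - (\<Sum>i\<in>{i\<in>{N j..n j}. ereal (label_z j i) \<le> lo}. f i)" for j and f :: "nat \<Rightarrow> real"
  proof -
    have "{i\<in>{N j..n j}. lo < label_z j i \<and> ereal (label_z j i) \<le> hi} =
       {i\<in>{N j..n j}. ereal (label_z j i) \<le> hi} - {i\<in>{N j..n j}. ereal (label_z j i) \<le> lo}" by auto
    thus ?thesis using True by (simp, intro sum_diff) (auto intro: order_trans)
  qed
  show ?thesis unfolding e1 e2 right_diff_distrib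
    by (intro tendsto_diff cumulative_intensity[OF N kappa r sg])
qed

text \<open>The intensity decreases in the label, so each of the labels from 2 to \<open>N j\<close>
  has at least this value while their total stays bounded. Uniform smallness is what turns the
  product over vertices into an exponential.\<close>

lemma uniformly_small_intensity:
  assumes N: "eventually (\<lambda>j. 2 \<le> N j \<and> N j \<le> n j) sequentially" and N_lim: "filterlim N at_top sequentially"
    and r: "\<And>j. 0 \<le> r j" "r \<longlonglongrightarrow> 0"
  shows "(\<lambda>j. ptail_shift j (r j) (level m j) (N j)) \<longlonglongrightarrow> 0"
proof -
  have 0: "eventually (\<lambda>j. 0 \<le> ptail_shift j (r j) (level m j) (N j)) sequentially"
    by (simp add: ptail_shift_def ptail_mean_nonneg)
  have le: "eventually (\<lambda>j. ptail_shift j (r j) (level m j) (N j) \<le> exp (r j) * (n j * ltail_mean (level m j) 0) * (1 / (real (N j) - 1))) sequentially"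
    using N
  proof eventually_elim
    case (elim j)
    have "(real (N j) - 1) * ptail_shift j (r j) (level m j) (N j) = (\<Sum>i\<in>{2..N j}. ptail_shift j (r j) (level m j) (N j))"
      using elim by (simp add: of_nat_diff)
    also have "\<dots> \<le> (\<Sum>i\<in>{2..N j}. ptail_shift j (r j) (level m j) i)"
    proof (rule sum_mono)
      fix i assume i: "i \<in> {2..N j}"
      have "real (n j) / real (N j) \<le> real (n j) / real i" using i elim by (intro divide_left_mono) auto
      hence "ln (real (n j) / real (N j)) \<le> ln (real (n j) / real i)" using i elim by simp
      thus "ptail_shift j (r j) (level m j) (N j) \<le> ptail_shift j (r j) (level m j) i"
        unfolding ptail_shift_def by (intro ptail_mean_mono) auto
    qed
    also have "\<dots> \<le> (\<Sum>i\<in>{2..n j}. ptail_shift j (r j) (level m j) i)"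
      using elim by (intro sum_mono2) (auto simp: ptail_shift_def ptail_mean_nonneg)
    also have "\<dots> = (\<Sum>i\<in>{i\<in>{2..n j}. 0 \<le> ln (real (n j) / real i)}. ptail_mean (level m j) (ln (real (n j) / real i) + r j))"
      using r by (intro sum.cong) (auto simp: ptail_shift_def)
    also have "\<dots> \<le> exp (r j) * (real (n j) * ltail_mean (level m j) (0 + r j))"
      using elim r by (intro sum_ptail_mean_upper) auto
    also have "\<dots> \<le> exp (r j) * (real (n j) * ltail_mean (level m j) 0)"
      using r by (intro mult_left_mono ltail_mean_antimono) auto
    finally show ?case using elim by (simp add: field_simps)
  qed
  have "((\<lambda>x::nat. 1 / (real x - 1)) \<longlongrightarrow> 0) at_top" by real_asymp
  hence "(\<lambda>j. 1 / (real (N j) - 1)) \<longlonglongrightarrow> 0" using N_lim by (rule filterlim_compose)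
  hence "(\<lambda>j. exp (r j) * (n j * ltail_mean (level m j) 0) * (1 / (real (N j) - 1))) \<longlonglongrightarrow> exp 0 * (clim * \<theta> powr (\<epsilon> - m)) * 0"
    by (intro tendsto_mult tendsto_exp r ltail_mean_total_lim)
  thus ?thesis using tendsto_sandwich[OF 0 le tendsto_const] by simp
qed

end

section \<open>Histories and in-degrees\<close>

lemma in_degree_wrt_graph: "in_degree (wrt_graph f n) i = card {m \<in> {2..n}. f m = i}"
  by (simp add: in_degree_def in_arcs_def wrt_graph_def)

context weighted_recursive_tree
begin

abbreviation history :: "nat \<Rightarrow> 'a measure" where
  "history n \<equiv> wrt_history M W pa n"

lemma space_history [simp]: "space (history n) = space M"
  by (simp add: wrt_history_def)

lemma weight_history [measurable]:
  assumes "1 \<le> k" shows "W k \<in> borel_measurable (history n)"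
proof -
  let ?N = "(\<Pi>\<^sub>M k\<in>{1..}. (borel :: real measure)) \<Otimes>\<^sub>M (\<Pi>\<^sub>M m\<in>{2..n}. count_space (UNIV :: nat set))"
  let ?f = "\<lambda>\<omega>. (\<lambda>k\<in>{1..}. W k \<omega>, \<lambda>m\<in>{2..n}. pa m \<omega>)"
  have "?f \<in> measurable (history n) ?N"
    unfolding wrt_history_def by (rule measurable_vimage_algebra1) (auto simp: space_pair_measure space_PiM)
  moreover have "(\<lambda>x. fst x k) \<in> borel_measurable ?N"
    using assms by (intro measurable_compose[OF measurable_fst] measurable_component_singleton) auto
  ultimately have "(\<lambda>\<omega>. fst (?f \<omega>) k) \<in> borel_measurable (history n)" by (rule measurable_compose)
  thus ?thesis using assms by simp
qed

lemma parent_history: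
  assumes "m \<in> {2..n}" shows "pa m \<in> measurable (history n) (count_space UNIV)"
proof -
  let ?N = "(\<Pi>\<^sub>M k\<in>{1..}. (borel :: real measure)) \<Otimes>\<^sub>M (\<Pi>\<^sub>M m\<in>{2..n}. count_space (UNIV :: nat set))"
  let ?f = "\<lambda>\<omega>. (\<lambda>k\<in>{1..}. W k \<omega>, \<lambda>m\<in>{2..n}. pa m \<omega>)"
  have "?f \<in> measurable (history n) ?N"
    unfolding wrt_history_def by (rule measurable_vimage_algebra1) (auto simp: space_pair_measure space_PiM)
  moreover have "(\<lambda>x. snd x m) \<in> measurable ?N (count_space UNIV)"
    using assms by (intro measurable_compose[OF measurable_snd] measurable_component_singleton) auto
  ultimately have "(\<lambda>\<omega>. snd (?f \<omega>) m) \<in> measurable (history n) (count_space UNIV)" by (rule measurable_compose)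
  thus ?thesis using assms by simp
qed

lemma measurable_history:
  "f \<in> borel_measurable (history n) \<Longrightarrow> f \<in> borel_measurable M"
  by (rule measurable_from_subalg[OF subalgebra_history])

definition S :: "nat \<Rightarrow> 'a \<Rightarrow> real" where "S m \<omega> = (\<Sum>k=1..m. W k \<omega>)"

definition deg :: "nat \<Rightarrow> nat \<Rightarrow> 'a \<Rightarrow> nat" where
  "deg n i \<omega> = card {m \<in> {2..n}. pa m \<omega> = i}"

lemma in_degree_eq_deg: "in_degree (wrt_graph (\<lambda>m. pa m \<omega>) n) i = deg n i \<omega>"
  by (simp add: deg_def in_degree_wrt_graph)

lemma deg_le: "deg n i \<omega> \<le> n"
proof -
  have "deg n i \<omega> \<le> card {2..n}" unfolding deg_def by (intro card_mono) auto
  thus ?thesis by simp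
qed

lemma deg_Suc:
  assumes "1 \<le> n"
  shows "deg (Suc n) i \<omega> = deg n i \<omega> + (if pa (Suc n) \<omega> = i then 1 else 0)"
proof -
  have "{m \<in> {2..Suc n}. pa m \<omega> = i} = (if pa (Suc n) \<omega> = i then insert (Suc n) {m \<in> {2..n}. pa m \<omega> = i} else {m \<in> {2..n}. pa m \<omega> = i})"
    using assms by (auto simp: le_Suc_eq)
  thus ?thesis by (simp add: deg_def)
qed

lemma deg_sum: "deg n i \<omega> = (\<Sum>m\<in>{2..n}. if pa m \<omega> = i then 1 else 0)"
  unfolding deg_def by (subst sum.inter_filter[symmetric]) simp_all

lemma deg_history [measurable]: "deg n i \<in> measurable (history n) (count_space UNIV)"
proof -
  have [measurable]: "pa m \<in> measurable (history n) (count_space UNIV)" if "m \<in> {2..n}" for m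
    using that by (rule parent_history)
  have "(\<lambda>\<omega>. \<Sum>m\<in>{2..n}. if pa m \<omega> = i then 1 else 0 :: nat) \<in> measurable (history n) (count_space UNIV)"
    by measurable
  thus ?thesis by (simp add: deg_sum[abs_def])
qed

lemma S_history [measurable]: "S m \<in> borel_measurable (history n)"
  unfolding S_def[abs_def] by (intro borel_measurable_sum weight_history) auto

text \<open>Law of total expectation for one attachment step: the new parent is averaged out under
  its conditional law, while each \<open>Y i\<close> may depend on the current tree and on all
  weights.\<close>

lemma parent_step:
  assumes m: "1 \<le> m" and Y: "\<And>i. i \<in> {1..m} \<Longrightarrow> Y i \<in> borel_measurable (history m)"
    and X [measurable]: "X \<in> borel_measurable M"
    and XY: "\<And>\<omega>. \<omega> \<in> space M \<Longrightarrow> pa (Suc m) \<omega> \<in> {1..m} \<Longrightarrow> X \<omega> = Y (pa (Suc m) \<omega>) \<omega>"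
    and bd: "\<And>i \<omega>. i \<in> {1..m} \<Longrightarrow> \<omega> \<in> space M \<Longrightarrow> \<bar>Y i \<omega>\<bar> \<le> C"
  shows "(\<integral>\<omega>. X \<omega> \<partial>M) = (\<integral>\<omega>. (\<Sum>i=1..m. W i \<omega> / S m \<omega> * Y i \<omega>) \<partial>M)"
    and "integrable M (\<lambda>\<omega>. \<Sum>i=1..m. W i \<omega> / S m \<omega> * Y i \<omega>)"
proof -
  interpret F: finite_measure_subalgebra M "history m"
    by unfold_locales (rule subalgebra_history)
  define E where "E i = {\<omega> \<in> space M. pa (Suc m) \<omega> = i}" for i
  have E [measurable]: "E i \<in> events" for i
    using measurable_sets[OF parent_measurable[of "Suc m"], of "{i}"] m
    by (simp add: E_def vimage_def Int_def conj_commute)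
  have YM: "Y i \<in> borel_measurable M" if "i \<in> {1..m}" for i
    using Y[OF that] by (rule measurable_history)
  have int: "integrable M (\<lambda>\<omega>. Y i \<omega> * indicator (E i) \<omega>)" if i: "i \<in> {1..m}" for i
  proof (rule integrable_const_bound[of _ "\<bar>C\<bar>"])
    show "AE \<omega> in M. norm (Y i \<omega> * indicator (E i) \<omega>) \<le> \<bar>C\<bar>"
      using bd[OF i] by (intro AE_I2) (force simp: indicator_def)
  qed (use YM[OF i] in measurable)
  let ?r = "\<lambda>i. real_cond_exp M (history m) (indicator (E i))"
  have ce: "AE \<omega> in M. Y i \<omega> * ?r i \<omega> = W i \<omega> / S m \<omega> * Y i \<omega>" if i: "i \<in> {1..m}" for i
    using attachment[OF i] by eventually_elim (simp add: E_def S_def)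
  have Wm: "(\<lambda>\<omega>. W i \<omega> / S m \<omega> * Y i \<omega>) \<in> borel_measurable M" if "i \<in> {1..m}" for i
    using YM[OF that] weight_measurable[of i] that measurable_history[OF S_history]
    by (intro borel_measurable_times borel_measurable_divide) auto
  have rm: "?r i \<in> borel_measurable M" for i by (rule borel_measurable_cond_exp2)
  have ii: "integrable M (\<lambda>\<omega>. W i \<omega> / S m \<omega> * Y i \<omega>)"
    "(\<integral>\<omega>. W i \<omega> / S m \<omega> * Y i \<omega> \<partial>M) = (\<integral>\<omega>. Y i \<omega> * indicator (E i) \<omega> \<partial>M)" if i: "i \<in> {1..m}" for i
  proof -
    note ri = F.real_cond_exp_intg[OF int[OF i] Y[OF i] borel_measurable_indicator[OF E]]
    show "integrable M (\<lambda>\<omega>. W i \<omega> / S m \<omega> * Y i \<omega>)"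
      using ri(1) by (subst integrable_cong_AE[OF _ _ ce[OF i], symmetric]) (use YM[OF i] rm Wm[OF i] in auto)
    show "(\<integral>\<omega>. W i \<omega> / S m \<omega> * Y i \<omega> \<partial>M) = (\<integral>\<omega>. Y i \<omega> * indicator (E i) \<omega> \<partial>M)"
      using ri(2) by (subst integral_cong_AE[OF _ _ ce[OF i], symmetric]) (use YM[OF i] rm Wm[OF i] in auto)
  qed
  show "integrable M (\<lambda>\<omega>. \<Sum>i=1..m. W i \<omega> / S m \<omega> * Y i \<omega>)"
    by (intro Bochner_Integration.integrable_sum ii)
  have AEr: "AE \<omega> in M. X \<omega> = (\<Sum>i=1..m. Y i \<omega> * indicator (E i) \<omega>)"
    using parent_in_range AE_space
  proof eventually_elim
    case (elim \<omega>)
    have p: "pa (Suc m) \<omega> \<in> {1..m}" using elim m by blast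
    have "(\<Sum>i=1..m. Y i \<omega> * indicator (E i) \<omega>) = (\<Sum>i\<in>{pa (Suc m) \<omega>}. Y i \<omega> * indicator (E i) \<omega>)"
      using p by (intro sum.mono_neutral_right) (auto simp: E_def)
    thus ?case using elim p XY[of \<omega>] by (simp add: E_def)
  qed
  have sm: "(\<lambda>\<omega>. \<Sum>i=1..m. Y i \<omega> * indicator (E i) \<omega>) \<in> borel_measurable M"
    using int by (intro borel_measurable_sum) (auto intro: borel_measurable_integrable)
  have "(\<integral>\<omega>. X \<omega> \<partial>M) = (\<integral>\<omega>. (\<Sum>i=1..m. Y i \<omega> * indicator (E i) \<omega>) \<partial>M)"
    by (rule integral_cong_AE[OF X sm AEr])
  also have "\<dots> = (\<Sum>i=1..m. \<integral>\<omega>. Y i \<omega> * indicator (E i) \<omega> \<partial>M)"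
    using int by (intro Bochner_Integration.integral_sum) auto
  also have "\<dots> = (\<Sum>i=1..m. \<integral>\<omega>. W i \<omega> / S m \<omega> * Y i \<omega> \<partial>M)"
    using ii by (intro sum.cong) auto
  also have "\<dots> = (\<integral>\<omega>. (\<Sum>i=1..m. W i \<omega> / S m \<omega> * Y i \<omega>) \<partial>M)"
    using ii by (intro Bochner_Integration.integral_sum[symmetric]) auto
  finally show "(\<integral>\<omega>. X \<omega> \<partial>M) = (\<integral>\<omega>. (\<Sum>i=1..m. W i \<omega> / S m \<omega> * Y i \<omega>) \<partial>M)" .
qed

end

section \<open>Poisson replacement\<close>

text \<open>Peeling off one factor leaves \<open>e a\<close> times the plain difference of the
  remaining products, and that difference is at most the sum of the \<open>e i\<close>. The
  first-order expression is what averaging over a single chosen parent produces.\<close>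

lemma prod_minus_first_order:
  fixes u e :: "'i \<Rightarrow> real"
  assumes "finite A" "\<And>i. i \<in> A \<Longrightarrow> 0 \<le> e i \<and> e i \<le> u i \<and> u i \<le> 1"
  shows "\<bar>(\<Prod>i\<in>A. u i - e i) - (\<Prod>i\<in>A. u i) + (\<Sum>i\<in>A. e i * (\<Prod>j\<in>A - {i}. u j))\<bar>
          \<le> (\<Sum>i\<in>A. \<Sum>j\<in>A - {i}. e i * e j)"
  using assms
proof (induction A rule: finite_induct)
  case empty
  then show ?case by simp
next
  case (insert a A)
  let ?P' = "\<Prod>i\<in>A. u i - e i" and ?P = "\<Prod>i\<in>A. u i"
  let ?S = "\<Sum>i\<in>A. e i * (\<Prod>j\<in>A - {i}. u j)"
  have ua: "0 \<le> e a" "e a \<le> u a" "u a \<le> 1" using insert.prems by auto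
  have uA: "0 \<le> e i \<and> e i \<le> u i \<and> u i \<le> 1" if "i \<in> A" for i using insert.prems that by auto
  have S: "(\<Sum>i\<in>insert a A. e i * (\<Prod>j\<in>insert a A - {i}. u j)) = e a * ?P + u a * ?S"
  proof -
    have "(\<Sum>i\<in>A. e i * (\<Prod>j\<in>insert a A - {i}. u j)) = (\<Sum>i\<in>A. u a * (e i * (\<Prod>j\<in>A - {i}. u j)))"
    proof (rule sum.cong[OF refl])
      fix i assume i: "i \<in> A"
      hence "insert a A - {i} = insert a (A - {i})" using insert.hyps by auto
      thus "e i * (\<Prod>j\<in>insert a A - {i}. u j) = u a * (e i * (\<Prod>j\<in>A - {i}. u j))"
        using insert.hyps by simp
    qed
    moreover have "insert a A - {a} = A" using insert.hyps by auto
    ultimately show ?thesis using insert.hyps by (simp add: sum_distrib_left)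
  qed
  have "\<bar>?P' - ?P\<bar> \<le> (\<Sum>i\<in>A. \<bar>(u i - e i) - u i\<bar>)"
    using norm_prod_diff[of A "\<lambda>i. u i - e i" u] uA by fastforce
  also have "\<dots> = (\<Sum>i\<in>A. e i)" using uA by (intro sum.cong) auto
  finally have PP: "\<bar>?P' - ?P\<bar> \<le> (\<Sum>i\<in>A. e i)" .
  have "(\<Prod>i\<in>insert a A. u i - e i) - (\<Prod>i\<in>insert a A. u i) + (\<Sum>i\<in>insert a A. e i * (\<Prod>j\<in>insert a A - {i}. u j))
     = u a * (?P' - ?P + ?S) - e a * (?P' - ?P)"
    unfolding S using insert.hyps by (simp add: algebra_simps)
  also have "\<bar>\<dots>\<bar> \<le> 1 * \<bar>?P' - ?P + ?S\<bar> + e a * \<bar>?P' - ?P\<bar>"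
    using ua by (intro order_trans[OF abs_triangle_ineq4] add_mono) (auto simp: abs_mult intro!: mult_left_le_one_le)
  also have "\<dots> \<le> (\<Sum>i\<in>A. \<Sum>j\<in>A - {i}. e i * e j) + e a * (\<Sum>i\<in>A. e i)"
    using insert.IH[OF uA] PP ua by (intro add_mono mult_left_mono) auto
  also have "\<dots> \<le> (\<Sum>i\<in>insert a A. \<Sum>j\<in>insert a A - {i}. e i * e j)"
  proof -
    have "(\<Sum>j\<in>insert a A - {a}. e a * e j) = e a * (\<Sum>i\<in>A. e i)"
      using insert.hyps by (simp add: sum_distrib_left)
    moreover have "(\<Sum>i\<in>A. \<Sum>j\<in>A - {i}. e i * e j) \<le> (\<Sum>i\<in>A. \<Sum>j\<in>insert a A - {i}. e i * e j)"
      using insert.hyps uA ua by (intro sum_mono sum_mono2) (auto intro!: mult_nonneg_nonneg)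
    ultimately show ?thesis using insert.hyps by simp
  qed
  finally show ?case .
qed

section \<open>Step functions of a degree with Poisson growth\<close>

text \<open>The mean of 1 minus the sum of \<open>q l\<close> over the thresholds \<open>l\<close>
  reached, for a degree that is now \<open>c\<close> and still gains a Poisson number of mean
  \<open>x\<close>. For \<open>l \<le> c\<close> natural subtraction gives
  \<open>ptail 0 x = 1\<close>: the threshold is already passed.\<close>

definition thin :: "nat set \<Rightarrow> (nat \<Rightarrow> real) \<Rightarrow> nat \<Rightarrow> real \<Rightarrow> real" where
  "thin L q c x = 1 - (\<Sum>l\<in>L. q l * ptail (l - c) x)"

locale thinning =
  fixes L :: "nat set" and q :: "nat \<Rightarrow> real" and k :: nat
  assumes finL: "finite L" and Lk: "\<And>l. l \<in> L \<Longrightarrow> k \<le> l"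
    and q0: "\<And>l. l \<in> L \<Longrightarrow> 0 \<le> q l" and q1: "(\<Sum>l\<in>L. q l) \<le> 1"
begin

definition drop :: "nat \<Rightarrow> real \<Rightarrow> real" where "drop c x = thin L q c x - thin L q (Suc c) x"

lemma thin_bounds:
  assumes "x \<ge> 0" shows "0 \<le> thin L q c x" "thin L q c x \<le> 1"
proof -
  have "(\<Sum>l\<in>L. q l * ptail (l - c) x) \<le> (\<Sum>l\<in>L. q l * 1)"
    using assms q0 by (intro sum_mono mult_left_mono ptail_le_1) auto
  thus "0 \<le> thin L q c x" using q1 by (simp add: thin_def)
  show "thin L q c x \<le> 1"
    using assms q0 ptail_nonneg by (auto simp: thin_def intro!: sum_nonneg)
qed

lemma drop_sum: "drop c x = (\<Sum>l\<in>L. q l * (ptail (l - Suc c) x - ptail (l - c) x))"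
  by (simp add: drop_def thin_def sum_subtractf right_diff_distrib)

lemma drop_nonneg: "x \<ge> 0 \<Longrightarrow> 0 \<le> drop c x"
  unfolding drop_sum using q0 ptail_antimono by (intro sum_nonneg mult_nonneg_nonneg) auto

lemma drop_le_thin: "x \<ge> 0 \<Longrightarrow> drop c x \<le> thin L q c x"
  using thin_bounds(1) by (simp add: drop_def)

text \<open>One more child matters only if the final degree reaches some threshold, and all
  thresholds are at least \<open>k\<close>; the exponential bound at base \<open>b\<close> supplies
  the decay \<open>1 / b ^ k\<close>.\<close>

lemma drop_chernoff:
  assumes x: "x \<ge> 0" "b \<ge> 1"
  shows "drop c x \<le> b ^ Suc c / b ^ k * exp ((b - 1) * x)"
proof -
  have "drop c x \<le> (\<Sum>l\<in>L. q l * (b ^ Suc c / b ^ k * exp ((b - 1) * x)))"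
    unfolding drop_sum
  proof (intro sum_mono mult_left_mono)
    fix l assume l: "l \<in> L"
    have "ptail (l - Suc c) x - ptail (l - c) x \<le> ptail (l - Suc c) x" using ptail_nonneg x by simp
    also have "\<dots> \<le> exp ((b - 1) * x) / b ^ (l - Suc c)"
      using ptail_chernoff[OF x, of "l - Suc c"] x by (simp add: field_simps)
    also have "\<dots> \<le> b ^ Suc c / b ^ k * exp ((b - 1) * x)"
    proof -
      have "b ^ k \<le> b ^ (Suc c + (l - Suc c))" using x Lk[OF l] by (intro power_increasing) auto
      also have "\<dots> = b ^ Suc c * b ^ (l - Suc c)" by (rule power_add)
      finally have "1 / b ^ (l - Suc c) \<le> b ^ Suc c / b ^ k" using x by (simp add: field_simps)
      hence "1 / b ^ (l - Suc c) * exp ((b - 1) * x) \<le> b ^ Suc c / b ^ k * exp ((b - 1) * x)"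
        by (rule mult_right_mono) simp
      thus ?thesis by simp
    qed
    finally show "ptail (l - Suc c) x - ptail (l - c) x \<le> b ^ Suc c / b ^ k * exp ((b - 1) * x)" .
  qed (use q0 in auto)
  also have "\<dots> = (\<Sum>l\<in>L. q l) * (b ^ Suc c / b ^ k * exp ((b - 1) * x))" by (rule sum_distrib_right[symmetric])
  also have "\<dots> \<le> 1 * (b ^ Suc c / b ^ k * exp ((b - 1) * x))"
    using q1 x by (intro mult_right_mono) auto
  finally show ?thesis by simp
qed

text \<open>Raising a Poisson mean by a small p amounts, to first order, to adding one unit with
  probability p. Hence a Bernoulli attachment and a Poisson increment of the same mean agree to
  first order.\<close>

lemma thin_deriv: "(thin L q c has_real_derivative - drop c x) (at x)"
proof -
  have "(thin L q c has_real_derivative 0 - (\<Sum>l\<in>L. q l * (ptail (l - c - 1) x - ptail (l - c) x))) (at x)"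
    unfolding thin_def[abs_def]
    by (intro DERIV_diff DERIV_const DERIV_sum DERIV_cmult ptail_deriv_diff)
  thus ?thesis by (simp add: drop_sum)
qed

lemma drop_deriv: "(drop c has_real_derivative drop (Suc c) x - drop c x) (at x)"
proof -
  have "(drop c has_real_derivative - drop c x - (- drop (Suc c) x)) (at x)"
  proof -
    have *: "drop c = (\<lambda>x. thin L q c x - thin L q (Suc c) x)" by (rule ext) (simp add: drop_def)
    show ?thesis by (subst *) (intro DERIV_diff thin_deriv)
  qed
  thus ?thesis by simp
qed

text \<open>Two uses of the mean value theorem: the remainder is \<open>p\<close> times a change of
  \<open>drop\<close>, whose derivative is a difference of two consecutive drops, each controlled by
  the exponential bound.\<close>

lemma thin_taylor:
  assumes x: "x \<ge> 0" "p \<ge> 0" and b: "b \<ge> 1"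
  shows "\<bar>thin L q c (x + p) - (thin L q c x - p * drop c x)\<bar> \<le> p\<^sup>2 * (b ^ (c + 2) / b ^ k * exp ((b - 1) * (x + p)))"
proof (cases "p = 0")
  case False
  hence p: "p > 0" using x by simp
  let ?B = "b ^ (c + 2) / b ^ k * exp ((b - 1) * (x + p))"
  have B: "0 \<le> ?B" using b by simp
  obtain y where y: "x < y" "y < x + p" "thin L q c (x + p) - thin L q c x = (x + p - x) * - drop c y"
    using MVT2[of x "x + p" "thin L q c" "\<lambda>x. - drop c x"] p thin_deriv by auto
  obtain z where z: "x < z" "z < y" "drop c y - drop c x = (y - x) * (drop (Suc c) z - drop c z)"
    using MVT2[of x y "drop c" "\<lambda>x. drop (Suc c) x - drop c x"] y drop_deriv by auto
  have e: "exp ((b - 1) * z) \<le> exp ((b - 1) * (x + p))" using z y b by (auto intro!: mult_left_mono)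
  have "drop (Suc c) z \<le> b ^ Suc (Suc c) / b ^ k * exp ((b - 1) * z)"
    using z x b by (intro drop_chernoff) auto
  also have "\<dots> \<le> b ^ Suc (Suc c) / b ^ k * exp ((b - 1) * (x + p))"
    using e b by (intro mult_left_mono) auto
  also have "\<dots> = ?B" by simp
  finally have 1: "drop (Suc c) z \<le> ?B" .
  have "drop c z \<le> b ^ Suc c / b ^ k * exp ((b - 1) * z)"
    using z x b by (intro drop_chernoff) auto
  also have "\<dots> \<le> ?B"
    using e b by (intro mult_mono divide_right_mono power_increasing) auto
  finally have 2: "drop c z \<le> ?B" .
  have "0 \<le> drop c z" "0 \<le> drop (Suc c) z" using drop_nonneg z x by auto
  with 1 2 have 3: "\<bar>drop (Suc c) z - drop c z\<bar> \<le> ?B" by linarith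
  have "thin L q c (x + p) - (thin L q c x - p * drop c x) = - p * (drop c y - drop c x)"
    using y(3) by (simp add: algebra_simps)
  also have "\<bar>\<dots>\<bar> = p * (y - x) * \<bar>drop (Suc c) z - drop c z\<bar>"
    unfolding z(3) using p y by (simp add: abs_mult)
  also have "\<dots> \<le> p * p * ?B" using p y 3 by (intro mult_mono) auto
  finally show ?thesis by (simp add: power2_eq_square)
qed auto

end

lemma measurable_thin [measurable (raw)]:
  assumes [measurable]: "g \<in> borel_measurable M" "h \<in> measurable M (count_space UNIV)"
  shows "(\<lambda>x. thin L q (h x) (g x)) \<in> borel_measurable M"
proof (rule measurable_compose_countable[OF _ assms(2)])
  show "(\<lambda>x. thin L q i (g x)) \<in> borel_measurable M" for i unfolding thin_def by measurable
qed

context weighted_recursive_tree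
begin

definition attach_prob :: "nat \<Rightarrow> nat \<Rightarrow> 'a \<Rightarrow> real" where
  "attach_prob m i \<omega> = (if i \<le> m then W i \<omega> / S m \<omega> else 0)"

text \<open>The conditional mean, given the weights, of the degree that vertex \<open>i\<close> gains between times \<open>m\<close> and \<open>n\<close>.\<close>

definition future_mean :: "nat \<Rightarrow> nat \<Rightarrow> nat \<Rightarrow> 'a \<Rightarrow> real" where
  "future_mean n m i \<omega> = (\<Sum>l\<in>{m..<n}. attach_prob l i \<omega>)"

lemma future_mean_step: "m < n \<Longrightarrow> future_mean n m i \<omega> = attach_prob m i \<omega> + future_mean n (Suc m) i \<omega>"
  by (simp add: future_mean_def sum.atLeast_Suc_lessThan)

lemma attach_prob_history [measurable]: "1 \<le> i \<Longrightarrow> attach_prob m i \<in> borel_measurable (history l)"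
  unfolding attach_prob_def[abs_def]
  using weight_history[of i l] S_history by (cases "i \<le> m") auto

lemma future_mean_history [measurable]: "1 \<le> i \<Longrightarrow> future_mean n m i \<in> borel_measurable (history l)"
  unfolding future_mean_def[abs_def] by (intro borel_measurable_sum attach_prob_history)

end

section \<open>Exponential moments on an event of typical weights\<close>

text \<open>The event belongs to every history, in particular to the one generated by the weights
  alone. Restricting expectations to it therefore commutes with each conditional step.\<close>

locale good_weights = weighted_recursive_tree M D W pa
  for M :: "'a measure" and D W pa +
  fixes Good :: "'a set"
  assumes good_history: "Good \<in> sets (history l)"
    and good_pos: "\<omega> \<in> Good \<Longrightarrow> 1 \<le> i \<Longrightarrow> 0 < W i \<omega>"
begin

lemma S_pos: "\<omega> \<in> Good \<Longrightarrow> 1 \<le> m \<Longrightarrow> 0 < S m \<omega>"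
  unfolding S_def by (intro sum_pos) (auto intro: good_pos)

lemma attach_prob_bounds:
  assumes "\<omega> \<in> Good" "1 \<le> i" shows "0 \<le> attach_prob m i \<omega>" "attach_prob m i \<omega> \<le> 1"
proof -
  show "0 \<le> attach_prob m i \<omega>" unfolding attach_prob_def
    using assms good_pos[OF assms] S_pos[OF assms(1), of m] by auto
  show "attach_prob m i \<omega> \<le> 1"
  proof (cases "i \<le> m")
    case True
    have "W i \<omega> \<le> S m \<omega>" unfolding S_def
      using assms True by (intro member_le_sum) (auto intro: good_pos[THEN less_imp_le])
    thus ?thesis using True assms S_pos[OF assms(1), of m] by (simp add: attach_prob_def)
  qed (simp add: attach_prob_def)
qed

lemma sum_attach_prob:
  assumes "\<omega> \<in> Good" "1 \<le> m" shows "(\<Sum>i=1..m. W i \<omega> / S m \<omega>) = 1"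
proof -
  have "(\<Sum>i=1..m. W i \<omega> / S m \<omega>) = (\<Sum>i=1..m. W i \<omega>) / S m \<omega>" by (simp only: sum_divide_distrib)
  also have "(\<Sum>i=1..m. W i \<omega>) = S m \<omega>" by (simp add: S_def)
  finally show ?thesis using S_pos[OF assms] by simp
qed

lemma future_mean_bounds:
  assumes "\<omega> \<in> Good" "1 \<le> i" shows "0 \<le> future_mean n m i \<omega>" "future_mean n m i \<omega> \<le> real n"
proof -
  show "0 \<le> future_mean n m i \<omega>" unfolding future_mean_def
    using attach_prob_bounds[OF assms] by (intro sum_nonneg) auto
  have "future_mean n m i \<omega> \<le> (\<Sum>l\<in>{m..<n}. 1)" unfolding future_mean_def
    using attach_prob_bounds[OF assms] by (intro sum_mono) auto
  thus "future_mean n m i \<omega> \<le> real n" by simp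
qed

text \<open>Given the weights, the exponential moments of the current degrees, corrected for the
  expected future growth, form a supermartingale.\<close>

definition expo :: "real \<Rightarrow> nat \<Rightarrow> nat \<Rightarrow> nat set \<Rightarrow> 'a \<Rightarrow> real" where
  "expo b n m I \<omega> = indicator Good \<omega> * (\<Prod>i\<in>I. b ^ deg m i \<omega> * exp ((b - 1) * future_mean n m i \<omega>))"

lemma expo_history:
  assumes "\<And>i. i \<in> I \<Longrightarrow> 1 \<le> i"
  shows "expo b n m I \<in> borel_measurable (history m)"
proof -
  have [measurable]: "Good \<in> sets (history m)" by (rule good_history)
  have 1: "(\<lambda>\<omega>. b ^ deg m i \<omega>) \<in> borel_measurable (history m)" for i
    by (rule measurable_compose[OF deg_history]) simp
  have [measurable]: "future_mean n m i \<in> borel_measurable (history m)" if "i \<in> I" for i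
    using assms[OF that] by (rule future_mean_history)
  show ?thesis unfolding expo_def[abs_def] using 1 by measurable
qed

lemma expo_bounds:
  assumes "\<And>i. i \<in> I \<Longrightarrow> 1 \<le> i" "b \<ge> 1" "m \<le> n"
  shows "0 \<le> expo b n m I \<omega>" "expo b n m I \<omega> \<le> (b ^ n * exp ((b - 1) * real n)) ^ card I"
proof -
  show "0 \<le> expo b n m I \<omega>" using assms by (auto simp: expo_def intro!: mult_nonneg_nonneg prod_nonneg)
  show "expo b n m I \<omega> \<le> (b ^ n * exp ((b - 1) * real n)) ^ card I"
  proof (cases "\<omega> \<in> Good")
    case True
    have "(\<Prod>i\<in>I. b ^ deg m i \<omega> * exp ((b - 1) * future_mean n m i \<omega>)) \<le> (\<Prod>i\<in>I. b ^ n * exp ((b - 1) * real n))"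
    proof (rule prod_mono, intro conjI)
      fix i assume i: "i \<in> I"
      show "b ^ deg m i \<omega> * exp ((b - 1) * future_mean n m i \<omega>) \<le> b ^ n * exp ((b - 1) * real n)"
      proof (rule mult_mono)
        show "b ^ deg m i \<omega> \<le> b ^ n" using deg_le[of m i \<omega>] assms by (intro power_increasing) auto
        show "exp ((b - 1) * future_mean n m i \<omega>) \<le> exp ((b - 1) * real n)"
          using future_mean_bounds[OF True assms(1)[OF i]] assms by (auto intro!: mult_left_mono)
      qed (use assms in auto)
    qed (use assms in auto)
    thus ?thesis using True by (simp add: expo_def)
  qed (use assms in \<open>simp add: expo_def\<close>)
qed

lemma expo_integrable:
  assumes "\<And>i. i \<in> I \<Longrightarrow> 1 \<le> i" "b \<ge> 1" "m \<le> n"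
  shows "integrable M (expo b n m I)"
  using expo_bounds[OF assms]
  by (intro integrable_const_bound[of _ "(b ^ n * exp ((b - 1) * real n)) ^ card I"]
       measurable_history[OF expo_history] assms(1)) auto

text \<open>At most one vertex of \<open>I\<close> gains a child. Averaging multiplies by 1 plus
  \<open>b - 1\<close> times the total attachment probability of \<open>I\<close>, which is at most
  the exponential that \<open>future_mean\<close> gives up in this step.\<close>

lemma expo_step:
  assumes I: "finite I" "\<And>i. i \<in> I \<Longrightarrow> 1 \<le> i" and b: "b \<ge> 1" and m: "1 \<le> m" "m < n"
  shows "expectation (expo b n (Suc m) I) \<le> expectation (expo b n m I)"
proof -
  define base where "base \<omega> = indicator Good \<omega> * (\<Prod>i\<in>I. b ^ deg m i \<omega> * exp ((b - 1) * future_mean n (Suc m) i \<omega>))" for \<omega>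
  define Y where "Y j \<omega> = base \<omega> * (if j \<in> I then b else 1)" for j \<omega>
  have [measurable]: "Good \<in> sets (history m)" by (rule good_history)
  have 1: "(\<lambda>\<omega>. b ^ deg m i \<omega>) \<in> borel_measurable (history m)" for i
    by (rule measurable_compose[OF deg_history]) simp
  have 2: "future_mean n (Suc m) i \<in> borel_measurable (history m)" if "i \<in> I" for i
    using I(2)[OF that] by (rule future_mean_history)
  have base_m [measurable]: "base \<in> borel_measurable (history m)" unfolding base_def[abs_def] using 1 2 by measurable
  have base_nonneg: "0 \<le> base \<omega>" for \<omega> using b by (auto simp: base_def intro!: mult_nonneg_nonneg prod_nonneg)
  have base_le: "base \<omega> \<le> expo b n m I \<omega>" for \<omega>
  proof (cases "\<omega> \<in> Good")
    case True
    have "future_mean n (Suc m) i \<omega> \<le> future_mean n m i \<omega>" if "i \<in> I" for i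
      using future_mean_step[OF m(2)] attach_prob_bounds[OF True I(2)[OF that]] by simp
    thus ?thesis using True b unfolding base_def expo_def
      by (auto intro!: prod_mono mult_left_mono)
  qed (simp add: base_def expo_def)
  have base_bd: "base \<omega> \<le> (b ^ n * exp ((b - 1) * real n)) ^ card I" for \<omega>
    using base_le[of \<omega>] expo_bounds(2)[where I = I and b = b and m = m and n = n and \<omega> = \<omega>] I(2) b m
    by (meson order_trans less_imp_le)
  have XY: "expo b n (Suc m) I \<omega> = Y (pa (Suc m) \<omega>) \<omega>" for \<omega>
  proof -
    let ?j = "pa (Suc m) \<omega>"
    have "(\<Prod>i\<in>I. b ^ deg (Suc m) i \<omega> * exp ((b - 1) * future_mean n (Suc m) i \<omega>)) =
      (\<Prod>i\<in>I. b ^ deg m i \<omega> * exp ((b - 1) * future_mean n (Suc m) i \<omega>) * (if ?j = i then b else 1))"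
      using m by (intro prod.cong) (auto simp: deg_Suc)
    also have "\<dots> = (\<Prod>i\<in>I. b ^ deg m i \<omega> * exp ((b - 1) * future_mean n (Suc m) i \<omega>)) * (\<Prod>i\<in>I. if ?j = i then b else 1)"
      by (rule prod.distrib)
    also have "(\<Prod>i\<in>I. if ?j = i then b else 1) = (if ?j \<in> I then b else 1)"
      using I(1) by (simp add: prod.delta)
    finally show ?thesis by (simp add: expo_def Y_def base_def)
  qed
  have "expectation (expo b n (Suc m) I) = expectation (\<lambda>\<omega>. \<Sum>i=1..m. W i \<omega> / S m \<omega> * Y i \<omega>)"
  proof (rule parent_step(1)[OF m(1)])
    show "Y i \<in> borel_measurable (history m)" for i unfolding Y_def[abs_def] by measurable
    show "expo b n (Suc m) I \<in> borel_measurable M" by (intro measurable_history[OF expo_history] I)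
    show "\<bar>Y i \<omega>\<bar> \<le> (b ^ n * exp ((b - 1) * real n)) ^ card I * b" for i \<omega>
      unfolding Y_def abs_mult using base_nonneg[of \<omega>] base_bd[of \<omega>] b by (intro mult_mono) auto
  qed (rule XY)
  also have "\<dots> \<le> expectation (expo b n m I)"
  proof (rule integral_mono)
    show "integrable M (\<lambda>\<omega>. \<Sum>i=1..m. W i \<omega> / S m \<omega> * Y i \<omega>)"
    proof (rule parent_step(2)[OF m(1), where X = "expo b n (Suc m) I"])
      show "Y i \<in> borel_measurable (history m)" for i unfolding Y_def[abs_def] by measurable
      show "expo b n (Suc m) I \<in> borel_measurable M" by (intro measurable_history[OF expo_history] I)
      show "\<bar>Y i \<omega>\<bar> \<le> (b ^ n * exp ((b - 1) * real n)) ^ card I * b" for i \<omega>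
        unfolding Y_def abs_mult using base_nonneg[of \<omega>] base_bd[of \<omega>] b by (intro mult_mono) auto
    qed (rule XY)
    show "integrable M (expo b n m I)" using I b m by (intro expo_integrable) auto
    fix \<omega>
    show "(\<Sum>i=1..m. W i \<omega> / S m \<omega> * Y i \<omega>) \<le> expo b n m I \<omega>"
    proof (cases "\<omega> \<in> Good")
      case False
      thus ?thesis by (simp add: Y_def base_def expo_def)
    next
      case True
      have "(\<Sum>i=1..m. W i \<omega> / S m \<omega> * Y i \<omega>) =
         (\<Sum>i=1..m. base \<omega> * (W i \<omega> / S m \<omega>) + base \<omega> * ((b - 1) * (if i \<in> I then W i \<omega> / S m \<omega> else 0)))"
        by (intro sum.cong) (auto simp: Y_def algebra_simps)
      also have "\<dots> = base \<omega> * (1 + (b - 1) * (\<Sum>i=1..m. if i \<in> I then W i \<omega> / S m \<omega> else 0))"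
        unfolding sum.distrib sum_distrib_left[symmetric] sum_attach_prob[OF True m(1)] by (simp add: distrib_left)
      also have "(\<Sum>i=1..m. if i \<in> I then W i \<omega> / S m \<omega> else 0) = (\<Sum>i\<in>{1..m} \<inter> I. W i \<omega> / S m \<omega>)"
        by (simp add: sum.inter_restrict)
      also have "{1..m} \<inter> I = {i \<in> I. i \<le> m}" using I(2) by auto
      also have "(\<Sum>i\<in>{i \<in> I. i \<le> m}. W i \<omega> / S m \<omega>) = (\<Sum>i\<in>I. attach_prob m i \<omega>)"
        unfolding attach_prob_def using I(1) by (rule sum.inter_filter)
      also have "base \<omega> * (1 + (b - 1) * (\<Sum>i\<in>I. attach_prob m i \<omega>)) \<le> base \<omega> * exp ((b - 1) * (\<Sum>i\<in>I. attach_prob m i \<omega>))"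
        by (intro mult_left_mono base_nonneg exp_ge_add_one_self)
      also have "\<dots> = expo b n m I \<omega>"
      proof -
        have "exp ((b - 1) * (\<Sum>i\<in>I. attach_prob m i \<omega>)) = (\<Prod>i\<in>I. exp ((b - 1) * attach_prob m i \<omega>))"
          using I(1) by (simp add: sum_distrib_left exp_sum)
        thus ?thesis unfolding base_def expo_def
          by (simp add: future_mean_step[OF m(2)] distrib_left exp_add prod.distrib mult_ac)
      qed
      finally show ?thesis .
    qed
  qed
  finally show ?thesis .
qed

lemma expo_antimono:
  assumes I: "finite I" "\<And>i. i \<in> I \<Longrightarrow> 1 \<le> i" and b: "b \<ge> 1" and m: "1 \<le> m" "m \<le> m'" "m' \<le> n"
  shows "expectation (expo b n m' I) \<le> expectation (expo b n m I)"
  using m(2,3)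
proof (induction m' rule: dec_induct)
  case (step l)
  from expo_step[OF I b, of l n] step m show ?case by (simp add: le_trans)
qed simp

end

section \<open>Interpolation between true and Poisson degrees\<close>

context good_weights
begin

text \<open>True degrees up to time \<open>m\<close>, followed by independent Poisson growth up to
  \<open>n\<close>. At \<open>m = n\<close> no growth remains and the true degrees are left; at
  \<open>m = N\<close> the vertices from \<open>N\<close> on almost surely have degree 0 and
  everything is Poisson.\<close>

definition hybrid :: "(nat \<Rightarrow> nat set) \<Rightarrow> (nat \<Rightarrow> nat \<Rightarrow> real) \<Rightarrow> nat \<Rightarrow> nat \<Rightarrow> nat \<Rightarrow> 'a \<Rightarrow> real" where
  "hybrid L q N n m \<omega> = indicator Good \<omega> * (\<Prod>i\<in>{N..n}. thin (L i) (q i) (deg m i \<omega>) (future_mean n m i \<omega>))"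

lemma hybrid_history:
  assumes "1 \<le> N" shows "hybrid L q N n m \<in> borel_measurable (history m)"
proof -
  have [measurable]: "Good \<in> sets (history m)" by (rule good_history)
  have [measurable]: "future_mean n m i \<in> borel_measurable (history m)" if "i \<in> {N..n}" for i
    using that assms by (intro future_mean_history) auto
  show ?thesis unfolding hybrid_def[abs_def] by measurable
qed

lemma hybrid_bounds:
  assumes th: "\<And>i. i \<in> {N..n} \<Longrightarrow> thinning (L i) (q i) k" and N: "1 \<le> N"
  shows "0 \<le> hybrid L q N n m \<omega>" "hybrid L q N n m \<omega> \<le> 1"
proof -
  have "0 \<le> (\<Prod>i\<in>{N..n}. thin (L i) (q i) (deg m i \<omega>) (future_mean n m i \<omega>)) \<and>
     (\<Prod>i\<in>{N..n}. thin (L i) (q i) (deg m i \<omega>) (future_mean n m i \<omega>)) \<le> 1" if "\<omega> \<in> Good"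
    using thinning.thin_bounds[OF th] future_mean_bounds[OF that] N
    by (intro conjI prod_nonneg prod_le_1) auto
  thus "0 \<le> hybrid L q N n m \<omega>" "hybrid L q N n m \<omega> \<le> 1"
    by (auto simp: hybrid_def indicator_def)
qed

lemma hybrid_integrable:
  assumes th: "\<And>i. i \<in> {N..n} \<Longrightarrow> thinning (L i) (q i) k" and N: "1 \<le> N"
  shows "integrable M (hybrid L q N n m)"
  using hybrid_bounds[OF th N]
  by (intro integrable_const_bound[of _ 1] measurable_history[OF hybrid_history] N) auto

text \<open>The two hybrids agree to first order in the attachment probabilities. The remaining
  errors are quadratic: a Taylor remainder for each vertex, carrying one factor
  \<open>1 / b ^ k\<close>, and products over pairs of distinct vertices, carrying two.\<close>

lemma hybrid_step:
  assumes th: "\<And>i. i \<in> {N..n} \<Longrightarrow> thinning (L i) (q i) k" and N: "1 \<le> N" and m: "N \<le> m" "m < n"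
    and b: "b \<ge> 1"
    and C: "\<And>\<omega> i. \<omega> \<in> Good \<Longrightarrow> i \<in> {N..n} \<Longrightarrow> attach_prob m i \<omega> \<le> C"
  shows "\<bar>expectation (hybrid L q N n (Suc m)) - expectation (hybrid L q N n m)\<bar> \<le>
     C\<^sup>2 * (b\<^sup>2 / b ^ k * (\<Sum>i\<in>{N..n}. expectation (expo b n m {i}))
       + b\<^sup>2 / (b ^ k)\<^sup>2 * (\<Sum>i\<in>{N..n}. \<Sum>j\<in>{N..n} - {i}. expectation (expo b n m {i, j})))"
proof -
  let ?A = "{N..n}"
  let ?dr = "\<lambda>i. thinning.drop (L i) (q i)"
  define fm where "fm i \<omega> = future_mean n (Suc m) i \<omega>" for i \<omega>
  define u where "u i \<omega> = thin (L i) (q i) (deg m i \<omega>) (fm i \<omega>)" for i \<omega>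
  define d where "d i \<omega> = ?dr i (deg m i \<omega>) (fm i \<omega>)" for i \<omega>
  define e where "e i \<omega> = attach_prob m i \<omega> * d i \<omega>" for i \<omega>
  define Y where "Y j \<omega> = indicator Good \<omega> * (\<Prod>i\<in>?A. thin (L i) (q i) (deg m i \<omega> + (if j = i then 1 else 0)) (fm i \<omega>))" for j \<omega>
  define Z where "Z \<omega> = indicator Good \<omega> * ((\<Prod>i\<in>?A. u i \<omega>) - (\<Sum>i\<in>?A. e i \<omega> * (\<Prod>j\<in>?A - {i}. u j \<omega>)))" for \<omega>
  have m1: "1 \<le> m" using N m by simp
  have iN: "1 \<le> i" if "i \<in> ?A" for i using that N by auto
  have fm0: "0 \<le> fm i \<omega>" if "\<omega> \<in> Good" "i \<in> ?A" for i \<omega>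
    unfolding fm_def using future_mean_bounds[OF that(1) iN[OF that(2)]] by simp
  have [measurable]: "Good \<in> sets (history m)" by (rule good_history)
  have fmm: "fm i \<in> borel_measurable (history m)" if "i \<in> ?A" for i
    unfolding fm_def[abs_def] by (rule future_mean_history[OF iN[OF that]])
  have Ym: "Y j \<in> borel_measurable (history m)" for j
  proof -
    note fmm[measurable]
    show ?thesis unfolding Y_def[abs_def] by measurable
  qed
  have Y01: "0 \<le> Y j \<omega> \<and> Y j \<omega> \<le> 1" for j \<omega>
  proof (cases "\<omega> \<in> Good")
    case True
    have "0 \<le> (\<Prod>i\<in>?A. thin (L i) (q i) (deg m i \<omega> + (if j = i then 1 else 0)) (fm i \<omega>)) \<and>
       (\<Prod>i\<in>?A. thin (L i) (q i) (deg m i \<omega> + (if j = i then 1 else 0)) (fm i \<omega>)) \<le> 1"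
      using thinning.thin_bounds[OF th] fm0[OF True] by (intro conjI prod_nonneg prod_le_1) auto
    thus ?thesis by (simp add: Y_def indicator_def)
  qed (simp add: Y_def)
  have XY: "hybrid L q N n (Suc m) \<omega> = Y (pa (Suc m) \<omega>) \<omega>" for \<omega>
    unfolding hybrid_def Y_def fm_def using deg_Suc[OF m1] by simp
  have step: "expectation (hybrid L q N n (Suc m)) = expectation (\<lambda>\<omega>. \<Sum>j=1..m. W j \<omega> / S m \<omega> * Y j \<omega>)"
    and int1: "integrable M (\<lambda>\<omega>. \<Sum>j=1..m. W j \<omega> / S m \<omega> * Y j \<omega>)"
  proof -
    have Y1: "\<bar>Y j \<omega>\<bar> \<le> 1" for j \<omega> using Y01[of j \<omega>] by simp
    note ps = parent_step[where Y = Y and X = "hybrid L q N n (Suc m)" and C = 1,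
        OF m1 Ym measurable_history[OF hybrid_history[OF N]] XY Y1]
    show "expectation (hybrid L q N n (Suc m)) = expectation (\<lambda>\<omega>. \<Sum>j=1..m. W j \<omega> / S m \<omega> * Y j \<omega>)"
      by (rule ps(1))
    show "integrable M (\<lambda>\<omega>. \<Sum>j=1..m. W j \<omega> / S m \<omega> * Y j \<omega>)" by (rule ps(2))
  qed
  have pr: "0 \<le> attach_prob m i \<omega>" "attach_prob m i \<omega> \<le> 1" if "\<omega> \<in> Good" "i \<in> ?A" for i \<omega>
    using attach_prob_bounds[OF that(1) iN[OF that(2)]] by auto
  have ub: "0 \<le> u i \<omega>" "u i \<omega> \<le> 1" "0 \<le> d i \<omega>" "d i \<omega> \<le> u i \<omega>" if "\<omega> \<in> Good" "i \<in> ?A" for i \<omega>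
    unfolding u_def d_def using thinning.thin_bounds[OF th[OF that(2)] fm0[OF that]]
      thinning.drop_nonneg[OF th[OF that(2)] fm0[OF that]] thinning.drop_le_thin[OF th[OF that(2)] fm0[OF that]] by auto
  have eb: "0 \<le> e i \<omega>" "e i \<omega> \<le> u i \<omega>" if "\<omega> \<in> Good" "i \<in> ?A" for i \<omega>
  proof -
    show "0 \<le> e i \<omega>" unfolding e_def using pr[OF that] ub[OF that] by simp
    have "e i \<omega> \<le> 1 * d i \<omega>" unfolding e_def using pr[OF that] ub[OF that] by (intro mult_right_mono) auto
    thus "e i \<omega> \<le> u i \<omega>" using ub[OF that] by simp
  qed
  \<comment> \<open>The chosen parent changes only its own factor, and a parent outside
    \<open>?A\<close> changes none, so the average is affine in the drops.\<close>
  have average: "(\<Sum>j=1..m. W j \<omega> / S m \<omega> * Y j \<omega>) = Z \<omega>" for \<omega>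
  proof (cases "\<omega> \<in> Good")
    case False
    thus ?thesis by (simp add: Y_def Z_def)
  next
    case True
    let ?U = "\<Prod>i\<in>?A. u i \<omega>"
    have Yj: "Y j \<omega> = ?U - (if j \<in> ?A then d j \<omega> * (\<Prod>i\<in>?A - {j}. u i \<omega>) else 0)" for j
    proof (cases "j \<in> ?A")
      case True
      have "Y j \<omega> = thin (L j) (q j) (deg m j \<omega> + 1) (fm j \<omega>) * (\<Prod>i\<in>?A - {j}. thin (L i) (q i) (deg m i \<omega> + (if j = i then 1 else 0)) (fm i \<omega>))"
        using \<open>\<omega> \<in> Good\<close> unfolding Y_def by (subst prod.remove[OF _ True]) auto
      also have "(\<Prod>i\<in>?A - {j}. thin (L i) (q i) (deg m i \<omega> + (if j = i then 1 else 0)) (fm i \<omega>)) = (\<Prod>i\<in>?A - {j}. u i \<omega>)"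
        unfolding u_def by (intro prod.cong) auto
      also have "thin (L j) (q j) (deg m j \<omega> + 1) (fm j \<omega>) = u j \<omega> - d j \<omega>"
        unfolding u_def d_def thinning.drop_def[OF th[OF True]] by simp
      also have "(u j \<omega> - d j \<omega>) * (\<Prod>i\<in>?A - {j}. u i \<omega>) = ?U - d j \<omega> * (\<Prod>i\<in>?A - {j}. u i \<omega>)"
      proof -
        have "?U = u j \<omega> * (\<Prod>i\<in>?A - {j}. u i \<omega>)" by (rule prod.remove[OF _ True]) simp
        thus ?thesis by (simp only: left_diff_distrib)
      qed
      finally show ?thesis using True by simp
    next
      case False
      hence "Y j \<omega> = ?U" using \<open>\<omega> \<in> Good\<close> unfolding Y_def u_def by (auto intro!: prod.cong)
      thus ?thesis by (simp only: if_not_P[OF False] diff_0_right)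
    qed
    have "(\<Sum>j=1..m. W j \<omega> / S m \<omega> * Y j \<omega>) =
       (\<Sum>j=1..m. W j \<omega> / S m \<omega> * ?U) - (\<Sum>j=1..m. if j \<in> ?A then W j \<omega> / S m \<omega> * (d j \<omega> * (\<Prod>i\<in>?A - {j}. u i \<omega>)) else 0)"
      unfolding Yj sum_subtractf[symmetric] by (intro sum.cong) (auto simp: right_diff_distrib)
    also have "(\<Sum>j=1..m. W j \<omega> / S m \<omega> * ?U) = ?U"
      unfolding sum_distrib_right[symmetric] sum_attach_prob[OF True m1] by simp
    also have "(\<Sum>j=1..m. if j \<in> ?A then W j \<omega> / S m \<omega> * (d j \<omega> * (\<Prod>i\<in>?A - {j}. u i \<omega>)) else 0) =
      (\<Sum>j\<in>{1..m} \<inter> ?A. W j \<omega> / S m \<omega> * (d j \<omega> * (\<Prod>i\<in>?A - {j}. u i \<omega>)))"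
      by (rule sum.inter_restrict[symmetric]) simp
    also have "\<dots> = (\<Sum>j\<in>?A. e j \<omega> * (\<Prod>i\<in>?A - {j}. u i \<omega>))"
      unfolding e_def attach_prob_def using N by (intro sum.mono_neutral_cong_left) auto
    finally show ?thesis using True by (simp add: Z_def)
  qed
  \<comment> \<open>Both quantities are compared with the product of
    \<open>u i \<omega> - e i \<omega>\<close>: the hybrid factor by factor through
    \<open>thin_taylor\<close>, and \<open>Z\<close> through
    \<open>prod_minus_first_order\<close>.\<close>
  have bound: "\<bar>Z \<omega> - hybrid L q N n m \<omega>\<bar> \<le> C\<^sup>2 * (b\<^sup>2 / b ^ k * (\<Sum>i\<in>?A. expo b n m {i} \<omega>)
       + b\<^sup>2 / (b ^ k)\<^sup>2 * (\<Sum>i\<in>?A. \<Sum>j\<in>?A - {i}. expo b n m {i, j} \<omega>))" for \<omega>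
  proof (cases "\<omega> \<in> Good")
    case False
    thus ?thesis by (simp add: Z_def hybrid_def expo_def)
  next
    case True
    define w where "w i = thin (L i) (q i) (deg m i \<omega>) (future_mean n m i \<omega>)" for i
    define x where "x i = b ^ deg m i \<omega> * exp ((b - 1) * future_mean n m i \<omega>)" for i
    have x0: "0 \<le> x i" for i using b by (simp add: x_def)
    have fmw: "future_mean n m i \<omega> = fm i \<omega> + attach_prob m i \<omega>" for i
      by (simp add: fm_def future_mean_step[OF m(2)])
    have wb: "0 \<le> w i" "w i \<le> 1" if "i \<in> ?A" for i
      unfolding w_def using thinning.thin_bounds[OF th[OF that]] future_mean_bounds[OF True iN[OF that]] by auto
    have e_le: "e i \<omega> \<le> C * (b / b ^ k * x i)" if i: "i \<in> ?A" for i
      unfolding e_def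
    proof (rule mult_mono)
      show "attach_prob m i \<omega> \<le> C" using C True i by blast
      have "d i \<omega> \<le> b ^ Suc (deg m i \<omega>) / b ^ k * exp ((b - 1) * fm i \<omega>)"
        unfolding d_def using thinning.drop_chernoff[OF th[OF i] fm0[OF True i] b] .
      also have "\<dots> \<le> b ^ Suc (deg m i \<omega>) / b ^ k * exp ((b - 1) * future_mean n m i \<omega>)"
        using b pr[OF True i] unfolding fmw by (intro mult_left_mono) (auto intro!: mult_left_mono)
      finally show "d i \<omega> \<le> b / b ^ k * x i" by (simp add: x_def)
      show "0 \<le> C" using C[OF True i] pr[OF True i] by linarith
    qed (use ub[OF True i] in auto)
    have taylor: "\<bar>w i - (u i \<omega> - e i \<omega>)\<bar> \<le> C\<^sup>2 * (b\<^sup>2 / b ^ k * x i)" if i: "i \<in> ?A" for i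
    proof -
      have "\<bar>w i - (u i \<omega> - e i \<omega>)\<bar> \<le> (attach_prob m i \<omega>)\<^sup>2 * (b ^ (deg m i \<omega> + 2) / b ^ k * exp ((b - 1) * (fm i \<omega> + attach_prob m i \<omega>)))"
        unfolding w_def u_def e_def d_def fmw
        using thinning.thin_taylor[OF th[OF i] fm0[OF True i] pr(1)[OF True i] b] .
      also have "\<dots> = (attach_prob m i \<omega>)\<^sup>2 * (b\<^sup>2 / b ^ k * x i)"
        by (simp add: x_def fmw power_add power2_eq_square)
      also have "\<dots> \<le> C\<^sup>2 * (b\<^sup>2 / b ^ k * x i)"
        using C[OF True i] pr[OF True i] x0 b by (intro mult_right_mono power_mono) auto
      finally show ?thesis .
    qed
    have "\<bar>(\<Prod>i\<in>?A. w i) - (\<Prod>i\<in>?A. u i \<omega> - e i \<omega>)\<bar> \<le> (\<Sum>i\<in>?A. \<bar>w i - (u i \<omega> - e i \<omega>)\<bar>)"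
    proof -
      have "norm ((\<Prod>i\<in>?A. w i) - (\<Prod>i\<in>?A. u i \<omega> - e i \<omega>)) \<le> (\<Sum>i\<in>?A. norm (w i - (u i \<omega> - e i \<omega>)))"
      proof (rule norm_prod_diff)
        fix i assume i: "i \<in> ?A"
        show "norm (w i) \<le> 1" using wb[OF i] by simp
        show "norm (u i \<omega> - e i \<omega>) \<le> 1" using eb[OF True i] ub[OF True i] by simp
      qed
      thus ?thesis by simp
    qed
    also have "\<dots> \<le> (\<Sum>i\<in>?A. C\<^sup>2 * (b\<^sup>2 / b ^ k * x i))" by (intro sum_mono taylor)
    finally have 1: "\<bar>(\<Prod>i\<in>?A. w i) - (\<Prod>i\<in>?A. u i \<omega> - e i \<omega>)\<bar> \<le> C\<^sup>2 * (b\<^sup>2 / b ^ k * (\<Sum>i\<in>?A. x i))"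
      by (simp only: sum_distrib_left)
    have "\<bar>(\<Prod>i\<in>?A. u i \<omega> - e i \<omega>) - (\<Prod>i\<in>?A. u i \<omega>) + (\<Sum>i\<in>?A. e i \<omega> * (\<Prod>j\<in>?A - {i}. u j \<omega>))\<bar>
        \<le> (\<Sum>i\<in>?A. \<Sum>j\<in>?A - {i}. e i \<omega> * e j \<omega>)"
      using eb[OF True] ub[OF True] by (intro prod_minus_first_order) auto
    also have "\<dots> \<le> (\<Sum>i\<in>?A. \<Sum>j\<in>?A - {i}. (C * (b / b ^ k * x i)) * (C * (b / b ^ k * x j)))"
    proof (intro sum_mono)
      fix i j assume i: "i \<in> ?A" and j: "j \<in> ?A - {i}"
      show "e i \<omega> * e j \<omega> \<le> (C * (b / b ^ k * x i)) * (C * (b / b ^ k * x j))"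
        using e_le[OF i] e_le[of j] eb[OF True i] eb[OF True, of j] j by (intro mult_mono) auto
    qed
    also have "\<dots> = C\<^sup>2 * (b\<^sup>2 / (b ^ k)\<^sup>2 * (\<Sum>i\<in>?A. \<Sum>j\<in>?A - {i}. x i * x j))"
      unfolding sum_distrib_left by (intro sum.cong refl) (simp add: power2_eq_square)
    finally have 2: "\<bar>(\<Prod>i\<in>?A. u i \<omega> - e i \<omega>) - (\<Prod>i\<in>?A. u i \<omega>) + (\<Sum>i\<in>?A. e i \<omega> * (\<Prod>j\<in>?A - {i}. u j \<omega>))\<bar>
       \<le> C\<^sup>2 * (b\<^sup>2 / (b ^ k)\<^sup>2 * (\<Sum>i\<in>?A. \<Sum>j\<in>?A - {i}. x i * x j))" .
    have x1: "expo b n m {i} \<omega> = x i" for i using True by (simp add: expo_def x_def)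
    have x2: "expo b n m {i, j} \<omega> = x i * x j" if "j \<in> ?A - {i}" for i j using True that by (auto simp: expo_def x_def)
    have "Z \<omega> - hybrid L q N n m \<omega> = (\<Prod>i\<in>?A. u i \<omega>) - (\<Sum>i\<in>?A. e i \<omega> * (\<Prod>j\<in>?A - {i}. u j \<omega>)) - (\<Prod>i\<in>?A. w i)"
      using True by (simp add: Z_def hybrid_def w_def)
    hence "\<bar>Z \<omega> - hybrid L q N n m \<omega>\<bar> \<le> C\<^sup>2 * (b\<^sup>2 / b ^ k * (\<Sum>i\<in>?A. x i)) + C\<^sup>2 * (b\<^sup>2 / (b ^ k)\<^sup>2 * (\<Sum>i\<in>?A. \<Sum>j\<in>?A - {i}. x i * x j))"
      using 1 2 by linarith
    moreover have "(\<Sum>i\<in>?A. \<Sum>j\<in>?A - {i}. expo b n m {i, j} \<omega>) = (\<Sum>i\<in>?A. \<Sum>j\<in>?A - {i}. x i * x j)"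
      by (intro sum.cong refl x2)
    ultimately show ?thesis by (simp only: x1 distrib_left)
  qed
  have ei: "integrable M (expo b n m {i})" "integrable M (expo b n m {i, j})" if "i \<in> ?A" "j \<in> ?A" for i j
    using that iN b m by (auto intro!: expo_integrable)
  have intZ: "integrable M Z" using int1 by (simp only: average)
  have "\<bar>expectation (hybrid L q N n (Suc m)) - expectation (hybrid L q N n m)\<bar> = \<bar>expectation (\<lambda>\<omega>. Z \<omega> - hybrid L q N n m \<omega>)\<bar>"
    unfolding step average using intZ hybrid_integrable[OF th N] by (subst Bochner_Integration.integral_diff) auto
  also have "\<dots> \<le> expectation (\<lambda>\<omega>. \<bar>Z \<omega> - hybrid L q N n m \<omega>\<bar>)"
    by (rule integral_abs_bound)
  also have "\<dots> \<le> expectation (\<lambda>\<omega>. C\<^sup>2 * (b\<^sup>2 / b ^ k * (\<Sum>i\<in>?A. expo b n m {i} \<omega>)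
       + b\<^sup>2 / (b ^ k)\<^sup>2 * (\<Sum>i\<in>?A. \<Sum>j\<in>?A - {i}. expo b n m {i, j} \<omega>)))"
  proof (rule integral_mono)
    show "integrable M (\<lambda>\<omega>. \<bar>Z \<omega> - hybrid L q N n m \<omega>\<bar>)"
      by (intro Bochner_Integration.integrable_abs Bochner_Integration.integrable_diff intZ hybrid_integrable[OF th N])
    show "integrable M (\<lambda>\<omega>. C\<^sup>2 * (b\<^sup>2 / b ^ k * (\<Sum>i\<in>?A. expo b n m {i} \<omega>)
       + b\<^sup>2 / (b ^ k)\<^sup>2 * (\<Sum>i\<in>?A. \<Sum>j\<in>?A - {i}. expo b n m {i, j} \<omega>)))"
      by (intro integrable_mult_right Bochner_Integration.integrable_add Bochner_Integration.integrable_sum ei)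
        (simp_all only: Diff_iff)
  qed (rule bound)
  also have "\<dots> = C\<^sup>2 * (b\<^sup>2 / b ^ k * (\<Sum>i\<in>{N..n}. expectation (expo b n m {i}))
       + b\<^sup>2 / (b ^ k)\<^sup>2 * (\<Sum>i\<in>{N..n}. \<Sum>j\<in>{N..n} - {i}. expectation (expo b n m {i, j})))"
  proof -
    have 1: "integrable M (\<lambda>\<omega>. \<Sum>i\<in>?A. expo b n m {i} \<omega>)" using ei by (intro Bochner_Integration.integrable_sum) auto
    have 2: "integrable M (\<lambda>\<omega>. \<Sum>j\<in>?A - {i}. expo b n m {i, j} \<omega>)" if "i \<in> ?A" for i
      using ei(2)[OF that] by (intro Bochner_Integration.integrable_sum) auto
    have 3: "integrable M (\<lambda>\<omega>. \<Sum>i\<in>?A. \<Sum>j\<in>?A - {i}. expo b n m {i, j} \<omega>)" 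
      using 2 by (rule Bochner_Integration.integrable_sum)
    have "expectation (\<lambda>\<omega>. \<Sum>i\<in>?A. expo b n m {i} \<omega>) = (\<Sum>i\<in>{N..n}. expectation (expo b n m {i}))"
      using ei by (intro Bochner_Integration.integral_sum) auto
    moreover have "expectation (\<lambda>\<omega>. \<Sum>i\<in>?A. \<Sum>j\<in>?A - {i}. expo b n m {i, j} \<omega>) = (\<Sum>i\<in>{N..n}. \<Sum>j\<in>{N..n} - {i}. expectation (expo b n m {i, j}))"
      using ei 2 by (subst Bochner_Integration.integral_sum) (auto intro!: sum.cong Bochner_Integration.integral_sum)
    ultimately show ?thesis using 1 3 by simp
  qed
  finally show ?thesis .
qed

text \<open>A parent has a smaller label than its child, so no edge created up to time
  \<open>N\<close> points to a label of \<open>N\<close> or more.\<close>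

lemma deg_young_eq_0: "AE \<omega> in M. \<forall>i\<ge>N. deg N i \<omega> = 0"
  using parent_in_range
proof eventually_elim
  case (elim \<omega>)
  show ?case
  proof (intro allI impI)
    fix i assume i: "N \<le> i"
    have pm: "pa m \<omega> \<noteq> i" if m: "m \<in> {2..N}" for m
    proof -
      obtain p where p: "m = Suc p" "1 \<le> p" using m by (cases m) auto
      have "pa (Suc p) \<omega> \<in> {1..p}" using elim p(2) by blast
      thus ?thesis using p m i by auto
    qed
    have "{m \<in> {2..N}. pa m \<omega> = i} = {}" using pm by blast
    thus "deg N i \<omega> = 0" unfolding deg_def by (simp only: card.empty)
  qed
qed

text \<open>The supermartingale is moved back to time \<open>N\<close>, where these vertices have
  degree 0 and only the growth predicted by the weights is left.\<close>

lemma expo_young_bound: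
  assumes I: "finite I" "\<And>i. i \<in> I \<Longrightarrow> N \<le> i" and N: "1 \<le> N" "N \<le> m" "m \<le> n" and b: "b \<ge> 1"
    and B: "\<And>\<omega> i. \<omega> \<in> Good \<Longrightarrow> i \<in> I \<Longrightarrow> exp ((b - 1) * future_mean n N i \<omega>) \<le> B i"
      "\<And>i. i \<in> I \<Longrightarrow> 0 \<le> B i"
  shows "expectation (expo b n m I) \<le> (\<Prod>i\<in>I. B i)"
proof -
  have I1: "1 \<le> i" if "i \<in> I" for i using I(2)[OF that] N by simp
  have "expectation (expo b n m I) \<le> expectation (expo b n N I)"
    using I I1 N b by (intro expo_antimono) auto
  also have "\<dots> \<le> expectation (\<lambda>_. \<Prod>i\<in>I. B i)"
  proof (rule integral_mono_AE)
    show "integrable M (expo b n N I)" using I1 N b by (intro expo_integrable) auto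
    show "AE \<omega> in M. expo b n N I \<omega> \<le> (\<Prod>i\<in>I. B i)"
      using deg_young_eq_0[of N]
    proof eventually_elim
      case (elim \<omega>)
      show ?case
      proof (cases "\<omega> \<in> Good")
        case True
        have "(\<Prod>i\<in>I. b ^ deg N i \<omega> * exp ((b - 1) * future_mean n N i \<omega>)) \<le> (\<Prod>i\<in>I. B i)"
          using elim I(2) B(1)[OF True] by (intro prod_mono) auto
        thus ?thesis using True by (simp add: expo_def)
      qed (use B in \<open>auto simp: expo_def intro!: prod_nonneg\<close>)
    qed
  qed auto
  finally show ?thesis by (simp add: prob_space)
qed

text \<open>Replacing, one attachment step after the other, the single chosen parent by independent
  Poisson increments at all vertices changes the expectation only by a second-order error.\<close>

lemma poisson_replacement:
  assumes th: "\<And>i. i \<in> {N..n} \<Longrightarrow> thinning (L i) (q i) k" and N: "1 \<le> N" "N \<le> n"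
    and b: "b \<ge> 1"
    and C: "\<And>\<omega> i m. \<omega> \<in> Good \<Longrightarrow> N \<le> m \<Longrightarrow> i \<in> {N..n} \<Longrightarrow> attach_prob m i \<omega> \<le> C m"
    and B: "\<And>\<omega> i. \<omega> \<in> Good \<Longrightarrow> i \<in> {N..n} \<Longrightarrow> exp ((b - 1) * future_mean n N i \<omega>) \<le> B i"
      "\<And>i. i \<in> {N..n} \<Longrightarrow> 0 \<le> B i"
  defines "A \<equiv> (\<Sum>i\<in>{N..n}. B i) / b ^ k"
  shows "\<bar>expectation (hybrid L q N n n) - expectation (hybrid L q N n N)\<bar> \<le>
     (\<Sum>m\<in>{N..<n}. (C m)\<^sup>2) * (b\<^sup>2 * (A + A\<^sup>2))"
proof -
  let ?E = "\<lambda>m. expectation (hybrid L q N n m)"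
  have step: "\<bar>?E (Suc m) - ?E m\<bar> \<le> (C m)\<^sup>2 * (b\<^sup>2 * (A + A\<^sup>2))" if m: "m \<in> {N..<n}" for m
  proof -
    have 1: "(\<Sum>i\<in>{N..n}. expectation (expo b n m {i})) \<le> (\<Sum>i\<in>{N..n}. B i)"
    proof (rule sum_mono)
      fix i assume i: "i \<in> {N..n}"
      show "expectation (expo b n m {i}) \<le> B i"
      proof -
        have "expectation (expo b n m {i}) \<le> (\<Prod>i\<in>{i}. B i)"
          using i m by (intro expo_young_bound[where N = N] N b B) auto
        thus ?thesis by simp
      qed
    qed
    have "(\<Sum>i\<in>{N..n}. \<Sum>j\<in>{N..n} - {i}. expectation (expo b n m {i, j})) \<le> (\<Sum>i\<in>{N..n}. \<Sum>j\<in>{N..n} - {i}. B i * B j)"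
    proof (intro sum_mono)
      fix i j assume i: "i \<in> {N..n}" and j: "j \<in> {N..n} - {i}"
      have "expectation (expo b n m {i, j}) \<le> (\<Prod>i\<in>{i, j}. B i)"
        using i j m by (intro expo_young_bound[where N = N] N b B) auto
      moreover have "i \<noteq> j" using j by auto
      ultimately show "expectation (expo b n m {i, j}) \<le> B i * B j" by simp
    qed
    also have "\<dots> \<le> (\<Sum>i\<in>{N..n}. \<Sum>j\<in>{N..n}. B i * B j)"
      using B(2) by (intro sum_mono sum_mono2) auto
    also have "\<dots> = (\<Sum>i\<in>{N..n}. B i)\<^sup>2" by (simp add: power2_eq_square sum_product)
    finally have 2: "(\<Sum>i\<in>{N..n}. \<Sum>j\<in>{N..n} - {i}. expectation (expo b n m {i, j})) \<le> (\<Sum>i\<in>{N..n}. B i)\<^sup>2" .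
    have "\<bar>?E (Suc m) - ?E m\<bar> \<le> (C m)\<^sup>2 * (b\<^sup>2 / b ^ k * (\<Sum>i\<in>{N..n}. expectation (expo b n m {i}))
       + b\<^sup>2 / (b ^ k)\<^sup>2 * (\<Sum>i\<in>{N..n}. \<Sum>j\<in>{N..n} - {i}. expectation (expo b n m {i, j})))"
    proof (rule hybrid_step[OF th N(1)])
      show "N \<le> m" "m < n" using m by auto
      thus "attach_prob m i \<omega> \<le> C m" if "\<omega> \<in> Good" "i \<in> {N..n}" for \<omega> i
        using C that by blast
    qed (simp_all add: b)
    also have "\<dots> \<le> (C m)\<^sup>2 * (b\<^sup>2 / b ^ k * (\<Sum>i\<in>{N..n}. B i) + b\<^sup>2 / (b ^ k)\<^sup>2 * (\<Sum>i\<in>{N..n}. B i)\<^sup>2)"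
      using 1 2 b by (intro mult_left_mono add_mono) auto
    also have "\<dots> = (C m)\<^sup>2 * (b\<^sup>2 * (A + A\<^sup>2))"
      by (simp add: A_def power_divide distrib_left)
    finally show ?thesis .
  qed
  have tele: "?E n - ?E N = (\<Sum>m\<in>{N..<n}. ?E (Suc m) - ?E m)"
    by (rule sum_Suc_diff'[OF N(2), of ?E, symmetric])
  have "\<bar>?E n - ?E N\<bar> \<le> (\<Sum>m\<in>{N..<n}. \<bar>?E (Suc m) - ?E m\<bar>)" unfolding tele by (rule sum_abs)
  also have "\<dots> \<le> (\<Sum>m\<in>{N..<n}. (C m)\<^sup>2 * (b\<^sup>2 * (A + A\<^sup>2)))" by (intro sum_mono step)
  finally show ?thesis by (simp only: sum_distrib_right)
qed

end

section \<open>Typical weight sequences\<close>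

lemma sum_inverse_ln_bounds:
  assumes "1 \<le> i" "i \<le> n"
  shows "ln (real n / real i) \<le> (\<Sum>l\<in>{i..<n}. 1 / real l)"
    and "(\<Sum>l\<in>{i..<n}. 1 / real l) \<le> ln (real n / real i) + 1 / real i"
proof -
  have "ln (real n / real i) \<le> (\<Sum>l\<in>{i..<n}. 1 / real l) \<and> (\<Sum>l\<in>{i..<n}. 1 / real l) \<le> ln (real n / real i) + (1 / real i - 1 / real n)"
    using assms(2)
  proof (induction rule: dec_induct)
    case base
    thus ?case using assms by simp
  next
    case (step l)
    have l: "0 < real l" using step assms by simp
    define y where "y = 1 + 1 / real l"
    have y: "0 < y" using l by (simp add: y_def add_pos_pos)
    have ly: "real l * y = real (Suc l)" using l by (simp add: y_def distrib_left)
    have i0: "0 < real i" using assms by simp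
    have "real (Suc l) / real i = (real l / real i) * y" unfolding ly[symmetric] by simp
    hence s: "ln (real (Suc l) / real i) = ln (real l / real i) + ln y"
      using l y i0 by (simp only: ln_mult_pos divide_pos_pos)
    have u: "ln y \<le> 1 / real l" unfolding y_def using l by (intro ln_add_one_self_le_self) auto
    have "ln (1 / y) \<le> 1 / y - 1" using y by (intro ln_le_minus_one) auto
    moreover have "ln (1 / y) = - ln y" using y by (simp add: ln_div)
    moreover have "1 / y = real l / real (Suc l)" unfolding ly[symmetric] using y l by simp
    moreover have "1 - real l / real (Suc l) = 1 / real (Suc l)" by (simp add: field_simps)
    ultimately have d: "1 / real (Suc l) \<le> ln y" by linarith
    show ?case using step.IH step.hyps unfolding s using u d by (simp add: sum.atLeastLessThan_Suc)
  qed
  moreover have "0 \<le> 1 / real n" by simp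
  ultimately show "ln (real n / real i) \<le> (\<Sum>l\<in>{i..<n}. 1 / real l)"
    "(\<Sum>l\<in>{i..<n}. 1 / real l) \<le> ln (real n / real i) + 1 / real i" by linarith+
qed

lemma sum_inverse_squares:
  assumes "1 \<le> N"
  shows "(\<Sum>l\<in>{N..<n}. 1 / (real l)\<^sup>2) \<le> 2 / real N"
proof (cases "N \<le> n")
  case True
  have "(\<Sum>l\<in>{N..<n}. 1 / (real l)\<^sup>2) \<le> 2 / real N - 2 / real n"
    using True
  proof (induction rule: dec_induct)
    case base
    thus ?case using assms by simp
  next
    case (step l)
    have l: "real l \<ge> 1" using step assms by simp
    have "2 / real l - 2 / real (Suc l) = 2 / (real l * real (Suc l))" using l by (simp add: field_simps)
    also have "\<dots> \<ge> 2 / (real l * (2 * real l))" using l by (intro divide_left_mono mult_left_mono) auto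
    also have "2 / (real l * (2 * real l)) = 1 / (real l)\<^sup>2" by (simp add: power2_eq_square)
    finally have "1 / (real l)\<^sup>2 \<le> 2 / real l - 2 / real (Suc l)" .
    thus ?case using step.IH step.hyps by (simp add: sum.atLeastLessThan_Suc)
  qed
  thus ?thesis by (smt (verit) divide_nonneg_nonneg of_nat_0_le_iff)
qed (use assms in simp)

lemma sum_powr_le:
  assumes "0 < \<rho>" "\<rho> < 1"
  shows "(\<Sum>i=1..n. real i powr (- \<rho>)) \<le> real n powr (1 - \<rho>) / (1 - \<rho>)"
proof (induction n)
  case (Suc n)
  have "real (Suc n) powr (- \<rho>) \<le> (real (Suc n) powr (1 - \<rho>) - real n powr (1 - \<rho>)) / (1 - \<rho>)"
  proof (cases "n = 0")
    case True
    thus ?thesis using assms by simp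
  next
    case False
    have "\<exists>z>real n. z < real (Suc n) \<and> real (Suc n) powr (1 - \<rho>) - real n powr (1 - \<rho>) = (real (Suc n) - real n) * ((1 - \<rho>) * z powr (1 - \<rho> - 1))"
    proof (rule MVT2)
      show "((\<lambda>x. x powr (1 - \<rho>)) has_real_derivative (1 - \<rho>) * x powr (1 - \<rho> - 1)) (at x)" if "real n \<le> x" for x
        using that False by (intro has_real_derivative_powr) auto
    qed simp
    then obtain z where z: "real n < z" "z < real (Suc n)" "real (Suc n) powr (1 - \<rho>) - real n powr (1 - \<rho>) = (1 - \<rho>) * z powr (- \<rho>)"
      by auto
    have "real (Suc n) powr (- \<rho>) \<le> z powr (- \<rho>)" using z assms False by (intro powr_mono2') auto
    thus ?thesis unfolding z(3) using assms by simp
  qed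
  thus ?case using Suc assms by (simp add: diff_divide_distrib)
qed (use assms in simp)

locale beta_wrt = weighted_recursive_tree M "beta_distribution \<alpha> \<beta>" W pa + beta_tree_setting \<alpha> \<beta> \<theta> lam \<epsilon> a n
  for M :: "'a measure" and W pa \<alpha> \<beta> \<theta> lam \<epsilon> a n
begin

text \<open>Any exponent strictly between 1/2 and 1 would serve in place of 3/4: above 1/2 the
  Hoeffding bounds are summable, and below 1 the resulting errors in \<open>1 / S l\<close> are
  summable.\<close>

definition Good :: "nat \<Rightarrow> 'a set" where
  "Good m0 = {\<omega> \<in> space M. (\<forall>i\<in>{1..}. 0 < W i \<omega> \<and> W i \<omega> < 1) \<and> (\<forall>l\<in>{m0..}. \<bar>S l \<omega> - real l / lam\<bar> \<le> real l powr (3/4))}"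

lemma Good_history: "Good m0 \<in> sets (history l)"
proof -
  have "{\<omega> \<in> space (history l). 0 < W (Suc i) \<omega> \<and> W (Suc i) \<omega> < 1} \<in> sets (history l)" for i
  proof -
    have [measurable]: "W (Suc i) \<in> borel_measurable (history l)" by (intro weight_history) auto
    show ?thesis by measurable
  qed
  hence A: "{\<omega> \<in> space (history l). (\<forall>i. 0 < W (Suc i) \<omega> \<and> W (Suc i) \<omega> < 1)} \<in> sets (history l)"
    by (rule sets.sets_Collect_countable_All)
  have "{\<omega> \<in> space (history l). \<bar>S (m0 + k) \<omega> - real (m0 + k) / lam\<bar> \<le> real (m0 + k) powr (3/4)} \<in> sets (history l)" for k
    by measurable
  hence "{\<omega> \<in> space (history l). (\<forall>k. \<bar>S (m0 + k) \<omega> - real (m0 + k) / lam\<bar> \<le> real (m0 + k) powr (3/4))} \<in> sets (history l)"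
    by (rule sets.sets_Collect_countable_All)
  with A have "{\<omega> \<in> space (history l). (\<forall>i. 0 < W (Suc i) \<omega> \<and> W (Suc i) \<omega> < 1)} \<inter>
      {\<omega> \<in> space (history l). (\<forall>k. \<bar>S (m0 + k) \<omega> - real (m0 + k) / lam\<bar> \<le> real (m0 + k) powr (3/4))} \<in> sets (history l)"
    by (rule sets.Int)
  also have "{\<omega> \<in> space (history l). (\<forall>i. 0 < W (Suc i) \<omega> \<and> W (Suc i) \<omega> < 1)} \<inter>
      {\<omega> \<in> space (history l). (\<forall>k. \<bar>S (m0 + k) \<omega> - real (m0 + k) / lam\<bar> \<le> real (m0 + k) powr (3/4))} = Good m0"
  proof -
    have 1: "(\<forall>i. P (Suc i)) \<longleftrightarrow> (\<forall>i\<in>{1..}. P i)" for P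
      by (metis Suc_le_D atLeast_iff One_nat_def Suc_le_mono le0)
    have 2: "(\<forall>k. P (m0 + k)) \<longleftrightarrow> (\<forall>l\<in>{m0..}. P l)" for P
      by (metis atLeast_iff le_add1 le_iff_add)
    show ?thesis unfolding Good_def 1[of "\<lambda>i. 0 < W i _ \<and> W i _ < 1"]
        2[of "\<lambda>l. \<bar>S l _ - real l / lam\<bar> \<le> real l powr (3/4)"] by (simp only: space_history) blast
  qed
  finally show ?thesis .
qed

lemma GoodD:
  assumes "\<omega> \<in> Good m0"
  shows "1 \<le> i \<Longrightarrow> 0 < W i \<omega>" "1 \<le> i \<Longrightarrow> W i \<omega> < 1"
    "m0 \<le> l \<Longrightarrow> \<bar>S l \<omega> - real l / lam\<bar> \<le> real l powr (3/4)"
  using assms unfolding Good_def by blast+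

lemma Good_events [measurable]: "Good m0 \<in> events"
  using Good_history[of m0 0] subalgebra_history[of 0] by (auto simp: subalgebra_def)

sublocale G: good_weights M "beta_distribution \<alpha> \<beta>" W pa "Good m0" for m0
proof unfold_locales
  show "Good m0 \<in> sets (history l)" for l by (rule Good_history)
  show "0 < W i \<omega>" if "\<omega> \<in> Good m0" "1 \<le> i" for \<omega> i using that unfolding Good_def by blast
qed

lemma AE_weights: "AE \<omega> in M. \<forall>i\<in>{1..}. 0 < W i \<omega> \<and> W i \<omega> < 1"
proof -
  have "AE \<omega> in M. 0 < W i \<omega> \<and> W i \<omega> < 1" if i: "i \<in> {1..}" for i
  proof -
    have "AE w in distr M borel (W i). 0 < w \<and> w < 1" using AE_beta i by (simp only: weight_law atLeast_iff)
    thus ?thesis using weight_measurable[of i] i by (subst (asm) AE_distr_iff) auto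
  qed
  thus ?thesis by (subst AE_ball_countable) auto
qed

lemma expectation_weight:
  assumes "1 \<le> i" shows "expectation (W i) = 1 / lam"
proof -
  have "expectation (W i) = (\<integral>w. w \<partial>distr M borel (W i))"
    using weight_measurable[OF assms] by (subst integral_distr) auto
  thus ?thesis using weight_law[OF assms] theta_eq lam by simp
qed

lemma S_measurable [measurable]: "S l \<in> borel_measurable M"
  by (rule measurable_history[OF S_history])

lemma deviation_prob:
  assumes "l \<ge> 1"
  shows "prob {\<omega> \<in> space M. \<bar>S l \<omega> - real l / lam\<bar> \<ge> real l powr (3/4)} \<le> 2 * exp (- 2 * sqrt (real l))"
proof -
  interpret H: Hoeffding_ineq M "{1..l}" W "\<lambda>_. 0" "\<lambda>_. 1" "\<Sum>i\<in>{1..l}. expectation (W i)"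
  proof unfold_locales
    show "indep_vars (\<lambda>_. borel) W {1..l}" using weights_indep by (rule indep_vars_subset) auto
    show "AE x in M. W i x \<in> {0..1}" if "i \<in> {1..l}" for i
    proof -
      have i1: "i \<in> {1..}" using that by simp
      show ?thesis using AE_weights
      proof eventually_elim
        case (elim x)
        from bspec[OF elim i1] show ?case by simp
      qed
    qed
  qed auto
  have mu: "(\<Sum>i\<in>{1..l}. expectation (W i)) = real l / lam"
  proof -
    have "(\<Sum>i\<in>{1..l}. expectation (W i)) = (\<Sum>i\<in>{1..l}. 1 / lam)" by (intro sum.cong expectation_weight) auto
    thus ?thesis by simp
  qed
  have e: "- 2 * (real l powr (3/4))\<^sup>2 / (\<Sum>i\<in>{1..l}. (1 - 0)\<^sup>2) = - 2 * sqrt (real l)"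
  proof -
    have "(real l powr (3/4))\<^sup>2 = real l powr (3/2)" by (simp add: power2_eq_square flip: powr_add)
    also have "\<dots> = real l powr (1 + 1/2)" by simp
    also have "\<dots> = real l * sqrt (real l)" using assms by (subst powr_add) (simp add: powr_half_sqrt)
    finally show ?thesis using assms by simp
  qed
  have "prob {\<omega> \<in> space M. \<bar>(\<Sum>i\<in>{1..l}. W i \<omega>) - (\<Sum>i\<in>{1..l}. expectation (W i))\<bar> \<ge> real l powr (3/4)}
     \<le> 2 * exp (- 2 * (real l powr (3/4))\<^sup>2 / (\<Sum>i\<in>{1..l}. (1 - 0)\<^sup>2))"
    by (rule H.Hoeffding_ineq_abs_ge) (use assms in auto)
  thus ?thesis unfolding e mu by (simp add: S_def)
qed

lemma summable_deviation: "summable (\<lambda>l. 2 * exp (- 2 * sqrt (real l)))"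
proof (rule summable_comparison_test_ev)
  have "eventually (\<lambda>l. 2 * exp (- 2 * sqrt (real l)) \<le> 1 / real l ^ 2) sequentially" by real_asymp
  thus "eventually (\<lambda>l. norm (2 * exp (- 2 * sqrt (real l))) \<le> 1 / real l ^ 2) sequentially" by simp
  show "summable (\<lambda>l. 1 / real l ^ 2)" using inverse_power_summable[of 2, where 'a = real] by (simp add: inverse_eq_divide)
qed

text \<open>A union bound with the tail of the convergent series in
  \<open>summable_deviation\<close>. Having it for all large \<open>m0\<close> allows
  \<open>m0\<close> to exceed \<open>settle\<close> as well.\<close>

lemma Good_likely:
  assumes "\<delta> > 0"
  shows "\<exists>m1. \<forall>m0\<ge>m1. prob (space M - Good m0) < \<delta>"
proof -
  obtain m1 where m1: "\<And>m. m \<ge> m1 \<Longrightarrow> norm (\<Sum>l. 2 * exp (- 2 * sqrt (real (l + m)))) < \<delta>"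
    using suminf_exist_split[OF assms summable_deviation] by auto
  show ?thesis
  proof (intro exI[of _ "max 1 m1"] allI impI)
    fix m0 assume m0: "max 1 m1 \<le> m0"
    define E where "E l = {\<omega> \<in> space M. \<bar>S l \<omega> - real l / lam\<bar> \<ge> real l powr (3/4)}" for l
    have E [measurable]: "E l \<in> events" for l unfolding E_def by measurable
    have sm: "summable (\<lambda>l. 2 * exp (- 2 * sqrt (real (l + m0))))"
      using summable_iff_shift[of "\<lambda>l. 2 * exp (- 2 * sqrt (real l))" m0] summable_deviation by simp
    have le: "prob (E (l + m0)) \<le> 2 * exp (- 2 * sqrt (real (l + m0)))" for l
      unfolding E_def using m0 by (intro deviation_prob) auto
    have smE: "summable (\<lambda>l. prob (E (l + m0)))"
      by (rule summable_comparison_test'[OF sm, of 0]) (use le in auto)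
    have "prob (space M - Good m0) \<le> prob (\<Union>l. E (l + m0))"
    proof (rule finite_measure_mono_AE)
      show "AE \<omega> in M. \<omega> \<in> space M - Good m0 \<longrightarrow> \<omega> \<in> (\<Union>l. E (l + m0))"
        using AE_weights
      proof eventually_elim
        case (elim \<omega>)
        show ?case
        proof
          assume w: "\<omega> \<in> space M - Good m0"
          then obtain l where l: "l \<ge> m0" "\<not> \<bar>S l \<omega> - real l / lam\<bar> \<le> real l powr (3/4)"
            using elim unfolding Good_def by blast
          hence "\<omega> \<in> E ((l - m0) + m0)" using w by (simp add: E_def)
          thus "\<omega> \<in> (\<Union>l. E (l + m0))" by blast
        qed
      qed
    qed measurable
    also have "\<dots> \<le> (\<Sum>l. prob (E (l + m0)))"
      by (intro finite_measure_subadditive_countably smE) auto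
    also have "\<dots> \<le> (\<Sum>l. 2 * exp (- 2 * sqrt (real (l + m0))))"
      by (intro suminf_le le smE sm)
    also have "\<dots> < \<delta>" using m1[of m0] m0 by auto
    finally show "prob (space M - Good m0) < \<delta>" .
  qed
qed

text \<open>For \<open>l \<ge> settle\<close> the deviation \<open>l\<^sup>3\<^sup>/\<^sup>4\<close> is at most half of the mean \<open>l / lam\<close> of \<open>S l\<close>.\<close>

definition settle :: nat where "settle = nat \<lceil>(2 * lam) ^ 4\<rceil>"

text \<open>In units of \<open>lam\<close>: the tail of the errors in \<open>1 / S l\<close>, of
  order \<open>l powr (- 5/4)\<close>, plus the gap between a harmonic sum and a logarithm.\<close>

definition rem :: "nat \<Rightarrow> real" where
  "rem N = (\<Sum>l. 2 * lam * real (l + N) powr (- (5/4))) + 1 / real N"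

lemma summable_rem: "summable (\<lambda>l. 2 * lam * real (l + N) powr (- (5/4)))"
proof -
  have "summable (\<lambda>l. 2 * lam * real l powr (- (5/4)))"
    by (intro summable_mult) (simp add: summable_real_powr_iff)
  thus ?thesis using summable_iff_shift[of "\<lambda>l. 2 * lam * real l powr (- (5/4))" N] by simp
qed

lemma rem_nonneg: "0 \<le> rem N"
  unfolding rem_def using lam_pos by (intro add_nonneg_nonneg suminf_nonneg summable_rem) auto

lemma rem_lim: "rem \<longlonglongrightarrow> 0"
proof -
  have "(\<lambda>N. \<Sum>l. 2 * lam * real (l + N) powr (- (5/4))) \<longlonglongrightarrow> 0"
  proof -
    let ?f = "\<lambda>l. 2 * lam * real l powr (- (5/4))"
    have sm: "summable ?f" using summable_rem[of 0] by simp
    have "(\<lambda>N. suminf ?f - (\<Sum>i<N. ?f i)) \<longlonglongrightarrow> suminf ?f - suminf ?f"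
      by (intro tendsto_diff tendsto_const summable_LIMSEQ sm)
    thus ?thesis using suminf_minus_initial_segment[OF sm] by simp
  qed
  moreover have "(\<lambda>N. 1 / real N) \<longlonglongrightarrow> 0" by real_asymp
  ultimately show ?thesis unfolding rem_def[abs_def] using tendsto_add by fastforce
qed

lemma S_lower:
  assumes w: "\<omega> \<in> Good m0" and m0: "settle \<le> m0" and l: "m0 \<le> l" "1 \<le> l"
  shows "real l / (2 * lam) \<le> S l \<omega>" "\<bar>1 / S l \<omega> - lam / real l\<bar> \<le> lam * (2 * lam * real l powr (- (5/4)))"
proof -
  have d: "\<bar>S l \<omega> - real l / lam\<bar> \<le> real l powr (3/4)" using GoodD(3)[OF w l(1)] .
  have "(2 * lam) ^ 4 \<le> real l" using m0 l unfolding settle_def by linarith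
  moreover have "(2 * lam) ^ 4 = (2 * lam) powr 4" using lam_pos by (subst powr_numeral) auto
  ultimately have "(2 * lam) powr 4 \<le> real l" by (simp only:)
  hence "((2 * lam) powr 4) powr (1/4) \<le> real l powr (1/4)" using lam_pos by (intro powr_mono2) auto
  hence q: "2 * lam \<le> real l powr (1/4)" using lam_pos unfolding powr_powr by simp
  have "real l powr (3/4) * real l powr (1/4) = real l" using l by (simp flip: powr_add)
  moreover have "real l powr (3/4) * (2 * lam) \<le> real l powr (3/4) * real l powr (1/4)" using q by (intro mult_left_mono) auto
  ultimately have "real l powr (3/4) \<le> real l / (2 * lam)" using lam_pos by (simp add: field_simps)
  moreover have "real l / lam = 2 * (real l / (2 * lam))" using lam_pos by simp
  ultimately show low: "real l / (2 * lam) \<le> S l \<omega>" using d by linarith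
  have pos: "0 < real l / (2 * lam)" using l lam_pos by simp
  hence Sp: "0 < S l \<omega>" using low by linarith
  have "1 / S l \<omega> - lam / real l = (real l / lam - S l \<omega>) * (lam / (real l * S l \<omega>))"
    using Sp l lam_pos by (simp add: field_simps)
  hence "\<bar>1 / S l \<omega> - lam / real l\<bar> = \<bar>S l \<omega> - real l / lam\<bar> * (lam / (real l * S l \<omega>))"
    using Sp lam_pos by (simp add: abs_mult abs_minus_commute)
  also have "\<dots> \<le> real l powr (3/4) * (lam / (real l * (real l / (2 * lam))))"
  proof (rule mult_mono)
    have lp: "0 < real l" using l by simp
    have "real l * (real l / (2 * lam)) \<le> real l * S l \<omega>" using low lp by (intro mult_left_mono) auto
    moreover have "0 < real l * S l \<omega> * (real l * (real l / (2 * lam)))"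
      by (rule mult_pos_pos[OF mult_pos_pos[OF lp Sp] mult_pos_pos[OF lp pos]])
    ultimately show "lam / (real l * S l \<omega>) \<le> lam / (real l * (real l / (2 * lam)))"
      using lam_pos by (intro divide_left_mono) auto
    show "0 \<le> lam / (real l * S l \<omega>)" using lp Sp lam_pos by simp
  qed (use d in auto)
  also have "\<dots> = lam * (2 * lam * (real l powr (3/4) / (real l * real l)))" using lam_pos by (simp add: field_simps)
  also have "real l powr (3/4) / (real l * real l) = real l powr (- (5/4))"
  proof -
    have "real l * real l = real l powr 2" using l by (simp add: powr_numeral power2_eq_square)
    hence "real l powr (3/4) / (real l * real l) = real l powr (3/4 - 2)" by (simp only: powr_diff)
    thus ?thesis by simp
  qed
  finally show "\<bar>1 / S l \<omega> - lam / real l\<bar> \<le> lam * (2 * lam * real l powr (- (5/4)))" .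
qed

lemma inverse_S_sum:
  assumes w: "\<omega> \<in> Good m0" and m0: "settle \<le> m0" "1 \<le> m0" and i: "m0 \<le> N" "N \<le> i" "i \<le> t"
  shows "\<bar>(\<Sum>l\<in>{i..<t}. 1 / S l \<omega>) - lam * ln (real t / real i)\<bar> \<le> lam * rem N"
proof -
  have "\<bar>(\<Sum>l\<in>{i..<t}. 1 / S l \<omega>) - (\<Sum>l\<in>{i..<t}. lam / real l)\<bar> \<le> (\<Sum>l\<in>{i..<t}. \<bar>1 / S l \<omega> - lam / real l\<bar>)"
    unfolding sum_subtractf[symmetric] by (rule sum_abs)
  also have "\<dots> \<le> (\<Sum>l\<in>{i..<t}. lam * (2 * lam * real l powr (- (5/4))))"
    using i m0 by (intro sum_mono S_lower(2)[OF w m0(1)]) auto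
  also have "\<dots> = lam * (\<Sum>l\<in>{i..<t}. 2 * lam * real l powr (- (5/4)))" by (simp add: sum_distrib_left)
  also have "(\<Sum>l\<in>{i..<t}. 2 * lam * real l powr (- (5/4))) \<le> (\<Sum>l\<in>{N..<t}. 2 * lam * real l powr (- (5/4)))"
    using i lam_pos by (intro sum_mono2) auto
  also have "(\<Sum>l\<in>{N..<t}. 2 * lam * real l powr (- (5/4))) = (\<Sum>l\<in>{0..<t - N}. 2 * lam * real (l + N) powr (- (5/4)))"
    using i sum.shift_bounds_nat_ivl[of "\<lambda>l. 2 * lam * real l powr (- (5/4))" 0 N "t - N"] by simp
  also have "\<dots> \<le> (\<Sum>l. 2 * lam * real (l + N) powr (- (5/4)))"
    using lam_pos by (intro sum_le_suminf summable_rem) auto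
  finally have 1: "\<bar>(\<Sum>l\<in>{i..<t}. 1 / S l \<omega>) - (\<Sum>l\<in>{i..<t}. lam / real l)\<bar> \<le> lam * (\<Sum>l. 2 * lam * real (l + N) powr (- (5/4)))"
    using lam_pos by simp
  have "(\<Sum>l\<in>{i..<t}. lam / real l) = lam * (\<Sum>l\<in>{i..<t}. 1 / real l)" by (simp add: sum_distrib_left)
  moreover have "ln (real t / real i) \<le> (\<Sum>l\<in>{i..<t}. 1 / real l)" "(\<Sum>l\<in>{i..<t}. 1 / real l) \<le> ln (real t / real i) + 1 / real i"
    using i m0 by (auto intro!: sum_inverse_ln_bounds)
  moreover have "1 / real i \<le> 1 / real N" using i m0 by (simp add: field_simps)
  ultimately have "lam * ln (real t / real i) \<le> (\<Sum>l\<in>{i..<t}. lam / real l)" "(\<Sum>l\<in>{i..<t}. lam / real l) \<le> lam * (ln (real t / real i) + 1 / real N)"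
    using lam_pos by auto
  with 1 show ?thesis unfolding rem_def distrib_left by linarith
qed

text \<open>Vertex \<open>i\<close> can be chosen only from time \<open>i\<close> on, so its mean
  growth is \<open>W i \<omega>\<close> times the sum of \<open>1 / S l\<close> over later times.
  The error is also proportional to \<open>W i \<omega>\<close> and can thus be written as a shift
  of the age that is the same for all vertices.\<close>

lemma future_mean_sandwich:
  assumes w: "\<omega> \<in> Good m0" and m0: "settle \<le> m0" "1 \<le> m0" and i: "m0 \<le> N" "N \<le> i" "i \<le> t"
  shows "W i \<omega> * lam * (ln (real t / real i) - rem N) \<le> future_mean t N i \<omega>"
    "future_mean t N i \<omega> \<le> W i \<omega> * lam * (ln (real t / real i) + rem N)"
proof -
  have "future_mean t N i \<omega> = (\<Sum>l\<in>{N..<t}. if i \<le> l then W i \<omega> / S l \<omega> else 0)"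
    by (simp add: future_mean_def attach_prob_def)
  also have "\<dots> = (\<Sum>l\<in>{l\<in>{N..<t}. i \<le> l}. W i \<omega> / S l \<omega>)" by (rule sum.inter_filter[symmetric]) simp
  also have "{l\<in>{N..<t}. i \<le> l} = {i..<t}" using i by auto
  finally have e: "future_mean t N i \<omega> = W i \<omega> * (\<Sum>l\<in>{i..<t}. 1 / S l \<omega>)" by (simp add: sum_distrib_left)
  have Wp: "0 \<le> W i \<omega>" using GoodD(1)[OF w, of i] i m0 by simp
  note b = inverse_S_sum[OF w m0 i]
  have "lam * (ln (real t / real i) - rem N) \<le> (\<Sum>l\<in>{i..<t}. 1 / S l \<omega>)" "(\<Sum>l\<in>{i..<t}. 1 / S l \<omega>) \<le> lam * (ln (real t / real i) + rem N)"
    using b unfolding right_diff_distrib distrib_left by linarith+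
  from mult_left_mono[OF this(1) Wp] mult_left_mono[OF this(2) Wp]
  show "W i \<omega> * lam * (ln (real t / real i) - rem N) \<le> future_mean t N i \<omega>"
    "future_mean t N i \<omega> \<le> W i \<omega> * lam * (ln (real t / real i) + rem N)" unfolding e by (simp_all only: mult.assoc)
qed

lemma attach_prob_Good:
  assumes w: "\<omega> \<in> Good m0" and m0: "settle \<le> m0" "1 \<le> m0" and i: "m0 \<le> m" "1 \<le> i"
  shows "attach_prob m i \<omega> \<le> 2 * lam / real m" "attach_prob m i \<omega> \<le> 1 / S m \<omega>"
proof -
  have low: "real m / (2 * lam) \<le> S m \<omega>" using S_lower(1)[OF w m0(1) i(1)] m0 i by simp
  have pos: "0 < real m / (2 * lam)" using i m0 lam_pos by simp
  have Wb: "0 < W i \<omega>" "W i \<omega> < 1" using GoodD(1,2)[OF w i(2)] by auto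
  show 1: "attach_prob m i \<omega> \<le> 1 / S m \<omega>" unfolding attach_prob_def using Wb low pos by (auto intro!: divide_right_mono)
  have Sp: "0 < S m \<omega>" using low pos by linarith
  have "1 / S m \<omega> \<le> 1 / (real m / (2 * lam))" by (rule divide_left_mono[OF low _ mult_pos_pos[OF Sp pos]]) simp
  hence "1 / S m \<omega> \<le> 2 * lam / real m" by simp
  with 1 show "attach_prob m i \<omega> \<le> 2 * lam / real m" by linarith
qed

end

section \<open>The generating functional of the tree\<close>

context beta_tree_setting
begin

lemma theta_powr_lg: "n j > 0 \<Longrightarrow> \<theta> powr (lg j) = real (n j)"
  using theta by (simp add: lg_def)

lemma theta_powr_lim_0:
  assumes "(\<lambda>j. f j / lg j) \<longlonglongrightarrow> c" "c < 0"
  shows "(\<lambda>j. \<theta> powr (f j)) \<longlonglongrightarrow> 0"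
proof -
  have t: "ln \<theta> > 0" using theta by simp
  have "filterlim (\<lambda>j. f j / lg j * lg j) at_bot sequentially"
    by (rule filterlim_tendsto_neg_mult_at_bot[OF assms lg_lim])
  moreover have "eventually (\<lambda>j. f j / lg j * lg j = f j) sequentially"
    using lg_pos by eventually_elim simp
  ultimately have "filterlim f at_bot sequentially" by (simp add: filterlim_cong)
  hence "filterlim (\<lambda>j. ln \<theta> * f j) at_bot sequentially"
    by (intro filterlim_tendsto_pos_mult_at_bot[OF tendsto_const t])
  hence "(\<lambda>j. exp (ln \<theta> * f j)) \<longlonglongrightarrow> 0" by (rule filterlim_compose[OF exp_at_bot])
  thus ?thesis using theta by (simp add: powr_def mult.commute)
qed

text \<open>The cutoff will be about the power \<open>\<eta>\<close> of n. The second condition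
  places it below the labels of the top vertices, which are near n to the power 1 - log_spread / ln
  \<theta>. The third makes a union bound over the older labels succeed: with base b = (1 +
  \<theta>) / 2, each of them reaches the level with probability of order n to the power 1/2 - log
  \<theta> b, up to lower-order factors.\<close>

lemma cutoff_exponent_exists:
  "\<exists>\<eta>>0. \<eta> < 1 \<and> log_spread < (1 - \<eta>) * ln \<theta> \<and> \<eta> + 1/2 < log \<theta> ((1 + \<theta>) / 2)"
proof -
  have t: "1 < \<theta>" "0 < \<theta>" "ln \<theta> > 0" using theta by auto
  \<comment> \<open>Arithmetic against geometric mean of 1 and \<open>\<theta>\<close>: this is what
    makes the exponent 1/2 strictly smaller than
    \<open>log \<theta> ((1 + \<theta>) / 2)\<close>.\<close>
  have "0 < (sqrt \<theta> - 1)\<^sup>2" using t by simp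
  also have "(sqrt \<theta> - 1)\<^sup>2 = \<theta> - 2 * sqrt \<theta> + 1" using t by (simp add: power2_diff)
  finally have "sqrt \<theta> < (1 + \<theta>) / 2" by simp
  hence "\<theta> powr (1/2) < (1 + \<theta>) / 2" using t by (simp add: powr_half_sqrt)
  hence "log \<theta> (\<theta> powr (1/2)) < log \<theta> ((1 + \<theta>) / 2)" using t by (intro log_less) auto
  hence a: "1/2 < log \<theta> ((1 + \<theta>) / 2)" using t by simp
  have "ln (1 / \<theta>) < 1 / \<theta> - 1" using t ln_less_self[of "1/\<theta>"] by (smt (verit) ln_le_minus_one ln_eq_minus_one divide_eq_1_iff zero_less_divide_1_iff)
  hence "1 - 1 / \<theta> < ln \<theta>" using t by (simp add: ln_div)
  hence b: "log_spread < ln \<theta>" using lam(5) by (simp add: log_spread_def inverse_eq_divide)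
  define \<eta> where "\<eta> = min (1/2) (min ((1 - log_spread / ln \<theta>) / 2) ((log \<theta> ((1 + \<theta>) / 2) - 1/2) / 2))"
  have c: "log_spread / ln \<theta> < 1" using b t by simp
  have e0: "\<eta> > 0" using a c by (auto simp: \<eta>_def)
  have "\<eta> \<le> 1/2" unfolding \<eta>_def by (rule min.cobounded1)
  hence e1: "\<eta> < 1" by linarith
  have "\<eta> \<le> (1 - log_spread / ln \<theta>) / 2" unfolding \<eta>_def by linarith
  moreover have "y / 2 < y" if "0 < y" for y :: real using that by simp
  ultimately have "\<eta> < 1 - log_spread / ln \<theta>" using c by (meson diff_gt_0_iff_gt order.strict_trans1)
  hence "log_spread / ln \<theta> < 1 - \<eta>" by (simp only: less_diff_eq add.commute)
  hence e2: "log_spread < (1 - \<eta>) * ln \<theta>" by (simp only: pos_divide_less_eq[OF t(3)])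
  have "\<eta> \<le> (log \<theta> ((1 + \<theta>) / 2) - 1/2) / 2" unfolding \<eta>_def by linarith
  moreover have "(y - 1/2) / 2 < y - 1/2" if "1/2 < y" for y :: real using that by simp
  ultimately have "\<eta> < log \<theta> ((1 + \<theta>) / 2) - 1/2" using a by (meson order.strict_trans1)
  hence "\<eta> + 1/2 < log \<theta> ((1 + \<theta>) / 2)" by (simp only: less_diff_eq)
  with e0 e1 e2 show ?thesis by blast
qed

definition cutoff :: "real \<Rightarrow> nat \<Rightarrow> nat" where "cutoff \<eta> j = nat \<lceil>\<theta> powr (\<eta> * lg j)\<rceil>"

lemma cutoff_bounds:
  assumes "0 < \<eta>"
  shows "\<theta> powr (\<eta> * lg j) \<le> real (cutoff \<eta> j)"
    and "eventually (\<lambda>j. real (cutoff \<eta> j) \<le> 2 * \<theta> powr (\<eta> * lg j)) sequentially"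
proof -
  show "\<theta> powr (\<eta> * lg j) \<le> real (cutoff \<eta> j)" unfolding cutoff_def by linarith
  show "eventually (\<lambda>j. real (cutoff \<eta> j) \<le> 2 * \<theta> powr (\<eta> * lg j)) sequentially"
    using lg_pos
  proof eventually_elim
    case (elim j)
    have "1 \<le> \<theta> powr (\<eta> * lg j)" using theta elim assms by (intro ge_one_powr_ge_zero) auto
    thus ?case unfolding cutoff_def by linarith
  qed
qed

lemma cutoff_lim:
  assumes "0 < \<eta>" shows "filterlim (cutoff \<eta>) at_top sequentially"
proof -
  have "filterlim (\<lambda>j. ln \<theta> * (\<eta> * lg j)) at_top sequentially"
    using theta assms by (intro filterlim_tendsto_pos_mult_at_top[OF tendsto_const] lg_lim) auto
  hence "filterlim (\<lambda>j. exp (ln \<theta> * (\<eta> * lg j))) at_top sequentially" by (rule filterlim_compose[OF exp_at_top])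
  hence p: "filterlim (\<lambda>j. \<theta> powr (\<eta> * lg j)) at_top sequentially" using theta by (simp add: powr_def mult.commute)
  show ?thesis unfolding filterlim_at_top
  proof
    fix Z :: nat
    have "eventually (\<lambda>j. real Z \<le> \<theta> powr (\<eta> * lg j)) sequentially" using p unfolding filterlim_at_top by blast
    thus "eventually (\<lambda>j. Z \<le> cutoff \<eta> j) sequentially"
      by eventually_elim (use cutoff_bounds(1)[OF assms] in \<open>meson of_nat_le_iff order_trans\<close>)
  qed
qed

lemma cutoff_far:
  assumes "0 < \<eta>"
  shows "eventually (\<lambda>j. (1 - \<eta>) * ln \<theta> * lg j - ln 2 \<le> ln (real (n j) / real (cutoff \<eta> j))) sequentially"
proof -
  have "eventually (\<lambda>j. 1 \<le> cutoff \<eta> j) sequentially"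
    using eventually_ge_at_top[of 1] cutoff_lim[OF assms] by (rule eventually_compose_filterlim)
  moreover have "eventually (\<lambda>j. 1 \<le> n j) sequentially"
    using eventually_ge_at_top[of 1] n_lim by (rule eventually_compose_filterlim)
  ultimately show ?thesis using cutoff_bounds(2)[OF assms] lg_pos
  proof eventually_elim
    case (elim j)
    have t: "0 < \<theta>" "\<theta> \<noteq> 1" using theta by auto
    have "ln (real (cutoff \<eta> j)) \<le> ln (2 * \<theta> powr (\<eta> * lg j))" using elim t by (subst ln_le_cancel_iff) auto
    also have "\<dots> = ln 2 + \<eta> * lg j * ln \<theta>" using t by (simp add: ln_mult ln_powr)
    finally have "ln (real (cutoff \<eta> j)) \<le> ln 2 + \<eta> * lg j * ln \<theta>" .
    moreover have "ln (real (n j)) = lg j * ln \<theta>" using t by (simp add: lg_ln)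
    moreover have "ln (real (n j) / real (cutoff \<eta> j)) = ln (real (n j)) - ln (real (cutoff \<eta> j))"
      using elim by (simp add: ln_div)
    ultimately show ?case by (simp add: algebra_simps)
  qed
qed

lemma cutoff_le:
  assumes "0 < \<eta>" "\<eta> < 1"
  shows "eventually (\<lambda>j. 2 \<le> cutoff \<eta> j \<and> cutoff \<eta> j \<le> n j) sequentially"
proof -
  have c: "(1 - \<eta>) * ln \<theta> > 0" using assms theta by simp
  have "eventually (\<lambda>x. (1 - \<eta>) * ln \<theta> * x - ln 2 > 0) at_top" using c by real_asymp
  hence "eventually (\<lambda>j. (1 - \<eta>) * ln \<theta> * lg j - ln 2 > 0) sequentially" using lg_lim by (rule eventually_compose_filterlim)
  moreover have "eventually (\<lambda>j. 2 \<le> cutoff \<eta> j) sequentially"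
    using eventually_ge_at_top[of 2] cutoff_lim[OF assms(1)] by (rule eventually_compose_filterlim)
  moreover have "eventually (\<lambda>j. 1 \<le> n j) sequentially"
    using eventually_ge_at_top[of 1] n_lim by (rule eventually_compose_filterlim)
  ultimately show ?thesis using cutoff_far[OF assms(1)]
  proof eventually_elim
    case (elim j)
    have "0 < ln (real (n j) / real (cutoff \<eta> j))" using elim by linarith
    moreover have "0 < real (n j) / real (cutoff \<eta> j)" using elim by simp
    ultimately have "1 < real (n j) / real (cutoff \<eta> j)" by (simp add: ln_gt_zero_iff)
    thus ?case using elim by (simp add: less_divide_eq)
  qed
qed

end

context beta_wrt
begin

lemma future_mean_old:
  assumes w: "\<omega> \<in> Good m0" and m0: "settle \<le> m0" "1 \<le> m0" and t: "m0 \<le> t" and i: "1 \<le> i"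
  shows "future_mean t m0 i \<omega> \<le> lam * (ln (real t) + rem m0)"
proof -
  have "future_mean t m0 i \<omega> \<le> (\<Sum>l\<in>{m0..<t}. 1 / S l \<omega>)"
    unfolding future_mean_def using i by (intro sum_mono attach_prob_Good(2)[OF w m0]) auto
  also have "\<dots> \<le> lam * ln (real t / real m0) + lam * rem m0"
    using inverse_S_sum[OF w m0 order.refl order.refl t] by linarith
  also have "ln (real t / real m0) \<le> ln (real t)" using m0 t by (simp add: ln_div)
  hence "lam * ln (real t / real m0) + lam * rem m0 \<le> lam * (ln (real t) + rem m0)"
    using lam_pos by (simp add: distrib_left)
  finally show ?thesis .
qed

text \<open>Markov's inequality for \<open>b ^ deg\<close>, with \<open>expo\<close> moved back to
  time \<open>m0\<close>, where the degree is at most \<open>m0\<close>. No Poisson comparison is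
  involved, so the bound holds for the oldest labels too.\<close>

lemma deg_tail_old:
  assumes m0: "settle \<le> m0" "1 \<le> m0" and t: "m0 \<le> t" and i: "1 \<le> i" and b: "1 \<le> b"
  shows "prob {\<omega> \<in> Good m0. k \<le> deg t i \<omega>} \<le> b ^ m0 * exp ((b - 1) * lam * (ln (real t) + rem m0)) / b ^ k"
proof -
  define K where "K = b ^ m0 * exp ((b - 1) * lam * (ln (real t) + rem m0))"
  have dm [measurable]: "deg t i \<in> measurable M (count_space UNIV)"
    by (rule measurable_from_subalg[OF subalgebra_history deg_history])
  have ev: "{\<omega> \<in> Good m0. k \<le> deg t i \<omega>} \<in> events"
  proof -
    have "{\<omega> \<in> space M. k \<le> deg t i \<omega>} \<in> events" by measurable
    moreover have "{\<omega> \<in> Good m0. k \<le> deg t i \<omega>} = Good m0 \<inter> {\<omega> \<in> space M. k \<le> deg t i \<omega>}" by (auto simp: Good_def)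
    ultimately show ?thesis by simp
  qed
  have ie: "integrable M (G.expo m0 b t t {i})" "integrable M (G.expo m0 b t m0 {i})"
    using i b t by (auto intro!: G.expo_integrable)
  have "prob {\<omega> \<in> Good m0. k \<le> deg t i \<omega>} = expectation (indicator {\<omega> \<in> Good m0. k \<le> deg t i \<omega>})"
    using ev by simp
  also have "\<dots> \<le> expectation (\<lambda>\<omega>. G.expo m0 b t t {i} \<omega> / b ^ k)"
  proof (rule integral_mono)
    show "integrable M (indicator {\<omega> \<in> Good m0. k \<le> deg t i \<omega>} :: 'a \<Rightarrow> real)" using ev by (simp add: emeasure_eq_measure)
    show "integrable M (\<lambda>\<omega>. G.expo m0 b t t {i} \<omega> / b ^ k)" using ie by simp
    show "indicator {\<omega> \<in> Good m0. k \<le> deg t i \<omega>} \<omega> \<le> G.expo m0 b t t {i} \<omega> / b ^ k" for \<omega>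
    proof (cases "\<omega> \<in> Good m0 \<and> k \<le> deg t i \<omega>")
      case True
      have "b ^ k \<le> b ^ deg t i \<omega>" using True b by (intro power_increasing) auto
      thus ?thesis using True b by (simp add: G.expo_def future_mean_def)
    next
      case False
      have "0 \<le> G.expo m0 b t t {i} \<omega>" using G.expo_bounds(1)[of "{i}" b t t m0 \<omega>] i b by auto
      thus ?thesis using False b by simp
    qed
  qed
  also have "\<dots> = expectation (G.expo m0 b t t {i}) / b ^ k" by simp
  also have "expectation (G.expo m0 b t t {i}) \<le> expectation (G.expo m0 b t m0 {i})"
    using i b t m0 by (intro G.expo_antimono) auto
  also have "\<dots> \<le> expectation (\<lambda>_. K)"
  proof (rule integral_mono[OF ie(2)])
    fix \<omega>
    show "G.expo m0 b t m0 {i} \<omega> \<le> K"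
    proof (cases "\<omega> \<in> Good m0")
      case True
      have "b ^ deg m0 i \<omega> \<le> b ^ m0" using deg_le[of m0 i \<omega>] b by (intro power_increasing) auto
      moreover have "(b - 1) * future_mean t m0 i \<omega> \<le> (b - 1) * (lam * (ln (real t) + rem m0))"
        using future_mean_old[OF True m0 t i] b by (intro mult_left_mono) auto
      hence "exp ((b - 1) * future_mean t m0 i \<omega>) \<le> exp ((b - 1) * lam * (ln (real t) + rem m0))"
        by (simp only: exp_le_cancel_iff mult.assoc)
      ultimately have "b ^ deg m0 i \<omega> * exp ((b - 1) * future_mean t m0 i \<omega>) \<le> K"
        unfolding K_def using b by (intro mult_mono) auto
      thus ?thesis using True by (simp add: G.expo_def)
    qed (use b in \<open>simp add: G.expo_def K_def\<close>)
  qed simp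
  finally show ?thesis using b prob_space by (simp add: K_def divide_right_mono)
qed

lemma old_vertices_low:
  assumes eta: "0 < \<eta>" "\<eta> + 1/2 < log \<theta> ((1 + \<theta>) / 2)" and m0: "settle \<le> m0" "1 \<le> m0"
  shows "(\<lambda>j. prob {\<omega> \<in> Good m0. \<exists>i\<in>{1..<cutoff \<eta> j}. level m j \<le> deg (n j) i \<omega>}) \<longlonglongrightarrow> 0"
proof -
  \<comment> \<open>This base makes \<open>(b - 1) * lam\<close> equal to 1/2, so that the expected
    exponential growth is of order \<open>sqrt (n j)\<close>.\<close>
  define b where "b = (1 + \<theta>) / 2"
  have b: "1 < b" using theta by (simp add: b_def)
  have bl: "(b - 1) * lam = 1 / 2" using theta by (simp add: b_def lam_eq field_simps)
  define K where "K = 2 * b ^ m0 * exp (rem m0 / 2)"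
  define f where "f j = \<eta> * lg j + lg j / 2 - real (level m j) * log \<theta> b" for j
  have dm [measurable]: "deg t i \<in> measurable M (count_space UNIV)" for t i
    by (rule measurable_from_subalg[OF subalgebra_history deg_history])
  have "(\<lambda>j. \<eta> + 1/2 - real (level m j) / lg j * log \<theta> b) \<longlonglongrightarrow> \<eta> + 1/2 - 1 * log \<theta> b"
    by (intro tendsto_intros level_over_lg)
  moreover have "eventually (\<lambda>j. \<eta> + 1/2 - real (level m j) / lg j * log \<theta> b = f j / lg j) sequentially"
    using lg_pos by eventually_elim (simp add: f_def diff_divide_distrib add_divide_distrib)
  ultimately have "(\<lambda>j. f j / lg j) \<longlonglongrightarrow> \<eta> + 1/2 - 1 * log \<theta> b" by (rule Lim_transform_eventually)
  hence "(\<lambda>j. \<theta> powr f j) \<longlonglongrightarrow> 0" by (rule theta_powr_lim_0) (use eta in \<open>simp add: b_def\<close>)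
  hence lim: "(\<lambda>j. K * \<theta> powr f j) \<longlonglongrightarrow> 0" by (rule tendsto_mult_right_zero)
  have "eventually (\<lambda>j. prob {\<omega> \<in> Good m0. \<exists>i\<in>{1..<cutoff \<eta> j}. level m j \<le> deg (n j) i \<omega>} \<le> K * \<theta> powr f j) sequentially"
  proof -
    have "eventually (\<lambda>j. max 1 m0 \<le> n j) sequentially"
      using eventually_ge_at_top n_lim by (rule eventually_compose_filterlim)
    thus ?thesis using cutoff_bounds(2)[OF eta(1)] lg_pos
    proof eventually_elim
      case (elim j)
      let ?k = "level m j" and ?t = "n j"
      have ev: "{\<omega> \<in> Good m0. ?k \<le> deg ?t i \<omega>} \<in> events" for i
      proof -
        have "{\<omega> \<in> space M. ?k \<le> deg ?t i \<omega>} \<in> events" by measurable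
        moreover have "{\<omega> \<in> Good m0. ?k \<le> deg ?t i \<omega>} = Good m0 \<inter> {\<omega> \<in> space M. ?k \<le> deg ?t i \<omega>}" by (auto simp: Good_def)
        ultimately show ?thesis by simp
      qed
      have "{\<omega> \<in> Good m0. \<exists>i\<in>{1..<cutoff \<eta> j}. ?k \<le> deg ?t i \<omega>} = (\<Union>i\<in>{1..<cutoff \<eta> j}. {\<omega> \<in> Good m0. ?k \<le> deg ?t i \<omega>})" by auto
      hence "prob {\<omega> \<in> Good m0. \<exists>i\<in>{1..<cutoff \<eta> j}. ?k \<le> deg ?t i \<omega>} \<le> (\<Sum>i\<in>{1..<cutoff \<eta> j}. prob {\<omega> \<in> Good m0. ?k \<le> deg ?t i \<omega>})"
        using ev by (simp only:) (intro finite_measure_subadditive_finite, auto)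
      also have "\<dots> \<le> (\<Sum>i\<in>{1..<cutoff \<eta> j}. b ^ m0 * exp ((b - 1) * lam * (ln (real ?t) + rem m0)) / b ^ ?k)"
        using b elim by (intro sum_mono deg_tail_old[OF m0]) auto
      also have "\<dots> = real (cutoff \<eta> j - 1) * (b ^ m0 * exp ((b - 1) * lam * (ln (real ?t) + rem m0)) / b ^ ?k)" by simp
      also have "\<dots> \<le> (2 * \<theta> powr (\<eta> * lg j)) * (b ^ m0 * exp ((b - 1) * lam * (ln (real ?t) + rem m0)) / b ^ ?k)"
        using elim b by (intro mult_right_mono) auto
      also have "\<dots> = K * (\<theta> powr (\<eta> * lg j) * exp (ln (real ?t) / 2) / b ^ ?k)"
        unfolding bl K_def by (simp add: add_divide_distrib exp_add mult_ac)
      also have "exp (ln (real ?t) / 2) = \<theta> powr (lg j / 2)"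
        using theta by (simp add: powr_def lg_ln)
      also have "b ^ ?k = \<theta> powr (real ?k * log \<theta> b)"
      proof -
        have "\<theta> powr (real ?k * log \<theta> b) = (\<theta> powr log \<theta> b) powr real ?k" by (simp add: powr_powr mult.commute)
        thus ?thesis using theta b by (simp add: powr_realpow)
      qed
      also have "\<theta> powr (\<eta> * lg j) * \<theta> powr (lg j / 2) / \<theta> powr (real ?k * log \<theta> b) = \<theta> powr f j"
        unfolding f_def by (simp only: powr_add[symmetric] powr_diff[symmetric])
      finally show ?case .
    qed
  qed
  thus ?thesis by (intro tendsto_sandwich[OF _ _ tendsto_const lim]) auto
qed

lemma replacement_error:
  assumes eta: "0 < \<eta>" "\<eta> < 1" and m0: "settle \<le> m0" "1 \<le> m0"
    and th: "\<And>j i. thinning (L j i) (q j i) (level m j)"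
  shows "(\<lambda>j. expectation (G.hybrid m0 (L j) (q j) (cutoff \<eta> j) (n j) (n j))
            - expectation (G.hybrid m0 (L j) (q j) (cutoff \<eta> j) (n j) (cutoff \<eta> j))) \<longlonglongrightarrow> 0"
proof -
  \<comment> \<open>A base slightly below \<open>\<theta>\<close> gives \<rho> = (b - 1) * lam < 1,
    so the sum of (n / i) powr \<rho> is of order n, while \<open>b ^ level\<close> is n to the
    power 1 - \<eta>/4 up to lower-order factors. Hence \<open>A\<close> has exponent about
    \<eta>/4, and \<open>A\<^sup>2\<close> divided by the cutoff has exponent about \<eta>/2 -
    \<eta> < 0.\<close>
  define b where "b = \<theta> powr (1 - \<eta> / 4)"
  have b: "1 < b" "b < \<theta>"
  proof -
    show "1 < b" unfolding b_def using theta eta by (intro gr_one_powr) auto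
    have "\<theta> powr (1 - \<eta> / 4) < \<theta> powr 1" using theta eta by (intro powr_less_mono) auto
    thus "b < \<theta>" using theta by (simp add: b_def)
  qed
  define \<rho> where "\<rho> = (b - 1) * lam"
  have rho: "0 < \<rho>" "\<rho> < 1"
  proof -
    show "0 < \<rho>" using b lam_pos by (simp add: \<rho>_def)
    have "(b - 1) * lam < (\<theta> - 1) * lam" using b lam_pos by (intro mult_strict_right_mono) auto
    thus "\<rho> < 1" using theta by (simp add: \<rho>_def lam_eq)
  qed
  define K where "K = exp \<rho> / (1 - \<rho>)"
  have K: "0 \<le> K" using rho by (simp add: K_def)
  define f where "f j = lg j - (1 - \<eta> / 4) * real (level m j)" for j
  define R where "R j = 8 * lam\<^sup>2 * b\<^sup>2 * (K * \<theta> powr (f j - \<eta> * lg j) + K\<^sup>2 * \<theta> powr (2 * f j - \<eta> * lg j))" for j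
  have "(\<lambda>j. 1 - (1 - \<eta> / 4) * (real (level m j) / lg j)) \<longlonglongrightarrow> 1 - (1 - \<eta> / 4) * 1"
    by (intro tendsto_intros level_over_lg)
  moreover have "eventually (\<lambda>j. 1 - (1 - \<eta> / 4) * (real (level m j) / lg j) = f j / lg j) sequentially"
    using lg_pos by eventually_elim (simp add: f_def diff_divide_distrib)
  ultimately have fl: "(\<lambda>j. f j / lg j) \<longlonglongrightarrow> \<eta> / 4" using Lim_transform_eventually by fastforce
  have "(\<lambda>j. \<theta> powr (c * f j - \<eta> * lg j)) \<longlonglongrightarrow> 0" if c: "c * (\<eta> / 4) - \<eta> < 0" for c
  proof (rule theta_powr_lim_0[OF _ c])
    have "(\<lambda>j. c * (f j / lg j) - \<eta>) \<longlonglongrightarrow> c * (\<eta> / 4) - \<eta>" by (intro tendsto_intros fl)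
    moreover have "eventually (\<lambda>j. c * (f j / lg j) - \<eta> = (c * f j - \<eta> * lg j) / lg j) sequentially"
      using lg_pos by eventually_elim (simp add: diff_divide_distrib)
    ultimately show "(\<lambda>j. (c * f j - \<eta> * lg j) / lg j) \<longlonglongrightarrow> c * (\<eta> / 4) - \<eta>" by (rule Lim_transform_eventually)
  qed
  from this[of 1] this[of 2] eta have "(\<lambda>j. \<theta> powr (f j - \<eta> * lg j)) \<longlonglongrightarrow> 0" "(\<lambda>j. \<theta> powr (2 * f j - \<eta> * lg j)) \<longlonglongrightarrow> 0" by simp_all
  hence "R \<longlonglongrightarrow> 8 * lam\<^sup>2 * b\<^sup>2 * (K * 0 + K\<^sup>2 * 0)" unfolding R_def[abs_def] by (intro tendsto_intros)
  hence R0: "R \<longlonglongrightarrow> 0" by simp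
  have reml: "eventually (\<lambda>j. rem (cutoff \<eta> j) \<le> 1) sequentially"
  proof -
    have "(\<lambda>j. rem (cutoff \<eta> j)) \<longlonglongrightarrow> 0" by (rule filterlim_compose[OF rem_lim cutoff_lim[OF eta(1)]])
    from order_tendstoD(2)[OF this, of 1] show ?thesis by (auto elim: eventually_mono)
  qed
  have "eventually (\<lambda>j. max 1 m0 \<le> cutoff \<eta> j) sequentially"
    using eventually_ge_at_top cutoff_lim[OF eta(1)] by (rule eventually_compose_filterlim)
  hence "eventually (\<lambda>j. norm (expectation (G.hybrid m0 (L j) (q j) (cutoff \<eta> j) (n j) (n j))
            - expectation (G.hybrid m0 (L j) (q j) (cutoff \<eta> j) (n j) (cutoff \<eta> j))) \<le> R j) sequentially"
    using cutoff_le[OF eta] reml lg_pos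
  proof eventually_elim
    case (elim j)
    let ?N = "cutoff \<eta> j" and ?t = "n j" and ?k = "level m j"
    define B where "B i = exp (\<rho> * (ln (real ?t / real i) + rem ?N))" for i
    define A where "A = (\<Sum>i\<in>{?N..?t}. B i) / b ^ ?k"
    have Bf: "exp ((b - 1) * future_mean ?t ?N i \<omega>) \<le> B i" if w: "\<omega> \<in> Good m0" and i: "i \<in> {?N..?t}" for \<omega> i
    proof -
      have "future_mean ?t ?N i \<omega> \<le> W i \<omega> * lam * (ln (real ?t / real i) + rem ?N)"
        using elim i by (intro future_mean_sandwich(2)[OF w m0]) auto
      also have "\<dots> \<le> 1 * lam * (ln (real ?t / real i) + rem ?N)"
      proof (intro mult_right_mono)
        show "W i \<omega> \<le> 1" using GoodD(2)[OF w, of i] i elim by simp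
        have "0 \<le> ln (real ?t / real i)" using i elim by simp
        thus "0 \<le> ln (real ?t / real i) + rem ?N" using rem_nonneg[of ?N] by linarith
      qed (use lam_pos in auto)
      finally have "(b - 1) * future_mean ?t ?N i \<omega> \<le> (b - 1) * (lam * (ln (real ?t / real i) + rem ?N))"
        using b by (intro mult_left_mono) auto
      thus ?thesis by (simp add: B_def \<rho>_def mult.assoc)
    qed
    have err: "\<bar>expectation (G.hybrid m0 (L j) (q j) ?N ?t ?t) - expectation (G.hybrid m0 (L j) (q j) ?N ?t ?N)\<bar>
       \<le> (\<Sum>l\<in>{?N..<?t}. (2 * lam / real l)\<^sup>2) * (b\<^sup>2 * (A + A\<^sup>2))"
      unfolding A_def
    proof (rule G.poisson_replacement)
      show "thinning (L j i) (q j i) ?k" for i by (rule th)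
      show "attach_prob l i \<omega> \<le> 2 * lam / real l" if "\<omega> \<in> Good m0" "?N \<le> l" "i \<in> {?N..?t}" for \<omega> i l
        using that elim by (intro attach_prob_Good(1)[OF _ m0]) auto
      show "0 \<le> B i" for i by (simp add: B_def)
    qed (use elim b Bf in auto)
    have "(\<Sum>i\<in>{?N..?t}. B i) \<le> exp \<rho> * (real ?t powr \<rho> * (\<Sum>i=1..?t. real i powr (- \<rho>)))"
    proof -
      have "(\<Sum>i\<in>{?N..?t}. B i) \<le> (\<Sum>i\<in>{?N..?t}. exp \<rho> * (real ?t powr \<rho> * real i powr (- \<rho>)))"
      proof (rule sum_mono)
        fix i assume i: "i \<in> {?N..?t}"
        have "B i \<le> exp (\<rho> * ln (real ?t / real i) + \<rho>)"
          unfolding B_def using elim rho by (simp add: distrib_left)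
        also have "\<dots> = exp \<rho> * (real ?t powr \<rho> * real i powr (- \<rho>))"
          using i elim by (simp add: ln_div right_diff_distrib exp_add exp_diff powr_def exp_minus field_simps)
        finally show "B i \<le> exp \<rho> * (real ?t powr \<rho> * real i powr (- \<rho>))" .
      qed
      also have "\<dots> \<le> (\<Sum>i\<in>{1..?t}. exp \<rho> * (real ?t powr \<rho> * real i powr (- \<rho>)))"
        using elim by (intro sum_mono2) auto
      finally show ?thesis by (simp add: sum_distrib_left)
    qed
    also have "\<dots> \<le> exp \<rho> * (real ?t powr \<rho> * (real ?t powr (1 - \<rho>) / (1 - \<rho>)))"
      by (intro mult_left_mono sum_powr_le rho) auto
    also have "\<dots> = K * real ?t"
    proof -
      have "real ?t powr \<rho> * real ?t powr (1 - \<rho>) = real ?t" using elim by (simp flip: powr_add)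
      thus ?thesis unfolding K_def by simp
    qed
    also have "real ?t = \<theta> powr lg j" using elim by (intro theta_powr_lg[symmetric]) auto
    finally have "A \<le> K * \<theta> powr lg j / b ^ ?k"
      unfolding A_def using b by (intro divide_right_mono) auto
    also have "b ^ ?k = \<theta> powr ((1 - \<eta> / 4) * real ?k)"
      unfolding b_def using theta by (simp add: powr_realpow[symmetric] powr_powr)
    also have "K * \<theta> powr lg j / \<theta> powr ((1 - \<eta> / 4) * real ?k) = K * \<theta> powr f j"
      unfolding f_def by (simp add: powr_diff)
    finally have A: "A \<le> K * \<theta> powr f j" .
    have A0: "0 \<le> A" unfolding A_def B_def using b by (intro divide_nonneg_nonneg sum_nonneg) auto
    have "(\<Sum>l\<in>{?N..<?t}. (2 * lam / real l)\<^sup>2) = 4 * lam\<^sup>2 * (\<Sum>l\<in>{?N..<?t}. 1 / (real l)\<^sup>2)"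
      by (simp add: sum_distrib_left power_divide power_mult_distrib)
    also have "\<dots> \<le> 4 * lam\<^sup>2 * (2 / real ?N)"
      using elim by (intro mult_left_mono sum_inverse_squares) auto
    also have "\<dots> \<le> 4 * lam\<^sup>2 * (2 / \<theta> powr (\<eta> * lg j))"
      using cutoff_bounds(1)[OF eta(1), of j] theta elim by (intro mult_left_mono divide_left_mono) auto
    finally have sq: "(\<Sum>l\<in>{?N..<?t}. (2 * lam / real l)\<^sup>2) \<le> 4 * lam\<^sup>2 * (2 / \<theta> powr (\<eta> * lg j))" .
    have "A + A\<^sup>2 \<le> K * \<theta> powr f j + (K * \<theta> powr f j)\<^sup>2"
      using A A0 by (intro add_mono power_mono) auto
    hence bq: "b\<^sup>2 * (A + A\<^sup>2) \<le> b\<^sup>2 * (K * \<theta> powr f j + (K * \<theta> powr f j)\<^sup>2)" by (rule mult_left_mono) simp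
    have "(\<Sum>l\<in>{?N..<?t}. (2 * lam / real l)\<^sup>2) * (b\<^sup>2 * (A + A\<^sup>2)) \<le>
        4 * lam\<^sup>2 * (2 / \<theta> powr (\<eta> * lg j)) * (b\<^sup>2 * (K * \<theta> powr f j + (K * \<theta> powr f j)\<^sup>2))"
      by (rule mult_mono[OF sq bq]) (use A0 in auto)
    also have "\<dots> = R j"
    proof -
      have "\<theta> powr (2 * f j) = (\<theta> powr f j)\<^sup>2"
        unfolding power2_eq_square by (simp only: powr_add[symmetric] mult_2)
      hence e1: "\<theta> powr (2 * f j - \<eta> * lg j) = (\<theta> powr f j)\<^sup>2 / \<theta> powr (\<eta> * lg j)"
        by (simp only: powr_diff)
      have e2: "4 * x * (2 / E) * (y * (K * P + (K * P)\<^sup>2)) = 8 * x * y * (K * (P / E) + K\<^sup>2 * (P\<^sup>2 / E))" for x y E P :: real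
        by (simp add: power_mult_distrib add_divide_distrib algebra_simps)
      show ?thesis unfolding R_def e1 powr_diff[of _ "f j"] by (rule e2)
    qed
    finally show ?case using err by simp
  qed
  thus ?thesis by (rule Lim_null_comparison[OF _ R0])
qed

end

section \<open>Cells, level products, and the limiting rate\<close>

text \<open>The set of grid points below \<open>z\<close> serves as a name for the interval of the
  partition that contains \<open>z\<close>; the intervals are open on the left and closed on the
  right, and the names range over subsets of \<open>X\<close>.\<close>

definition cell :: "real set \<Rightarrow> real \<Rightarrow> real set" where "cell X z = {x \<in> X. x < z}"

lemma cell_in_Pow: "cell X z \<in> Pow X" by (auto simp: cell_def)

text \<open>\<open>step_mass s r\<close> is the size of the jump at \<open>r\<close> of the decreasing product \<open>s 0 * s 1 * \<dots>\<close>.\<close>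

definition step_mass :: "(nat \<Rightarrow> real) \<Rightarrow> nat \<Rightarrow> real" where
  "step_mass s r = (\<Prod>t<r. s t) * (1 - s r)"

lemma sum_step_mass: "(\<Sum>r<R. step_mass s r) = 1 - (\<Prod>t<R. s t)"
  by (induction R) (auto simp: step_mass_def algebra_simps)

lemma step_mass_nonneg:
  assumes "\<And>r. 0 \<le> s r \<and> s r \<le> 1" shows "0 \<le> step_mass s r"
  unfolding step_mass_def using assms by (intro mult_nonneg_nonneg prod_nonneg) auto

text \<open>The masses of the levels reached telescope, leaving the product of their factors
  \<open>s r\<close>. So without remaining growth the hybrid is the generating functional
  itself.\<close>

lemma thin_zero:
  "thin {k..<k+R} (\<lambda>l. step_mass s (l - k)) c 0 = (\<Prod>r<R. if k + r \<le> c then s r else 1)"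
proof -
  have "thin {k..<k+R} (\<lambda>l. step_mass s (l - k)) c 0 = 1 - (\<Sum>l\<in>{k..<k+R}. step_mass s (l - k) * (if l \<le> c then 1 else 0))"
    unfolding thin_def by (intro arg_cong2[where f = "(-)"] refl sum.cong arg_cong2[where f = "(*)"]) (auto simp: ptail_at_0)
  also have "(\<Sum>l\<in>{k..<k+R}. step_mass s (l - k) * (if l \<le> c then 1 else 0)) = (\<Sum>r<R. step_mass s r * (if k + r \<le> c then 1 else 0))"
    by (rule sum.reindex_bij_witness[of _ "\<lambda>r. r + k" "\<lambda>l. l - k"]) auto
  also have "1 - (\<Sum>r<R. step_mass s r * (if k + r \<le> c then 1 else 0)) = (\<Prod>r<R. if k + r \<le> c then s r else 1)"
  proof (induction R)
    case (Suc R)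
    show ?case
    proof (cases "k + R \<le> c")
      case True
      have "(\<Sum>r<R. step_mass s r * (if k + r \<le> c then 1 else 0)) = (\<Sum>r<R. step_mass s r)"
        using True by (intro sum.cong) auto
      moreover have "(\<Prod>r<R. if k + r \<le> c then s r else 1) = (\<Prod>r<R. s r)"
        using True by (intro prod.cong) auto
      ultimately show ?thesis using True by (simp add: sum_step_mass) (simp add: step_mass_def algebra_simps)
    qed (use Suc in simp)
  qed simp
  finally show ?thesis .
qed

lemma thinning_step_mass:
  assumes "\<And>r. 0 \<le> s r \<and> s r \<le> 1"
  shows "thinning {k..<k+R} (\<lambda>l. step_mass s (l - k)) k"
proof
  have "(\<Sum>l\<in>{k..<k+R}. step_mass s (l - k)) = (\<Sum>r<R. step_mass s r)"
    by (rule sum.reindex_bij_witness[of _ "\<lambda>r. r + k" "\<lambda>l. l - k"]) auto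
  also have "\<dots> \<le> 1" unfolding sum_step_mass using assms by (simp add: prod_nonneg)
  finally show "(\<Sum>l\<in>{k..<k+R}. step_mass s (l - k)) \<le> 1" .
qed (use step_mass_nonneg[OF assms] in auto)

lemma prod_one_minus_exp:
  fixes e :: "nat \<Rightarrow> real"
  assumes "finite A" "\<And>i. i \<in> A \<Longrightarrow> 0 \<le> e i \<and> e i \<le> \<delta>" "\<delta> \<le> 1"
  shows "\<bar>(\<Prod>i\<in>A. 1 - e i) - exp (- (\<Sum>i\<in>A. e i))\<bar> \<le> \<delta> * (\<Sum>i\<in>A. e i)"
proof -
  have "norm ((\<Prod>i\<in>A. 1 - e i) - (\<Prod>i\<in>A. exp (- e i))) \<le> (\<Sum>i\<in>A. norm ((1 - e i) - exp (- e i)))"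
  proof (rule norm_prod_diff)
    fix i assume i: "i \<in> A"
    show "norm (1 - e i) \<le> 1" "norm (exp (- e i)) \<le> 1" using assms(2)[OF i] assms(3) by auto
  qed
  also have "\<dots> \<le> (\<Sum>i\<in>A. \<delta> * e i)"
  proof (rule sum_mono)
    fix i assume i: "i \<in> A"
    have e: "0 \<le> e i" "e i \<le> \<delta>" using assms(2)[OF i] by auto
    have 1: "1 - e i \<le> exp (- e i)" using exp_ge_add_one_self[of "- e i"] by simp
    have "1 + e i \<le> exp (e i)" by (rule exp_ge_add_one_self)
    hence "exp (- e i) \<le> 1 / (1 + e i)" using e by (simp add: exp_minus field_simps)
    also have "\<dots> \<le> 1 - e i + e i * e i" using e by (simp add: field_simps)
    also have "e i * e i \<le> \<delta> * e i" using e by (intro mult_right_mono) auto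
    finally show "norm ((1 - e i) - exp (- e i)) \<le> \<delta> * e i" using 1 by simp
  qed
  also have "(\<Prod>i\<in>A. exp (- e i)) = exp (- (\<Sum>i\<in>A. e i))"
    unfolding sum_negf[symmetric] by (rule exp_sum[OF assms(1), symmetric])
  finally show ?thesis by (simp add: sum_distrib_left)
qed

context beta_tree_setting
begin

lemma cell_interval:
  assumes "finite X" "b \<subseteq> X"
  obtains lo hi :: ereal where "\<And>z. cell X z = b \<longleftrightarrow> lo < ereal z \<and> ereal z \<le> hi"
proof -
  define lo where "lo = (if b = {} then - \<infinity> else ereal (Max b))"
  define hi where "hi = (if X - b = {} then \<infinity> else ereal (Min (X - b)))"
  have fb: "finite b" "finite (X - b)" using assms finite_subset by auto
  have c1: "cell X z = b \<longleftrightarrow> (\<forall>x\<in>b. x < z) \<and> (\<forall>x\<in>X - b. z \<le> x)" for z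
  proof
    assume *: "cell X z = b"
    show "(\<forall>x\<in>b. x < z) \<and> (\<forall>x\<in>X - b. z \<le> x)" unfolding *[symmetric] cell_def by auto
  next
    assume *: "(\<forall>x\<in>b. x < z) \<and> (\<forall>x\<in>X - b. z \<le> x)"
    show "cell X z = b"
    proof (intro equalityI subsetI)
      fix x assume "x \<in> cell X z"
      hence "x \<in> X" "x < z" by (auto simp: cell_def)
      thus "x \<in> b" using * by force
    next
      fix x assume "x \<in> b"
      thus "x \<in> cell X z" using * assms(2) by (auto simp: cell_def)
    qed
  qed
  have c2: "(\<forall>x\<in>b. x < z) \<longleftrightarrow> lo < ereal z" for z using fb by (auto simp: lo_def)
  have c3: "(\<forall>x\<in>X - b. z \<le> x) \<longleftrightarrow> ereal z \<le> hi" for z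
  proof (cases "X - b = {}")
    case True
    show ?thesis unfolding hi_def True by simp
  next
    case False
    show ?thesis unfolding hi_def if_not_P[OF False] ereal_less_eq Min_ge_iff[OF fb(2) False] ..
  qed
  show ?thesis by (rule that[of lo hi]) (simp only: c1 c2 c3)
qed

lemma cell_measurable: "finite X \<Longrightarrow> {z. cell X z = b} \<in> sets borel"
proof (cases "b \<subseteq> X")
  case True
  assume "finite X"
  from cell_interval[OF this True] obtain lo hi where *: "\<And>z. cell X z = b \<longleftrightarrow> lo < ereal z \<and> ereal z \<le> hi" by blast
  have "{z. lo < ereal z \<and> ereal z \<le> hi} \<in> sets borel" by measurable
  thus ?thesis by (simp add: *)
next
  case False
  hence "{z. cell X z = b} = {}" by (auto simp: cell_def)
  thus ?thesis by simp
qed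

definition cell_prob :: "real set \<Rightarrow> real set \<Rightarrow> real" where
  "cell_prob X b = measure std_normal_distribution {z. cell X z = b}"

text \<open>The factor \<open>clim * \<theta> powr (\<epsilon> - (lo + int r))\<close> is the
  limiting mean number of vertices at or above relative level \<open>lo + int r\<close>; it is split
  among the cells by the normal law and weighted by the jump of the level product there.\<close>

definition limit_rate :: "real set \<Rightarrow> int \<Rightarrow> nat \<Rightarrow> (nat \<Rightarrow> real set \<Rightarrow> real) \<Rightarrow> real" where
  "limit_rate X lo R s = (\<Sum>b\<in>Pow X. cell_prob X b * (\<Sum>r<R. step_mass (\<lambda>t. s t b) r * (clim * \<theta> powr (\<epsilon> - (lo + int r)))))"

definition mean_loss :: "real set \<Rightarrow> int \<Rightarrow> nat \<Rightarrow> (nat \<Rightarrow> real set \<Rightarrow> real) \<Rightarrow> nat \<Rightarrow> real \<Rightarrow> nat \<Rightarrow> real" where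
  "mean_loss X lo R s j x i = (\<Sum>r<R. step_mass (\<lambda>t. s t (cell X (label_z j i))) r * ptail_shift j x (level lo j + r) i)"

lemma level_add: "eventually (\<lambda>j. \<forall>r. level lo j + r = level (lo + int r) j) sequentially"
  using floor_a_lim[of "- lo"] by eventually_elim (auto simp: level_def nat_add_distrib)

lemma mean_loss_sum_lim:
  assumes X: "finite X"
    and N: "eventually (\<lambda>j. 2 \<le> N j \<and> N j \<le> n j) sequentially"
    and kappa: "\<kappa> > log_spread" "eventually (\<lambda>j. ln (real (n j) / real (N j)) \<ge> \<kappa> * lg j - C) sequentially"
    and r: "\<And>j. 0 \<le> x j" "x \<longlonglongrightarrow> 0" and sg: "y = x \<or> y = (\<lambda>j. - x j)"
  shows "(\<lambda>j. \<Sum>i\<in>{N j..n j}. mean_loss X lo R s j (y j) i) \<longlonglongrightarrow> limit_rate X lo R s"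
proof -
  let ?D = "\<lambda>b r j. \<Sum>i\<in>{i\<in>{N j..n j}. cell X (label_z j i) = b}. ptail_shift j (y j) (level (lo + int r) j) i"
  have celllim: "(\<lambda>j. ?D b r j) \<longlonglongrightarrow> clim * \<theta> powr (\<epsilon> - (lo + int r)) * cell_prob X b" if b: "b \<in> Pow X" for b r
  proof -
    obtain l h where lh: "\<And>z. cell X z = b \<longleftrightarrow> l < ereal z \<and> ereal z \<le> h" using cell_interval[OF X, of b] b by auto
    show ?thesis unfolding cell_prob_def lh using cell_intensity[OF N kappa r sg, where m = "lo + int r" and lo = l and hi = h] by simp
  qed
  have "(\<lambda>j. \<Sum>b\<in>Pow X. \<Sum>r<R. step_mass (\<lambda>t. s t b) r * ?D b r j) \<longlonglongrightarrow>
     (\<Sum>b\<in>Pow X. \<Sum>r<R. step_mass (\<lambda>t. s t b) r * (clim * \<theta> powr (\<epsilon> - (lo + int r)) * cell_prob X b))"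
    by (intro tendsto_sum tendsto_mult tendsto_const celllim)
  also have "(\<Sum>b\<in>Pow X. \<Sum>r<R. step_mass (\<lambda>t. s t b) r * (clim * \<theta> powr (\<epsilon> - (lo + int r)) * cell_prob X b)) = limit_rate X lo R s"
    unfolding limit_rate_def sum_distrib_left by (intro sum.cong refl) (simp add: mult_ac)
  finally have main: "(\<lambda>j. \<Sum>b\<in>Pow X. \<Sum>r<R. step_mass (\<lambda>t. s t b) r * ?D b r j) \<longlonglongrightarrow> limit_rate X lo R s" .
  have "eventually (\<lambda>j. (\<Sum>b\<in>Pow X. \<Sum>r<R. step_mass (\<lambda>t. s t b) r * ?D b r j) = (\<Sum>i\<in>{N j..n j}. mean_loss X lo R s j (y j) i)) sequentially"
    using level_add[of lo]
  proof eventually_elim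
    case (elim j)
    have "(\<Sum>i\<in>{N j..n j}. mean_loss X lo R s j (y j) i) =
       (\<Sum>b\<in>Pow X. \<Sum>i\<in>{i\<in>{N j..n j}. cell X (label_z j i) = b}. mean_loss X lo R s j (y j) i)"
      using X cell_in_Pow by (intro sum.group[symmetric]) auto
    also have "\<dots> = (\<Sum>b\<in>Pow X. \<Sum>i\<in>{i\<in>{N j..n j}. cell X (label_z j i) = b}. \<Sum>r<R. step_mass (\<lambda>t. s t b) r * ptail_shift j (y j) (level (lo + int r) j) i)"
      unfolding mean_loss_def using elim by (intro sum.cong refl) auto
    also have "\<dots> = (\<Sum>b\<in>Pow X. \<Sum>r<R. step_mass (\<lambda>t. s t b) r * ?D b r j)"
      unfolding sum_distrib_left by (intro sum.cong refl sum.swap)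
    finally show ?case by simp
  qed
  from Lim_transform_eventually[OF main this] show ?thesis .
qed

lemma ptail_mean_antimono_level: "0 \<le> t \<Longrightarrow> k \<le> l \<Longrightarrow> ptail_mean l t \<le> ptail_mean k t"
  unfolding ptail_mean_def
proof (rule integral_mono_AE)
  assume *: "0 \<le> t" "k \<le> l"
  show "AE w in beta_distribution \<alpha> \<beta>. ptail l (w * lam * t) \<le> ptail k (w * lam * t)"
    using AE_beta by eventually_elim (use * lam_pos in \<open>auto intro!: ptail_antimono\<close>)
qed (auto intro: integrable_ptail)

lemma ptail_shift_nonneg: "0 \<le> ptail_shift j x k i"
  by (simp add: ptail_shift_def ptail_mean_nonneg)

lemma mean_loss_bounds:
  assumes s: "\<And>r b. 0 \<le> s r b \<and> s r b \<le> 1" and N: "1 \<le> N" and i: "N \<le> i" "i \<le> n j" and x: "0 \<le> x" "y \<le> x"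
  shows "0 \<le> mean_loss X lo R s j y i" "mean_loss X lo R s j y i \<le> ptail_shift j x (level lo j) N"
proof -
  let ?q = "\<lambda>r. step_mass (\<lambda>t. s t (cell X (label_z j i))) r"
  have q: "0 \<le> ?q r" for r using s by (intro step_mass_nonneg) auto
  show "0 \<le> mean_loss X lo R s j y i"
    unfolding mean_loss_def using q ptail_shift_nonneg by (intro sum_nonneg mult_nonneg_nonneg) auto
  have "real (n j) / real i \<le> real (n j) / real N" using N i by (intro divide_left_mono) auto
  hence "ln (real (n j) / real i) \<le> ln (real (n j) / real N)" using N i by simp
  hence le: "max 0 (ln (real (n j) / real i) + y) \<le> max 0 (ln (real (n j) / real N) + x)" using x by auto
  have "mean_loss X lo R s j y i \<le> (\<Sum>r<R. ?q r * ptail_shift j x (level lo j) N)"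
    unfolding mean_loss_def
  proof (intro sum_mono mult_left_mono q)
    fix r
    have "ptail_shift j y (level lo j + r) i \<le> ptail_mean (level lo j + r) (max 0 (ln (real (n j) / real N) + x))"
      unfolding ptail_shift_def using le by (intro ptail_mean_mono) auto
    also have "\<dots> \<le> ptail_shift j x (level lo j) N"
      unfolding ptail_shift_def by (intro ptail_mean_antimono_level) auto
    finally show "ptail_shift j y (level lo j + r) i \<le> ptail_shift j x (level lo j) N" .
  qed
  also have "\<dots> = (\<Sum>r<R. ?q r) * ptail_shift j x (level lo j) N" by (simp add: sum_distrib_right)
  also have "\<dots> \<le> 1 * ptail_shift j x (level lo j) N"
    unfolding sum_step_mass using s by (intro mult_right_mono ptail_shift_nonneg) (simp add: prod_nonneg)
  finally show "mean_loss X lo R s j y i \<le> ptail_shift j x (level lo j) N" by simp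
qed

text \<open>The losses are uniformly small and their sum converges, so each factor may be replaced
  by an exponential at a total cost of the maximal loss times the sum.\<close>

lemma loss_product_lim:
  assumes X: "finite X" and s: "\<And>r b. 0 \<le> s r b \<and> s r b \<le> 1"
    and N: "eventually (\<lambda>j. 2 \<le> N j \<and> N j \<le> n j) sequentially" "filterlim N at_top sequentially"
    and kappa: "\<kappa> > log_spread" "eventually (\<lambda>j. ln (real (n j) / real (N j)) \<ge> \<kappa> * lg j - C) sequentially"
    and r: "\<And>j. 0 \<le> x j" "x \<longlonglongrightarrow> 0" and sg: "y = x \<or> y = (\<lambda>j. - x j)"
  shows "(\<lambda>j. \<Prod>i\<in>{N j..n j}. 1 - mean_loss X lo R s j (y j) i) \<longlonglongrightarrow> exp (- limit_rate X lo R s)"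
proof -
  let ?S = "\<lambda>j. \<Sum>i\<in>{N j..n j}. mean_loss X lo R s j (y j) i"
  have S: "?S \<longlonglongrightarrow> limit_rate X lo R s" by (rule mean_loss_sum_lim[OF X N(1) kappa r sg])
  have d: "(\<lambda>j. ptail_shift j (x j) (level lo j) (N j)) \<longlonglongrightarrow> 0" by (rule uniformly_small_intensity[OF N r])
  have d1: "eventually (\<lambda>j. ptail_shift j (x j) (level lo j) (N j) \<le> 1) sequentially"
    using order_tendstoD(2)[OF d, of 1] by (auto elim: eventually_mono)
  have yx: "y j \<le> x j" for j using sg r(1)[of j] by auto
  have "(\<lambda>j. (\<Prod>i\<in>{N j..n j}. 1 - mean_loss X lo R s j (y j) i) - exp (- ?S j)) \<longlonglongrightarrow> 0"
  proof (rule Lim_null_comparison)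
    show "eventually (\<lambda>j. norm ((\<Prod>i\<in>{N j..n j}. 1 - mean_loss X lo R s j (y j) i) - exp (- ?S j))
       \<le> ptail_shift j (x j) (level lo j) (N j) * ?S j) sequentially"
      using d1 N(1)
    proof eventually_elim
      case (elim j)
      have "\<bar>(\<Prod>i\<in>{N j..n j}. 1 - mean_loss X lo R s j (y j) i) - exp (- ?S j)\<bar> \<le> ptail_shift j (x j) (level lo j) (N j) * ?S j"
      proof (rule prod_one_minus_exp)
        fix i assume i: "i \<in> {N j..n j}"
        show "0 \<le> mean_loss X lo R s j (y j) i \<and> mean_loss X lo R s j (y j) i \<le> ptail_shift j (x j) (level lo j) (N j)"
          using mean_loss_bounds[where s = s and N = "N j" and i = i and j = j and x = "x j" and y = "y j" and X = X and lo = lo and R = R] s elim i r(1)[of j] yx[of j] by auto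
      qed (use elim in auto)
      thus ?case by simp
    qed
    show "(\<lambda>j. ptail_shift j (x j) (level lo j) (N j) * ?S j) \<longlonglongrightarrow> 0"
      using tendsto_mult[OF d S] by simp
  qed
  moreover have "(\<lambda>j. exp (- ?S j)) \<longlonglongrightarrow> exp (- limit_rate X lo R s)" by (intro tendsto_intros S)
  ultimately show ?thesis using tendsto_add by fastforce
qed

end

lemma (in thinning) thin_antimono_arg: "0 \<le> x \<Longrightarrow> x \<le> y \<Longrightarrow> thin L q c y \<le> thin L q c x"
  unfolding thin_def using q0 by (intro diff_left_mono sum_mono mult_left_mono ptail_mono) auto

section \<open>Limit of the generating functional of the tree\<close>

context beta_wrt
begin

lemma deg_measurable [measurable]: "deg t i \<in> measurable M (count_space UNIV)"
  by (rule measurable_from_subalg[OF subalgebra_history deg_history])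

definition tree_gf :: "real set \<Rightarrow> int \<Rightarrow> nat \<Rightarrow> (nat \<Rightarrow> real set \<Rightarrow> real) \<Rightarrow> nat \<Rightarrow> 'a \<Rightarrow> real" where
  "tree_gf X lo R s j \<omega> = (\<Prod>i\<in>{1..n j}. \<Prod>r<R. if level lo j + r \<le> deg (n j) i \<omega> then s r (cell X (label_z j i)) else 1)"

lemma tree_gf_measurable [measurable]: "tree_gf X lo R s j \<in> borel_measurable M"
  unfolding tree_gf_def[abs_def] by measurable

context
  fixes X :: "real set" and lo :: int and R :: nat and s :: "nat \<Rightarrow> real set \<Rightarrow> real"
  assumes X: "finite X" and s: "\<And>r b. 0 \<le> s r b \<and> s r b \<le> 1"
begin

definition Lv :: "nat \<Rightarrow> nat \<Rightarrow> nat set" where "Lv j i = {level lo j..<level lo j + R}"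

definition qv :: "nat \<Rightarrow> nat \<Rightarrow> nat \<Rightarrow> real" where
  "qv j i l = step_mass (\<lambda>t. s t (cell X (label_z j i))) (l - level lo j)"

lemma thinning_v: "thinning (Lv j i) (qv j i) (level lo j)"
  unfolding Lv_def qv_def[abs_def] using s by (intro thinning_step_mass) auto

lemma tree_gf_bounds: "0 \<le> tree_gf X lo R s j \<omega>" "tree_gf X lo R s j \<omega> \<le> 1"
  unfolding tree_gf_def using s by (auto intro!: prod_nonneg prod_le_1)

lemma tree_gf_integrable: "integrable M (tree_gf X lo R s j)"
  using tree_gf_bounds by (intro integrable_const_bound[of _ 1]) auto

text \<open>A vertex below the lowest level contributes the factor 1. On the good event, labels
  below \<open>N\<close> thus matter only if one of them reaches \<open>level lo j\<close>.\<close>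

lemma tree_gf_vs_hybrid:
  assumes N: "1 \<le> N" "N \<le> n j"
  shows "\<bar>expectation (tree_gf X lo R s j) - expectation (G.hybrid m0 (Lv j) (qv j) N (n j) (n j))\<bar>
     \<le> prob (space M - Good m0) + prob {\<omega> \<in> Good m0. \<exists>i\<in>{1..<N}. level lo j \<le> deg (n j) i \<omega>}"
proof -
  let ?h = "G.hybrid m0 (Lv j) (qv j) N (n j) (n j)" and ?f = "tree_gf X lo R s j"
  define Bad where "Bad = {\<omega> \<in> Good m0. \<exists>i\<in>{1..<N}. level lo j \<le> deg (n j) i \<omega>}"
  have Bad [measurable]: "Bad \<in> events"
  proof -
    have "{\<omega> \<in> space M. \<exists>i\<in>{1..<N}. level lo j \<le> deg (n j) i \<omega>} \<in> events" by measurable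
    moreover have "Bad = Good m0 \<inter> {\<omega> \<in> space M. \<exists>i\<in>{1..<N}. level lo j \<le> deg (n j) i \<omega>}" by (auto simp: Good_def Bad_def)
    ultimately show ?thesis by simp
  qed
  have hb: "0 \<le> ?h \<omega>" "?h \<omega> \<le> 1" for \<omega> using G.hybrid_bounds[OF thinning_v N(1)] by auto
  have hi: "integrable M ?h" by (rule G.hybrid_integrable[OF thinning_v N(1)])
  have pw: "\<bar>?f \<omega> - ?h \<omega>\<bar> \<le> indicator (space M - Good m0) \<omega> + indicator Bad \<omega>" if "\<omega> \<in> space M" for \<omega>
  proof (cases "\<omega> \<in> Good m0 \<and> \<omega> \<notin> Bad")
    case False
    have "\<bar>?f \<omega> - ?h \<omega>\<bar> \<le> 1" using tree_gf_bounds[of j \<omega>] hb[of \<omega>] by linarith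
    thus ?thesis using False that by (auto simp: indicator_def)
  next
    case True
    let ?g = "\<lambda>i. \<Prod>r<R. if level lo j + r \<le> deg (n j) i \<omega> then s r (cell X (label_z j i)) else 1"
    have "{1..n j} = {1..<N} \<union> {N..n j}" using N by auto
    hence "?f \<omega> = (\<Prod>i\<in>{1..<N}. ?g i) * (\<Prod>i\<in>{N..n j}. ?g i)"
      unfolding tree_gf_def by (simp only:) (rule prod.union_disjoint, auto)
    also have "(\<Prod>i\<in>{1..<N}. ?g i) = 1"
    proof (rule prod.neutral, rule ballI)
      fix i assume "i \<in> {1..<N}"
      hence "deg (n j) i \<omega> < level lo j" using True by (auto simp: Bad_def not_le)
      thus "?g i = 1" by (intro prod.neutral) auto
    qed
    also have "(\<Prod>i\<in>{N..n j}. ?g i) = ?h \<omega>"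
      using True unfolding G.hybrid_def Lv_def qv_def[abs_def]
      by (simp add: future_mean_def thin_zero)
    finally have "?f \<omega> = ?h \<omega>" by simp
    thus ?thesis by simp
  qed
  have "expectation ?f - expectation ?h = expectation (\<lambda>\<omega>. ?f \<omega> - ?h \<omega>)"
    using tree_gf_integrable hi by simp
  hence "\<bar>expectation ?f - expectation ?h\<bar> \<le> expectation (\<lambda>\<omega>. \<bar>?f \<omega> - ?h \<omega>\<bar>)"
    using integral_abs_bound[of M "\<lambda>\<omega>. ?f \<omega> - ?h \<omega>"] by simp
  also have "\<dots> \<le> expectation (\<lambda>\<omega>. indicator (space M - Good m0) \<omega> + indicator Bad \<omega>)"
  proof (rule integral_mono)
    show "integrable M (\<lambda>\<omega>. indicator (space M - Good m0) \<omega> + indicator Bad \<omega> :: real)"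
      by (intro Bochner_Integration.integrable_add integrable_real_indicator) (auto simp: emeasure_eq_measure)
  qed (use tree_gf_integrable hi pw in auto)
  also have "\<dots> = prob (space M - Good m0) + prob Bad"
    by (subst Bochner_Integration.integral_add) (auto intro!: integrable_real_indicator simp: emeasure_eq_measure)
  finally show ?thesis by (simp only: Bad_def)
qed

definition loss_fun :: "nat \<Rightarrow> real \<Rightarrow> nat \<Rightarrow> real \<Rightarrow> real" where
  "loss_fun j x i w = thin (Lv j i) (qv j i) 0 (w * lam * max 0 (ln (real (n j) / real i) + x))"

lemma loss_fun_measurable [measurable]: "loss_fun j x i \<in> borel_measurable borel"
  unfolding loss_fun_def[abs_def] thin_def by measurable

lemma loss_fun_bounds:
  assumes "0 < w" shows "0 \<le> loss_fun j x i w" "loss_fun j x i w \<le> 1"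
  unfolding loss_fun_def using thinning.thin_bounds[OF thinning_v] assms lam_pos by auto

lemma loss_fun_mean: "(\<integral>w. loss_fun j x i w \<partial>beta_distribution \<alpha> \<beta>) = 1 - mean_loss X lo R s j x i"
proof -
  let ?k = "level lo j" and ?t = "max 0 (ln (real (n j) / real i) + x)"
  have i: "integrable (beta_distribution \<alpha> \<beta>) (\<lambda>w. ptail l (w * lam * ?t))" for l by (rule integrable_ptail) simp
  have "(\<integral>w. loss_fun j x i w \<partial>beta_distribution \<alpha> \<beta>) = 1 - (\<Sum>l\<in>Lv j i. qv j i l * ptail_mean l ?t)"
    unfolding loss_fun_def thin_def ptail_mean_def using i B.prob_space
    by (simp add: Bochner_Integration.integral_diff Bochner_Integration.integral_sum)
  also have "(\<Sum>l\<in>Lv j i. qv j i l * ptail_mean l ?t) = mean_loss X lo R s j x i"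
    unfolding Lv_def qv_def mean_loss_def ptail_shift_def
    by (rule sum.reindex_bij_witness[of _ "\<lambda>r. r + ?k" "\<lambda>l. l - ?k"]) (auto simp: add.commute)
  finally show ?thesis .
qed

lemma loss_product_expectation:
  assumes N: "1 \<le> N"
  shows "expectation (\<lambda>\<omega>. \<Prod>i\<in>{N..n j}. loss_fun j x i (W i \<omega>)) = (\<Prod>i\<in>{N..n j}. 1 - mean_loss X lo R s j x i)"
    and "integrable M (\<lambda>\<omega>. \<Prod>i\<in>{N..n j}. loss_fun j x i (W i \<omega>))"
proof -
  have Wm: "W i \<in> borel_measurable M" if "i \<in> {N..n j}" for i using that N by (intro weight_measurable) auto
  have ind: "indep_vars (\<lambda>_. borel) (\<lambda>i \<omega>. loss_fun j x i (W i \<omega>)) {N..n j}"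
  proof (rule indep_vars_compose2[where X = W and M' = "\<lambda>_. borel"])
    show "indep_vars (\<lambda>_. borel) W {N..n j}" using weights_indep by (rule indep_vars_subset) (use N in auto)
  qed measurable
  have int: "integrable M (\<lambda>\<omega>. loss_fun j x i (W i \<omega>))" if i: "i \<in> {N..n j}" for i
  proof (rule integrable_const_bound[of _ 1])
    have i1: "i \<in> {1..}" using i N by auto
    show "AE \<omega> in M. norm (loss_fun j x i (W i \<omega>)) \<le> 1"
      using AE_weights
    proof eventually_elim
      case (elim \<omega>)
      have "0 < W i \<omega>" using elim i1 by blast
      thus ?case using loss_fun_bounds[of "W i \<omega>" j x i] by simp
    qed
    show "(\<lambda>\<omega>. loss_fun j x i (W i \<omega>)) \<in> borel_measurable M" using Wm[OF i] by measurable
  qed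
  have "expectation (\<lambda>\<omega>. \<Prod>i\<in>{N..n j}. loss_fun j x i (W i \<omega>)) = (\<Prod>i\<in>{N..n j}. expectation (\<lambda>\<omega>. loss_fun j x i (W i \<omega>)))"
    by (intro indep_vars_lebesgue_integral ind int) auto
  also have "\<dots> = (\<Prod>i\<in>{N..n j}. 1 - mean_loss X lo R s j x i)"
  proof (rule prod.cong[OF refl])
    fix i assume i: "i \<in> {N..n j}"
    have "expectation (\<lambda>\<omega>. loss_fun j x i (W i \<omega>)) = (\<integral>w. loss_fun j x i w \<partial>distr M borel (W i))"
      using Wm[OF i] by (subst integral_distr) auto
    also have "distr M borel (W i) = beta_distribution \<alpha> \<beta>" using i N by (intro weight_law) auto
    finally show "expectation (\<lambda>\<omega>. loss_fun j x i (W i \<omega>)) = 1 - mean_loss X lo R s j x i" by (simp only: loss_fun_mean)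
  qed
  finally show "expectation (\<lambda>\<omega>. \<Prod>i\<in>{N..n j}. loss_fun j x i (W i \<omega>)) = (\<Prod>i\<in>{N..n j}. 1 - mean_loss X lo R s j x i)" .
  show "integrable M (\<lambda>\<omega>. \<Prod>i\<in>{N..n j}. loss_fun j x i (W i \<omega>))"
    by (intro indep_vars_integrable ind int) auto
qed

text \<open>At time \<open>N\<close> the hybrid is almost surely a function of the weights, and
  \<open>thin\<close> decreases in the mean. The sandwich of \<open>future_mean\<close> thus becomes
  one between products of functions of single weights, which are independent. These products are not
  restricted to the good event; as they lie between 0 and 1, this costs its complement in the lower
  bound and nothing in the upper one.\<close>

lemma hybrid_start_sandwich:
  assumes m0: "settle \<le> m0" "1 \<le> m0" and N: "m0 \<le> N" "N \<le> n j"
  shows "(\<Prod>i\<in>{N..n j}. 1 - mean_loss X lo R s j (rem N) i) - prob (space M - Good m0)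
      \<le> expectation (G.hybrid m0 (Lv j) (qv j) N (n j) N)"
    "expectation (G.hybrid m0 (Lv j) (qv j) N (n j) N) \<le> (\<Prod>i\<in>{N..n j}. 1 - mean_loss X lo R s j (- rem N) i)"
proof -
  let ?h = "G.hybrid m0 (Lv j) (qv j) N (n j) N"
  let ?P = "\<lambda>x \<omega>. \<Prod>i\<in>{N..n j}. loss_fun j x i (W i \<omega>)"
  have N1: "1 \<le> N" using m0 N by simp
  have hi: "integrable M ?h" by (rule G.hybrid_integrable[OF thinning_v N1])
  have Pb: "0 \<le> ?P x \<omega> \<and> ?P x \<omega> \<le> 1" if w: "\<forall>i\<in>{1..}. 0 < W i \<omega> \<and> W i \<omega> < 1" for x \<omega>
  proof -
    have "0 < W i \<omega>" if "i \<in> {N..n j}" for i using w that N1 by auto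
    thus ?thesis using loss_fun_bounds by (intro conjI prod_nonneg prod_le_1) auto
  qed
  have h_eq: "?h \<omega> = (\<Prod>i\<in>{N..n j}. thin (Lv j i) (qv j i) 0 (future_mean (n j) N i \<omega>))"
    if "\<omega> \<in> Good m0" "\<forall>i\<ge>N. deg N i \<omega> = 0" for \<omega>
    unfolding G.hybrid_def using that by (auto intro!: prod.cong)
  have sand: "?P (rem N) \<omega> \<le> ?h \<omega> \<and> ?h \<omega> \<le> ?P (- rem N) \<omega>"
    if w: "\<omega> \<in> Good m0" and d: "\<forall>i\<ge>N. deg N i \<omega> = 0" for \<omega>
  proof -
    have "loss_fun j (rem N) i (W i \<omega>) \<le> thin (Lv j i) (qv j i) 0 (future_mean (n j) N i \<omega>) \<and>
       thin (Lv j i) (qv j i) 0 (future_mean (n j) N i \<omega>) \<le> loss_fun j (- rem N) i (W i \<omega>)" if i: "i \<in> {N..n j}" for i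
    proof -
      have i1: "1 \<le> i" using i N1 by simp
      have Wp: "0 < W i \<omega>" using GoodD(1)[OF w i1] .
      have fm0: "0 \<le> future_mean (n j) N i \<omega>" by (rule G.future_mean_bounds(1)[OF w i1])
      have up: "future_mean (n j) N i \<omega> \<le> W i \<omega> * lam * max 0 (ln (real (n j) / real i) + rem N)"
      proof -
        have "future_mean (n j) N i \<omega> \<le> W i \<omega> * lam * (ln (real (n j) / real i) + rem N)"
          using i N by (intro future_mean_sandwich(2)[OF w m0]) auto
        also have "\<dots> \<le> W i \<omega> * lam * max 0 (ln (real (n j) / real i) + rem N)"
          using Wp lam_pos by (intro mult_left_mono) auto
        finally show ?thesis .
      qed
      have dn: "W i \<omega> * lam * max 0 (ln (real (n j) / real i) - rem N) \<le> future_mean (n j) N i \<omega>"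
      proof (cases "0 \<le> ln (real (n j) / real i) - rem N")
        case True
        have "W i \<omega> * lam * (ln (real (n j) / real i) - rem N) \<le> future_mean (n j) N i \<omega>"
          using i N by (intro future_mean_sandwich(1)[OF w m0]) auto
        thus ?thesis using True by (simp only: max_absorb2)
      next
        case False
        hence "max 0 (ln (real (n j) / real i) - rem N) = 0" by simp
        thus ?thesis using fm0 by (simp only: mult_zero_right)
      qed
      have dn0: "0 \<le> W i \<omega> * lam * max 0 (ln (real (n j) / real i) + - rem N)" using Wp lam_pos by simp
      show ?thesis unfolding loss_fun_def
        using thinning.thin_antimono_arg[OF thinning_v fm0 up] thinning.thin_antimono_arg[OF thinning_v dn0, of "future_mean (n j) N i \<omega>"] dn
        by simp
    qed note b = this
    have W0: "0 < W i \<omega>" if "i \<in> {N..n j}" for i using that N1 by (intro GoodD(1)[OF w]) auto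
    have fmn: "0 \<le> future_mean (n j) N i \<omega>" if "i \<in> {N..n j}" for i using that N1 by (intro G.future_mean_bounds(1)[OF w]) auto
    show ?thesis unfolding h_eq[OF w d]
      using b loss_fun_bounds[OF W0] thinning.thin_bounds[OF thinning_v fmn] by (intro conjI prod_mono) auto
  qed
  have "expectation (?P (rem N)) - prob (space M - Good m0) = expectation (\<lambda>\<omega>. ?P (rem N) \<omega> - indicator (space M - Good m0) \<omega>)"
    using loss_product_expectation(2)[OF N1] by (subst Bochner_Integration.integral_diff) (auto intro!: integrable_real_indicator simp: emeasure_eq_measure)
  also have "\<dots> \<le> expectation ?h"
  proof (rule integral_mono_AE)
    show "integrable M (\<lambda>\<omega>. ?P (rem N) \<omega> - indicator (space M - Good m0) \<omega>)"
      using loss_product_expectation(2)[OF N1] by (intro Bochner_Integration.integrable_diff integrable_real_indicator) (auto simp: emeasure_eq_measure)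
    show "AE \<omega> in M. ?P (rem N) \<omega> - indicator (space M - Good m0) \<omega> \<le> ?h \<omega>"
      using AE_weights G.deg_young_eq_0[of N] AE_space
    proof eventually_elim
      case (elim \<omega>)
      show ?case
      proof (cases "\<omega> \<in> Good m0")
        case True
        thus ?thesis using sand[OF True elim(2)] by simp
      next
        case False
        thus ?thesis using Pb[OF elim(1), of "rem N"] elim(3) by (simp add: G.hybrid_def)
      qed
    qed
  qed (rule hi)
  finally show "(\<Prod>i\<in>{N..n j}. 1 - mean_loss X lo R s j (rem N) i) - prob (space M - Good m0) \<le> expectation ?h"
    by (simp only: loss_product_expectation(1)[OF N1])
  have "expectation ?h \<le> expectation (?P (- rem N))"
  proof (rule integral_mono_AE)
    show "AE \<omega> in M. ?h \<omega> \<le> ?P (- rem N) \<omega>"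
      using AE_weights G.deg_young_eq_0[of N]
    proof eventually_elim
      case (elim \<omega>)
      show ?case
      proof (cases "\<omega> \<in> Good m0")
        case True
        thus ?thesis using sand[OF True elim(2)] by simp
      next
        case False
        thus ?thesis using Pb[OF elim(1), of "- rem N"] by (simp add: G.hybrid_def)
      qed
    qed
  qed (use hi loss_product_expectation(2)[OF N1] in auto)
  thus "expectation ?h \<le> (\<Prod>i\<in>{N..n j}. 1 - mean_loss X lo R s j (- rem N) i)"
    by (simp only: loss_product_expectation(1)[OF N1])
qed

theorem tree_gf_lim: "(\<lambda>j. expectation (tree_gf X lo R s j)) \<longlonglongrightarrow> exp (- limit_rate X lo R s)"
proof (rule LIMSEQ_I)
  fix \<delta> :: real assume \<delta>: "\<delta> > 0"
  obtain \<eta> where eta: "0 < \<eta>" "\<eta> < 1" "log_spread < (1 - \<eta>) * ln \<theta>" "\<eta> + 1/2 < log \<theta> ((1 + \<theta>) / 2)"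
    using cutoff_exponent_exists by blast
  let ?N = "cutoff \<eta>"
  have "\<delta> / 8 > 0" using \<delta> by simp
  from Good_likely[OF this] obtain m1 where m1: "\<forall>m0\<ge>m1. prob (space M - Good m0) < \<delta> / 8" by blast
  \<comment> \<open>\<open>m0\<close> does not depend on \<open>j\<close>: atypical weights cost a
    fixed small probability, and all other errors vanish as \<open>j\<close> grows.\<close>
  define m0 where "m0 = max m1 (max settle 1)"
  have m0: "settle \<le> m0" "1 \<le> m0" and "m1 \<le> m0" by (simp_all add: m0_def)
  have pG: "prob (space M - Good m0) < \<delta> / 8" using m1 \<open>m1 \<le> m0\<close> by blast
  let ?E = "exp (- limit_rate X lo R s)"
  have xl: "(\<lambda>j. rem (?N j)) \<longlonglongrightarrow> 0" by (rule filterlim_compose[OF rem_lim cutoff_lim[OF eta(1)]])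
  have prl: "(\<lambda>j. \<Prod>i\<in>{?N j..n j}. 1 - mean_loss X lo R s j (y j) i) \<longlonglongrightarrow> ?E"
    if "y = (\<lambda>j. rem (?N j)) \<or> y = (\<lambda>j. - rem (?N j))" for y
    by (rule loss_product_lim[OF X s cutoff_le[OF eta(1,2)] cutoff_lim[OF eta(1)] eta(3) cutoff_far[OF eta(1)] _ xl that])
       (rule rem_nonneg)
  have small: "eventually (\<lambda>j. \<bar>f j - c\<bar> < \<delta> / 8) sequentially" if "f \<longlonglongrightarrow> c" for f and c :: real
    using tendstoD[OF that, of "\<delta> / 8"] \<delta> by (simp add: dist_real_def)
  have "eventually (\<lambda>j. m0 \<le> ?N j) sequentially"
    using eventually_ge_at_top cutoff_lim[OF eta(1)] by (rule eventually_compose_filterlim)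
  hence "eventually (\<lambda>j. norm (expectation (tree_gf X lo R s j) - ?E) < \<delta>) sequentially"
    using cutoff_le[OF eta(1,2)] small[OF prl[of "\<lambda>j. rem (?N j)", OF disjI1[OF refl]]]
      small[OF prl[of "\<lambda>j. - rem (?N j)", OF disjI2[OF refl]]]
      small[OF replacement_error[where L = Lv and q = qv and m = lo, OF eta(1,2) m0 thinning_v]] small[OF old_vertices_low[OF eta(1,4) m0, of lo]]
  proof eventually_elim
    case (elim j)
    have 1: "\<bar>expectation (tree_gf X lo R s j) - expectation (G.hybrid m0 (Lv j) (qv j) (?N j) (n j) (n j))\<bar>
     \<le> prob (space M - Good m0) + prob {\<omega> \<in> Good m0. \<exists>i\<in>{1..<?N j}. level lo j \<le> deg (n j) i \<omega>}"
      using elim by (intro tree_gf_vs_hybrid) auto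
    have 2: "(\<Prod>i\<in>{?N j..n j}. 1 - mean_loss X lo R s j (rem (?N j)) i) - prob (space M - Good m0)
        \<le> expectation (G.hybrid m0 (Lv j) (qv j) (?N j) (n j) (?N j))"
      "expectation (G.hybrid m0 (Lv j) (qv j) (?N j) (n j) (?N j)) \<le> (\<Prod>i\<in>{?N j..n j}. 1 - mean_loss X lo R s j (- rem (?N j)) i)"
      using elim by (auto intro!: hybrid_start_sandwich[OF m0])
    have 3: "\<bar>(\<Prod>i\<in>{?N j..n j}. 1 - mean_loss X lo R s j (rem (?N j)) i) - ?E\<bar> < \<delta> / 8"
      "\<bar>(\<Prod>i\<in>{?N j..n j}. 1 - mean_loss X lo R s j (- rem (?N j)) i) - ?E\<bar> < \<delta> / 8"
      using elim(3,4) by blast+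
    have "\<bar>expectation (tree_gf X lo R s j) - ?E\<bar> < \<delta>"
      using 1 2 3 elim(5,6) pG \<delta> unfolding abs_less_iff abs_le_iff by linarith
    thus ?case by simp
  qed
  thus "\<exists>no. \<forall>j\<ge>no. norm (expectation (tree_gf X lo R s j) - ?E) < \<delta>" by (simp add: eventually_sequentially)
qed

end

end

section \<open>Convergence of counts from generating functions\<close>

lemma (in prob_space) discrete_integral_approx:
  assumes X: "X \<in> measurable M (count_space A)" and F: "finite F" "F \<subseteq> A"
    and \<phi>: "\<And>p. p \<in> A \<Longrightarrow> \<bar>\<phi> p\<bar> \<le> (C :: real)"
  shows "\<bar>expectation (\<lambda>\<omega>. \<phi> (X \<omega>)) - (\<Sum>p\<in>F. \<phi> p * prob {\<omega> \<in> space M. X \<omega> = p})\<bar>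
     \<le> C * (1 - (\<Sum>p\<in>F. prob {\<omega> \<in> space M. X \<omega> = p}))"
proof -
  have XA: "X \<omega> \<in> A" if "\<omega> \<in> space M" for \<omega> using measurable_space[OF X that] by simp
  have ev [measurable]: "{\<omega> \<in> space M. X \<omega> = p} \<in> events" if "p \<in> F" for p
  proof -
    have "X -` {p} \<inter> space M \<in> events" using that F by (intro measurable_sets[OF X]) auto
    thus ?thesis by (simp add: vimage_def Int_def conj_commute)
  qed
  let ?I = "\<lambda>p. indicator {\<omega> \<in> space M. X \<omega> = p} :: 'a \<Rightarrow> real"
  have ii: "integrable M (?I p)" if "p \<in> F" for p using ev[OF that] by (simp add: emeasure_eq_measure)
  have m: "(\<lambda>\<omega>. \<phi> (X \<omega>)) \<in> borel_measurable M"
    by (rule measurable_compose[OF X]) simp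
  have i1: "integrable M (\<lambda>\<omega>. \<phi> (X \<omega>))"
    using \<phi> XA m by (intro integrable_const_bound[of _ C]) (auto intro!: AE_I2)
  have i2: "integrable M (\<lambda>\<omega>. \<Sum>p\<in>F. \<phi> p * ?I p \<omega>)" "integrable M (\<lambda>\<omega>. \<Sum>p\<in>F. ?I p \<omega>)"
    using ii by (auto intro!: Bochner_Integration.integrable_sum)
  have e1: "expectation (\<lambda>\<omega>. \<Sum>p\<in>F. \<phi> p * ?I p \<omega>) = (\<Sum>p\<in>F. \<phi> p * prob {\<omega> \<in> space M. X \<omega> = p})"
    using ii ev by (subst Bochner_Integration.integral_sum) (auto intro!: sum.cong)
  have e2: "expectation (\<lambda>\<omega>. \<Sum>p\<in>F. ?I p \<omega>) = (\<Sum>p\<in>F. prob {\<omega> \<in> space M. X \<omega> = p})"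
    using ii ev by (subst Bochner_Integration.integral_sum) (auto intro!: sum.cong)
  have "\<bar>expectation (\<lambda>\<omega>. \<phi> (X \<omega>)) - expectation (\<lambda>\<omega>. \<Sum>p\<in>F. \<phi> p * ?I p \<omega>)\<bar> = \<bar>expectation (\<lambda>\<omega>. \<phi> (X \<omega>) - (\<Sum>p\<in>F. \<phi> p * ?I p \<omega>))\<bar>"
    using i1 i2 by simp
  also have "\<dots> \<le> expectation (\<lambda>\<omega>. \<bar>\<phi> (X \<omega>) - (\<Sum>p\<in>F. \<phi> p * ?I p \<omega>)\<bar>)" by (rule integral_abs_bound)
  also have "\<dots> \<le> expectation (\<lambda>\<omega>. C * (1 - (\<Sum>p\<in>F. ?I p \<omega>)))"
  proof (rule integral_mono)
    fix \<omega> assume w: "\<omega> \<in> space M"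
    have s: "(\<Sum>p\<in>F. f p * ?I p \<omega>) = (if X \<omega> \<in> F then f (X \<omega>) else 0)" for f
    proof -
      have "(\<Sum>p\<in>F. f p * ?I p \<omega>) = (\<Sum>p\<in>F. if X \<omega> = p then f p else 0)"
        using w by (intro sum.cong) (auto simp: indicator_def)
      thus ?thesis using F by (simp add: sum.delta')
    qed
    show "\<bar>\<phi> (X \<omega>) - (\<Sum>p\<in>F. \<phi> p * ?I p \<omega>)\<bar> \<le> C * (1 - (\<Sum>p\<in>F. ?I p \<omega>))"
      using s[of \<phi>] s[of "\<lambda>_. 1"] \<phi>[OF XA[OF w]] by simp
  qed (use i1 i2 in \<open>auto intro!: Bochner_Integration.integrable_abs\<close>)
  also have "\<dots> = C * (1 - (\<Sum>p\<in>F. prob {\<omega> \<in> space M. X \<omega> = p}))"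
    using i2(2) by (simp add: e2 prob_space)
  finally show ?thesis unfolding e1 .
qed

text \<open>Convergence of point masses is enough because the limit is a probability: a finite set
  of nearly full limiting mass has nearly full mass for all large indices, so no mass
  escapes.\<close>

lemma discrete_convergence:
  fixes X :: "nat \<Rightarrow> 'a \<Rightarrow> 's" and Y :: "'b \<Rightarrow> 's" and \<phi> :: "'s \<Rightarrow> real"
  assumes "prob_space M" "prob_space R" and A: "countable A"
    and X: "\<And>n. X n \<in> measurable M (count_space A)" and Y: "Y \<in> measurable R (count_space A)"
    and lim: "\<And>p. p \<in> A \<Longrightarrow> (\<lambda>n. measure M {\<omega> \<in> space M. X n \<omega> = p}) \<longlonglongrightarrow> measure R {\<omega> \<in> space R. Y \<omega> = p}"
    and \<phi>: "\<And>p. p \<in> A \<Longrightarrow> \<bar>\<phi> p\<bar> \<le> C"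
  shows "(\<lambda>n. \<integral>\<omega>. \<phi> (X n \<omega>) \<partial>M) \<longlonglongrightarrow> (\<integral>\<omega>. \<phi> (Y \<omega>) \<partial>R)"
proof -
  interpret M: prob_space M by fact
  interpret R: prob_space R by fact
  have YA: "Y \<omega> \<in> A" if "\<omega> \<in> space R" for \<omega> using measurable_space[OF Y that] by simp
  have Ane: "A \<noteq> {}" using YA R.not_empty by auto
  obtain \<omega>0 where "\<omega>0 \<in> space R" using R.not_empty by auto
  hence C0: "0 \<le> C" using \<phi>[OF YA] abs_ge_zero order_trans by blast
  define F where "F k = from_nat_into A ` {..<k}" for k
  have F: "finite (F k)" "F k \<subseteq> A" for k using from_nat_into[OF Ane] by (auto simp: F_def)
  have evR: "{\<omega> \<in> space R. Y \<omega> \<in> B} \<in> sets R" if "B \<subseteq> A" for B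
  proof -
    have "Y -` B \<inter> space R \<in> sets R" using that by (intro measurable_sets[OF Y]) auto
    thus ?thesis by (simp add: vimage_def Int_def conj_commute)
  qed
  have "(\<lambda>k. R.prob {\<omega> \<in> space R. Y \<omega> \<in> F k}) \<longlonglongrightarrow> R.prob (\<Union>k. {\<omega> \<in> space R. Y \<omega> \<in> F k})"
    using evR F by (intro R.finite_Lim_measure_incseq) (auto simp: incseq_def F_def)
  also have "(\<Union>k. {\<omega> \<in> space R. Y \<omega> \<in> F k}) = space R"
  proof -
    have "\<exists>k. Y \<omega> \<in> F k" if w: "\<omega> \<in> space R" for \<omega>
    proof -
      obtain i where "from_nat_into A i = Y \<omega>" using from_nat_into_to_nat_on[OF A YA[OF w]] by blast
      hence "Y \<omega> \<in> F (Suc i)" by (auto simp: F_def intro!: image_eqI[of _ _ i])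
      thus ?thesis ..
    qed
    thus ?thesis by auto
  qed
  finally have "(\<lambda>k. R.prob {\<omega> \<in> space R. Y \<omega> \<in> F k}) \<longlonglongrightarrow> 1" by (simp add: R.prob_space)
  moreover have "R.prob {\<omega> \<in> space R. Y \<omega> \<in> F k} = (\<Sum>p\<in>F k. R.prob {\<omega> \<in> space R. Y \<omega> = p})" for k
  proof -
    have "{\<omega> \<in> space R. Y \<omega> \<in> F k} = (\<Union>p\<in>F k. {\<omega> \<in> space R. Y \<omega> = p})" by auto
    moreover have "{\<omega> \<in> space R. Y \<omega> = p} \<in> sets R" if "p \<in> F k" for p
      using evR[of "{p}"] F(2)[of k] that by auto
    ultimately show ?thesis
      using F(1)[of k] by (simp only:) (intro R.finite_measure_finite_Union, auto simp: disjoint_family_on_def)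
  qed
  ultimately have Flim: "(\<lambda>k. \<Sum>p\<in>F k. R.prob {\<omega> \<in> space R. Y \<omega> = p}) \<longlonglongrightarrow> 1" by simp
  show ?thesis
  proof (rule LIMSEQ_I)
    fix e :: real assume e: "e > 0"
    define d where "d = e / (4 * (C + 1))"
    have d: "d > 0" using e C0 by (simp add: d_def)
    have Cd: "C * d \<le> e / 4" using e C0 by (simp add: d_def field_simps)
    obtain k where k: "1 - d < (\<Sum>p\<in>F k. R.prob {\<omega> \<in> space R. Y \<omega> = p})"
      using order_tendstoD(1)[OF Flim, of "1 - d"] d by (auto simp: eventually_sequentially)
    let ?PX = "\<lambda>n. \<Sum>p\<in>F k. M.prob {\<omega> \<in> space M. X n \<omega> = p}"
    let ?PY = "\<Sum>p\<in>F k. R.prob {\<omega> \<in> space R. Y \<omega> = p}"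
    let ?SX = "\<lambda>n. \<Sum>p\<in>F k. \<phi> p * M.prob {\<omega> \<in> space M. X n \<omega> = p}"
    let ?SY = "\<Sum>p\<in>F k. \<phi> p * R.prob {\<omega> \<in> space R. Y \<omega> = p}"
    have l1: "?PX \<longlonglongrightarrow> ?PY" using F(2)[of k] by (intro tendsto_sum lim) auto
    have l2: "?SX \<longlonglongrightarrow> ?SY" using F(2)[of k] by (intro tendsto_sum tendsto_mult tendsto_const lim) auto
    have "eventually (\<lambda>n. 1 - d < ?PX n) sequentially" by (rule order_tendstoD(1)[OF l1 k])
    moreover have "eventually (\<lambda>n. \<bar>?SX n - ?SY\<bar> < e / 4) sequentially"
      using tendstoD[OF l2, of "e / 4"] e by (simp add: dist_real_def)
    ultimately have "eventually (\<lambda>n. norm ((\<integral>\<omega>. \<phi> (X n \<omega>) \<partial>M) - (\<integral>\<omega>. \<phi> (Y \<omega>) \<partial>R)) < e) sequentially"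
    proof eventually_elim
      case (elim n)
      have 1: "\<bar>(\<integral>\<omega>. \<phi> (X n \<omega>) \<partial>M) - ?SX n\<bar> \<le> C * (1 - ?PX n)"
        by (rule M.discrete_integral_approx[OF X F \<phi>])
      have 2: "\<bar>(\<integral>\<omega>. \<phi> (Y \<omega>) \<partial>R) - ?SY\<bar> \<le> C * (1 - ?PY)"
        by (rule R.discrete_integral_approx[OF Y F \<phi>])
      have 3: "C * (1 - ?PX n) \<le> C * d" "C * (1 - ?PY) \<le> C * d" using elim k C0 by (auto intro!: mult_left_mono)
      have "\<bar>(\<integral>\<omega>. \<phi> (X n \<omega>) \<partial>M) - (\<integral>\<omega>. \<phi> (Y \<omega>) \<partial>R)\<bar> < e"
        using 1 2 3 Cd elim(2) e unfolding abs_less_iff abs_le_iff by linarith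
      thus ?case by simp
    qed
    thus "\<exists>no. \<forall>n\<ge>no. norm ((\<integral>\<omega>. \<phi> (X n \<omega>) \<partial>M) - (\<integral>\<omega>. \<phi> (Y \<omega>) \<partial>R)) < e" by (simp add: eventually_sequentially)
  qed
qed

section \<open>Recovering count probabilities from generating functions\<close>

text \<open>A count \<open>r\<close> is encoded as the number \<open>(1/2) ^ r\<close>. The monomial
  of degree \<open>i\<close> there is the generating function kernel with argument
  \<open>(1/2) ^ i\<close>, so by Weierstrass approximation generating functions at powers of 1/2
  determine point masses.\<close>

lemma point_polynomial:
  assumes "0 < \<delta>" "\<delta> \<le> 1"
  shows "\<exists>(c :: nat \<Rightarrow> real) d. \<forall>r. \<bar>\<Sum>i\<le>d. c i * ((1/2) ^ r) ^ i\<bar> \<le> 1 \<and>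
    \<bar>(\<Sum>i\<le>d. c i * ((1/2) ^ r) ^ i) - (if r = q then 1 else 0)\<bar> \<le> 2 * \<delta>"
proof -
  \<comment> \<open>A tent around \<open>(1/2) ^ q\<close> whose half-width is the distance to the
    nearest other code, \<open>(1/2) ^ Suc q\<close>. The height \<open>1 - \<delta>\<close> keeps
    the approximating polynomial between -1 and 1 at all codes.\<close>
  define f where "f = (\<lambda>x::real. (1 - \<delta>) * max 0 (1 - \<bar>x - (1/2) ^ q\<bar> * 2 ^ Suc q))"
  have "continuous_on {0..1} f" unfolding f_def by (intro continuous_intros)
  then obtain g where g: "real_polynomial_function g" "\<And>x. x \<in> {0..1} \<Longrightarrow> \<bar>f x - g x\<bar> < \<delta>"
    using Stone_Weierstrass_real_polynomial_function[of "{0..1::real}" f \<delta>] assms by auto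
  obtain c d where cd: "g = (\<lambda>x. \<Sum>i\<le>d. c i * x ^ i)" using g(1) real_polynomial_function_iff_sum by blast
  have "f ((1/2) ^ r) = (if r = q then 1 - \<delta> else 0)" for r
  proof (cases r q rule: linorder_cases)
    case less
    have "(1/2 :: real) ^ q \<le> (1/2) ^ Suc r" using less by (intro power_decreasing) auto
    hence "(1/2 :: real) ^ r - (1/2) ^ q \<ge> (1/2) ^ q" by simp
    hence "(1/2 :: real) ^ q \<le> \<bar>(1/2 :: real) ^ r - (1/2) ^ q\<bar>" by linarith
    hence "(1/2) ^ q * 2 ^ Suc q \<le> \<bar>(1/2 :: real) ^ r - (1/2) ^ q\<bar> * 2 ^ Suc q" by (rule mult_right_mono) simp
    moreover have "(1/2 :: real) ^ q * 2 ^ Suc q = 2" by (simp add: power_divide)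
    ultimately have "1 - \<bar>(1/2 :: real) ^ r - (1/2) ^ q\<bar> * 2 ^ Suc q \<le> 0" by linarith
    hence "max 0 (1 - \<bar>(1/2 :: real) ^ r - (1/2) ^ q\<bar> * 2 ^ Suc q) = 0" by (rule max_absorb1)
    thus ?thesis using less unfolding f_def by (simp only: mult_zero_right) simp
  next
    case greater
    have "(1/2 :: real) ^ r \<le> (1/2) ^ Suc q" using greater by (intro power_decreasing) auto
    moreover have "(1/2 :: real) ^ q = 2 * (1/2) ^ Suc q" by simp
    ultimately have "(1/2 :: real) ^ Suc q \<le> \<bar>(1/2 :: real) ^ r - (1/2) ^ q\<bar>" by linarith
    hence "(1/2) ^ Suc q * 2 ^ Suc q \<le> \<bar>(1/2 :: real) ^ r - (1/2) ^ q\<bar> * 2 ^ Suc q" by (rule mult_right_mono) simp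
    moreover have "(1/2 :: real) ^ Suc q * 2 ^ Suc q = 1" by (simp add: power_divide)
    ultimately have "1 - \<bar>(1/2 :: real) ^ r - (1/2) ^ q\<bar> * 2 ^ Suc q \<le> 0" by linarith
    hence "max 0 (1 - \<bar>(1/2 :: real) ^ r - (1/2) ^ q\<bar> * 2 ^ Suc q) = 0" by (rule max_absorb1)
    thus ?thesis using greater unfolding f_def by (simp only: mult_zero_right) simp
  qed (simp add: f_def)
  moreover have "(1/2 :: real) ^ r \<in> {0..1}" for r by (simp add: power_le_one)
  ultimately have "\<bar>(if r = q then 1 - \<delta> else 0) - g ((1/2) ^ r)\<bar> < \<delta>" for r using g(2) by metis
  note gd = this
  have "\<bar>g ((1/2) ^ r)\<bar> \<le> 1 \<and> \<bar>g ((1/2) ^ r) - (if r = q then 1 else 0)\<bar> \<le> 2 * \<delta>" for r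
  proof (cases "r = q")
    case True
    have "\<bar>(1 - \<delta>) - g ((1/2) ^ r)\<bar> < \<delta>" using gd[of r] by (simp only: if_P[OF True])
    hence "\<bar>g ((1/2) ^ r)\<bar> \<le> 1 \<and> \<bar>g ((1/2) ^ r) - 1\<bar> \<le> 2 * \<delta>" using assms by linarith
    thus ?thesis by (simp only: if_P[OF True])
  next
    case False
    have "\<bar>0 - g ((1/2) ^ r)\<bar> < \<delta>" using gd[of r] by (simp only: if_not_P[OF False])
    hence "\<bar>g ((1/2) ^ r)\<bar> \<le> 1 \<and> \<bar>g ((1/2) ^ r) - 0\<bar> \<le> 2 * \<delta>" using assms by linarith
    thus ?thesis by (simp only: if_not_P[OF False])
  qed
  thus ?thesis unfolding cd by blast
qed

lemma (in prob_space) gf_indicator_approx: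
  fixes N :: "'a \<Rightarrow> 'j \<Rightarrow> nat" and c :: "'j \<Rightarrow> nat \<Rightarrow> real"
  assumes J: "finite J" and N [measurable]: "\<And>j. j \<in> J \<Longrightarrow> (\<lambda>\<omega>. N \<omega> j) \<in> measurable M (count_space UNIV)"
    and p1: "\<And>j r. j \<in> J \<Longrightarrow> \<bar>\<Sum>i\<le>d j. c j i * ((1/2) ^ r) ^ i\<bar> \<le> 1"
    and p2: "\<And>j r. j \<in> J \<Longrightarrow> \<bar>(\<Sum>i\<le>d j. c j i * ((1/2) ^ r) ^ i) - (if r = q j then 1 else 0)\<bar> \<le> \<delta>"
  shows "\<bar>prob {\<omega> \<in> space M. \<forall>j\<in>J. N \<omega> j = q j} -
     (\<Sum>g\<in>PiE J (\<lambda>j. {..d j}). (\<Prod>j\<in>J. c j (g j)) * expectation (\<lambda>\<omega>. \<Prod>j\<in>J. ((1/2) ^ g j) ^ N \<omega> j))\<bar> \<le> real (card J) * \<delta>"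
proof -
  let ?p = "\<lambda>j r. \<Sum>i\<le>d j. c j i * ((1/2 :: real) ^ r) ^ i"
  let ?E = "{\<omega> \<in> space M. \<forall>j\<in>J. N \<omega> j = q j}"
  have E: "?E \<in> events" using J by measurable
  have pm: "(\<lambda>\<omega>. ?p j (N \<omega> j)) \<in> borel_measurable M" if "j \<in> J" for j
    by (rule measurable_compose[OF N[OF that]]) simp
  have gm: "(\<lambda>\<omega>. ((1/2 :: real) ^ g j) ^ N \<omega> j) \<in> borel_measurable M" if "j \<in> J" for j and g :: "'j \<Rightarrow> nat"
    by (rule measurable_compose[OF N[OF that]]) simp
  have gi: "integrable M (\<lambda>\<omega>. \<Prod>j\<in>J. ((1/2 :: real) ^ g j) ^ N \<omega> j)" for g
  proof (rule integrable_const_bound[of _ 1])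
    show "AE \<omega> in M. norm (\<Prod>j\<in>J. ((1/2 :: real) ^ g j) ^ N \<omega> j) \<le> 1"
      by (intro AE_I2) (auto simp: abs_prod intro!: prod_le_1 power_le_one)
  qed (intro borel_measurable_prod gm)
  have expand: "(\<Prod>j\<in>J. ?p j (N \<omega> j)) = (\<Sum>g\<in>PiE J (\<lambda>j. {..d j}). (\<Prod>j\<in>J. c j (g j)) * (\<Prod>j\<in>J. ((1/2) ^ g j) ^ N \<omega> j))" for \<omega>
  proof -
    have "(\<Prod>j\<in>J. ?p j (N \<omega> j)) = (\<Sum>g\<in>PiE J (\<lambda>j. {..d j}). \<Prod>j\<in>J. c j (g j) * ((1/2) ^ N \<omega> j) ^ g j)"
      using J by (intro prod_sum_PiE) auto
    also have "\<dots> = (\<Sum>g\<in>PiE J (\<lambda>j. {..d j}). (\<Prod>j\<in>J. c j (g j)) * (\<Prod>j\<in>J. ((1/2) ^ g j) ^ N \<omega> j))"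
      by (intro sum.cong refl) (simp add: prod.distrib power_mult[symmetric] mult.commute)
    finally show ?thesis .
  qed
  have pi: "integrable M (\<lambda>\<omega>. \<Prod>j\<in>J. ?p j (N \<omega> j))" unfolding expand using gi by simp
  have ex: "(\<Sum>g\<in>PiE J (\<lambda>j. {..d j}). (\<Prod>j\<in>J. c j (g j)) * expectation (\<lambda>\<omega>. \<Prod>j\<in>J. ((1/2) ^ g j) ^ N \<omega> j))
     = expectation (\<lambda>\<omega>. \<Prod>j\<in>J. ?p j (N \<omega> j))"
    unfolding expand using gi by (subst Bochner_Integration.integral_sum) auto
  have "\<bar>prob ?E - expectation (\<lambda>\<omega>. \<Prod>j\<in>J. ?p j (N \<omega> j))\<bar> = \<bar>expectation (\<lambda>\<omega>. indicator ?E \<omega> - (\<Prod>j\<in>J. ?p j (N \<omega> j)))\<bar>"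
    using E pi by (subst Bochner_Integration.integral_diff) (auto simp: emeasure_eq_measure)
  also have "\<dots> \<le> expectation (\<lambda>\<omega>. \<bar>indicator ?E \<omega> - (\<Prod>j\<in>J. ?p j (N \<omega> j))\<bar>)" by (rule integral_abs_bound)
  also have "\<dots> \<le> expectation (\<lambda>_. real (card J) * \<delta>)"
  proof (rule integral_mono)
    show "integrable M (\<lambda>\<omega>. \<bar>indicator ?E \<omega> - (\<Prod>j\<in>J. ?p j (N \<omega> j))\<bar>)"
      using E pi by (intro Bochner_Integration.integrable_abs Bochner_Integration.integrable_diff) (auto simp: emeasure_eq_measure)
    fix \<omega> assume w: "\<omega> \<in> space M"
    have "(indicator ?E \<omega> :: real) = (\<Prod>j\<in>J. if N \<omega> j = q j then 1 else 0)"
    proof (cases "\<forall>j\<in>J. N \<omega> j = q j")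
      case False
      then obtain j where "j \<in> J" "N \<omega> j \<noteq> q j" by blast
      hence "(\<Prod>j\<in>J. if N \<omega> j = q j then 1 else 0 :: real) = 0" using J by (intro prod_zero) auto
      thus ?thesis using False by (auto simp: indicator_def)
    qed (use w in auto)
    also have "norm (\<dots> - (\<Prod>j\<in>J. ?p j (N \<omega> j))) \<le> (\<Sum>j\<in>J. norm ((if N \<omega> j = q j then 1 else 0) - ?p j (N \<omega> j)))"
      using p1 by (intro norm_prod_diff) auto
    also have "\<dots> \<le> (\<Sum>j\<in>J. \<delta>)" using p2 by (intro sum_mono) (auto simp: abs_minus_commute)
    finally show "\<bar>indicator ?E \<omega> - (\<Prod>j\<in>J. ?p j (N \<omega> j))\<bar> \<le> real (card J) * \<delta>" by simp
  qed simp
  finally show ?thesis unfolding ex by (simp add: prob_space)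
qed

lemma gf_continuity:
  fixes N :: "nat \<Rightarrow> 'a \<Rightarrow> 'j \<Rightarrow> nat" and N' :: "'b \<Rightarrow> 'j \<Rightarrow> nat"
  assumes "prob_space M" "prob_space R" and J: "finite J"
    and N: "\<And>n j. j \<in> J \<Longrightarrow> (\<lambda>\<omega>. N n \<omega> j) \<in> measurable M (count_space UNIV)"
    and N': "\<And>j. j \<in> J \<Longrightarrow> (\<lambda>\<omega>. N' \<omega> j) \<in> measurable R (count_space UNIV)"
    and lim: "\<And>a. (\<lambda>n. \<integral>\<omega>. (\<Prod>j\<in>J. ((1/2 :: real) ^ a j) ^ N n \<omega> j) \<partial>M) \<longlonglongrightarrow> (\<integral>\<omega>. (\<Prod>j\<in>J. ((1/2) ^ a j) ^ N' \<omega> j) \<partial>R)"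
  shows "(\<lambda>n. measure M {\<omega> \<in> space M. \<forall>j\<in>J. N n \<omega> j = q j}) \<longlonglongrightarrow> measure R {\<omega> \<in> space R. \<forall>j\<in>J. N' \<omega> j = q j}"
proof (rule LIMSEQ_I)
  fix e :: real assume e: "e > 0"
  interpret M: prob_space M by fact
  interpret R: prob_space R by fact
  define \<delta> where "\<delta> = min 1 (e / (8 * (real (card J) + 1)))"
  have "0 < 8 * (real (card J) + 1)" by simp
  from divide_pos_pos[OF e this] have \<delta>: "0 < \<delta>" "\<delta> \<le> 1" by (simp_all add: \<delta>_def)
  have "\<delta> \<le> e / (8 * (real (card J) + 1))" by (simp add: \<delta>_def)
  hence "(real (card J) + 1) * \<delta> \<le> e / 8" by (simp add: field_simps)
  hence Jd: "real (card J) * (2 * \<delta>) \<le> e / 4" using \<delta> by (simp add: algebra_simps)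
  define Ap where "Ap j c d \<longleftrightarrow> (\<forall>r. \<bar>\<Sum>i\<le>d. c i * ((1/2 :: real) ^ r) ^ i\<bar> \<le> 1 \<and>
    \<bar>(\<Sum>i\<le>d. c i * ((1/2) ^ r) ^ i) - (if r = q j then 1 else 0)\<bar> \<le> 2 * \<delta>)" for j c and d :: nat
  have "\<exists>c d. Ap j c d" for j unfolding Ap_def by (rule point_polynomial[OF \<delta>])
  then obtain c d where cd': "\<And>j. Ap j (c j) (d j)" by metis
  have cd: "\<bar>\<Sum>i\<le>d j. c j i * ((1/2 :: real) ^ r) ^ i\<bar> \<le> 1"
    "\<bar>(\<Sum>i\<le>d j. c j i * ((1/2) ^ r) ^ i) - (if r = q j then 1 else 0)\<bar> \<le> 2 * \<delta>" for j r
    using cd'[of j] unfolding Ap_def by blast+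
  let ?S = "\<lambda>n. \<Sum>g\<in>PiE J (\<lambda>j. {..d j}). (\<Prod>j\<in>J. c j (g j)) * (\<integral>\<omega>. (\<Prod>j\<in>J. ((1/2) ^ g j) ^ N n \<omega> j) \<partial>M)"
  let ?S' = "\<Sum>g\<in>PiE J (\<lambda>j. {..d j}). (\<Prod>j\<in>J. c j (g j)) * (\<integral>\<omega>. (\<Prod>j\<in>J. ((1/2) ^ g j) ^ N' \<omega> j) \<partial>R)"
  have "?S \<longlonglongrightarrow> ?S'" by (intro tendsto_sum tendsto_mult tendsto_const lim)
  hence "eventually (\<lambda>n. \<bar>?S n - ?S'\<bar> < e / 4) sequentially"
    using tendstoD[of ?S ?S' sequentially "e / 4"] e by (simp add: dist_real_def)
  hence "eventually (\<lambda>n. norm (measure M {\<omega> \<in> space M. \<forall>j\<in>J. N n \<omega> j = q j} - measure R {\<omega> \<in> space R. \<forall>j\<in>J. N' \<omega> j = q j}) < e) sequentially"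
  proof eventually_elim
    case (elim n)
    have 1: "\<bar>measure M {\<omega> \<in> space M. \<forall>j\<in>J. N n \<omega> j = q j} - ?S n\<bar> \<le> real (card J) * (2 * \<delta>)"
      by (rule M.gf_indicator_approx[OF J N], assumption) (rule cd)+
    have 2: "\<bar>measure R {\<omega> \<in> space R. \<forall>j\<in>J. N' \<omega> j = q j} - ?S'\<bar> \<le> real (card J) * (2 * \<delta>)"
      by (rule R.gf_indicator_approx[OF J N'], assumption) (rule cd)+
    have "\<bar>measure M {\<omega> \<in> space M. \<forall>j\<in>J. N n \<omega> j = q j} - measure R {\<omega> \<in> space R. \<forall>j\<in>J. N' \<omega> j = q j}\<bar> < e"
      using 1 2 Jd elim e unfolding abs_less_iff abs_le_iff by linarith
    thus ?case by simp
  qed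
  thus "\<exists>no. \<forall>n\<ge>no. norm (measure M {\<omega> \<in> space M. \<forall>j\<in>J. N n \<omega> j = q j} - measure R {\<omega> \<in> space R. \<forall>j\<in>J. N' \<omega> j = q j}) < e"
    by (simp add: eventually_sequentially)
qed

section \<open>Uniform orderings\<close>

definition tuples :: "('k \<Rightarrow> 'v set) \<Rightarrow> (nat \<Rightarrow> 'k) \<Rightarrow> nat \<Rightarrow> (nat \<Rightarrow> 'v) set" where
  "tuples C \<kappa> K = {u \<in> extensional {1..K}. inj_on u {1..K} \<and> (\<forall>i\<in>{1..K}. u i \<in> C (\<kappa> i))}"

text \<open>Entries are chosen one after the other; as the classes are disjoint, only earlier
  entries of the same class occupy places. Natural subtraction returns 0 when a class is exhausted,
  as it should.\<close>

lemma card_tuples: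
  assumes fin: "\<And>k. finite (C k)" and disj: "\<And>k l. k \<noteq> l \<Longrightarrow> C k \<inter> C l = {}"
  shows "finite (tuples C \<kappa> K) \<and>
    card (tuples C \<kappa> K) = (\<Prod>i\<in>{1..K}. card (C (\<kappa> i)) - card {i' \<in> {1..<i}. \<kappa> i' = \<kappa> i})"
proof (induction K)
  case 0
  have "tuples C \<kappa> 0 = {\<lambda>_. undefined}" by (auto simp: tuples_def)
  thus ?case by simp
next
  case (Suc K)
  define F where "F u = C (\<kappa> (Suc K)) - u ` {1..K}" for u
  define T where "T = Sigma (tuples C \<kappa> K) F"
  have cF: "card (F u) = card (C (\<kappa> (Suc K))) - card {i' \<in> {1..<Suc K}. \<kappa> i' = \<kappa> (Suc K)}" if u: "u \<in> tuples C \<kappa> K" for u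
  proof -
    let ?I = "{i' \<in> {1..<Suc K}. \<kappa> i' = \<kappa> (Suc K)}"
    have ui: "inj_on u {1..K}" "\<And>i. i \<in> {1..K} \<Longrightarrow> u i \<in> C (\<kappa> i)" using u by (auto simp: tuples_def)
    have "C (\<kappa> (Suc K)) \<inter> u ` {1..K} = u ` ?I"
    proof (intro equalityI subsetI)
      fix x assume "x \<in> C (\<kappa> (Suc K)) \<inter> u ` {1..K}"
      then obtain i where i: "i \<in> {1..K}" "x = u i" "x \<in> C (\<kappa> (Suc K))" by auto
      have "\<kappa> i = \<kappa> (Suc K)" using disj[of "\<kappa> i" "\<kappa> (Suc K)"] ui(2)[OF i(1)] i by auto
      thus "x \<in> u ` ?I" using i by auto
    next
      fix x assume "x \<in> u ` ?I"
      then obtain i where i: "i \<in> ?I" "x = u i" by auto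
      hence "i \<in> {1..K}" by auto
      thus "x \<in> C (\<kappa> (Suc K)) \<inter> u ` {1..K}" using ui(2)[of i] i by auto
    qed
    hence "F u = C (\<kappa> (Suc K)) - u ` ?I" unfolding F_def by blast
    moreover have "u ` ?I \<subseteq> C (\<kappa> (Suc K))" using \<open>C (\<kappa> (Suc K)) \<inter> u ` {1..K} = u ` ?I\<close> by blast
    moreover have "card (u ` ?I) = card ?I" by (intro card_image inj_on_subset[OF ui(1)]) auto
    ultimately show ?thesis by (simp add: card_Diff_subset)
  qed
  have finF: "finite (F u)" for u unfolding F_def using fin by simp
  have bij: "bij_betw (\<lambda>(u, x). u(Suc K := x)) T (tuples C \<kappa> (Suc K))"
  proof (rule bij_betw_byWitness[where f' = "\<lambda>v. (restrict v {1..K}, v (Suc K))"])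
    show "\<forall>a\<in>T. (\<lambda>v. (restrict v {1..K}, v (Suc K))) ((\<lambda>(u, x). u(Suc K := x)) a) = a"
      by (auto simp: T_def tuples_def fun_eq_iff restrict_def extensional_def)
    show "\<forall>v\<in>tuples C \<kappa> (Suc K). (\<lambda>(u, x). u(Suc K := x)) (restrict v {1..K}, v (Suc K)) = v"
    proof
      fix v assume v: "v \<in> tuples C \<kappa> (Suc K)"
      have "((restrict v {1..K})(Suc K := v (Suc K))) i = v i" for i
      proof (cases "i \<in> {1..Suc K}")
        case False
        hence "v i = undefined" using v by (auto simp: tuples_def extensional_def)
        thus ?thesis using False by auto
      qed (auto simp: restrict_def)
      thus "(\<lambda>(u, x). u(Suc K := x)) (restrict v {1..K}, v (Suc K)) = v" by auto
    qed
    show "(\<lambda>(u, x). u(Suc K := x)) ` T \<subseteq> tuples C \<kappa> (Suc K)"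
    proof
      fix v assume "v \<in> (\<lambda>(u, x). u(Suc K := x)) ` T"
      then obtain u x where ux: "u \<in> tuples C \<kappa> K" "x \<in> F u" and v: "v = u(Suc K := x)" by (auto simp: T_def)
      have 1: "{1..Suc K} = insert (Suc K) {1..K}" by auto
      have u: "u \<in> extensional {1..K}" "inj_on u {1..K}" "\<And>i. i \<in> {1..K} \<Longrightarrow> u i \<in> C (\<kappa> i)"
        and x: "x \<in> C (\<kappa> (Suc K))" "x \<notin> u ` {1..K}" using ux unfolding tuples_def F_def by blast+
      have vi: "v i = u i" if "i \<in> {1..K}" for i using that by (simp add: v)
      have "v ` {1..K} = u ` {1..K}" using vi by (intro image_cong refl)
      moreover have "inj_on v {1..K}" using u(2) vi inj_on_cong[of "{1..K}" v u] by blast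
      moreover have "{1..K} - {Suc K} = {1..K}" by auto
      ultimately have "inj_on v {1..Suc K}"
        unfolding 1 inj_on_insert using x(2) by (simp add: v)
      moreover have "v \<in> extensional {1..Suc K}" using u(1) unfolding v extensional_def by auto
      moreover have "v (Suc K) \<in> C (\<kappa> (Suc K))" using x(1) by (simp add: v)
      with u(3) vi have "\<forall>i\<in>{1..Suc K}. v i \<in> C (\<kappa> i)" unfolding 1 by simp
      ultimately show "v \<in> tuples C \<kappa> (Suc K)" unfolding tuples_def by blast
    qed
    show "(\<lambda>v. (restrict v {1..K}, v (Suc K))) ` tuples C \<kappa> (Suc K) \<subseteq> T"
    proof
      fix a assume "a \<in> (\<lambda>v. (restrict v {1..K}, v (Suc K))) ` tuples C \<kappa> (Suc K)"
      then obtain v where v: "v \<in> tuples C \<kappa> (Suc K)" and a: "a = (restrict v {1..K}, v (Suc K))" by auto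
      have inj: "inj_on v {1..Suc K}" using v by (simp add: tuples_def)
      have "restrict v {1..K} \<in> tuples C \<kappa> K"
        using v inj_on_subset[OF inj, of "{1..K}"] by (simp add: tuples_def)
      moreover have "v (Suc K) \<noteq> v i" if "i \<in> {1..K}" for i
        using inj_onD[OF inj, of "Suc K" i] that by auto
      hence "v (Suc K) \<notin> restrict v {1..K} ` {1..K}" by (simp add: image_iff)
      hence "v (Suc K) \<in> F (restrict v {1..K})" using v by (simp add: F_def tuples_def)
      ultimately show "a \<in> T" unfolding a T_def by auto
    qed
  qed
  have finT: "finite T" unfolding T_def using Suc finF by auto
  have "card T = (\<Sum>u\<in>tuples C \<kappa> K. card (F u))" unfolding T_def using Suc finF by (intro card_SigmaI) auto
  also have "\<dots> = card (tuples C \<kappa> K) * (card (C (\<kappa> (Suc K))) - card {i' \<in> {1..<Suc K}. \<kappa> i' = \<kappa> (Suc K)})"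
    using cF by simp
  also have "\<dots> = (\<Prod>i\<in>{1..Suc K}. card (C (\<kappa> i)) - card {i' \<in> {1..<i}. \<kappa> i' = \<kappa> i})"
    using Suc by (simp add: prod.cl_ivl_Suc)
  finally show ?case using bij_betw_same_card[OF bij] bij_betw_finite[OF bij] finT by simp
qed

section \<open>Orderings by decreasing degree and their initial segments\<close>

definition orderings :: "nat \<Rightarrow> (nat \<Rightarrow> nat) \<Rightarrow> (nat \<Rightarrow> nat) set" where
  "orderings n dg = {p \<in> extensional {1..n}. bij_betw p {1..n} {1..n} \<and>
     (\<forall>i\<in>{1..n}. \<forall>j\<in>{1..n}. i \<le> j \<longrightarrow> dg (p j) \<le> dg (p i))}"

lemma degree_orderings_wrt: "degree_orderings (wrt_graph f n) = orderings n (in_degree (wrt_graph f n))"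
  by (simp add: degree_orderings_def orderings_def wrt_graph_def)

lemma finite_orderings: "finite (orderings n dg)"
proof (rule finite_subset)
  show "orderings n dg \<subseteq> PiE {1..n} (\<lambda>_. {1..n})"
    by (auto simp: orderings_def PiE_def dest: bij_betwE)
qed (intro finite_PiE, auto)

lemma orderings_nonempty: "orderings n dg \<noteq> {}"
proof -
  define xs where "xs = sort_key (\<lambda>x. - int (dg x)) [1..<Suc n]"
  have xs: "distinct xs" "set xs = {1..n}" "length xs = n" "sorted (map (\<lambda>x. - int (dg x)) xs)"
    unfolding xs_def by (auto simp: atLeastLessThanSuc_atLeastAtMost simp del: upt_Suc)
  define p where "p = (\<lambda>i\<in>{1..n}. xs ! (i - 1))"
  have "bij_betw (\<lambda>i. i - 1) {1..n} {..<n}"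
    by (rule bij_betw_byWitness[where f' = Suc]) auto
  moreover have "bij_betw ((!) xs) {..<n} {1..n}" using bij_betw_nth[OF xs(1)] xs by auto
  ultimately have "bij_betw ((!) xs \<circ> (\<lambda>i. i - 1)) {1..n} {1..n}" by (rule bij_betw_trans)
  hence "bij_betw p {1..n} {1..n}" by (rule bij_betw_cong[THEN iffD1, rotated]) (simp add: p_def)
  moreover have "dg (p j) \<le> dg (p i)" if "i \<in> {1..n}" "j \<in> {1..n}" "i \<le> j" for i j
    using sorted_nth_mono[OF xs(4), of "i - 1" "j - 1"] that xs(3) by (auto simp: p_def)
  ultimately have "p \<in> orderings n dg" by (auto simp: orderings_def p_def)
  thus ?thesis by blast
qed

text \<open>The positions of degree at least \<open>l\<close> form an initial segment, whose length
  is the number of such vertices. The degrees at the top ranks are thus functions of the counts, the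
  same for all orderings.\<close>

lemma ordering_degree_ge_iff:
  assumes p: "p \<in> orderings n dg" and i: "i \<in> {1..n}"
  shows "l \<le> dg (p i) \<longleftrightarrow> i \<le> card {x \<in> {1..n}. l \<le> dg x}"
proof -
  have bij: "bij_betw p {1..n} {1..n}" and mono: "\<And>i j. i \<in> {1..n} \<Longrightarrow> j \<in> {1..n} \<Longrightarrow> i \<le> j \<Longrightarrow> dg (p j) \<le> dg (p i)"
    using p by (auto simp: orderings_def)
  define A where "A = {i \<in> {1..n}. l \<le> dg (p i)}"
  have "p ` A = {x \<in> p ` {1..n}. l \<le> dg x}" unfolding A_def by blast
  hence "p ` A = {x \<in> {1..n}. l \<le> dg x}" by (simp only: bij_betw_imp_surj_on[OF bij])
  moreover have "inj_on p A" using bij_betw_imp_inj_on[OF bij] by (rule inj_on_subset) (auto simp: A_def)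
  ultimately have cA: "card {x \<in> {1..n}. l \<le> dg x} = card A" using card_image by metis
  show ?thesis unfolding cA
  proof
    assume "l \<le> dg (p i)"
    have "{1..i} \<subseteq> A"
    proof
      fix i' assume "i' \<in> {1..i}"
      hence i': "i' \<in> {1..n}" "i' \<le> i" using i by auto
      show "i' \<in> A" using mono[of i' i, OF i'(1) i i'(2)] \<open>l \<le> dg (p i)\<close> i'(1) by (simp add: A_def)
    qed
    hence "card {1..i} \<le> card A" by (rule card_mono[rotated]) (simp add: A_def)
    thus "i \<le> card A" by simp
  next
    assume le: "i \<le> card A"
    show "l \<le> dg (p i)"
    proof (rule ccontr)
      assume nl: "\<not> l \<le> dg (p i)"
      have "A \<subseteq> {1..<i}"
      proof
        fix a assume a: "a \<in> A"
        hence a1: "a \<in> {1..n}" "l \<le> dg (p a)" by (auto simp: A_def)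
        have "\<not> i \<le> a" using mono[OF i a1(1)] a1(2) nl by linarith
        thus "a \<in> {1..<i}" using a1 by auto
      qed
      hence "card A \<le> card {1..<i}" by (rule card_mono[rotated]) simp
      thus False using le i by auto
    qed
  qed
qed

text \<open>The permutation for \<open>K\<close> entries is followed by the transposition of the
  present image and the desired image of the next entry. Both have the same degree, and injectivity
  leaves the earlier images fixed.\<close>

lemma degree_preserving_permutation:
  fixes dg u u' :: "nat \<Rightarrow> nat"
  assumes "inj_on u {1..K}" "inj_on u' {1..K}"
    and "\<And>i. i \<in> {1..K} \<Longrightarrow> u i \<in> A \<and> u' i \<in> A \<and> dg (u i) = dg (u' i)"
  shows "\<exists>\<pi>. bij_betw \<pi> A A \<and> (\<forall>x\<in>A. dg (\<pi> x) = dg x) \<and> (\<forall>i\<in>{1..K}. \<pi> (u i) = u' i)"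
  using assms
proof (induction K)
  case 0
  show ?case by (intro exI[of _ "\<lambda>x. x"]) (auto simp: bij_betw_def)
next
  case (Suc K)
  have "inj_on u {1..K}" "inj_on u' {1..K}" using Suc.prems(1,2) by (auto elim: inj_on_subset)
  then obtain \<pi> where \<pi>: "bij_betw \<pi> A A" "\<forall>x\<in>A. dg (\<pi> x) = dg x" "\<forall>i\<in>{1..K}. \<pi> (u i) = u' i"
    using Suc.IH Suc.prems(3) by fastforce
  let ?y = "\<pi> (u (Suc K))" and ?z = "u' (Suc K)"
  have uA: "u (Suc K) \<in> A" "?z \<in> A" "dg (u (Suc K)) = dg ?z" using Suc.prems(3)[of "Suc K"] by auto
  have yA: "?y \<in> A" using bij_betwE[OF \<pi>(1)] uA by blast
  have dyz: "dg ?y = dg ?z" using \<pi>(2) uA by simp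
  define t where "t x = (if x = ?y then ?z else if x = ?z then ?y else x)" for x
  have tb: "bij_betw t A A"
    by (rule bij_betw_byWitness[where f' = t]) (use yA uA in \<open>auto simp: t_def\<close>)
  have "bij_betw (t \<circ> \<pi>) A A" by (rule bij_betw_trans[OF \<pi>(1) tb])
  moreover have "dg (t x) = dg x" for x using dyz by (simp add: t_def)
  hence "\<forall>x\<in>A. dg ((t \<circ> \<pi>) x) = dg x" using \<pi>(2) by simp
  moreover have "\<forall>i\<in>{1..Suc K}. (t \<circ> \<pi>) (u i) = u' i"
  proof
    fix i assume i: "i \<in> {1..Suc K}"
    show "(t \<circ> \<pi>) (u i) = u' i"
    proof (cases "i = Suc K")
      case False
      hence i': "i \<in> {1..K}" using i by auto
      have "u i \<noteq> u (Suc K)" using inj_onD[OF Suc.prems(1), of i "Suc K"] i False by auto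
      hence "\<pi> (u i) \<noteq> ?y" using inj_onD[OF bij_betw_imp_inj_on[OF \<pi>(1)], of "u i" "u (Suc K)"] Suc.prems(3)[OF i] uA by blast
      moreover have "u' i \<noteq> ?z" using inj_onD[OF Suc.prems(2), of i "Suc K"] i False by auto
      ultimately show ?thesis using \<pi>(3) i' by (simp add: t_def)
    qed (simp add: t_def)
  qed
  ultimately show ?case by blast
qed

definition degree_tuples :: "nat \<Rightarrow> (nat \<Rightarrow> nat) \<Rightarrow> (nat \<Rightarrow> nat) \<Rightarrow> nat \<Rightarrow> (nat \<Rightarrow> nat) set" where
  "degree_tuples n dg \<delta> K = tuples (\<lambda>d. {x \<in> {1..n}. dg x = d}) \<delta> K"

lemma finite_degree_tuples: "finite (degree_tuples n dg \<delta> K)"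
  unfolding degree_tuples_def using card_tuples[of "\<lambda>d. {x \<in> {1..n}. dg x = d}" \<delta> K] by auto

text \<open>A degree-preserving permutation maps the orderings that start with one tuple injectively
  into those that start with another, so all these fibres have the same size. Cross-multiplication
  avoids quotients by cardinalities that may be 0.\<close>

lemma orderings_over_tuples:
  assumes K: "K \<le> n" and B: "B \<subseteq> degree_tuples n dg \<delta> K"
  shows "card {p \<in> orderings n dg. restrict p {1..K} \<in> B} * card (degree_tuples n dg \<delta> K) =
     card B * card {p \<in> orderings n dg. restrict p {1..K} \<in> degree_tuples n dg \<delta> K}"
proof -
  let ?V = "degree_tuples n dg \<delta> K"
  define fib where "fib u = {p \<in> orderings n dg. restrict p {1..K} = u}" for u
  have ffib: "finite (fib u)" for u unfolding fib_def using finite_orderings by simp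
  have le: "card (fib u) \<le> card (fib u')" if u: "u \<in> ?V" and u': "u' \<in> ?V" for u u'
  proof -
    have U: "inj_on u {1..K}" "inj_on u' {1..K}" "u \<in> extensional {1..K}" "u' \<in> extensional {1..K}"
      "\<And>i. i \<in> {1..K} \<Longrightarrow> u i \<in> {1..n} \<and> u' i \<in> {1..n} \<and> dg (u i) = dg (u' i)"
      using u u' by (auto simp: degree_tuples_def tuples_def)
    obtain \<pi> where \<pi>: "bij_betw \<pi> {1..n} {1..n}" "\<forall>x\<in>{1..n}. dg (\<pi> x) = dg x" "\<forall>i\<in>{1..K}. \<pi> (u i) = u' i"
      using degree_preserving_permutation[OF U(1,2,5)] by blast
    define h where "h p = restrict (\<pi> \<circ> p) {1..n}" for p
    have "inj_on h (fib u)"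
    proof (rule inj_onI)
      fix p q assume p: "p \<in> fib u" and q: "q \<in> fib u" and pq: "h p = h q"
      have ex: "p \<in> extensional {1..n}" "q \<in> extensional {1..n}" "bij_betw p {1..n} {1..n}" "bij_betw q {1..n} {1..n}"
        using p q by (auto simp: fib_def orderings_def)
      show "p = q"
      proof (rule extensionalityI[OF ex(1,2)])
        fix x assume x: "x \<in> {1..n}"
        have "\<pi> (p x) = \<pi> (q x)" using fun_cong[OF pq, of x] x by (simp add: h_def)
        thus "p x = q x" using bij_betw_imp_inj_on[OF \<pi>(1)] bij_betwE[OF ex(3)] bij_betwE[OF ex(4)] x by (auto dest: inj_onD)
      qed
    qed
    moreover have "h ` fib u \<subseteq> fib u'"
    proof
      fix p' assume "p' \<in> h ` fib u"
      then obtain p where p: "p \<in> fib u" and p': "p' = h p" by auto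
      have po: "p \<in> extensional {1..n}" "bij_betw p {1..n} {1..n}"
        "\<And>i j. i \<in> {1..n} \<Longrightarrow> j \<in> {1..n} \<Longrightarrow> i \<le> j \<Longrightarrow> dg (p j) \<le> dg (p i)" and pu: "restrict p {1..K} = u"
        using p by (auto simp: fib_def orderings_def)
      have pA: "p i \<in> {1..n}" if "i \<in> {1..n}" for i using bij_betwE[OF po(2)] that by blast
      have "bij_betw (\<pi> \<circ> p) {1..n} {1..n}" by (rule bij_betw_trans[OF po(2) \<pi>(1)])
      hence "bij_betw (h p) {1..n} {1..n}" by (rule bij_betw_cong[THEN iffD1, rotated]) (simp add: h_def)
      moreover have "dg (h p i) = dg (p i)" if "i \<in> {1..n}" for i using \<pi>(2) pA[OF that] that by (simp add: h_def)
      ultimately have "h p \<in> orderings n dg" using po(3) by (auto simp: orderings_def h_def)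
      moreover have "restrict (h p) {1..K} = u'"
      proof (rule extensionalityI[OF restrict_extensional U(4)])
        fix i assume i: "i \<in> {1..K}"
        have "p i = u i" using fun_cong[OF pu, of i] i by simp
        thus "restrict (h p) {1..K} i = u' i" using i K \<pi>(3) by (simp add: h_def)
      qed
      ultimately show "p' \<in> fib u'" by (simp add: p' fib_def)
    qed
    ultimately show ?thesis using ffib by (intro card_inj_on_le) auto
  qed
  have total: "card {p \<in> orderings n dg. restrict p {1..K} \<in> B'} = (\<Sum>u\<in>B'. card (fib u))" if B': "B' \<subseteq> ?V" for B'
  proof -
    have "{p \<in> orderings n dg. restrict p {1..K} \<in> B'} = (\<Union>u\<in>B'. fib u)" by (auto simp: fib_def)
    moreover have "finite B'" using B' finite_degree_tuples finite_subset by blast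
    ultimately show ?thesis using ffib by (simp only:) (intro card_UN_disjoint, auto simp: fib_def)
  qed
  show ?thesis
  proof (cases "?V = {}")
    case True
    thus ?thesis using B by simp
  next
    case False
    then obtain u0 where u0: "u0 \<in> ?V" by blast
    have c: "card (fib u) = card (fib u0)" if "u \<in> ?V" for u using le[OF that u0] le[OF u0 that] by simp
    have "card {p \<in> orderings n dg. restrict p {1..K} \<in> B'} = card B' * card (fib u0)" if "B' \<subseteq> ?V" for B'
      unfolding total[OF that] using c that by (simp add: subset_iff)
    from this[OF B] this[OF order.refl] show ?thesis by simp
  qed
qed

text \<open>Here \<open>c (r, \<beta>)\<close> counts the items of level at least \<open>r\<close> in cell \<open>\<beta>\<close>. The value is the probability that a
  uniform ordering by decreasing level starts with the levels \<open>\<rho> 1, \<dots>, \<rho> K\<close> and the cells \<open>b 1, \<dots>, b K\<close>;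
  the minimum with 1 only keeps the function bounded at families \<open>c\<close> that are not of this kind.\<close>

definition pattern_weight :: "'b set \<Rightarrow> nat \<Rightarrow> (nat \<Rightarrow> nat) \<Rightarrow> (nat \<Rightarrow> 'b) \<Rightarrow> (nat \<times> 'b \<Rightarrow> nat) \<Rightarrow> real" where
  "pattern_weight B K \<rho> b c = min 1 (if \<forall>i\<in>{1..K}. i \<le> (\<Sum>\<beta>\<in>B. c (\<rho> i, \<beta>)) \<and> (\<Sum>\<beta>\<in>B. c (Suc (\<rho> i), \<beta>)) < i
     then real (\<Prod>i\<in>{1..K}. c (\<rho> i, b i) - c (Suc (\<rho> i), b i) - card {i' \<in> {1..<i}. (\<rho> i', b i') = (\<rho> i, b i)}) /
          real (\<Prod>i\<in>{1..K}. (\<Sum>\<beta>\<in>B. c (\<rho> i, \<beta>)) - (\<Sum>\<beta>\<in>B. c (Suc (\<rho> i), \<beta>)) - card {i' \<in> {1..<i}. \<rho> i' = \<rho> i})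
     else 0)"

lemma pattern_weight_bound: "\<bar>pattern_weight B K \<rho> b c\<bar> \<le> 1"
proof -
  have "\<bar>min 1 (if C then real x / real y else 0)\<bar> \<le> 1" for C and x y :: nat by simp
  thus ?thesis unfolding pattern_weight_def by this
qed

lemma pattern_weight_cong:
  assumes "\<And>i \<beta>. i \<in> {1..K} \<Longrightarrow> \<beta> \<in> B \<Longrightarrow> c (\<rho> i, \<beta>) = c' (\<rho> i, \<beta>) \<and> c (Suc (\<rho> i), \<beta>) = c' (Suc (\<rho> i), \<beta>)"
    and "\<And>i. i \<in> {1..K} \<Longrightarrow> b i \<in> B"
  shows "pattern_weight B K \<rho> b c = pattern_weight B K \<rho> b c'"
proof -
  have 1: "(\<Sum>\<beta>\<in>B. c (\<rho> i, \<beta>)) = (\<Sum>\<beta>\<in>B. c' (\<rho> i, \<beta>))" "(\<Sum>\<beta>\<in>B. c (Suc (\<rho> i), \<beta>)) = (\<Sum>\<beta>\<in>B. c' (Suc (\<rho> i), \<beta>))"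
    "c (\<rho> i, b i) = c' (\<rho> i, b i)" "c (Suc (\<rho> i), b i) = c' (Suc (\<rho> i), b i)" if "i \<in> {1..K}" for i
    using assms(1)[OF that] assms(2)[OF that] by (auto intro!: sum.cong)
  show ?thesis unfolding pattern_weight_def by (simp only: 1 cong: prod.cong ball_cong)
qed

text \<open>Levels are integers here so that the lemma serves both the degrees of the tree and the
  floors of the Poisson points.\<close>

lemma tuple_proportion:
  fixes lev :: "nat \<Rightarrow> int" and cl :: "nat \<Rightarrow> 'b"
  assumes A: "finite A" and B: "finite B" "cl ` A \<subseteq> B"
    and c: "\<And>r \<beta>. c (r, \<beta>) = card {x \<in> A. lo + int r \<le> lev x \<and> cl x = \<beta>}"
  shows "(\<Sum>\<beta>\<in>B. c (r, \<beta>)) = card {x \<in> A. lo + int r \<le> lev x}"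
    and "card (tuples (\<lambda>r. {x \<in> A. lev x = lo + int r}) \<rho> K) =
       (\<Prod>i\<in>{1..K}. (\<Sum>\<beta>\<in>B. c (\<rho> i, \<beta>)) - (\<Sum>\<beta>\<in>B. c (Suc (\<rho> i), \<beta>)) - card {i' \<in> {1..<i}. \<rho> i' = \<rho> i})"
    and "card (tuples (\<lambda>(r, \<beta>). {x \<in> A. lev x = lo + int r \<and> cl x = \<beta>}) (\<lambda>i. (\<rho> i, b i)) K) =
       (\<Prod>i\<in>{1..K}. c (\<rho> i, b i) - c (Suc (\<rho> i), b i) - card {i' \<in> {1..<i}. (\<rho> i', b i') = (\<rho> i, b i)})"
proof -
  show s: "(\<Sum>\<beta>\<in>B. c (r, \<beta>)) = card {x \<in> A. lo + int r \<le> lev x}" for r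
  proof -
    have "{x \<in> A. lo + int r \<le> lev x} = (\<Union>\<beta>\<in>B. {x \<in> A. lo + int r \<le> lev x \<and> cl x = \<beta>})" using B(2) by auto
    moreover have "card (\<Union>\<beta>\<in>B. {x \<in> A. lo + int r \<le> lev x \<and> cl x = \<beta>}) = (\<Sum>\<beta>\<in>B. card {x \<in> A. lo + int r \<le> lev x \<and> cl x = \<beta>})"
      using A B(1) by (intro card_UN_disjoint) auto
    ultimately show ?thesis by (simp add: c)
  qed
  have e1: "card {x \<in> A. lev x = lo + int r} = (\<Sum>\<beta>\<in>B. c (r, \<beta>)) - (\<Sum>\<beta>\<in>B. c (Suc r, \<beta>))" for r
  proof -
    have "{x \<in> A. lev x = lo + int r} = {x \<in> A. lo + int r \<le> lev x} - {x \<in> A. lo + int (Suc r) \<le> lev x}" by auto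
    moreover have "card ({x \<in> A. lo + int r \<le> lev x} - {x \<in> A. lo + int (Suc r) \<le> lev x}) = card {x \<in> A. lo + int r \<le> lev x} - card {x \<in> A. lo + int (Suc r) \<le> lev x}"
      using A by (intro card_Diff_subset) auto
    ultimately show ?thesis unfolding s by simp
  qed
  have e2: "card {x \<in> A. lev x = lo + int r \<and> cl x = \<beta>} = c (r, \<beta>) - c (Suc r, \<beta>)" for r \<beta>
  proof -
    have "{x \<in> A. lev x = lo + int r \<and> cl x = \<beta>} = {x \<in> A. lo + int r \<le> lev x \<and> cl x = \<beta>} - {x \<in> A. lo + int (Suc r) \<le> lev x \<and> cl x = \<beta>}" by auto
    moreover have "card ({x \<in> A. lo + int r \<le> lev x \<and> cl x = \<beta>} - {x \<in> A. lo + int (Suc r) \<le> lev x \<and> cl x = \<beta>}) =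
        card {x \<in> A. lo + int r \<le> lev x \<and> cl x = \<beta>} - card {x \<in> A. lo + int (Suc r) \<le> lev x \<and> cl x = \<beta>}"
      using A by (intro card_Diff_subset) auto
    ultimately show ?thesis unfolding c by simp
  qed
  show "card (tuples (\<lambda>r. {x \<in> A. lev x = lo + int r}) \<rho> K) =
       (\<Prod>i\<in>{1..K}. (\<Sum>\<beta>\<in>B. c (\<rho> i, \<beta>)) - (\<Sum>\<beta>\<in>B. c (Suc (\<rho> i), \<beta>)) - card {i' \<in> {1..<i}. \<rho> i' = \<rho> i})"
    unfolding e1[symmetric] using A by (intro card_tuples[THEN conjunct2]) auto
  have "card (tuples (\<lambda>(r, \<beta>). {x \<in> A. lev x = lo + int r \<and> cl x = \<beta>}) (\<lambda>i. (\<rho> i, b i)) K) =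
    (\<Prod>i\<in>{1..K}. card (case (\<rho> i, b i) of (r, \<beta>) \<Rightarrow> {x \<in> A. lev x = lo + int r \<and> cl x = \<beta>}) - card {i' \<in> {1..<i}. (\<rho> i', b i') = (\<rho> i, b i)})"
  proof (rule card_tuples[THEN conjunct2])
    show "finite (case k of (r, \<beta>) \<Rightarrow> {x \<in> A. lev x = lo + int r \<and> cl x = \<beta>})" for k using A by (cases k) auto
    show "(case k of (r, \<beta>) \<Rightarrow> {x \<in> A. lev x = lo + int r \<and> cl x = \<beta>}) \<inter> (case l of (r, \<beta>) \<Rightarrow> {x \<in> A. lev x = lo + int r \<and> cl x = \<beta>}) = {}"
      if "k \<noteq> l" for k l using that by (cases k; cases l) auto
  qed
  thus "card (tuples (\<lambda>(r, \<beta>). {x \<in> A. lev x = lo + int r \<and> cl x = \<beta>}) (\<lambda>i. (\<rho> i, b i)) K) =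
       (\<Prod>i\<in>{1..K}. c (\<rho> i, b i) - c (Suc (\<rho> i), b i) - card {i' \<in> {1..<i}. (\<rho> i', b i') = (\<rho> i, b i)})"
    by (simp only: prod.case e2)
qed

lemma measurable_nat_binary:
  assumes f: "f \<in> measurable N (count_space UNIV)" and g: "g \<in> measurable N (count_space (UNIV :: nat set))"
  shows "(\<lambda>w. h (f w :: nat) (g w)) \<in> measurable N (count_space (UNIV :: 'c set))"
  by (rule measurable_compose_countable[where f = "\<lambda>i w. h i (g w)" and g = f, OF measurable_compose[OF g] f]) simp

lemma pattern_weight_measurable:
  assumes c: "\<And>k. (\<lambda>w. c w k) \<in> measurable N (count_space UNIV)" and B: "finite B"
  shows "(\<lambda>w. pattern_weight B K \<rho> b (c w)) \<in> borel_measurable N"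
proof -
  have s: "(\<lambda>w. \<Sum>\<beta>\<in>B. c w (r, \<beta>)) \<in> measurable N (count_space UNIV)" for r
    using B
  proof (induction B)
    case (insert x B)
    show ?case using measurable_nat_binary[OF c[of "(r, x)"] insert.IH, of "(+)"] insert.hyps by simp
  qed simp
  have "Measurable.pred N (\<lambda>w. i \<le> (\<Sum>\<beta>\<in>B. c w (\<rho> i, \<beta>)) \<and> (\<Sum>\<beta>\<in>B. c w (Suc (\<rho> i), \<beta>)) < i)" for i
    by (rule measurable_nat_binary[OF s s])
  hence p: "Measurable.pred N (\<lambda>w. \<forall>i\<in>{1..K}. i \<le> (\<Sum>\<beta>\<in>B. c w (\<rho> i, \<beta>)) \<and> (\<Sum>\<beta>\<in>B. c w (Suc (\<rho> i), \<beta>)) < i)"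
    by (intro pred_intros_finite) auto
  have 1: "(\<lambda>w. real (c w (\<rho> i, b i) - c w (Suc (\<rho> i), b i) - k)) \<in> borel_measurable N" for i k
    by (rule measurable_compose[OF measurable_nat_binary[OF c c, where h = "\<lambda>x y. x - y - k"]]) simp
  have 2: "(\<lambda>w. real ((\<Sum>\<beta>\<in>B. c w (\<rho> i, \<beta>)) - (\<Sum>\<beta>\<in>B. c w (Suc (\<rho> i), \<beta>)) - k)) \<in> borel_measurable N" for i k
    by (rule measurable_compose[OF measurable_nat_binary[OF s s, where h = "\<lambda>x y. x - y - k"]]) simp
  show ?thesis unfolding pattern_weight_def of_nat_prod
    by (intro borel_measurable_min measurable_If borel_measurable_const borel_measurable_divide borel_measurable_prod 1 2)
       (use p in \<open>simp add: pred_def\<close>)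
qed

text \<open>The counts decide whether the top ranks have the prescribed levels, so either no
  ordering has them or all do. In the second case the initial tuple is uniform, and the proportion
  is a quotient of two tuple counts.\<close>

lemma ordering_pattern_weight:
  fixes cl :: "nat \<Rightarrow> 'b" and dg :: "nat \<Rightarrow> nat"
  assumes K: "K \<le> n" and B: "finite B" "cl ` {1..n} \<subseteq> B"
  shows "real (card {p \<in> orderings n dg. \<forall>i\<in>{1..K}. dg (p i) = lo + \<rho> i \<and> cl (p i) = b i}) / real (card (orderings n dg)) =
    pattern_weight B K \<rho> b (\<lambda>(r, \<beta>). card {x \<in> {1..n}. lo + r \<le> dg x \<and> cl x = \<beta>})"
proof -
  define c where "c = (\<lambda>(r, \<beta>). card {x \<in> {1..n}. lo + r \<le> dg x \<and> cl x = \<beta>})"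
  have c: "c (r, \<beta>) = card {x \<in> {1..n}. int lo + int r \<le> int (dg x) \<and> cl x = \<beta>}" for r \<beta>
    unfolding c_def by (simp flip: of_nat_add)
  note tp = tuple_proportion[OF finite_atLeastAtMost B, of c "int lo" "\<lambda>x. int (dg x)", OF c]
  let ?O = "orderings n dg"
  let ?A = "{p \<in> ?O. \<forall>i\<in>{1..K}. dg (p i) = lo + \<rho> i \<and> cl (p i) = b i}"
  let ?V = "degree_tuples n dg (\<lambda>i. lo + \<rho> i) K"
  define L where "L \<longleftrightarrow> (\<forall>i\<in>{1..K}. i \<le> (\<Sum>\<beta>\<in>B. c (\<rho> i, \<beta>)) \<and> (\<Sum>\<beta>\<in>B. c (Suc (\<rho> i), \<beta>)) < i)"
  have s: "(\<Sum>\<beta>\<in>B. c (r, \<beta>)) = card {x \<in> {1..n}. lo + r \<le> dg x}" for r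
    using tp(1)[of r] by (simp flip: of_nat_add)
  have lev: "dg (p i) = lo + \<rho> i \<longleftrightarrow> i \<le> (\<Sum>\<beta>\<in>B. c (\<rho> i, \<beta>)) \<and> (\<Sum>\<beta>\<in>B. c (Suc (\<rho> i), \<beta>)) < i"
    if "p \<in> ?O" "i \<in> {1..K}" for p i
  proof -
    have i: "i \<in> {1..n}" using that(2) K by simp
    have "dg (p i) = lo + \<rho> i \<longleftrightarrow> lo + \<rho> i \<le> dg (p i) \<and> \<not> lo + Suc (\<rho> i) \<le> dg (p i)" by linarith
    also have "\<dots> \<longleftrightarrow> i \<le> (\<Sum>\<beta>\<in>B. c (\<rho> i, \<beta>)) \<and> (\<Sum>\<beta>\<in>B. c (Suc (\<rho> i), \<beta>)) < i"
      unfolding s ordering_degree_ge_iff[OF that(1) i] by linarith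
    finally show ?thesis .
  qed
  have fin: "finite ?O" by (rule finite_orderings)
  have O0: "0 < card ?O" using fin orderings_nonempty by (simp add: card_gt_0_iff)
  show ?thesis
  proof (cases L)
    case False
    then obtain i where i: "i \<in> {1..K}" "\<not> (i \<le> (\<Sum>\<beta>\<in>B. c (\<rho> i, \<beta>)) \<and> (\<Sum>\<beta>\<in>B. c (Suc (\<rho> i), \<beta>)) < i)"
      unfolding L_def by blast
    have "?A = {}" using lev[OF _ i(1)] i by blast
    thus ?thesis using False unfolding pattern_weight_def L_def[symmetric] c_def[symmetric] by (simp only: card.empty if_False)
  next
    case True
    have inV: "restrict p {1..K} \<in> ?V" if p: "p \<in> ?O" for p
    proof -
      have bij: "bij_betw p {1..n} {1..n}" using p by (simp add: orderings_def)
      have "inj_on p {1..K}" using bij_betw_imp_inj_on[OF bij] by (rule inj_on_subset) (use K in auto)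
      moreover have "p i \<in> {1..n} \<and> dg (p i) = lo + \<rho> i" if i: "i \<in> {1..K}" for i
        using bij_betwE[OF bij] lev[OF p i] True i K unfolding L_def by fastforce
      ultimately show ?thesis unfolding degree_tuples_def tuples_def by simp
    qed
    define B' where "B' = {u \<in> ?V. \<forall>i\<in>{1..K}. cl (u i) = b i}"
    have "{p \<in> ?O. restrict p {1..K} \<in> ?V} = ?O" using inV by blast
    moreover have "{p \<in> ?O. restrict p {1..K} \<in> B'} = ?A"
    proof (intro Collect_cong conj_cong refl)
      fix p assume p: "p \<in> ?O"
      have "restrict p {1..K} \<in> B' \<longleftrightarrow> (\<forall>i\<in>{1..K}. cl (p i) = b i)" using inV[OF p] unfolding B'_def by simp
      also have "\<dots> \<longleftrightarrow> (\<forall>i\<in>{1..K}. dg (p i) = lo + \<rho> i \<and> cl (p i) = b i)" using lev[OF p] True unfolding L_def by blast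
      finally show "restrict p {1..K} \<in> B' \<longleftrightarrow> (\<forall>i\<in>{1..K}. dg (p i) = lo + \<rho> i \<and> cl (p i) = b i)" .
    qed
    moreover have B'V: "B' \<subseteq> ?V" unfolding B'_def by blast
    ultimately have eq: "card ?A * card ?V = card B' * card ?O" using orderings_over_tuples[OF K B'V] by simp
    have Vt: "?V = tuples (\<lambda>r. {x \<in> {1..n}. int (dg x) = int lo + int r}) \<rho> K"
      unfolding degree_tuples_def tuples_def by (simp flip: of_nat_add)
    have B't: "B' = tuples (\<lambda>(r, \<beta>). {x \<in> {1..n}. int (dg x) = int lo + int r \<and> cl x = \<beta>}) (\<lambda>i. (\<rho> i, b i)) K"
      unfolding B'_def degree_tuples_def tuples_def by (auto simp flip: of_nat_add)
    obtain p where "p \<in> ?O" using orderings_nonempty by blast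
    hence "?V \<noteq> {}" using inV by blast
    hence V0: "0 < card ?V" using finite_degree_tuples by (simp add: card_gt_0_iff)
    have "card B' \<le> card ?V" by (intro card_mono finite_degree_tuples B'V)
    hence "real (card B') / real (card ?V) \<le> 1" using V0 by simp
    moreover have "real (card ?A) / real (card ?O) = real (card B') / real (card ?V)"
      using eq O0 V0 by (simp add: frac_eq_eq flip: of_nat_mult)
    ultimately have "real (card ?A) / real (card ?O) = min 1 (real (card B') / real (card ?V))" by simp
    also have "\<dots> = pattern_weight B K \<rho> b c"
      unfolding pattern_weight_def if_P[OF True[unfolded L_def]] unfolding Vt B't tp(2) tp(3) by (rule refl)
    finally show ?thesis unfolding c_def .
  qed
qed

section \<open>Random tie-breaking in the tree\<close>

context degree_ordered_wrt
begin

text \<open>For a fixed ordering \<open>p\<close> the function \<open>H p\<close> is known from the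
  history, so conditioning replaces the random ordering by the uniform average over all admissible
  ones.\<close>

lemma uniform_ordering_expectation:
  assumes H: "\<And>p. H p \<in> borel_measurable (history n)" and bd: "\<And>p \<omega>. \<bar>H p \<omega>\<bar> \<le> C"
    and X: "X \<in> borel_measurable M"
    and XH: "\<And>\<omega>. \<omega> \<in> space M \<Longrightarrow> X \<omega> = H (\<lambda>i\<in>{1..n}. v n i \<omega>) \<omega>"
    and Q: "Q \<in> borel_measurable M"
    and QH: "\<And>\<omega>. Q \<omega> = (\<Sum>p\<in>orderings n (\<lambda>x. deg n x \<omega>). H p \<omega>) / real (card (orderings n (\<lambda>x. deg n x \<omega>)))"
  shows "expectation X = expectation Q"
proof -
  interpret F: finite_measure_subalgebra M "history n"
    by unfold_locales (rule subalgebra_history)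
  let ?P = "PiE {1..n} (\<lambda>_. {1..n})"
  let ?O = "\<lambda>\<omega>. orderings n (\<lambda>x. deg n x \<omega>)"
  have finP: "finite ?P" by (intro finite_PiE) auto
  have OP: "?O \<omega> \<subseteq> ?P" for \<omega> by (auto simp: orderings_def PiE_def dest: bij_betwE)
  define E where "E p = {\<omega> \<in> space M. (\<lambda>i\<in>{1..n}. v n i \<omega>) = p}" for p
  have E: "E p \<in> events" if p: "p \<in> ?P" for p
  proof -
    have "E p = {\<omega> \<in> space M. \<forall>i\<in>{1..n}. v n i \<omega> = p i}"
      using p unfolding E_def by (intro Collect_cong conj_cong refl) (auto simp: fun_eq_iff restrict_def PiE_def extensional_def)
    moreover have "{\<omega> \<in> space M. \<forall>i\<in>{1..n}. v n i \<omega> = p i} \<in> events"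
    proof (intro sets.sets_Collect_finite_All)
      fix i assume "i \<in> {1..n}"
      note [measurable] = ordering_measurable[OF this]
      show "{\<omega> \<in> space M. v n i \<omega> = p i} \<in> events" by measurable
    qed simp
    ultimately show ?thesis by simp
  qed
  let ?r = "\<lambda>p. real_cond_exp M (history n) (indicator (E p))"
  have r: "AE \<omega> in M. ?r p \<omega> = indicator (?O \<omega>) p / real (card (?O \<omega>))" if "p \<in> ?P" for p
    using ordering_uniform[of p n] that unfolding degree_orderings_wrt in_degree_eq_deg E_def by (auto simp: PiE_def)
  have rm: "?r p \<in> borel_measurable M" for p by (rule borel_measurable_cond_exp2)
  have main: "expectation (\<lambda>\<omega>. \<Sum>p\<in>?P. G p \<omega> * indicator (E p) \<omega>) = expectation (\<lambda>\<omega>. \<Sum>p\<in>?P. G p \<omega> * ?r p \<omega>)"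
    if G: "\<And>p. G p \<in> borel_measurable (history n)" "\<And>p \<omega>. \<bar>G p \<omega>\<bar> \<le> C'" for G C'
  proof -
    have GM: "G p \<in> borel_measurable M" for p using G(1) by (rule measurable_history)
    have int: "integrable M (\<lambda>\<omega>. G p \<omega> * indicator (E p) \<omega>)" if p: "p \<in> ?P" for p
    proof (rule integrable_const_bound[of _ C'])
      show "AE \<omega> in M. norm (G p \<omega> * indicator (E p) \<omega>) \<le> C'"
        using G(2)[of p] by (intro AE_I2) (force simp: indicator_def dest: order_trans[OF abs_ge_zero])
    qed (use GM E[OF p] in measurable)
    note ri = F.real_cond_exp_intg[OF int G(1) borel_measurable_indicator[OF E]]
    have "expectation (\<lambda>\<omega>. \<Sum>p\<in>?P. G p \<omega> * indicator (E p) \<omega>) = (\<Sum>p\<in>?P. expectation (\<lambda>\<omega>. G p \<omega> * indicator (E p) \<omega>))"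
      using int by (intro Bochner_Integration.integral_sum) auto
    also have "\<dots> = (\<Sum>p\<in>?P. expectation (\<lambda>\<omega>. G p \<omega> * ?r p \<omega>))" by (intro sum.cong refl ri(2)[symmetric]) auto
    also have "\<dots> = expectation (\<lambda>\<omega>. \<Sum>p\<in>?P. G p \<omega> * ?r p \<omega>)"
      using ri(1) by (intro Bochner_Integration.integral_sum[symmetric]) auto
    finally show ?thesis .
  qed
  have rAE: "AE \<omega> in M. \<forall>p\<in>?P. ?r p \<omega> = indicator (?O \<omega>) p / real (card (?O \<omega>))"
    using r finP by (intro AE_finite_allI) auto
  have O0: "real (card (?O \<omega>)) > 0" for \<omega> using finite_orderings orderings_nonempty by (simp add: card_gt_0_iff)
  have sumO: "(\<Sum>p\<in>?P. g p * (indicator (?O \<omega>) p / real (card (?O \<omega>)))) = (\<Sum>p\<in>?O \<omega>. g p) / real (card (?O \<omega>))" for g :: "_ \<Rightarrow> real" and \<omega>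
  proof -
    have "(\<Sum>p\<in>?P. g p * (indicator (?O \<omega>) p / real (card (?O \<omega>)))) = (\<Sum>p\<in>?O \<omega>. g p * (indicator (?O \<omega>) p / real (card (?O \<omega>))))"
      using finP OP by (intro sum.mono_neutral_right) auto
    thus ?thesis by (simp add: sum_divide_distrib)
  qed
  have red: "expectation (\<lambda>\<omega>. \<Sum>p\<in>?P. G p \<omega> * ?r p \<omega>) = expectation Q'"
    if G: "\<And>p. G p \<in> borel_measurable (history n)" and Q': "Q' \<in> borel_measurable M"
      "\<And>\<omega>. Q' \<omega> = (\<Sum>p\<in>?O \<omega>. G p \<omega>) / real (card (?O \<omega>))" for G Q'
  proof (rule integral_cong_AE[OF _ Q'(1)])
    show "(\<lambda>\<omega>. \<Sum>p\<in>?P. G p \<omega> * ?r p \<omega>) \<in> borel_measurable M"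
      using measurable_history[OF G] rm by (intro borel_measurable_sum borel_measurable_times)
    show "AE \<omega> in M. (\<Sum>p\<in>?P. G p \<omega> * ?r p \<omega>) = Q' \<omega>"
      using rAE
    proof eventually_elim
      case (elim \<omega>)
      have "(\<Sum>p\<in>?P. G p \<omega> * ?r p \<omega>) = (\<Sum>p\<in>?P. G p \<omega> * (indicator (?O \<omega>) p / real (card (?O \<omega>))))"
        using elim by (intro sum.cong refl) auto
      thus ?case unfolding sumO Q'(2) .
    qed
  qed
  \<comment> \<open>The case of the constant 1 derives from the conditional uniformity that
    \<open>v\<close> almost surely is one of the finitely many maps in \<open>?P\<close>.\<close>
  have "expectation (\<lambda>\<omega>. \<Sum>p\<in>?P. 1 * indicator (E p) \<omega>) = expectation (\<lambda>\<omega>. \<Sum>p\<in>?P. 1 * ?r p \<omega>)"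
    by (rule main[of "\<lambda>_ _. 1" 1]) simp_all
  also have "\<dots> = expectation (\<lambda>_. 1 :: real)"
    by (rule red[of "\<lambda>_ _. 1"]) (use O0 in \<open>simp_all add: less_imp_neq[symmetric]\<close>)
  also have "expectation (\<lambda>_. 1 :: real) = 1" by (simp add: prob_space)
  finally have one: "expectation (\<lambda>\<omega>. \<Sum>p\<in>?P. indicator (E p) \<omega> :: real) = 1" by (simp only: mult_1)
  have "prob (\<Union>p\<in>?P. E p) = (\<Sum>p\<in>?P. prob (E p))"
    using finP E by (intro finite_measure_finite_Union) (auto simp: disjoint_family_on_def E_def)
  also have "\<dots> = expectation (\<lambda>\<omega>. \<Sum>p\<in>?P. indicator (E p) \<omega>)"
  proof (subst Bochner_Integration.integral_sum)
    show "integrable M (indicator (E p) :: 'a \<Rightarrow> real)" if "p \<in> ?P" for p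
      using E[OF that] by (simp add: emeasure_eq_measure)
    show "(\<Sum>p\<in>?P. prob (E p)) = (\<Sum>p\<in>?P. expectation (indicator (E p)))"
      using E sets.Int_space_eq2 by (intro sum.cong refl) simp
  qed
  finally have "prob (\<Union>p\<in>?P. E p) = 1" using one by simp
  moreover have "(\<Union>p\<in>?P. E p) \<in> events" using finP E by (intro sets.finite_UN) auto
  ultimately have inE: "AE \<omega> in M. \<omega> \<in> (\<Union>p\<in>?P. E p)" by (subst (asm) prob_eq_1) auto
  have "expectation X = expectation (\<lambda>\<omega>. \<Sum>p\<in>?P. H p \<omega> * indicator (E p) \<omega>)"
  proof (rule integral_cong_AE[OF X])
    show "(\<lambda>\<omega>. \<Sum>p\<in>?P. H p \<omega> * indicator (E p) \<omega>) \<in> borel_measurable M"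
      using measurable_history[OF H] E by (intro borel_measurable_sum borel_measurable_times borel_measurable_indicator)
    show "AE \<omega> in M. X \<omega> = (\<Sum>p\<in>?P. H p \<omega> * indicator (E p) \<omega>)"
      using inE
    proof eventually_elim
      case (elim \<omega>)
      then obtain p where p: "p \<in> ?P" "\<omega> \<in> E p" by blast
      hence pv: "\<omega> \<in> space M" "(\<lambda>i\<in>{1..n}. v n i \<omega>) = p" by (simp_all add: E_def)
      have "(\<Sum>q\<in>?P. H q \<omega> * indicator (E q) \<omega>) = (\<Sum>q\<in>{p}. H q \<omega> * indicator (E q) \<omega>)"
      proof (rule sum.mono_neutral_right[OF finP])
        show "\<forall>q\<in>?P - {p}. H q \<omega> * indicator (E q) \<omega> = 0" 
        proof
          fix q assume "q \<in> ?P - {p}"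
          hence "\<omega> \<notin> E q" using pv(2) unfolding E_def by blast
          thus "H q \<omega> * indicator (E q) \<omega> = 0" by simp
        qed
      qed (use p in blast)
      also have "\<dots> = H p \<omega>" using p(2) by simp
      finally show ?case using XH[OF pv(1)] pv(2) by simp
    qed
  qed
  also have "\<dots> = expectation (\<lambda>\<omega>. \<Sum>p\<in>?P. H p \<omega> * ?r p \<omega>)" by (rule main[OF H bd])
  also have "\<dots> = expectation Q" by (rule red[OF H Q QH])
  finally show ?thesis .
qed

lemma count_measurable:
  "(\<lambda>\<omega>. (\<lambda>(r, \<beta>). card {x \<in> {1..n}. lo + r \<le> deg n x \<omega> \<and> cl x = \<beta>}) k) \<in> measurable M (count_space UNIV)"
proof -
  have [measurable]: "deg n x \<in> measurable M (count_space UNIV)" for x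
    by (rule measurable_from_subalg[OF subalgebra_history deg_history])
  obtain r \<beta> where k: "k = (r, \<beta>)" by (cases k)
  have "(\<lambda>(r, \<beta>). card {x \<in> {1..n}. lo + r \<le> deg n x \<omega> \<and> cl x = \<beta>}) k =
    (\<Sum>x\<in>{1..n}. if lo + r \<le> deg n x \<omega> \<and> cl x = \<beta> then 1 else 0)" for \<omega>
    unfolding k by (simp add: sum.inter_filter[symmetric])
  moreover have "(\<lambda>\<omega>. \<Sum>x\<in>{1..n}. if lo + r \<le> deg n x \<omega> \<and> cl x = \<beta> then 1 else 0 :: nat) \<in> measurable M (count_space UNIV)"
    by measurable
  ultimately show ?thesis by simp
qed

lemma pattern_probability:
  fixes cl :: "nat \<Rightarrow> 'b"
  assumes K: "K \<le> n" and B: "finite B" "cl ` {1..n} \<subseteq> B"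
  shows "prob {\<omega> \<in> space M. \<forall>i\<in>{1..K}. deg n (v n i \<omega>) \<omega> = lo + \<rho> i \<and> cl (v n i \<omega>) = b i} =
    expectation (\<lambda>\<omega>. pattern_weight B K \<rho> b (\<lambda>(r, \<beta>). card {x \<in> {1..n}. lo + r \<le> deg n x \<omega> \<and> cl x = \<beta>}))"
proof -
  have [measurable]: "deg n x \<in> measurable M (count_space UNIV)" for x
    by (rule measurable_from_subalg[OF subalgebra_history deg_history])
  let ?Q = "\<lambda>\<omega>. pattern_weight B K \<rho> b (\<lambda>(r, \<beta>). card {x \<in> {1..n}. lo + r \<le> deg n x \<omega> \<and> cl x = \<beta>})"
  define H where "H p \<omega> = (if \<forall>i\<in>{1..K}. deg n (p i) \<omega> = lo + \<rho> i \<and> cl (p i) = b i then 1 else 0 :: real)" for p \<omega>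
  let ?E = "{\<omega> \<in> space M. \<forall>i\<in>{1..K}. deg n (v n i \<omega>) \<omega> = lo + \<rho> i \<and> cl (v n i \<omega>) = b i}"
  have E: "?E \<in> events"
  proof (intro sets.sets_Collect_finite_All)
    fix i assume "i \<in> {1..K}"
    hence "i \<in> {1..n}" using K by simp
    note [measurable] = ordering_measurable[OF this]
    have "{\<omega> \<in> space M. deg n (v n i \<omega>) \<omega> = lo + \<rho> i \<and> cl (v n i \<omega>) = b i} =
       (\<Union>x. {\<omega> \<in> space M. v n i \<omega> = x \<and> deg n x \<omega> = lo + \<rho> i \<and> cl x = b i})" by blast
    also have "\<dots> \<in> events" by (intro sets.countable_UN) auto
    finally show "{\<omega> \<in> space M. deg n (v n i \<omega>) \<omega> = lo + \<rho> i \<and> cl (v n i \<omega>) = b i} \<in> events" .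
  qed simp
  have "prob ?E = expectation (indicator ?E)" using E by simp
  also have "\<dots> = expectation ?Q"
  proof (rule uniform_ordering_expectation[where C = 1])
    show "?Q \<in> borel_measurable M" by (rule pattern_weight_measurable[OF count_measurable B(1)])
    fix \<omega>
    have "(\<Sum>p\<in>orderings n (\<lambda>x. deg n x \<omega>). H p \<omega>) =
       real (card {p \<in> orderings n (\<lambda>x. deg n x \<omega>). \<forall>i\<in>{1..K}. deg n (p i) \<omega> = lo + \<rho> i \<and> cl (p i) = b i})"
      unfolding H_def using finite_orderings by (subst sum.inter_filter[symmetric]) simp_all
    thus "?Q \<omega> = (\<Sum>p\<in>orderings n (\<lambda>x. deg n x \<omega>). H p \<omega>) / real (card (orderings n (\<lambda>x. deg n x \<omega>)))"
      using ordering_pattern_weight[OF K B, of "\<lambda>x. deg n x \<omega>" lo \<rho> b] by (simp only:)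
  next
    show "H p \<in> borel_measurable (history n)" for p unfolding H_def[abs_def] by measurable
    show "\<bar>H p \<omega>\<bar> \<le> 1" for p \<omega> by (simp add: H_def)
    show "indicator ?E \<in> borel_measurable M" using E by simp
    show "indicator ?E \<omega> = H (\<lambda>i\<in>{1..n}. v n i \<omega>) \<omega>" if "\<omega> \<in> space M" for \<omega>
    proof -
      have "(\<lambda>i\<in>{1..n}. v n i \<omega>) i = v n i \<omega>" if "i \<in> {1..K}" for i using that K by simp
      thus ?thesis using that unfolding H_def indicator_def by simp
    qed
  qed
  finally show ?thesis .
qed

end

section \<open>The limiting Poisson process\<close>

lemma prod_power_counts:
  fixes s :: "nat \<Rightarrow> 'c \<Rightarrow> real"
  assumes A: "finite A" and B: "finite B" "cl ` A \<subseteq> B"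
  shows "(\<Prod>(r, b)\<in>{..<R} \<times> B. s r b ^ card {x \<in> A. Q r x \<and> cl x = b}) = (\<Prod>x\<in>A. \<Prod>r<R. if Q r x then s r (cl x) else 1)"
proof -
  have "(\<Prod>b\<in>B. s r b ^ card {x \<in> A. Q r x \<and> cl x = b}) = (\<Prod>x\<in>A. if Q r x then s r (cl x) else 1)" for r
  proof -
    have "(\<Prod>b\<in>B. s r b ^ card {x \<in> A. Q r x \<and> cl x = b}) = (\<Prod>b\<in>B. \<Prod>x\<in>{x \<in> {x \<in> A. Q r x}. cl x = b}. s r (cl x))"
      by (intro prod.cong refl) (simp add: conj_assoc)
    also have "\<dots> = (\<Prod>x\<in>{x \<in> A. Q r x}. s r (cl x))" using A B by (intro prod.group) auto
    also have "\<dots> = (\<Prod>x\<in>A. if Q r x then s r (cl x) else 1)" using A by (rule prod.inter_filter)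
    finally show ?thesis .
  qed
  hence "(\<Prod>(r, b)\<in>{..<R} \<times> B. s r b ^ card {x \<in> A. Q r x \<and> cl x = b}) = (\<Prod>r<R. \<Prod>x\<in>A. if Q r x then s r (cl x) else 1)"
    by (simp add: prod.cartesian_product[symmetric])
  thus ?thesis by (simp only: prod.swap[of _ A])
qed

lemma antimono_level_iff:
  fixes D :: "nat \<Rightarrow> int"
  assumes anti: "\<And>i j. 1 \<le> i \<Longrightarrow> i \<le> j \<Longrightarrow> D j \<le> D i" and fin: "finite {i \<in> {1..}. lo \<le> D i}" and i: "1 \<le> i"
  shows "lo \<le> D i \<longleftrightarrow> i \<le> (LEAST k. D (Suc k) < lo)"
proof -
  let ?k = "LEAST k. D (Suc k) < lo"
  have "\<not> {1..} \<subseteq> {i \<in> {1..}. lo \<le> D i}" using fin infinite_Ici[of "1::nat"] finite_subset by blast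
  then obtain j where "j \<ge> 1" "\<not> lo \<le> D j" by auto
  hence "D (Suc (j - 1)) < lo" by simp
  hence k: "D (Suc ?k) < lo" by (rule LeastI)
  show ?thesis
  proof
    assume "lo \<le> D i"
    thus "i \<le> ?k" using anti[of "Suc ?k" i] k by (cases "i \<le> ?k") auto
  next
    assume "i \<le> ?k"
    hence "\<not> D (Suc (i - 1)) < lo" using i by (intro not_less_Least) simp
    thus "lo \<le> D i" using i by simp
  qed
qed

text \<open>In a sequence already ranked by level, the level condition concerns the first
  \<open>K\<close> ranks directly; the quotient is then the proportion, among injective tuples with
  these levels, of those whose marks show the pattern. \<open>m\<close> cuts the infinite sequence
  at the items of level at least \<open>lo\<close>.\<close>

lemma pattern_weight_ranked:
  fixes D :: "nat \<Rightarrow> int" and cl :: "nat \<Rightarrow> 'b" and m K :: nat and lo :: int and \<rho> :: "nat \<Rightarrow> nat"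
  assumes anti: "\<And>i j. 1 \<le> i \<Longrightarrow> i \<le> j \<Longrightarrow> D j \<le> D i" and m: "\<And>i. 1 \<le> i \<Longrightarrow> lo \<le> D i \<longleftrightarrow> i \<le> m"
    and B: "finite B" "cl ` {1..m} \<subseteq> B"
    and c: "\<And>r \<beta>. c (r, \<beta>) = card {x \<in> {1..m}. lo + int r \<le> D x \<and> cl x = \<beta>}"
  defines "V \<equiv> tuples (\<lambda>r. {x \<in> {1..m}. D x = lo + int r}) \<rho> K"
  shows "finite V"
    and "\<forall>i\<in>{1..K}. D i = lo + int (\<rho> i) \<Longrightarrow> V \<noteq> {}"
    and "pattern_weight B K \<rho> b c = (if \<forall>i\<in>{1..K}. D i = lo + int (\<rho> i)
      then real (card {u \<in> V. \<forall>i\<in>{1..K}. cl (u i) = b i}) / real (card V) else 0)"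
proof -
  note tp = tuple_proportion[OF finite_atLeastAtMost B, of c lo D, OF c]
  show fV: "finite V" unfolding V_def by (rule card_tuples[THEN conjunct1]) auto
  show V0: "V \<noteq> {}" if L: "\<forall>i\<in>{1..K}. D i = lo + int (\<rho> i)"
  proof -
    have "i \<in> {1..m}" if i: "i \<in> {1..K}" for i
    proof -
      have "lo \<le> D i" using bspec[OF L i] by simp
      thus ?thesis using m[of i] i by simp
    qed
    hence "restrict (\<lambda>i. i) {1..K} \<in> V" using L unfolding V_def tuples_def by (auto simp: inj_on_def)
    thus ?thesis by blast
  qed
  have ge: "i \<le> (\<Sum>\<beta>\<in>B. c (r, \<beta>)) \<longleftrightarrow> lo + int r \<le> D i" if i: "1 \<le> i" for i r
  proof -
    let ?A = "{x \<in> {1..m}. lo + int r \<le> D x}"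
    have "i \<le> card ?A \<longleftrightarrow> lo + int r \<le> D i"
    proof
      assume le: "lo + int r \<le> D i"
      have "{1..i} \<subseteq> ?A"
      proof
        fix x assume x: "x \<in> {1..i}"
        have "D i \<le> D x" using x by (intro anti) auto
        hence "lo + int r \<le> D x" using le by linarith
        moreover have "x \<le> m" using m[of x] x calculation by auto
        ultimately show "x \<in> ?A" using x by simp
      qed
      hence "card {1..i} \<le> card ?A" by (intro card_mono) auto
      thus "i \<le> card ?A" by simp
    next
      assume le: "i \<le> card ?A"
      show "lo + int r \<le> D i"
      proof (rule ccontr)
        assume n: "\<not> lo + int r \<le> D i"
        have "?A \<subseteq> {1..<i}"
        proof
          fix x assume x: "x \<in> ?A"
          have "\<not> i \<le> x" using anti[OF i, of x] x n by auto
          thus "x \<in> {1..<i}" using x by auto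
        qed
        hence "card ?A \<le> card {1..<i}" by (intro card_mono) auto
        thus False using le i by simp
      qed
    qed
    thus ?thesis unfolding tp(1) .
  qed
  have L: "(\<forall>i\<in>{1..K}. i \<le> (\<Sum>\<beta>\<in>B. c (\<rho> i, \<beta>)) \<and> (\<Sum>\<beta>\<in>B. c (Suc (\<rho> i), \<beta>)) < i) \<longleftrightarrow> (\<forall>i\<in>{1..K}. D i = lo + int (\<rho> i))"
  proof (intro ball_cong refl)
    fix i assume "i \<in> {1..K}"
    hence i: "1 \<le> i" by simp
    have "(\<Sum>\<beta>\<in>B. c (Suc (\<rho> i), \<beta>)) < i \<longleftrightarrow> \<not> lo + int (Suc (\<rho> i)) \<le> D i" using ge[OF i, of "Suc (\<rho> i)"] by linarith
    thus "(i \<le> (\<Sum>\<beta>\<in>B. c (\<rho> i, \<beta>)) \<and> (\<Sum>\<beta>\<in>B. c (Suc (\<rho> i), \<beta>)) < i) \<longleftrightarrow> D i = lo + int (\<rho> i)"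
      unfolding ge[OF i] by auto
  qed
  have t2: "tuples (\<lambda>(r, \<beta>). {x \<in> {1..m}. D x = lo + int r \<and> cl x = \<beta>}) (\<lambda>i. (\<rho> i, b i)) K = {u \<in> V. \<forall>i\<in>{1..K}. cl (u i) = b i}"
    unfolding V_def tuples_def by auto
  have "card {u \<in> V. \<forall>i\<in>{1..K}. cl (u i) = b i} \<le> card V" using fV by (intro card_mono) auto
  hence "real (card {u \<in> V. \<forall>i\<in>{1..K}. cl (u i) = b i}) / real (card V) \<le> 1" by (cases "card V = 0") simp_all
  hence "min 1 (real (card {u \<in> V. \<forall>i\<in>{1..K}. cl (u i) = b i}) / real (card V)) = real (card {u \<in> V. \<forall>i\<in>{1..K}. cl (u i) = b i}) / real (card V)" by simp
  moreover have "pattern_weight B K \<rho> b c = min 1 (if \<forall>i\<in>{1..K}. D i = lo + int (\<rho> i)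
      then real (card {u \<in> V. \<forall>i\<in>{1..K}. cl (u i) = b i}) / real (card V) else 0)"
    unfolding pattern_weight_def L tp(2)[symmetric] tp(3)[symmetric] t2 unfolding V_def[symmetric] by (rule refl)
  ultimately show "pattern_weight B K \<rho> b c = (if \<forall>i\<in>{1..K}. D i = lo + int (\<rho> i)
      then real (card {u \<in> V. \<forall>i\<in>{1..K}. cl (u i) = b i}) / real (card V) else 0)" by simp
qed

text \<open>The given point masses already add up to 1, so the extended value is almost surely a
  natural number and the expectation is a power series.\<close>

lemma (in prob_space) poisson_gf:
  fixes Y :: "'a \<Rightarrow> ennreal"
  assumes Y [measurable]: "Y \<in> borel_measurable M"
    and law: "\<And>k::nat. prob {\<omega> \<in> space M. Y \<omega> = of_nat k} = exp (- l) * l ^ k / fact k" and l: "0 \<le> l" and t: "0 \<le> t" "t \<le> 1"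
  shows "AE \<omega> in M. \<exists>k::nat. Y \<omega> = of_nat k"
    and "expectation (\<lambda>\<omega>. t ^ nat \<lfloor>enn2real (Y \<omega>)\<rfloor>) = exp (- (l * (1 - t)))"
proof -
  define E where "E k = {\<omega> \<in> space M. Y \<omega> = of_nat k}" for k :: nat
  have E [measurable]: "E k \<in> events" for k unfolding E_def by measurable
  have disj: "disjoint_family E" by (auto simp: disjoint_family_on_def E_def)
  have ps: "(\<lambda>k. exp (- l) * (t' * l) ^ k / fact k) sums (exp (- l) * exp (t' * l))" for t' :: real
    using sums_mult[OF exp_converges[of "t' * l"], of "exp (- l)"] by (simp add: field_simps scaleR_conv_of_real)
  have "(\<lambda>k. prob (E k)) sums prob (\<Union>k. E k)" using disj by (intro finite_measure_UNION) auto
  moreover have "(\<lambda>k. prob (E k)) sums 1" unfolding E_def law using ps[of 1] by (simp add: exp_minus field_simps)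
  ultimately have "prob (\<Union>k. E k) = 1" using sums_unique2 by blast
  hence "AE \<omega> in M. \<omega> \<in> (\<Union>k. E k)" by (subst (asm) prob_eq_1) auto
  thus AEk: "AE \<omega> in M. \<exists>k::nat. Y \<omega> = of_nat k" by eventually_elim (auto simp: E_def)
  have single: "(\<lambda>k. t ^ k * indicator (E k) \<omega>) sums (t ^ j)" if "\<omega> \<in> E j" for \<omega> j
  proof -
    have "(\<lambda>k. if k = j then t ^ k else 0) sums (t ^ j)" by (rule sums_single)
    moreover have "(\<lambda>k. t ^ k * indicator (E k) \<omega>) = (\<lambda>k. if k = j then t ^ k else 0)"
      using that unfolding E_def by (intro ext) auto
    ultimately show ?thesis by simp
  qed
  have ik: "integrable M (\<lambda>\<omega>. t ^ k * indicator (E k) \<omega>)" for k using E by (simp add: emeasure_eq_measure)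
  have pk: "expectation (\<lambda>\<omega>. t ^ k * indicator (E k) \<omega>) = exp (- l) * (t * l) ^ k / fact k" for k
    using law[of k] sets.Int_space_eq2[OF E[of k]] by (simp add: E_def power_mult_distrib)
  have nk: "norm (t ^ k * indicator (E k) \<omega>) = t ^ k * indicator (E k) \<omega>" for k \<omega> using t by (simp add: abs_mult)
  have "expectation (\<lambda>\<omega>. t ^ nat \<lfloor>enn2real (Y \<omega>)\<rfloor>) = expectation (\<lambda>\<omega>. \<Sum>k. t ^ k * indicator (E k) \<omega>)"
  proof (rule integral_cong_AE)
    show "AE \<omega> in M. t ^ nat \<lfloor>enn2real (Y \<omega>)\<rfloor> = (\<Sum>k. t ^ k * indicator (E k) \<omega>)"
      using AEk AE_space
    proof eventually_elim
      case (elim \<omega>)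
      then obtain k where k: "Y \<omega> = of_nat k" by blast
      hence "\<omega> \<in> E k" using elim by (simp add: E_def)
      hence "(\<Sum>k. t ^ k * indicator (E k) \<omega>) = t ^ k" using single sums_unique by metis
      moreover have "enn2real (Y \<omega>) = real k" unfolding k by (simp add: ennreal_of_nat_eq_real_of_nat)
      ultimately show ?case by simp
    qed
    show "(\<lambda>\<omega>. t ^ nat \<lfloor>enn2real (Y \<omega>)\<rfloor>) \<in> borel_measurable M" by measurable
    show "(\<lambda>\<omega>. \<Sum>k. t ^ k * indicator (E k) \<omega>) \<in> borel_measurable M" by measurable
  qed
  also have "\<dots> = (\<Sum>k. expectation (\<lambda>\<omega>. t ^ k * indicator (E k) \<omega>))"
  proof (rule integral_suminf[OF ik])
    show "AE \<omega> in M. summable (\<lambda>k. norm (t ^ k * indicator (E k) \<omega>))"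
      using AEk AE_space
    proof eventually_elim
      case (elim \<omega>)
      then obtain k where "\<omega> \<in> E k" unfolding E_def by blast
      from sums_summable[OF single[OF this]] show ?case unfolding nk .
    qed
    show "summable (\<lambda>k. expectation (\<lambda>\<omega>. norm (t ^ k * indicator (E k) \<omega>)))"
      unfolding nk pk using ps by (rule sums_summable)
  qed
  also have "\<dots> = exp (- l) * exp (t * l)" unfolding pk using ps by (rule sums_unique[symmetric])
  also have "\<dots> = exp (- (l * (1 - t)))" by (simp add: exp_add[symmetric] algebra_simps)
  finally show "expectation (\<lambda>\<omega>. t ^ nat \<lfloor>enn2real (Y \<omega>)\<rfloor>) = exp (- (l * (1 - t)))" .
qed

text \<open>Abel summation. The tail is set to 0 from index \<open>R\<close> on because the last
  band of the Poisson process will be unbounded above.\<close>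

lemma sum_by_parts_tails:
  fixes q T :: "nat \<Rightarrow> real"
  shows "(\<Sum>r<R. ((if r < R then T r else 0) - (if Suc r < R then T (Suc r) else 0)) * (\<Sum>t<Suc r. q t)) = (\<Sum>r<R. q r * T r)"
proof -
  define T' where "T' r = (if r < R then T r else 0)" for r
  have "(\<Sum>r<n. (T' r - T' (Suc r)) * (\<Sum>t<Suc r. q t)) = (\<Sum>r<n. q r * T' r) - T' n * (\<Sum>t<n. q t)" for n
    by (induction n) (simp_all add: algebra_simps)
  from this[of R] show ?thesis by (simp add: T'_def)
qed

abbreviation PM :: "(nat \<Rightarrow> real) measure" where "PM \<equiv> \<Pi>\<^sub>M i\<in>{1..}. (borel :: real measure)"

lemma PM_component: "1 \<le> i \<Longrightarrow> (\<lambda>p. p i) \<in> borel_measurable PM"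
  by (intro measurable_component_singleton) auto

context beta_tree_setting
begin

lemma cell_measurable_space:
  assumes "finite X" shows "cell X \<in> measurable borel (count_space (Pow X))"
proof (subst measurable_count_space_eq2)
  show "cell X \<in> space borel \<rightarrow> Pow X \<and> (\<forall>b\<in>Pow X. cell X -` {b} \<inter> space borel \<in> sets borel)"
    using cell_measurable[OF assms] cell_in_Pow by (auto simp: vimage_def)
qed (use assms in simp)

lemma cell_fun_measurable: "finite X \<Longrightarrow> (\<lambda>z. h (cell X z)) \<in> borel_measurable borel" for h :: "real set \<Rightarrow> real"
  by (rule measurable_compose[OF cell_measurable_space]) auto

lemma integral_cell:
  fixes h :: "real set \<Rightarrow> real"
  assumes X: "finite X"
  shows "(\<integral>z. h (cell X z) \<partial>std_normal_distribution) = (\<Sum>b\<in>Pow X. cell_prob X b * h b)"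
proof -
  have ms: "{z. cell X z = b} \<in> sets std_normal_distribution" for b using cell_measurable[OF X] by simp
  have "(\<integral>z. h (cell X z) \<partial>std_normal_distribution) = (\<integral>z. (\<Sum>b\<in>Pow X. h b * indicator {z. cell X z = b} z) \<partial>std_normal_distribution)"
  proof (rule Bochner_Integration.integral_cong[OF refl])
    fix z
    have "(\<Sum>b\<in>Pow X. h b * indicator {z. cell X z = b} z) = (\<Sum>b\<in>{cell X z}. h b * indicator {z. cell X z = b} z)"
    proof (rule sum.mono_neutral_right)
      show "\<forall>i\<in>Pow X - {cell X z}. h i * indicator {z. cell X z = i} z = 0"
      proof
        fix i assume "i \<in> Pow X - {cell X z}"
        hence "cell X z \<noteq> i" by blast
        thus "h i * indicator {z. cell X z = i} z = 0" by (simp add: indicator_def)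
      qed
    qed (use X cell_in_Pow in auto)
    thus "h (cell X z) = (\<Sum>b\<in>Pow X. h b * indicator {z. cell X z = b} z)" by simp
  qed
  also have "\<dots> = (\<Sum>b\<in>Pow X. \<integral>z. h b * indicator {z. cell X z = b} z \<partial>std_normal_distribution)"
    using ms by (intro Bochner_Integration.integral_sum integrable_mult_right) (simp add: std_normal.emeasure_eq_measure)
  also have "\<dots> = (\<Sum>b\<in>Pow X. cell_prob X b * h b)"
    using ms by (intro sum.cong refl) (simp add: cell_prob_def mult.commute)
  finally show ?thesis .
qed

lemma sum_cell_prob: "finite X \<Longrightarrow> (\<Sum>b\<in>Pow X. cell_prob X b) = 1"
  using integral_cell[of X "\<lambda>_. 1"] std_normal.prob_space by simp

text \<open>For a decreasing sequence with finitely many terms of level at least \<open>lo\<close>,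
  this is their number, by \<open>good_level_iff\<close>. The form with \<open>LEAST\<close> makes
  it a measurable function of the whole sequence.\<close>

definition above :: "int \<Rightarrow> (nat \<Rightarrow> real) \<Rightarrow> nat" where
  "above lo p = (LEAST k. \<lfloor>p (Suc k) + \<epsilon>\<rfloor> < lo)"

definition limit_count :: "real set \<Rightarrow> int \<Rightarrow> (nat \<Rightarrow> real) \<times> (nat \<Rightarrow> real) \<Rightarrow> nat \<times> real set \<Rightarrow> nat" where
  "limit_count X lo w = (\<lambda>(r, b). card {i \<in> {1..above lo (fst w)}. lo + int r \<le> \<lfloor>fst w i + \<epsilon>\<rfloor> \<and> cell X (snd w i) = b})"

lemma floor_measurable:
  assumes "1 \<le> i" shows "(\<lambda>p. \<lfloor>p i + \<epsilon>\<rfloor>) \<in> measurable PM (count_space UNIV)"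
proof -
  note [measurable] = PM_component[OF assms]
  show ?thesis by measurable
qed

lemma above_measurable [measurable]: "above lo \<in> measurable PM (count_space UNIV)"
proof -
  have "(\<lambda>p. \<lfloor>p (Suc k) + \<epsilon>\<rfloor> < lo) \<in> measurable PM (count_space UNIV)" for k
    by (rule measurable_compose[OF floor_measurable]) auto
  thus ?thesis unfolding above_def[abs_def] by (rule measurable_Least)
qed

lemma limit_count_measurable:
  assumes X: "finite X"
  shows "(\<lambda>w. limit_count X lo w k) \<in> measurable (PM \<Otimes>\<^sub>M PM) (count_space UNIV)"
proof -
  obtain r b where k: "k = (r, b)" by (cases k)
  define f where "f m w = (\<Sum>i\<in>{1..m}. if lo + int r \<le> \<lfloor>fst w i + \<epsilon>\<rfloor> \<and> cell X (snd w i) = b then 1 else 0 :: nat)" for m and w :: "(nat \<Rightarrow> real) \<times> (nat \<Rightarrow> real)"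
  have "limit_count X lo w k = f (above lo (fst w)) w" for w
    unfolding limit_count_def k f_def by (simp add: sum.inter_filter[symmetric])
  moreover have "(\<lambda>w. f (above lo (fst w)) w) \<in> measurable (PM \<Otimes>\<^sub>M PM) (count_space UNIV)"
  proof (rule measurable_compose_countable[where f = f and g = "\<lambda>w. above lo (fst w)"])
    show "(\<lambda>w. above lo (fst w)) \<in> measurable (PM \<Otimes>\<^sub>M PM) (count_space UNIV)"
      by (rule measurable_compose[OF measurable_fst above_measurable])
    fix m
    have "(\<lambda>w. if lo + int r \<le> \<lfloor>fst w i + \<epsilon>\<rfloor> \<and> cell X (snd w i) = b then 1 else 0 :: nat) \<in> measurable (PM \<Otimes>\<^sub>M PM) (count_space UNIV)"
      if i: "i \<in> {1..m}" for i
    proof -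
      have 1: "(\<lambda>w. \<lfloor>fst w i + \<epsilon>\<rfloor>) \<in> measurable (PM \<Otimes>\<^sub>M PM) (count_space UNIV)"
        by (rule measurable_compose[OF measurable_fst floor_measurable]) (use i in auto)
      have 2: "(\<lambda>w. cell X (snd w i)) \<in> measurable (PM \<Otimes>\<^sub>M PM) (count_space (Pow X))"
        by (rule measurable_compose[OF measurable_compose[OF measurable_snd PM_component] cell_measurable_space[OF X]]) (use i in auto)
      have "Measurable.pred (PM \<Otimes>\<^sub>M PM) (\<lambda>w. lo + int r \<le> \<lfloor>fst w i + \<epsilon>\<rfloor>)"
        by (rule measurable_compose[OF 1]) auto
      moreover have "Measurable.pred (PM \<Otimes>\<^sub>M PM) (\<lambda>w. cell X (snd w i) = b)"
        by (rule measurable_compose[OF 2]) auto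
      ultimately show ?thesis by measurable
    qed
    thus "f m \<in> measurable (PM \<Otimes>\<^sub>M PM) (count_space UNIV)" unfolding f_def[abs_def]
      by measurable
  qed
  ultimately show ?thesis by simp
qed

end

section \<open>The marked Poisson process\<close>

locale beta_limit = beta_tree_setting \<alpha> \<beta> \<theta> lam \<epsilon> a n + R: prob_space R
  for \<alpha> \<beta> \<theta> lam \<epsilon> :: real and a :: "nat \<Rightarrow> real" and n :: "nat \<Rightarrow> nat" and R :: "'b measure" +
  fixes PP :: "'b \<Rightarrow> real measure" and P Z :: "nat \<Rightarrow> 'b \<Rightarrow> real"
  assumes poisson: "poisson_point_process R (density lborel (\<lambda>x. ennreal (clim * \<theta> powr (- x) * ln \<theta>))) PP"
    and points: "AE \<omega> in R. points_in_decreasing_order (PP \<omega>) (\<lambda>i. P i \<omega>)"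
    and Z_indep: "R.indep_vars (\<lambda>_. borel) Z {1..}"
    and Z_law: "i \<ge> 1 \<Longrightarrow> distr R borel (Z i) = std_normal_distribution"
    and PZ_indep: "R.indep_var PM (\<lambda>\<omega>. \<lambda>i\<in>{1..}. P i \<omega>) PM (\<lambda>\<omega>. \<lambda>i\<in>{1..}. Z i \<omega>)"
begin

abbreviation \<nu> :: "real measure" where "\<nu> \<equiv> density lborel (\<lambda>x. ennreal (clim * \<theta> powr (- x) * ln \<theta>))"

definition Pr :: "'b \<Rightarrow> nat \<Rightarrow> real" where "Pr \<omega> = (\<lambda>i\<in>{1..}. P i \<omega>)"
definition Zr :: "'b \<Rightarrow> nat \<Rightarrow> real" where "Zr \<omega> = (\<lambda>i\<in>{1..}. Z i \<omega>)"

lemma Pr_apply [simp]: "1 \<le> i \<Longrightarrow> Pr \<omega> i = P i \<omega>" by (simp add: Pr_def)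
lemma Zr_apply [simp]: "1 \<le> i \<Longrightarrow> Zr \<omega> i = Z i \<omega>" by (simp add: Zr_def)

lemma Pr_measurable [measurable]: "Pr \<in> measurable R PM" and Zr_measurable [measurable]: "Zr \<in> measurable R PM"
  using R.indep_var_rv1[OF PZ_indep] R.indep_var_rv2[OF PZ_indep] by (simp_all add: Pr_def[abs_def] Zr_def[abs_def])

lemma Z_measurable: "1 \<le> i \<Longrightarrow> Z i \<in> borel_measurable R"
  using Z_indep by (auto simp: R.indep_vars_def)

lemma P_measurable: "1 \<le> i \<Longrightarrow> P i \<in> borel_measurable R"
  using measurable_compose[OF Pr_measurable PM_component, of i] by simp

text \<open>Points and marks are independent, so they may be read off two separate copies
  \<open>\<omega>\<close> and \<open>\<omega>'\<close> of the sample, and the marks averaged with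
  the points held fixed.\<close>

lemma fubini:
  fixes \<phi> :: "(nat \<Rightarrow> real) \<times> (nat \<Rightarrow> real) \<Rightarrow> real"
  assumes f [measurable]: "\<phi> \<in> borel_measurable (PM \<Otimes>\<^sub>M PM)" and bd: "\<And>w. \<bar>\<phi> w\<bar> \<le> C"
  shows "R.expectation (\<lambda>\<omega>. \<phi> (Pr \<omega>, Zr \<omega>)) = R.expectation (\<lambda>\<omega>. R.expectation (\<lambda>\<omega>'. \<phi> (Pr \<omega>, Zr \<omega>')))"
    and "(\<lambda>\<omega>. R.expectation (\<lambda>\<omega>'. \<phi> (Pr \<omega>, Zr \<omega>'))) \<in> borel_measurable R"
proof -
  let ?DP = "distr R PM Pr" and ?DZ = "distr R PM Zr"
  interpret DP: prob_space ?DP by (rule R.prob_space_distr) measurable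
  interpret DZ: prob_space ?DZ by (rule R.prob_space_distr) measurable
  interpret pair_prob_space ?DP ?DZ ..
  have joint: "?DP \<Otimes>\<^sub>M ?DZ = distr R (PM \<Otimes>\<^sub>M PM) (\<lambda>\<omega>. (Pr \<omega>, Zr \<omega>))"
    using PZ_indep unfolding R.indep_var_distribution_eq Pr_def[abs_def] Zr_def[abs_def] by simp
  have fm: "\<phi> \<in> borel_measurable (?DP \<Otimes>\<^sub>M ?DZ)" by measurable
  have int: "integrable (?DP \<Otimes>\<^sub>M ?DZ) \<phi>"
    using bd by (intro P.integrable_const_bound[of _ C] fm) auto
  have inner: "(\<integral>z. \<phi> (Pr \<omega>, z) \<partial>?DZ) = R.expectation (\<lambda>\<omega>'. \<phi> (Pr \<omega>, Zr \<omega>'))" if w: "\<omega> \<in> space R" for \<omega>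
  proof -
    have p: "Pr \<omega> \<in> space PM" using measurable_space[OF Pr_measurable w] .
    show ?thesis
      by (rule integral_distr) (use measurable_compose[OF measurable_Pair1'[OF p] f] in measurable)
  qed
  have "R.expectation (\<lambda>\<omega>. \<phi> (Pr \<omega>, Zr \<omega>)) = integral\<^sup>L (?DP \<Otimes>\<^sub>M ?DZ) \<phi>"
    unfolding joint by (rule integral_distr[symmetric]) measurable
  also have "\<dots> = (\<integral>p. \<integral>z. \<phi> (p, z) \<partial>?DZ \<partial>?DP)" by (rule integral_fst'[OF int, symmetric])
  also have "\<dots> = R.expectation (\<lambda>\<omega>. \<integral>z. \<phi> (Pr \<omega>, z) \<partial>?DZ)"
    by (rule integral_distr) (measurable)
  also have "\<dots> = R.expectation (\<lambda>\<omega>. R.expectation (\<lambda>\<omega>'. \<phi> (Pr \<omega>, Zr \<omega>')))"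
    by (intro Bochner_Integration.integral_cong refl inner)
  finally show "R.expectation (\<lambda>\<omega>. \<phi> (Pr \<omega>, Zr \<omega>)) = R.expectation (\<lambda>\<omega>. R.expectation (\<lambda>\<omega>'. \<phi> (Pr \<omega>, Zr \<omega>')))" .
  have "(\<lambda>p. \<integral>z. \<phi> (p, z) \<partial>?DZ) \<in> borel_measurable PM" by measurable
  hence "(\<lambda>\<omega>. \<integral>z. \<phi> (Pr \<omega>, z) \<partial>?DZ) \<in> borel_measurable R" by (rule measurable_compose[OF Pr_measurable])
  thus "(\<lambda>\<omega>. R.expectation (\<lambda>\<omega>'. \<phi> (Pr \<omega>, Zr \<omega>'))) \<in> borel_measurable R"
    by (subst measurable_cong[OF inner[symmetric]])
qed

lemma Z_product:
  fixes f :: "'i \<Rightarrow> real \<Rightarrow> real"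
  assumes I: "finite I" and u: "inj_on u I" "\<And>i. i \<in> I \<Longrightarrow> 1 \<le> u i"
    and f: "\<And>i. i \<in> I \<Longrightarrow> f i \<in> borel_measurable borel" "\<And>i x. i \<in> I \<Longrightarrow> \<bar>f i x\<bar> \<le> C"
  shows "R.expectation (\<lambda>\<omega>. \<Prod>i\<in>I. f i (Z (u i) \<omega>)) = (\<Prod>i\<in>I. \<integral>z. f i z \<partial>std_normal_distribution)"
proof -
  define g where "g k = f (the_inv_into I u k)" for k
  have g: "g (u i) = f i" if "i \<in> I" for i using the_inv_into_f_f[OF u(1) that] by (simp add: g_def)
  have gm: "g k \<in> borel_measurable borel" if "k \<in> u ` I" for k using that g f(1) by auto
  have "R.indep_vars (\<lambda>_. borel) Z (u ` I)" using Z_indep u(2) by (intro R.indep_vars_subset[OF Z_indep]) auto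
  hence ind: "R.indep_vars (\<lambda>_. borel) (\<lambda>k \<omega>. g k (Z k \<omega>)) (u ` I)" by (rule R.indep_vars_compose2) (rule gm)
  have int: "integrable R (\<lambda>\<omega>. g k (Z k \<omega>))" if k: "k \<in> u ` I" for k
  proof (rule R.integrable_const_bound[of _ C])
    obtain i where i: "i \<in> I" "k = u i" using k by blast
    show "AE \<omega> in R. norm (g k (Z k \<omega>)) \<le> C" using f(2)[OF i(1)] g[OF i(1)] i(2) by simp
    show "(\<lambda>\<omega>. g k (Z k \<omega>)) \<in> borel_measurable R"
      using i u(2) by (intro measurable_compose[OF Z_measurable gm[OF k]]) auto
  qed
  have "R.expectation (\<lambda>\<omega>. \<Prod>i\<in>I. f i (Z (u i) \<omega>)) = R.expectation (\<lambda>\<omega>. \<Prod>k\<in>u ` I. g k (Z k \<omega>))"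
    using g by (simp add: prod.reindex[OF u(1)] cong: prod.cong)
  also have "\<dots> = (\<Prod>k\<in>u ` I. R.expectation (\<lambda>\<omega>. g k (Z k \<omega>)))"
    using I by (intro R.indep_vars_lebesgue_integral ind int) auto
  also have "\<dots> = (\<Prod>i\<in>I. R.expectation (\<lambda>\<omega>. f i (Z (u i) \<omega>)))"
    using g by (simp add: prod.reindex[OF u(1)] cong: prod.cong)
  also have "\<dots> = (\<Prod>i\<in>I. \<integral>z. f i z \<partial>std_normal_distribution)"
  proof (intro prod.cong refl)
    fix i assume i: "i \<in> I"
    show "R.expectation (\<lambda>\<omega>. f i (Z (u i) \<omega>)) = (\<integral>z. f i z \<partial>std_normal_distribution)"
      unfolding Z_law[OF u(2)[OF i], symmetric] using f(1)[OF i] Z_measurable[OF u(2)[OF i]] by (intro integral_distr[symmetric]) auto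
  qed
  finally show ?thesis .
qed

text \<open>The marks are independent with a common law, hence the result does not depend on
  \<open>u\<close>. This exchangeability is the core of \<open>limit_pattern\<close>.\<close>

lemma cells_product:
  assumes X: "finite X" and I: "finite I" and u: "inj_on u I" "\<And>i. i \<in> I \<Longrightarrow> 1 \<le> u i"
  shows "R.expectation (\<lambda>\<omega>. \<Prod>i\<in>I. h i (cell X (Z (u i) \<omega>))) = (\<Prod>i\<in>I. \<Sum>b\<in>Pow X. cell_prob X b * h i b)"
proof -
  define C where "C = (\<Sum>i\<in>I. \<Sum>b\<in>Pow X. \<bar>h i b\<bar>)"
  have "R.expectation (\<lambda>\<omega>. \<Prod>i\<in>I. h i (cell X (Z (u i) \<omega>))) = (\<Prod>i\<in>I. \<integral>z. h i (cell X z) \<partial>std_normal_distribution)"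
  proof (rule Z_product[OF I u])
    show "(\<lambda>z. h i (cell X z)) \<in> borel_measurable borel" for i by (rule cell_fun_measurable[OF X])
    fix i x assume i: "i \<in> I"
    have "\<bar>h i (cell X x)\<bar> \<le> (\<Sum>b\<in>Pow X. \<bar>h i b\<bar>)"
      using X cell_in_Pow by (intro member_le_sum) auto
    also have "\<dots> \<le> C" unfolding C_def using I i by (intro member_le_sum) (auto intro: sum_nonneg)
    finally show "\<bar>h i (cell X x)\<bar> \<le> C" .
  qed
  thus ?thesis unfolding integral_cell[OF X] .
qed

lemma tail_intensity: "emeasure \<nu> {x..} = ennreal (clim * \<theta> powr (- x))"
proof -
  have t: "\<theta> > 1" using theta by simp
  have c: "0 \<le> clim" unfolding clim_def using Gamma_real_pos[OF ab(1)] Gamma_real_pos[of "\<alpha> + \<beta>"] ab by simp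
  have "emeasure \<nu> {x..} = (\<integral>\<^sup>+y. ennreal (clim * \<theta> powr (- y) * ln \<theta>) * indicator {x..} y \<partial>lborel)"
    by (subst emeasure_density) auto
  also have "\<dots> = ennreal (0 - - (clim * \<theta> powr (- x)))"
  proof (rule nn_integral_FTC_atLeast)
    show "((\<lambda>y. - (clim * \<theta> powr (- y))) has_real_derivative clim * \<theta> powr (- y) * ln \<theta>) (at y)" for y
      using t by (auto intro!: derivative_eq_intros simp: powr_def)
    show "0 \<le> clim * \<theta> powr (- y) * ln \<theta>" for y using c t by simp
    have "((\<lambda>y. \<theta> powr (- y)) \<longlongrightarrow> 0) at_top" using t by real_asymp
    from tendsto_minus[OF tendsto_mult_left[OF this, of clim]]
    show "((\<lambda>y. - (clim * \<theta> powr (- y))) \<longlongrightarrow> 0) at_top" by simp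
  qed measurable
  finally show ?thesis by simp
qed

end

context beta_limit
begin

lemma PP_measurable: "A \<in> sets borel \<Longrightarrow> (\<lambda>\<omega>. emeasure (PP \<omega>) A) \<in> borel_measurable R"
  using poisson unfolding poisson_point_process_def by simp

lemma PP_law: "A \<in> sets borel \<Longrightarrow> emeasure \<nu> A < \<infinity> \<Longrightarrow>
    R.prob {\<omega> \<in> space R. emeasure (PP \<omega>) A = of_nat k} = exp (- measure \<nu> A) * measure \<nu> A ^ k / fact k"
  using poisson unfolding poisson_point_process_def by simp

lemma PP_indep:
  fixes A :: "nat \<Rightarrow> real set"
  shows "finite J \<Longrightarrow> A ` J \<subseteq> sets borel \<Longrightarrow> disjoint_family_on A J \<Longrightarrow>
    R.indep_vars (\<lambda>_. borel) (\<lambda>i \<omega>. emeasure (PP \<omega>) (A i)) J"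
  using poisson unfolding poisson_point_process_def by simp

definition good :: "int \<Rightarrow> 'b \<Rightarrow> bool" where
  "good lo \<omega> \<longleftrightarrow> (\<forall>i j. 1 \<le> i \<longrightarrow> i \<le> j \<longrightarrow> P j \<omega> \<le> P i \<omega>) \<and>
     PP \<omega> = distr (count_space {1..}) borel (\<lambda>i. P i \<omega>) \<and> finite {i \<in> {1..}. lo \<le> \<lfloor>P i \<omega> + \<epsilon>\<rfloor>}"

lemma emeasure_points:
  assumes "PP \<omega> = distr (count_space {1..}) borel (\<lambda>i. P i \<omega>)" "A \<in> sets borel"
  shows "emeasure (PP \<omega>) A = emeasure (count_space {1..}) {i \<in> {1..}. P i \<omega> \<in> A}"
proof -
  have "(\<lambda>i. P i \<omega>) -` A \<inter> {1..} = {i \<in> {1..}. P i \<omega> \<in> A}" by auto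
  thus ?thesis unfolding assms(1) using assms(2) by (subst emeasure_distr) auto
qed

text \<open>Level at least \<open>lo\<close> means lying in a half-line of finite intensity, whose
  count is almost surely a natural number. As \<open>PP \<omega>\<close> is an image of counting
  measure, that count is the number of indices of such points.\<close>

lemma AE_good: "AE \<omega> in R. good lo \<omega>"
proof -
  let ?A = "{real_of_int lo - \<epsilon>..}"
  have "emeasure \<nu> ?A < \<infinity>" by (simp add: tail_intensity)
  from R.poisson_gf(1)[OF PP_measurable[of ?A] PP_law[OF _ this], of 1]
  have "AE \<omega> in R. \<exists>k::nat. emeasure (PP \<omega>) ?A = of_nat k" by simp
  with points show ?thesis
  proof eventually_elim
    case (elim \<omega>)
    hence pd: "antimono_on {1..} (\<lambda>i. P i \<omega>)" "PP \<omega> = distr (count_space {1..}) borel (\<lambda>i. P i \<omega>)"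
      by (simp_all only: points_in_decreasing_order_def)
    have "emeasure (count_space {1..}) {i \<in> {1..}. P i \<omega> \<in> ?A} \<noteq> \<infinity>"
      using elim(2) emeasure_points[OF pd(2), of ?A] by auto
    hence "finite {i \<in> {1..}. P i \<omega> \<in> ?A}" by (subst (asm) emeasure_count_space) (auto split: if_splits)
    moreover have "{i \<in> {1..}. P i \<omega> \<in> ?A} = {i \<in> {1..}. lo \<le> \<lfloor>P i \<omega> + \<epsilon>\<rfloor>}" by (auto simp: le_floor_iff)
    moreover have "P j \<omega> \<le> P i \<omega>" if "1 \<le> i" "i \<le> j" for i j
      using monotone_onD[OF pd(1), of i j] that by simp
    ultimately show ?case using pd(2) unfolding good_def by simp
  qed
qed

lemma good_level_iff:
  assumes "good lo \<omega>" "1 \<le> i" shows "lo \<le> \<lfloor>P i \<omega> + \<epsilon>\<rfloor> \<longleftrightarrow> i \<le> above lo (Pr \<omega>)"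
proof -
  have "above lo (Pr \<omega>) = (LEAST k. \<lfloor>P (Suc k) \<omega> + \<epsilon>\<rfloor> < lo)" unfolding above_def by simp
  moreover have "lo \<le> \<lfloor>P i \<omega> + \<epsilon>\<rfloor> \<longleftrightarrow> i \<le> (LEAST k. \<lfloor>P (Suc k) \<omega> + \<epsilon>\<rfloor> < lo)"
    using assms by (intro antimono_level_iff floor_mono) (auto simp: good_def)
  ultimately show ?thesis by simp
qed

lemma limit_count_eq:
  "limit_count X lo (Pr \<omega>, Zr \<omega>') (r, b) = card {i \<in> {1..above lo (Pr \<omega>)}. lo + int r \<le> \<lfloor>P i \<omega> + \<epsilon>\<rfloor> \<and> cell X (Z i \<omega>') = b}"
  unfolding limit_count_def by (auto intro!: arg_cong[where f = card])

text \<open>Given the points, the weight averages, over the injective tuples with the prescribed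
  levels, the indicator that their marks show the cells \<open>b\<close>. Each tuple gives the same
  mean as the first \<open>K\<close> ranks themselves, so drawing a uniform tuple does not change
  the probability.\<close>

lemma limit_pattern:
  assumes X: "finite X" and b: "\<And>i. i \<in> {1..K} \<Longrightarrow> b i \<in> Pow X"
  shows "R.expectation (\<lambda>\<omega>. pattern_weight (Pow X) K \<rho> b (limit_count X lo (Pr \<omega>, Zr \<omega>))) =
    R.prob {\<omega> \<in> space R. \<forall>i\<in>{1..K}. \<lfloor>P i \<omega> + \<epsilon>\<rfloor> = lo + int (\<rho> i) \<and> cell X (Z i \<omega>) = b i}"
proof -
  let ?c = "\<lambda>\<omega>. \<forall>i\<in>{1..K}. \<lfloor>P i \<omega> + \<epsilon>\<rfloor> = lo + int (\<rho> i)" and ?p = "\<Prod>i\<in>{1..K}. cell_prob X (b i)"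
  let ?v = "\<lambda>\<omega>. if ?c \<omega> then ?p else 0"
  have cellp: "R.expectation (\<lambda>\<omega>'. \<Prod>i\<in>{1..K}. if cell X (Z (u i) \<omega>') = b i then 1 else 0) = ?p"
    if "inj_on u {1..K}" "\<And>i. i \<in> {1..K} \<Longrightarrow> 1 \<le> u i" for u
  proof -
    have "(\<Sum>\<beta>\<in>Pow X. cell_prob X \<beta> * (if \<beta> = b i then 1 else 0)) = cell_prob X (b i)" if "i \<in> {1..K}" for i
      using X b[OF that] by (subst sum.cong[OF refl, of _ _ "\<lambda>\<beta>. if \<beta> = b i then cell_prob X \<beta> else 0"]) (auto simp: sum.delta)
    thus ?thesis using cells_product[OF X finite_atLeastAtMost that, of "\<lambda>i \<beta>. if \<beta> = b i then 1 else 0"] by simp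
  qed
  define \<phi>1 where "\<phi>1 w = pattern_weight (Pow X) K \<rho> b (limit_count X lo w)" for w
  define \<phi>2 where "\<phi>2 w = (\<Prod>i\<in>{1..K}. if \<lfloor>fst w i + \<epsilon>\<rfloor> = lo + int (\<rho> i) \<and> cell X (snd w i) = b i then 1 else 0 :: real)" for w
  have m1: "\<phi>1 \<in> borel_measurable (PM \<Otimes>\<^sub>M PM)" unfolding \<phi>1_def[abs_def]
    by (rule pattern_weight_measurable[OF limit_count_measurable[OF X]]) (use X in simp)
  have m2: "\<phi>2 \<in> borel_measurable (PM \<Otimes>\<^sub>M PM)" unfolding \<phi>2_def[abs_def]
  proof (rule borel_measurable_prod)
    fix i assume i: "i \<in> {1..K}"
    have "Measurable.pred (PM \<Otimes>\<^sub>M PM) (\<lambda>w. \<lfloor>fst w i + \<epsilon>\<rfloor> = lo + int (\<rho> i))"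
      by (rule measurable_compose[OF measurable_compose[OF measurable_fst floor_measurable]]) (use i in auto)
    moreover have "Measurable.pred (PM \<Otimes>\<^sub>M PM) (\<lambda>w. cell X (snd w i) = b i)"
      by (rule measurable_compose[OF measurable_compose[OF measurable_compose[OF measurable_snd PM_component] cell_measurable_space[OF X]]]) (use i in auto)
    ultimately show "(\<lambda>w. if \<lfloor>fst w i + \<epsilon>\<rfloor> = lo + int (\<rho> i) \<and> cell X (snd w i) = b i then 1 else 0 :: real) \<in> borel_measurable (PM \<Otimes>\<^sub>M PM)"
      by measurable
  qed
  have b1: "\<bar>\<phi>1 w\<bar> \<le> 1" for w unfolding \<phi>1_def by (rule pattern_weight_bound)
  have b2: "\<bar>\<phi>2 w\<bar> \<le> 1" for w unfolding \<phi>2_def abs_prod by (intro prod_le_1) auto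
  have e2: "\<phi>2 (Pr \<omega>, Zr \<omega>') = (if \<forall>i\<in>{1..K}. \<lfloor>P i \<omega> + \<epsilon>\<rfloor> = lo + int (\<rho> i) \<and> cell X (Z i \<omega>') = b i then 1 else 0)" for \<omega> \<omega>'
  proof (cases "\<forall>i\<in>{1..K}. \<lfloor>P i \<omega> + \<epsilon>\<rfloor> = lo + int (\<rho> i) \<and> cell X (Z i \<omega>') = b i")
    case True
    thus ?thesis unfolding \<phi>2_def by simp
  next
    case False
    then obtain i where "i \<in> {1..K}" "\<not> (\<lfloor>P i \<omega> + \<epsilon>\<rfloor> = lo + int (\<rho> i) \<and> cell X (Z i \<omega>') = b i)" by blast
    hence "\<phi>2 (Pr \<omega>, Zr \<omega>') = 0" unfolding \<phi>2_def by (intro prod_zero) auto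
    thus ?thesis by (simp only: if_not_P[OF False])
  qed
  have i2: "R.expectation (\<lambda>\<omega>'. \<phi>2 (Pr \<omega>, Zr \<omega>')) = ?v \<omega>" for \<omega>
  proof (cases "?c \<omega>")
    case True
    have "\<phi>2 (Pr \<omega>, Zr \<omega>') = (\<Prod>i\<in>{1..K}. if cell X (Z i \<omega>') = b i then 1 else 0)" for \<omega>'
      unfolding \<phi>2_def using True by (intro prod.cong refl) simp
    thus ?thesis using cellp[of "\<lambda>i. i"] True by (simp only: if_P[OF True]) simp
  next
    case False
    hence "\<phi>2 (Pr \<omega>, Zr \<omega>') = 0" for \<omega>' unfolding e2 by (intro if_not_P) blast
    thus ?thesis by (simp only: if_not_P[OF False]) simp
  qed
  have i1: "AE \<omega> in R. R.expectation (\<lambda>\<omega>'. \<phi>1 (Pr \<omega>, Zr \<omega>')) = ?v \<omega>"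
    using AE_good[of lo]
  proof eventually_elim
    case (elim \<omega>)
    let ?D = "\<lambda>i. \<lfloor>P i \<omega> + \<epsilon>\<rfloor>" and ?m = "above lo (Pr \<omega>)"
    define V where "V = tuples (\<lambda>r. {x \<in> {1..?m}. ?D x = lo + int r}) \<rho> K"
    have anti: "?D j \<le> ?D i" if "1 \<le> i" "i \<le> j" for i j
      using elim that by (intro floor_mono) (auto simp: good_def)
    have pw: "finite V" "?c \<omega> \<Longrightarrow> V \<noteq> {}" "\<phi>1 (Pr \<omega>, Zr \<omega>') = (if ?c \<omega>
      then real (card {u \<in> V. \<forall>i\<in>{1..K}. cell X (Z (u i) \<omega>') = b i}) / real (card V) else 0)" for \<omega>'
    proof -
      have "(\<lambda>i. cell X (Z i \<omega>')) ` {1..?m} \<subseteq> Pow X" using cell_in_Pow by blast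
      note pr = pattern_weight_ranked[where D = ?D and lo = lo and m = ?m and c = "limit_count X lo (Pr \<omega>, Zr \<omega>')" and K = K and \<rho> = \<rho>,
        OF anti good_level_iff[OF elim] _ this limit_count_eq, folded V_def]
      show "finite V" "?c \<omega> \<Longrightarrow> V \<noteq> {}" using pr(1,2) X by simp_all
      show "\<phi>1 (Pr \<omega>, Zr \<omega>') = (if ?c \<omega>
        then real (card {u \<in> V. \<forall>i\<in>{1..K}. cell X (Z (u i) \<omega>') = b i}) / real (card V) else 0)"
        unfolding \<phi>1_def using X by (intro pr(3)) auto
    qed
    show ?case
    proof (cases "?c \<omega>")
      case False
      have "\<phi>1 (Pr \<omega>, Zr \<omega>') = 0" for \<omega>' unfolding pw(3) by (rule if_not_P[OF False])
      thus ?thesis by (simp only: if_not_P[OF False]) simp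
    next
      case True
      have V0: "real (card V) > 0" using pw(1,2) True by (simp add: card_gt_0_iff)
      let ?h = "\<lambda>u \<omega>'. \<Prod>i\<in>{1..K}. if cell X (Z (u i) \<omega>') = b i then 1 else 0 :: real"
      have Vu: "inj_on u {1..K}" "\<And>i. i \<in> {1..K} \<Longrightarrow> 1 \<le> u i" if "u \<in> V" for u
        using that unfolding V_def tuples_def by auto
      have "real (card {u \<in> V. \<forall>i\<in>{1..K}. cell X (Z (u i) \<omega>') = b i}) = (\<Sum>u\<in>V. ?h u \<omega>')" for \<omega>'
      proof -
        have "(\<Sum>u\<in>V. ?h u \<omega>') = (\<Sum>u\<in>V. if \<forall>i\<in>{1..K}. cell X (Z (u i) \<omega>') = b i then 1 else 0)"
        proof (rule sum.cong[OF refl])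
          fix u
          show "?h u \<omega>' = (if \<forall>i\<in>{1..K}. cell X (Z (u i) \<omega>') = b i then 1 else 0)"
          proof (cases "\<forall>i\<in>{1..K}. cell X (Z (u i) \<omega>') = b i")
            case False
            then obtain i where "i \<in> {1..K}" "cell X (Z (u i) \<omega>') \<noteq> b i" by blast
            hence "?h u \<omega>' = 0" by (intro prod_zero) auto
            thus ?thesis by (simp only: if_not_P[OF False])
          qed simp
        qed
        thus ?thesis using pw(1) by (simp add: sum.inter_filter[symmetric])
      qed
      hence eq: "\<phi>1 (Pr \<omega>, Zr \<omega>') = (\<Sum>u\<in>V. ?h u \<omega>') / real (card V)" for \<omega>'
        using pw(3)[of \<omega>'] by (simp only: if_P[OF True])
      have int: "integrable R (?h u)" if u: "u \<in> V" for u
      proof (rule R.integrable_const_bound[of _ 1])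
        show "AE \<omega>' in R. norm (?h u \<omega>') \<le> 1" by (intro AE_I2) (auto simp: abs_prod intro!: prod_le_1)
        have "(\<lambda>\<omega>'. (\<lambda>z. if cell X z = b i then 1 else 0 :: real) (Z (u i) \<omega>')) \<in> borel_measurable R" if "i \<in> {1..K}" for i
          by (rule measurable_compose[OF Z_measurable[OF Vu(2)[OF u that]] cell_fun_measurable[OF X, of "\<lambda>\<beta>. if \<beta> = b i then 1 else 0"]])
        thus "?h u \<in> borel_measurable R" by (intro borel_measurable_prod) simp
      qed
      have "R.expectation (\<lambda>\<omega>'. \<phi>1 (Pr \<omega>, Zr \<omega>')) = (\<Sum>u\<in>V. R.expectation (?h u)) / real (card V)"
        unfolding eq using int by simp
      also have "(\<Sum>u\<in>V. R.expectation (?h u)) = (\<Sum>u\<in>V. ?p)" by (intro sum.cong refl cellp Vu)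
      also have "\<dots> / real (card V) = ?p" using V0 by simp
      finally show ?thesis by (simp only: if_P[OF True])
    qed
  qed
  have E: "{\<omega> \<in> space R. \<forall>i\<in>{1..K}. \<lfloor>P i \<omega> + \<epsilon>\<rfloor> = lo + int (\<rho> i) \<and> cell X (Z i \<omega>) = b i} \<in> sets R" (is "?E \<in> _")
  proof (intro sets.sets_Collect_finite_All sets.sets_Collect_conj)
    fix i assume i: "i \<in> {1..K}"
    have [measurable]: "P i \<in> borel_measurable R" using P_measurable i by simp
    show "{\<omega> \<in> space R. \<lfloor>P i \<omega> + \<epsilon>\<rfloor> = lo + int (\<rho> i)} \<in> sets R" by measurable
    have "Z i \<in> borel_measurable R" using Z_measurable i by simp
    from measurable_sets[OF this cell_measurable[OF X, of "b i"]]
    show "{\<omega> \<in> space R. cell X (Z i \<omega>) = b i} \<in> sets R" by (simp add: vimage_def Int_def conj_commute)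
  qed simp
  have "R.prob ?E = R.expectation (indicator ?E)" using E by simp
  also have "\<dots> = R.expectation (\<lambda>\<omega>. \<phi>2 (Pr \<omega>, Zr \<omega>))"
    unfolding e2 by (intro Bochner_Integration.integral_cong refl) (simp add: indicator_def)
  also have "\<dots> = R.expectation (\<lambda>\<omega>. R.expectation (\<lambda>\<omega>'. \<phi>2 (Pr \<omega>, Zr \<omega>')))" by (rule fubini(1)[OF m2 b2])
  also have "\<dots> = R.expectation (\<lambda>\<omega>. R.expectation (\<lambda>\<omega>'. \<phi>1 (Pr \<omega>, Zr \<omega>')))"
  proof (rule integral_cong_AE[OF fubini(2)[OF m2 b2] fubini(2)[OF m1 b1]])
    show "AE \<omega> in R. R.expectation (\<lambda>\<omega>'. \<phi>2 (Pr \<omega>, Zr \<omega>')) = R.expectation (\<lambda>\<omega>'. \<phi>1 (Pr \<omega>, Zr \<omega>'))"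
      using i1 unfolding i2 by eventually_elim (rule sym)
  qed
  also have "\<dots> = R.expectation (\<lambda>\<omega>. \<phi>1 (Pr \<omega>, Zr \<omega>))" by (rule fubini(1)[OF m1 b1, symmetric])
  finally show ?thesis unfolding \<phi>1_def by simp
qed

end

context beta_limit
begin

text \<open>Points are sorted into disjoint bands by the highest tested level they reach. In band
  \<open>r\<close> each mark averages to the same factor \<open>\<tau> r\<close>, and the band
  counts are independent Poisson variables. Summation by parts turns band masses into the tail
  masses of \<open>limit_rate\<close>.\<close>

lemma limit_gf:
  assumes X: "finite X" and s: "\<And>r b. 0 \<le> s r b \<and> s r b \<le> 1" and L: "0 < L"
  shows "R.expectation (\<lambda>\<omega>. \<Prod>(r, b)\<in>{..<L} \<times> Pow X. s r b ^ limit_count X lo (Pr \<omega>, Zr \<omega>) (r, b)) = exp (- limit_rate X lo L s)"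
proof -
  define x where "x r = real_of_int (lo + int r) - \<epsilon>" for r
  \<comment> \<open>Bands of unit length, except that the last one is unbounded: beyond
    \<open>x (L - 1)\<close> all tested levels are reached.\<close>
  define I where "I r = {x r..} - (if Suc r < L then {x (Suc r)..} else {})" for r
  define \<tau> where "\<tau> r = (\<Sum>b\<in>Pow X. cell_prob X b * (\<Prod>t<Suc r. s t b))" for r
  define g where "g r y = \<tau> r ^ nat \<lfloor>enn2real y\<rfloor>" for r y
  define \<phi> where "\<phi> w = (\<Prod>(r, b)\<in>{..<L} \<times> Pow X. s r b ^ limit_count X lo w (r, b))" for w
  have Ib [measurable]: "I r \<in> sets borel" for r unfolding I_def by simp
  have cp0: "0 \<le> cell_prob X b" for b unfolding cell_prob_def by simp
  have \<tau>: "0 \<le> \<tau> r" "\<tau> r \<le> 1" for r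
  proof -
    have p: "0 \<le> (\<Prod>t<Suc r. s t b)" "(\<Prod>t<Suc r. s t b) \<le> 1" for b
      using s by (auto intro!: prod_nonneg prod_le_1 simp del: prod.lessThan_Suc)
    show "0 \<le> \<tau> r" unfolding \<tau>_def using cp0 p by (intro sum_nonneg mult_nonneg_nonneg)
    have "\<tau> r \<le> (\<Sum>b\<in>Pow X. cell_prob X b * 1)" unfolding \<tau>_def using cp0 p by (intro sum_mono mult_left_mono)
    thus "\<tau> r \<le> 1" using sum_cell_prob[OF X] by simp
  qed
  have inner: "R.expectation (\<lambda>\<omega>'. \<phi> (Pr \<omega>, Zr \<omega>')) = (\<Prod>r<L. g r (emeasure (PP \<omega>) (I r)))" if gd: "good lo \<omega>" for \<omega>
  proof -
    let ?D = "\<lambda>i. \<lfloor>P i \<omega> + \<epsilon>\<rfloor>" and ?m = "above lo (Pr \<omega>)"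
    define \<kappa> where "\<kappa> i = min (nat (?D i - lo)) (L - 1)" for i
    define h where "h i b = (\<Prod>r<L. if lo + int r \<le> ?D i then s r b else 1)" for i b
    have "\<phi> (Pr \<omega>, Zr \<omega>') = (\<Prod>i\<in>{1..?m}. h i (cell X (Z i \<omega>')))" for \<omega>'
      unfolding \<phi>_def limit_count_eq h_def
      using X cell_in_Pow by (intro prod_power_counts) auto
    hence "R.expectation (\<lambda>\<omega>'. \<phi> (Pr \<omega>, Zr \<omega>')) = (\<Prod>i\<in>{1..?m}. \<Sum>b\<in>Pow X. cell_prob X b * h i b)"
      using cells_product[OF X finite_atLeastAtMost, of "\<lambda>i. i" 1 ?m h] by (simp add: inj_on_def)
    also have "\<dots> = (\<Prod>i\<in>{1..?m}. \<tau> (\<kappa> i))"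
    proof (intro prod.cong refl)
      fix i assume i: "i \<in> {1..?m}"
      hence "lo \<le> ?D i" using good_level_iff[OF gd, of i] by simp
      hence "{r \<in> {..<L}. lo + int r \<le> ?D i} = {..<Suc (\<kappa> i)}" using L unfolding \<kappa>_def by auto
      hence "h i b = (\<Prod>t<Suc (\<kappa> i). s t b)" for b
        unfolding h_def by (subst prod.inter_filter[symmetric]) simp_all
      thus "(\<Sum>b\<in>Pow X. cell_prob X b * h i b) = \<tau> (\<kappa> i)" unfolding \<tau>_def by simp
    qed
    also have "\<dots> = (\<Prod>r<L. \<Prod>i\<in>{i \<in> {1..?m}. \<kappa> i = r}. \<tau> (\<kappa> i))"
      using L by (intro prod.group[symmetric]) (auto simp: \<kappa>_def)
    also have "\<dots> = (\<Prod>r<L. g r (emeasure (PP \<omega>) (I r)))"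
    proof (intro prod.cong refl)
      fix r assume r: "r \<in> {..<L}"
      have xr: "x t \<le> P i \<omega> \<longleftrightarrow> lo + int t \<le> ?D i" for t i unfolding x_def le_floor_iff by (simp add: algebra_simps)
      have "{i \<in> {1..?m}. \<kappa> i = r} = {i \<in> {1..}. P i \<omega> \<in> I r}"
      proof (rule set_eqI)
        fix i
        show "i \<in> {i \<in> {1..?m}. \<kappa> i = r} \<longleftrightarrow> i \<in> {i \<in> {1..}. P i \<omega> \<in> I r}"
        proof (cases "1 \<le> i")
          case True
          have "P i \<omega> \<in> I r \<longleftrightarrow> lo + int r \<le> ?D i \<and> (Suc r < L \<longrightarrow> \<not> lo + int (Suc r) \<le> ?D i)"
            unfolding I_def by (simp add: xr)
          also have "\<dots> \<longleftrightarrow> lo \<le> ?D i \<and> \<kappa> i = r" using r L unfolding \<kappa>_def by auto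
          finally show ?thesis using True good_level_iff[OF gd True] by auto
        qed auto
      qed
      moreover have "emeasure (PP \<omega>) (I r) = emeasure (count_space {1..}) {i \<in> {1..}. P i \<omega> \<in> I r}"
        using gd by (intro emeasure_points) (auto simp: good_def)
      ultimately have "emeasure (PP \<omega>) (I r) = emeasure (count_space {1..}) {i \<in> {1..?m}. \<kappa> i = r}" by (simp only:)
      also have "\<dots> = of_nat (card {i \<in> {1..?m}. \<kappa> i = r})" by (rule emeasure_count_space_finite) auto
      finally have e: "emeasure (PP \<omega>) (I r) = of_nat (card {i \<in> {1..?m}. \<kappa> i = r})" .
      have "(\<Prod>i\<in>{i \<in> {1..?m}. \<kappa> i = r}. \<tau> (\<kappa> i)) = \<tau> r ^ card {i \<in> {1..?m}. \<kappa> i = r}"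
        by simp
      also have "\<dots> = g r (emeasure (PP \<omega>) (I r))" unfolding g_def e by (simp add: ennreal_of_nat_eq_real_of_nat)
      finally show "(\<Prod>i\<in>{i \<in> {1..?m}. \<kappa> i = r}. \<tau> (\<kappa> i)) = g r (emeasure (PP \<omega>) (I r))" .
    qed
    finally show ?thesis .
  qed
  have \<phi>m: "\<phi> \<in> borel_measurable (PM \<Otimes>\<^sub>M PM)" unfolding \<phi>_def[abs_def] case_prod_beta
    by (intro borel_measurable_prod measurable_compose[OF limit_count_measurable[OF X]]) simp
  have \<phi>b: "\<bar>\<phi> w\<bar> \<le> 1" for w unfolding \<phi>_def abs_prod using s
    by (intro prod_le_1) (auto simp: power_abs intro!: power_le_one)
  have gm: "(\<lambda>\<omega>. g r (emeasure (PP \<omega>) (I r))) \<in> borel_measurable R" for r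
    unfolding g_def using PP_measurable[OF Ib[of r]] by measurable
  have gb: "g r \<in> borel_measurable borel" for r unfolding g_def[abs_def] by measurable
  define T where "T r = clim * \<theta> powr (\<epsilon> - (lo + int r))" for r
  have cl: "0 \<le> clim" unfolding clim_def using Gamma_real_pos[OF ab(1)] Gamma_real_pos[of "\<alpha> + \<beta>"] ab by simp
  have tail: "emeasure \<nu> {x r..} = ennreal (T r)" for r unfolding tail_intensity T_def x_def by simp
  have T0: "0 \<le> T r" for r unfolding T_def using cl by simp
  have fin: "emeasure \<nu> (I r) < \<infinity>" for r
  proof -
    have "emeasure \<nu> (I r) \<le> emeasure \<nu> {x r..}" by (intro emeasure_mono) (auto simp: I_def)
    thus ?thesis unfolding tail by (simp add: order.strict_trans1)
  qed
  have mI: "measure \<nu> (I r) = (if r < L then T r else 0) - (if Suc r < L then T (Suc r) else 0)" if "r < L" for r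
  proof -
    have "measure \<nu> (I r) = measure \<nu> {x r..} - measure \<nu> (if Suc r < L then {x (Suc r)..} else {})"
      unfolding I_def
    proof (rule measure_Diff)
      show "emeasure \<nu> {x r..} \<noteq> \<infinity>" by (simp add: tail)
      show "(if Suc r < L then {x (Suc r)..} else {}) \<subseteq> {x r..}" by (auto simp: x_def)
    qed simp_all
    thus ?thesis using that T0 by (auto simp: measure_def tail)
  qed
  have "R.expectation (\<lambda>\<omega>. \<phi> (Pr \<omega>, Zr \<omega>)) = R.expectation (\<lambda>\<omega>. R.expectation (\<lambda>\<omega>'. \<phi> (Pr \<omega>, Zr \<omega>')))"
    by (rule fubini(1)[OF \<phi>m \<phi>b])
  also have "\<dots> = R.expectation (\<lambda>\<omega>. \<Prod>r<L. g r (emeasure (PP \<omega>) (I r)))"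
  proof (rule integral_cong_AE)
    show "AE \<omega> in R. R.expectation (\<lambda>\<omega>'. \<phi> (Pr \<omega>, Zr \<omega>')) = (\<Prod>r<L. g r (emeasure (PP \<omega>) (I r)))"
      using AE_good[of lo] by eventually_elim (rule inner)
  qed (use gm fubini(2)[OF \<phi>m \<phi>b] in auto)
  also have "\<dots> = (\<Prod>r<L. R.expectation (\<lambda>\<omega>. g r (emeasure (PP \<omega>) (I r))))"
  proof (rule R.indep_vars_lebesgue_integral)
    have "disjoint_family_on I {..<L}" unfolding disjoint_family_on_def
    proof (intro ballI impI)
      have d: "I r \<inter> I r' = {}" if rr: "r < r'" "r' < L" for r r'
      proof -
        have "real (Suc r) \<le> real r'" using rr by (simp only: of_nat_le_iff Suc_le_eq)
        hence "x (Suc r) \<le> x r'" by (simp add: x_def)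
        moreover have "Suc r < L" using rr by simp
        ultimately show ?thesis unfolding I_def by auto
      qed
      fix r r' assume "r \<in> {..<L}" "r' \<in> {..<L}" "r \<noteq> r'"
      thus "I r \<inter> I r' = {}" using d[of r r'] d[of r' r] by (cases "r < r'") auto
    qed
    hence "R.indep_vars (\<lambda>_. borel) (\<lambda>r \<omega>. emeasure (PP \<omega>) (I r)) {..<L}" by (intro PP_indep) auto
    thus "R.indep_vars (\<lambda>_. borel) (\<lambda>r \<omega>. g r (emeasure (PP \<omega>) (I r))) {..<L}"
      by (rule R.indep_vars_compose2) (rule gb)
    show "integrable R (\<lambda>\<omega>. g r (emeasure (PP \<omega>) (I r)))" for r
      using \<tau>[of r] by (intro R.integrable_const_bound[of _ 1] gm AE_I2) (auto simp: g_def power_le_one)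
  qed simp
  also have "\<dots> = (\<Prod>r<L. exp (- (measure \<nu> (I r) * (1 - \<tau> r))))"
    unfolding g_def by (intro prod.cong refl R.poisson_gf(2) PP_measurable PP_law Ib fin \<tau>) simp
  also have "\<dots> = exp (- (\<Sum>r<L. measure \<nu> (I r) * (1 - \<tau> r)))"
    by (simp add: exp_sum sum_negf[symmetric])
  also have "(\<Sum>r<L. measure \<nu> (I r) * (1 - \<tau> r)) = limit_rate X lo L s"
  proof -
    let ?q = "\<lambda>b. step_mass (\<lambda>t. s t b)" and ?d = "\<lambda>r. (if r < L then T r else 0) - (if Suc r < L then T (Suc r) else 0)"
    have "1 - \<tau> r = (\<Sum>b\<in>Pow X. cell_prob X b * (\<Sum>t<Suc r. ?q b t))" for r
      unfolding sum_step_mass right_diff_distrib sum_subtractf \<tau>_def mult_1_right sum_cell_prob[OF X] by (rule refl)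
    note one_tau = this
    have "measure \<nu> (I r) * (1 - \<tau> r) = (\<Sum>b\<in>Pow X. cell_prob X b * (?d r * (\<Sum>t<Suc r. ?q b t)))" if "r \<in> {..<L}" for r
    proof -
      have "measure \<nu> (I r) = ?d r" using that by (intro mI) simp
      hence "measure \<nu> (I r) * (1 - \<tau> r) = ?d r * (\<Sum>b\<in>Pow X. cell_prob X b * (\<Sum>t<Suc r. ?q b t))" by (simp only: one_tau)
      also have "\<dots> = (\<Sum>b\<in>Pow X. cell_prob X b * (?d r * (\<Sum>t<Suc r. ?q b t)))"
        by (subst sum_distrib_left) (intro sum.cong refl mult.left_commute)
      finally show ?thesis .
    qed
    hence "(\<Sum>r<L. measure \<nu> (I r) * (1 - \<tau> r)) = (\<Sum>r<L. \<Sum>b\<in>Pow X. cell_prob X b * (?d r * (\<Sum>t<Suc r. ?q b t)))"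
      by (intro sum.cong refl)
    also have "\<dots> = (\<Sum>b\<in>Pow X. cell_prob X b * (\<Sum>r<L. ?d r * (\<Sum>t<Suc r. ?q b t)))"
      unfolding sum_distrib_left[of "cell_prob X _"] by (rule sum.swap)
    also have "\<dots> = limit_rate X lo L s" unfolding sum_by_parts_tails[of L T] unfolding limit_rate_def T_def by (rule refl)
    finally show ?thesis .
  qed
  finally show ?thesis unfolding \<phi>_def .
qed

end

section \<open>Convergence in distribution\<close>

definition grid :: "nat \<Rightarrow> real set" where
  "grid J = (\<lambda>k. real_of_int k / real J) ` {- (int J)\<^sup>2..(int J)\<^sup>2}"

lemma finite_grid: "finite (grid J)" by (simp add: grid_def)

text \<open>The margin 1 puts both neighbours of \<open>z\<close> among the multiples of
  \<open>1 / J\<close> into the grid, so a point with the same cell lies between the same two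
  neighbours.\<close>

lemma grid_cell_diameter:
  assumes J: "\<bar>z\<bar> + 1 \<le> real J" and eq: "cell (grid J) z' = cell (grid J) z"
  shows "\<bar>z' - z\<bar> \<le> 1 / real J"
proof -
  have J1: "1 \<le> real J" using J by linarith
  define k where "k = \<lceil>z * real J\<rceil>"
  have k: "real_of_int k - 1 < z * real J" "z * real J \<le> real_of_int k" unfolding k_def by linarith+
  have "\<bar>z * real J\<bar> \<le> (real J - 1) * real J" unfolding abs_mult using J by (intro mult_mono) auto
  hence zb: "\<bar>z * real J\<bar> \<le> (real J)\<^sup>2 - real J" by (simp add: algebra_simps power2_eq_square)
  have "real_of_int k \<le> (real J)\<^sup>2" "- (real J)\<^sup>2 \<le> real_of_int (k - 1)" using zb k J1 by (auto simp: abs_le_iff)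
  hence "real_of_int k \<le> real_of_int ((int J)\<^sup>2)" "real_of_int (- (int J)\<^sup>2) \<le> real_of_int (k - 1)" by simp_all
  hence kb: "k \<le> (int J)\<^sup>2" "- (int J)\<^sup>2 \<le> k - 1" by (simp_all only: of_int_le_iff)
  define x1 x2 where "x1 = real_of_int (k - 1) / real J" and "x2 = real_of_int k / real J"
  have g: "x1 \<in> grid J" "x2 \<in> grid J" unfolding grid_def x1_def x2_def using kb by (intro imageI; simp)+
  have z: "x1 < z" "z \<le> x2" unfolding x1_def x2_def using k J1 by (simp_all add: divide_less_eq le_divide_eq)
  have "x1 \<in> cell (grid J) z" "x2 \<notin> cell (grid J) z" using g z by (auto simp: cell_def)
  hence "x1 \<in> cell (grid J) z'" "x2 \<notin> cell (grid J) z'" unfolding eq by this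
  hence z': "x1 < z'" "z' \<le> x2" using g by (auto simp: cell_def)
  have "x2 - x1 = 1 / real J" unfolding x1_def x2_def by (simp add: diff_divide_distrib)
  thus ?thesis using z z' by (simp add: abs_le_iff)
qed

lemma integral_diff_le:
  fixes f g h :: "'a \<Rightarrow> real"
  assumes "integrable M f" "integrable M g" "integrable M h" "\<And>x. \<bar>f x - g x\<bar> \<le> h x"
  shows "\<bar>(\<integral>x. f x \<partial>M) - (\<integral>x. g x \<partial>M)\<bar> \<le> (\<integral>x. h x \<partial>M)"
proof -
  have "\<bar>\<integral>x. f x - g x \<partial>M\<bar> \<le> (\<integral>x. \<bar>f x - g x\<bar> \<partial>M)" by (rule integral_abs_bound)
  also have "\<dots> \<le> (\<integral>x. h x \<partial>M)"
    using assms by (intro integral_mono integrable_abs Bochner_Integration.integrable_diff)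
  finally show ?thesis using assms(1,2) by simp
qed

section \<open>From patterns to convergence in distribution by refining the grid\<close>

context beta_tree_setting
begin

text \<open>A bounded continuous function need not be uniformly continuous, so its oscillation over
  a pattern is small only pointwise as the grid is refined. Dominated convergence makes the mean
  oscillation small under the limit law; since it is a bounded function of the pattern, convergence
  of patterns transfers this smallness to the approximating laws.\<close>

lemma converges_if_patterns_converge:
  fixes DM :: "nat \<Rightarrow> nat \<Rightarrow> 'm \<Rightarrow> int" and ZM :: "nat \<Rightarrow> nat \<Rightarrow> 'm \<Rightarrow> real"
    and DR :: "nat \<Rightarrow> 'r \<Rightarrow> int" and ZR :: "nat \<Rightarrow> 'r \<Rightarrow> real"
  assumes M: "prob_space M" and R: "prob_space R"
    and DM: "\<And>j i. i \<in> {1..K} \<Longrightarrow> DM j i \<in> measurable M (count_space UNIV)"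
    and ZM: "\<And>j i. i \<in> {1..K} \<Longrightarrow> ZM j i \<in> borel_measurable M"
    and DR: "\<And>i. i \<in> {1..K} \<Longrightarrow> DR i \<in> measurable R (count_space UNIV)"
    and ZR: "\<And>i. i \<in> {1..K} \<Longrightarrow> ZR i \<in> borel_measurable R"
    and lim: "\<And>X q. finite X \<Longrightarrow> (\<And>i. i \<in> {1..K} \<Longrightarrow> snd (q i) \<in> Pow X) \<Longrightarrow>
      (\<lambda>j. measure M {\<omega> \<in> space M. \<forall>i\<in>{1..K}. DM j i \<omega> = fst (q i) \<and> cell X (ZM j i \<omega>) = snd (q i)})
      \<longlonglongrightarrow> measure R {\<omega> \<in> space R. \<forall>i\<in>{1..K}. DR i \<omega> = fst (q i) \<and> cell X (ZR i \<omega>) = snd (q i)}"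
  shows "converges_in_distribution (product_topology (\<lambda>_. euclidean) {1..K})
    M (\<lambda>j \<omega>. \<lambda>i\<in>{1..K}. (DM j i \<omega>, ZM j i \<omega>)) R (\<lambda>\<omega>. \<lambda>i\<in>{1..K}. (DR i \<omega>, ZR i \<omega>))"
  unfolding converges_in_distribution_def
proof (intro allI impI)
  interpret M: prob_space M by fact
  interpret R: prob_space R by fact
  let ?T = "product_topology (\<lambda>_. euclidean) {1..K} :: (nat \<Rightarrow> int \<times> real) topology"
  fix f :: "(nat \<Rightarrow> int \<times> real) \<Rightarrow> real"
  assume f: "continuous_map ?T euclideanreal f \<and> bounded (f ` topspace ?T)"
  define E where "E = (extensional {1..K} :: (nat \<Rightarrow> int \<times> real) set)"
  have TE: "topspace ?T = E" by (simp add: E_def PiE_UNIV_domain PiE_def)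
  obtain C where "\<forall>y\<in>f ` topspace ?T. norm y \<le> C" using f bounded_iff by blast
  hence C: "\<bar>f w\<bar> \<le> C" if "w \<in> E" for w using that unfolding TE by simp
  define W where "W j \<omega> = (\<lambda>i\<in>{1..K}. (DM j i \<omega>, ZM j i \<omega>))" for j \<omega>
  define Y where "Y \<omega> = (\<lambda>i\<in>{1..K}. (DR i \<omega>, ZR i \<omega>))" for \<omega>
  have WE: "W j \<omega> \<in> E" for j \<omega> by (simp add: W_def E_def)
  have YE: "Y \<omega> \<in> E" for \<omega> by (simp add: Y_def E_def)
  define pat where "pat J w = (\<lambda>i\<in>{1..K}. (fst (w i), cell (grid J) (snd (w i))))" for J and w :: "nat \<Rightarrow> int \<times> real"
  define S where "S J q = {w \<in> E. pat J w = q}" for J q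
  define F where "F J q = (if S J q \<noteq> {} then f (SOME w. w \<in> S J q) else 0)" for J q
  \<comment> \<open>The supremum runs over all sequences with pattern \<open>q\<close>, so the
    oscillation is a function of the pattern alone; it is finite because \<open>f\<close> is
    bounded.\<close>
  define osc where "osc J q = (if S J q \<noteq> {} then SUP w\<in>S J q. \<bar>f w - F J q\<bar> else 0)" for J q
  have Frep: "\<exists>w'\<in>S J q. F J q = f w'" if "S J q \<noteq> {}" for J q
    using some_in_eq[of "S J q"] that unfolding F_def by auto
  have C0: "0 \<le> C" using C[OF YE] abs_ge_zero order_trans by blast
  have Fb: "\<bar>F J q\<bar> \<le> C" for J q
  proof (cases "S J q = {}")
    case False
    from Frep[OF this] obtain w' where "w' \<in> S J q" "F J q = f w'" by blast
    thus ?thesis using C[of w'] unfolding S_def by simp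
  qed (simp add: F_def C0)
  have dev: "\<bar>f w - F J q\<bar> \<le> 2 * C" if "w \<in> S J q" for w J q
    using C[of w] Fb[of J q] that unfolding S_def by auto
  have bdd: "bdd_above ((\<lambda>w. \<bar>f w - F J q\<bar>) ` S J q)" for J q using dev by (intro bdd_aboveI2)
  have oscb: "0 \<le> osc J q \<and> osc J q \<le> 2 * C" for J q
  proof (cases "S J q = {}")
    case False
    then obtain w where w: "w \<in> S J q" by blast
    have "\<bar>f w - F J q\<bar> \<le> osc J q" unfolding osc_def if_P[OF False] using w bdd by (rule cSUP_upper)
    moreover have "osc J q \<le> 2 * C" unfolding osc_def if_P[OF False] using False dev by (rule cSUP_least)
    ultimately show ?thesis by linarith
  qed (simp add: osc_def C0)
  have close: "\<bar>f w - F J (pat J w)\<bar> \<le> osc J (pat J w)" if "w \<in> E" for w J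
  proof -
    have w: "w \<in> S J (pat J w)" using that by (simp add: S_def)
    hence ne: "S J (pat J w) \<noteq> {}" by blast
    show ?thesis unfolding osc_def if_P[OF ne] using w bdd by (rule cSUP_upper)
  qed
  have osc_lim: "(\<lambda>J. osc J (pat J w)) \<longlonglongrightarrow> 0" if w: "w \<in> E" for w
  proof (rule LIMSEQ_I)
    fix e :: real assume e: "e > 0"
    let ?U = "{w' \<in> topspace ?T. f w' \<in> ball (f w) (e / 4)}"
    have "openin ?T ?U" using f by (intro openin_continuous_map_preimage) auto
    moreover have "w \<in> ?U" using w e TE by simp
    ultimately obtain V where V: "\<And>i. i \<in> {1..K} \<Longrightarrow> openin euclidean (V i)" "w \<in> PiE {1..K} V" "PiE {1..K} V \<subseteq> ?U"
      unfolding openin_product_topology_alt by meson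
    have "eventually (\<lambda>J. \<forall>z'. cell (grid J) z' = cell (grid J) (snd (w i)) \<longrightarrow> (fst (w i), z') \<in> V i) sequentially" if i: "i \<in> {1..K}" for i
    proof -
      have "open (V i)" "w i \<in> V i" using V(1)[OF i] PiE_mem[OF V(2) i] by simp_all
      then obtain A B where AB: "open A" "open B" "w i \<in> A \<times> B" "A \<times> B \<subseteq> V i" by (rule open_prod_elim)
      then obtain \<eta> where \<eta>: "\<eta> > 0" "ball (snd (w i)) \<eta> \<subseteq> B" using open_contains_ball[of B] by (auto simp: mem_Times_iff)
      have "eventually (\<lambda>J. 1 / \<eta> < real J) sequentially" "eventually (\<lambda>J. \<bar>snd (w i)\<bar> + 1 < real J) sequentially"
        using filterlim_real_sequentially unfolding filterlim_at_top_dense by blast+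
      thus ?thesis
      proof eventually_elim
        case (elim J)
        show ?case
        proof (intro allI impI)
          fix z' assume "cell (grid J) z' = cell (grid J) (snd (w i))"
          hence "\<bar>z' - snd (w i)\<bar> \<le> 1 / real J" by (rule grid_cell_diameter[OF less_imp_le[OF elim(2)]])
          also have "1 / real J < \<eta>" using elim(1,2) \<eta>(1) by (simp add: field_simps)
          finally have "z' \<in> ball (snd (w i)) \<eta>" by (simp add: dist_real_def abs_minus_commute)
          thus "(fst (w i), z') \<in> V i" using \<eta>(2) AB(3,4) by (auto simp: mem_Times_iff)
        qed
      qed
    qed
    hence "eventually (\<lambda>J. \<forall>i\<in>{1..K}. \<forall>z'. cell (grid J) z' = cell (grid J) (snd (w i)) \<longrightarrow> (fst (w i), z') \<in> V i) sequentially"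
      by (intro eventually_ball_finite) auto
    hence "eventually (\<lambda>J. norm (osc J (pat J w) - 0) < e) sequentially"
    proof eventually_elim
      case (elim J)
      have near: "\<bar>f w' - f w\<bar> < e / 4" if w': "w' \<in> S J (pat J w)" for w'
      proof -
        have wp: "w' \<in> E" "pat J w' = pat J w" using w' by (simp_all add: S_def)
        have "w' i \<in> V i" if i: "i \<in> {1..K}" for i
        proof -
          have "fst (w' i) = fst (w i) \<and> cell (grid J) (snd (w' i)) = cell (grid J) (snd (w i))"
            using fun_cong[OF wp(2), of i] i by (simp add: pat_def)
          hence "(fst (w i), snd (w' i)) \<in> V i" "(fst (w i), snd (w' i)) = w' i" using elim i by (blast, simp add: prod_eq_iff)
          thus ?thesis by (simp only:)
        qed
        hence "w' \<in> PiE {1..K} V" using wp(1) unfolding E_def PiE_def by blast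
        hence "f w' \<in> ball (f w) (e / 4)" using V(3) by blast
        thus ?thesis by (simp add: dist_real_def abs_minus_commute)
      qed
      have ne: "S J (pat J w) \<noteq> {}" using w unfolding S_def by blast
      from Frep[OF ne] obtain w0 where w0: "w0 \<in> S J (pat J w)" "F J (pat J w) = f w0" by blast
      have "osc J (pat J w) \<le> e / 2" unfolding osc_def if_P[OF ne]
      proof (rule cSUP_least[OF ne])
        fix w' assume "w' \<in> S J (pat J w)"
        from near[OF this] near[OF w0(1)] show "\<bar>f w' - F J (pat J w)\<bar> \<le> e / 2" unfolding w0(2) by linarith
      qed
      thus ?case using oscb[of J "pat J w"] e by simp
    qed
    thus "\<exists>no. \<forall>J\<ge>no. norm (osc J (pat J w) - 0) < e" by (simp add: eventually_sequentially)
  qed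
  have F_lim: "(\<lambda>J. F J (pat J w)) \<longlonglongrightarrow> f w" if w: "w \<in> E" for w
  proof (rule LIM_zero_cancel, rule tendsto_rabs_zero_cancel, rule tendsto_sandwich[OF _ _ tendsto_const osc_lim[OF w]])
    show "eventually (\<lambda>J. 0 \<le> \<bar>F J (pat J w) - f w\<bar>) sequentially" by simp
    show "eventually (\<lambda>J. \<bar>F J (pat J w) - f w\<bar> \<le> osc J (pat J w)) sequentially"
      using close[OF w] by (intro always_eventually) (simp add: abs_minus_commute)
  qed
  define A where "A J = PiE {1..K} (\<lambda>_. UNIV \<times> Pow (grid J) :: (int \<times> real set) set)" for J
  have cA: "countable (A J)" for J
    unfolding A_def using finite_grid by (intro countable_PiE) (auto intro: countable_finite)
  have pe: "pat J (\<lambda>i\<in>{1..K}. (d i, z i)) = q \<longleftrightarrow> (\<forall>i\<in>{1..K}. d i = fst (q i) \<and> cell (grid J) (z i) = snd (q i))"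
    if "q \<in> A J" for J q d z
  proof -
    have qe: "q \<in> extensional {1..K}" using that by (simp add: A_def PiE_def)
    have "pat J (\<lambda>i\<in>{1..K}. (d i, z i)) = q \<longleftrightarrow> (\<forall>i\<in>{1..K}. pat J (\<lambda>i\<in>{1..K}. (d i, z i)) i = q i)"
      using extensionalityI[OF _ qe, of "pat J (\<lambda>i\<in>{1..K}. (d i, z i))"] by (auto simp: pat_def)
    thus ?thesis by (simp add: pat_def prod_eq_iff)
  qed
  have pA: "pat J w \<in> A J" for J w using cell_in_Pow by (auto simp: pat_def A_def)
  have meas: "(\<lambda>\<omega>. pat J (\<lambda>i\<in>{1..K}. (d i \<omega>, z i \<omega>))) \<in> measurable N (count_space (A J))"
    if d: "\<And>i. i \<in> {1..K} \<Longrightarrow> d i \<in> measurable N (count_space UNIV)" and z: "\<And>i. i \<in> {1..K} \<Longrightarrow> z i \<in> borel_measurable N"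
    for J N and d :: "nat \<Rightarrow> 'c \<Rightarrow> int" and z :: "nat \<Rightarrow> 'c \<Rightarrow> real"
  proof (subst measurable_count_space_eq_countable[OF cA], intro conjI ballI)
    show "(\<lambda>\<omega>. pat J (\<lambda>i\<in>{1..K}. (d i \<omega>, z i \<omega>))) \<in> space N \<rightarrow> A J" using pA by blast
    fix q assume q: "q \<in> A J"
    have "(\<lambda>\<omega>. pat J (\<lambda>i\<in>{1..K}. (d i \<omega>, z i \<omega>))) -` {q} \<inter> space N = {\<omega> \<in> space N. \<forall>i\<in>{1..K}. d i \<omega> = fst (q i) \<and> cell (grid J) (z i \<omega>) = snd (q i)}"
    proof (rule set_eqI)
      fix \<omega>
      show "\<omega> \<in> (\<lambda>\<omega>. pat J (\<lambda>i\<in>{1..K}. (d i \<omega>, z i \<omega>))) -` {q} \<inter> space N \<longleftrightarrow>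
          \<omega> \<in> {\<omega> \<in> space N. \<forall>i\<in>{1..K}. d i \<omega> = fst (q i) \<and> cell (grid J) (z i \<omega>) = snd (q i)}"
        using pe[OF q, of "\<lambda>i. d i \<omega>" "\<lambda>i. z i \<omega>"] by blast
    qed
    also have "\<dots> \<in> sets N"
    proof (intro sets.sets_Collect_finite_All sets.sets_Collect_conj)
      fix i assume i: "i \<in> {1..K}"
      from measurable_sets[OF d[OF i], of "{fst (q i)}"]
      show "{\<omega> \<in> space N. d i \<omega> = fst (q i)} \<in> sets N" by (simp add: vimage_def Int_def conj_commute)
      from measurable_sets[OF z[OF i] cell_measurable[OF finite_grid]]
      show "{\<omega> \<in> space N. cell (grid J) (z i \<omega>) = snd (q i)} \<in> sets N" by (simp add: vimage_def Int_def conj_commute)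
    qed simp
    finally show "(\<lambda>\<omega>. pat J (\<lambda>i\<in>{1..K}. (d i \<omega>, z i \<omega>))) -` {q} \<inter> space N \<in> sets N" .
  qed
  have mW: "(\<lambda>\<omega>. pat J (W j \<omega>)) \<in> measurable M (count_space (A J))" for J j unfolding W_def using DM ZM by (rule meas)
  have mY: "(\<lambda>\<omega>. pat J (Y \<omega>)) \<in> measurable R (count_space (A J))" for J unfolding Y_def using DR ZR by (rule meas)
  have conv: "(\<lambda>j. \<integral>\<omega>. \<phi> (pat J (W j \<omega>)) \<partial>M) \<longlonglongrightarrow> (\<integral>\<omega>. \<phi> (pat J (Y \<omega>)) \<partial>R)" if \<phi>: "\<And>q. \<bar>\<phi> q\<bar> \<le> C'" for \<phi> :: "_ \<Rightarrow> real" and J C'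
  proof (rule discrete_convergence[OF M R cA mW mY _ \<phi>])
    fix q assume q: "q \<in> A J"
    have qi: "snd (q i) \<in> Pow (grid J)" if "i \<in> {1..K}" for i using q that unfolding A_def by (auto simp: PiE_iff mem_Times_iff)
    show "(\<lambda>j. measure M {\<omega> \<in> space M. pat J (W j \<omega>) = q}) \<longlonglongrightarrow> measure R {\<omega> \<in> space R. pat J (Y \<omega>) = q}"
      unfolding W_def Y_def pe[OF q] by (rule lim[OF finite_grid qi])
  qed
  have mc: "(\<lambda>\<omega>. h (pat J (W j \<omega>))) \<in> borel_measurable M" "(\<lambda>\<omega>. h (pat J (Y \<omega>))) \<in> borel_measurable R" for h :: "_ \<Rightarrow> real" and J j
    by (rule measurable_compose[OF mW] measurable_compose[OF mY], simp)+
  \<comment> \<open>Measurability comes from writing \<open>f\<close> as a pointwise limit of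
    functions of the patterns, which take values in a countable set.\<close>
  have fW: "(\<lambda>\<omega>. f (W j \<omega>)) \<in> borel_measurable M" for j
    by (rule borel_measurable_LIMSEQ_metric[where f = "\<lambda>J \<omega>. F J (pat J (W j \<omega>))"]) (rule mc, rule F_lim[OF WE])
  have fY: "(\<lambda>\<omega>. f (Y \<omega>)) \<in> borel_measurable R"
    by (rule borel_measurable_LIMSEQ_metric[where f = "\<lambda>J \<omega>. F J (pat J (Y \<omega>))"]) (rule mc, rule F_lim[OF YE])
  have iM: "integrable M (\<lambda>\<omega>. f (W j \<omega>))" "integrable M (\<lambda>\<omega>. F J (pat J (W j \<omega>)))" "integrable M (\<lambda>\<omega>. osc J (pat J (W j \<omega>)))" for J j
  proof -
    show "integrable M (\<lambda>\<omega>. f (W j \<omega>))" by (rule M.integrable_const_bound[where B = C]) (use C[OF WE] fW in simp_all)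
    show "integrable M (\<lambda>\<omega>. F J (pat J (W j \<omega>)))" by (rule M.integrable_const_bound[where B = C]) (use Fb mc in simp_all)
    show "integrable M (\<lambda>\<omega>. osc J (pat J (W j \<omega>)))" by (rule M.integrable_const_bound[where B = "2 * C"]) (use oscb mc in simp_all)
  qed
  have iR: "integrable R (\<lambda>\<omega>. f (Y \<omega>))" "integrable R (\<lambda>\<omega>. F J (pat J (Y \<omega>)))" "integrable R (\<lambda>\<omega>. osc J (pat J (Y \<omega>)))" for J
  proof -
    show "integrable R (\<lambda>\<omega>. f (Y \<omega>))" by (rule R.integrable_const_bound[where B = C]) (use C[OF YE] fY in simp_all)
    show "integrable R (\<lambda>\<omega>. F J (pat J (Y \<omega>)))" by (rule R.integrable_const_bound[where B = C]) (use Fb mc in simp_all)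
    show "integrable R (\<lambda>\<omega>. osc J (pat J (Y \<omega>)))" by (rule R.integrable_const_bound[where B = "2 * C"]) (use oscb mc in simp_all)
  qed
  have dM: "\<bar>(\<integral>\<omega>. f (W j \<omega>) \<partial>M) - (\<integral>\<omega>. F J (pat J (W j \<omega>)) \<partial>M)\<bar> \<le> (\<integral>\<omega>. osc J (pat J (W j \<omega>)) \<partial>M)" for J j
    by (rule integral_diff_le[OF iM close[OF WE]])
  have dR: "\<bar>(\<integral>\<omega>. f (Y \<omega>) \<partial>R) - (\<integral>\<omega>. F J (pat J (Y \<omega>)) \<partial>R)\<bar> \<le> (\<integral>\<omega>. osc J (pat J (Y \<omega>)) \<partial>R)" for J
    by (rule integral_diff_le[OF iR close[OF YE]])
  have "(\<lambda>J. \<integral>\<omega>. osc J (pat J (Y \<omega>)) \<partial>R) \<longlonglongrightarrow> (\<integral>\<omega>. 0 \<partial>R)"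
  proof (rule integral_dominated_convergence[where w = "\<lambda>_. 2 * C"])
    show "AE \<omega> in R. (\<lambda>J. osc J (pat J (Y \<omega>))) \<longlonglongrightarrow> 0" using osc_lim[OF YE] by simp
    show "AE \<omega> in R. norm (osc J (pat J (Y \<omega>))) \<le> 2 * C" for J using oscb by simp
  qed (use mc(2) in simp_all)
  hence oR: "(\<lambda>J. \<integral>\<omega>. osc J (pat J (Y \<omega>)) \<partial>R) \<longlonglongrightarrow> 0" by simp
  show "(\<lambda>j. \<integral>\<omega>. f (\<lambda>i\<in>{1..K}. (DM j i \<omega>, ZM j i \<omega>)) \<partial>M) \<longlonglongrightarrow> (\<integral>\<omega>. f (\<lambda>i\<in>{1..K}. (DR i \<omega>, ZR i \<omega>)) \<partial>R)"
    unfolding W_def[symmetric] Y_def[symmetric]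
  proof (rule LIMSEQ_I)
    fix e :: real assume e: "e > 0"
    have small: "eventually (\<lambda>k. \<bar>x k - l\<bar> < e / 4) sequentially" if "x \<longlonglongrightarrow> l" for x and l :: real
      using tendstoD[OF that, of "e / 4"] e by (simp add: dist_real_def)
    from eventually_happens'[OF sequentially_bot small[OF oR]]
    obtain J where J: "\<bar>(\<integral>\<omega>. osc J (pat J (Y \<omega>)) \<partial>R) - 0\<bar> < e / 4" by blast
    have c1: "(\<lambda>j. \<integral>\<omega>. F J (pat J (W j \<omega>)) \<partial>M) \<longlonglongrightarrow> (\<integral>\<omega>. F J (pat J (Y \<omega>)) \<partial>R)" by (rule conv[OF Fb])
    have c2: "(\<lambda>j. \<integral>\<omega>. osc J (pat J (W j \<omega>)) \<partial>M) \<longlonglongrightarrow> (\<integral>\<omega>. osc J (pat J (Y \<omega>)) \<partial>R)"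
      by (rule conv[of _ "2 * C"]) (use oscb in auto)
    from small[OF c1] small[OF c2]
    have "eventually (\<lambda>j. norm ((\<integral>\<omega>. f (W j \<omega>) \<partial>M) - (\<integral>\<omega>. f (Y \<omega>) \<partial>R)) < e) sequentially"
    proof eventually_elim
      case (elim j)
      have "\<bar>(\<integral>\<omega>. f (W j \<omega>) \<partial>M) - (\<integral>\<omega>. f (Y \<omega>) \<partial>R)\<bar> < e"
        using dM[of j J] dR[of J] elim J unfolding abs_less_iff abs_le_iff by linarith
      thus ?case by simp
    qed
    thus "\<exists>no. \<forall>j\<ge>no. norm ((\<integral>\<omega>. f (W j \<omega>) \<partial>M) - (\<integral>\<omega>. f (Y \<omega>) \<partial>R)) < e" by (simp add: eventually_sequentially)
  qed
qed

end

lemma converges_in_distribution_offset: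
  assumes "converges_in_distribution T M (\<lambda>j. X (j + k)) R Y"
  shows "converges_in_distribution T M X R Y"
  unfolding converges_in_distribution_def
proof (intro allI impI)
  fix f assume "continuous_map T euclideanreal f \<and> bounded (f ` topspace T)"
  with assms have "(\<lambda>j. \<integral>\<omega>. f (X (j + k) \<omega>) \<partial>M) \<longlonglongrightarrow> (\<integral>\<omega>. f (Y \<omega>) \<partial>R)"
    unfolding converges_in_distribution_def by blast
  thus "(\<lambda>j. \<integral>\<omega>. f (X j \<omega>) \<partial>M) \<longlonglongrightarrow> (\<integral>\<omega>. f (Y \<omega>) \<partial>R)" by (rule LIMSEQ_offset)
qed

section \<open>The tree compared with the limit\<close>

locale beta_wrt_limit =
  degree_ordered_wrt M "beta_distribution \<alpha> \<beta>" W pa v + beta_wrt M W pa \<alpha> \<beta> \<theta> lam \<epsilon> a n +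
  beta_limit \<alpha> \<beta> \<theta> lam \<epsilon> a n R PP P Z
  for M :: "'a measure" and W pa v \<alpha> \<beta> \<theta> lam \<epsilon> a n and R :: "'b measure" and PP P Z
begin

definition tree_count :: "real set \<Rightarrow> int \<Rightarrow> nat \<Rightarrow> 'a \<Rightarrow> nat \<times> real set \<Rightarrow> nat" where
  "tree_count X lo j \<omega> = (\<lambda>(r, b). card {x \<in> {1..n j}. level lo j + r \<le> deg (n j) x \<omega> \<and> cell X (label_z j x) = b})"

lemma tree_count_measurable: "(\<lambda>\<omega>. tree_count X lo j \<omega> k) \<in> measurable M (count_space UNIV)"
  unfolding tree_count_def by (rule count_measurable)

text \<open>The weight is a bounded function of finitely many counts. Their generating functions
  converge because \<open>tree_gf_lim\<close> and \<open>limit_gf\<close> involve the same rate;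
  hence the joint point masses of the counts converge, and so does the mean of the weight.\<close>

lemma pattern_weight_limit:
  assumes X: "finite X" and b: "\<And>i. i \<in> {1..K} \<Longrightarrow> b i \<in> Pow X"
  shows "(\<lambda>j. expectation (\<lambda>\<omega>. pattern_weight (Pow X) K \<rho> b (tree_count X lo j \<omega>)))
    \<longlonglongrightarrow> R.expectation (\<lambda>\<omega>. pattern_weight (Pow X) K \<rho> b (limit_count X lo (Pr \<omega>, Zr \<omega>)))"
proof -
  \<comment> \<open>Large enough that all levels \<open>\<rho> i\<close> and
    \<open>Suc (\<rho> i)\<close> are tested; the weight reads no other counts in its level
    arguments.\<close>
  define L where "L = Suc (Suc (\<Sum>i\<in>{1..K}. \<rho> i))"
  have L0: "0 < L" by (simp add: L_def)
  have \<rho>L: "\<rho> i < L \<and> Suc (\<rho> i) < L" if "i \<in> {1..K}" for i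
    using member_le_sum[OF that, of \<rho>] by (simp add: L_def)
  let ?J = "{..<L} \<times> Pow X"
  have J: "finite ?J" using X by simp
  let ?A = "PiE ?J (\<lambda>_. UNIV :: nat set)"
  have A: "countable ?A" using J by (intro countable_PiE) auto
  have mN': "(\<lambda>\<omega>. limit_count X lo (Pr \<omega>, Zr \<omega>) k) \<in> measurable R (count_space UNIV)" for k
    by (rule measurable_compose[OF measurable_Pair[OF Pr_measurable Zr_measurable] limit_count_measurable[OF X]])
  have gf: "(\<lambda>j. expectation (\<lambda>\<omega>. \<Prod>k\<in>?J. ((1/2 :: real) ^ e k) ^ tree_count X lo j \<omega> k))
    \<longlonglongrightarrow> R.expectation (\<lambda>\<omega>. \<Prod>k\<in>?J. ((1/2) ^ e k) ^ limit_count X lo (Pr \<omega>, Zr \<omega>) k)" for e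
  proof -
    let ?s = "\<lambda>r b. (1/2 :: real) ^ e (r, b)"
    have s: "0 \<le> ?s r b \<and> ?s r b \<le> 1" for r b by (simp add: power_le_one)
    have "(\<Prod>k\<in>?J. ((1/2 :: real) ^ e k) ^ tree_count X lo j \<omega> k) = tree_gf X lo L ?s j \<omega>" for j \<omega>
    proof -
      have "(\<Prod>k\<in>?J. ((1/2 :: real) ^ e k) ^ tree_count X lo j \<omega> k) =
        (\<Prod>(r, b)\<in>?J. ?s r b ^ card {x \<in> {1..n j}. level lo j + r \<le> deg (n j) x \<omega> \<and> cell X (label_z j x) = b})"
        by (intro prod.cong refl) (auto simp: tree_count_def)
      also have "\<dots> = tree_gf X lo L ?s j \<omega>" unfolding tree_gf_def
        using X cell_in_Pow by (intro prod_power_counts) auto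
      finally show ?thesis .
    qed
    moreover have "(\<Prod>k\<in>?J. ((1/2 :: real) ^ e k) ^ c k) = (\<Prod>(r, b)\<in>?J. ?s r b ^ c (r, b))" for c :: "nat \<times> real set \<Rightarrow> nat"
      by (intro prod.cong refl) auto
    hence "R.expectation (\<lambda>\<omega>. \<Prod>k\<in>?J. ((1/2) ^ e k) ^ limit_count X lo (Pr \<omega>, Zr \<omega>) k) = exp (- limit_rate X lo L ?s)"
      using limit_gf[where s = ?s, OF X s L0, of lo] by (simp only:)
    ultimately show ?thesis using tree_gf_lim[where s = ?s, OF X s, of lo L] by (simp only:)
  qed
  note gl = gf_continuity[OF prob_space_axioms R.prob_space_axioms J tree_count_measurable mN' gf]
  have rm: "(\<lambda>\<omega>. restrict (c \<omega>) ?J) \<in> measurable N (count_space ?A)"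
    if c: "\<And>k. (\<lambda>\<omega>. c \<omega> k) \<in> measurable N (count_space UNIV)" for N and c :: "'c \<Rightarrow> nat \<times> real set \<Rightarrow> nat"
  proof (subst measurable_count_space_eq_countable[OF A], intro conjI ballI)
    show "(\<lambda>\<omega>. restrict (c \<omega>) ?J) \<in> space N \<rightarrow> ?A" by auto
    fix q assume q: "q \<in> ?A"
    have "(\<lambda>\<omega>. restrict (c \<omega>) ?J) -` {q} \<inter> space N = {\<omega> \<in> space N. \<forall>k\<in>?J. c \<omega> k = q k}"
      using q by (auto simp: PiE_iff extensional_def restrict_def fun_eq_iff)
    also have "\<dots> \<in> sets N"
    proof (intro sets.sets_Collect_finite_All J)
      fix k
      from measurable_sets[OF c[of k], of "{q k}"]
      show "{\<omega> \<in> space N. c \<omega> k = q k} \<in> sets N" by (simp add: vimage_def Int_def conj_commute)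
    qed
    finally show "(\<lambda>\<omega>. restrict (c \<omega>) ?J) -` {q} \<inter> space N \<in> sets N" .
  qed
  have re: "restrict c ?J = q \<longleftrightarrow> (\<forall>k\<in>?J. c k = q k)" if "q \<in> ?A" for c q
    using that by (auto simp: PiE_iff extensional_def restrict_def fun_eq_iff)
  have "(\<lambda>j. expectation (\<lambda>\<omega>. pattern_weight (Pow X) K \<rho> b (restrict (tree_count X lo j \<omega>) ?J)))
    \<longlonglongrightarrow> R.expectation (\<lambda>\<omega>. pattern_weight (Pow X) K \<rho> b (restrict (limit_count X lo (Pr \<omega>, Zr \<omega>)) ?J))"
  proof (rule discrete_convergence[OF prob_space_axioms R.prob_space_axioms A rm[OF tree_count_measurable] rm[OF mN']])
    show "\<bar>pattern_weight (Pow X) K \<rho> b q\<bar> \<le> 1" for q by (rule pattern_weight_bound)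
    fix q assume q: "q \<in> ?A"
    show "(\<lambda>j. prob {\<omega> \<in> space M. restrict (tree_count X lo j \<omega>) ?J = q}) \<longlonglongrightarrow>
       R.prob {\<omega> \<in> space R. restrict (limit_count X lo (Pr \<omega>, Zr \<omega>)) ?J = q}"
      unfolding re[OF q] by (rule gl)
  qed
  moreover have "pattern_weight (Pow X) K \<rho> b (restrict c ?J) = pattern_weight (Pow X) K \<rho> b c" for c
    using \<rho>L by (intro pattern_weight_cong b) auto
  ultimately show ?thesis by simp
qed

lemma pattern_limit:
  assumes X: "finite X" and q: "\<And>i. i \<in> {1..K} \<Longrightarrow> snd (q i) \<in> Pow X"
  shows "(\<lambda>j. prob {\<omega> \<in> space M. \<forall>i\<in>{1..K}. int (deg (n j) (v (n j) i \<omega>) \<omega>) - \<lfloor>a (n j)\<rfloor> = fst (q i) \<and>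
      cell X (label_z j (v (n j) i \<omega>)) = snd (q i)})
    \<longlonglongrightarrow> R.prob {\<omega> \<in> space R. \<forall>i\<in>{1..K}. \<lfloor>P i \<omega> + \<epsilon>\<rfloor> = fst (q i) \<and> cell X (Z i \<omega>) = snd (q i)}"
proof -
  \<comment> \<open>A common lowest level, so that all prescribed integer levels become natural
    offsets; including 0 keeps the minimum defined for \<open>K = 0\<close>.\<close>
  define lo where "lo = Min (insert 0 ((\<lambda>i. fst (q i)) ` {1..K}))"
  define \<rho> where "\<rho> i = nat (fst (q i) - lo)" for i
  have lo: "lo + int (\<rho> i) = fst (q i)" if "i \<in> {1..K}" for i
  proof -
    have "lo \<le> fst (q i)" unfolding lo_def using that by (intro Min_le) auto
    thus ?thesis by (simp add: \<rho>_def)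
  qed
  let ?b = "\<lambda>i. snd (q i)"
  have "R.expectation (\<lambda>\<omega>. pattern_weight (Pow X) K \<rho> ?b (limit_count X lo (Pr \<omega>, Zr \<omega>))) =
     R.prob {\<omega> \<in> space R. \<forall>i\<in>{1..K}. \<lfloor>P i \<omega> + \<epsilon>\<rfloor> = lo + int (\<rho> i) \<and> cell X (Z i \<omega>) = ?b i}"
    by (rule limit_pattern[OF X q])
  also have "\<dots> = R.prob {\<omega> \<in> space R. \<forall>i\<in>{1..K}. \<lfloor>P i \<omega> + \<epsilon>\<rfloor> = fst (q i) \<and> cell X (Z i \<omega>) = ?b i}"
    by (intro arg_cong[where f = R.prob] Collect_cong conj_cong ball_cong refl) (simp only: lo)
  finally have R: "R.expectation (\<lambda>\<omega>. pattern_weight (Pow X) K \<rho> ?b (limit_count X lo (Pr \<omega>, Zr \<omega>))) = \<dots>" .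
  have "eventually (\<lambda>j. K \<le> n j) sequentially" using n_lim unfolding filterlim_at_top by blast
  with floor_a_lim[of "- lo"]
  have "eventually (\<lambda>j. expectation (\<lambda>\<omega>. pattern_weight (Pow X) K \<rho> ?b (tree_count X lo j \<omega>)) =
     prob {\<omega> \<in> space M. \<forall>i\<in>{1..K}. int (deg (n j) (v (n j) i \<omega>) \<omega>) - \<lfloor>a (n j)\<rfloor> = fst (q i) \<and>
      cell X (label_z j (v (n j) i \<omega>)) = snd (q i)}) sequentially"
  proof eventually_elim
    case (elim j)
    have "(\<lambda>x. cell X (label_z j x)) ` {1..n j} \<subseteq> Pow X" using cell_in_Pow by blast
    from pattern_probability[OF elim(2) _ this, of "level lo j" \<rho> ?b] X
    have "expectation (\<lambda>\<omega>. pattern_weight (Pow X) K \<rho> ?b (tree_count X lo j \<omega>)) =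
      prob {\<omega> \<in> space M. \<forall>i\<in>{1..K}. deg (n j) (v (n j) i \<omega>) \<omega> = level lo j + \<rho> i \<and> cell X (label_z j (v (n j) i \<omega>)) = ?b i}"
      unfolding tree_count_def by simp
    also have "\<dots> = prob {\<omega> \<in> space M. \<forall>i\<in>{1..K}. int (deg (n j) (v (n j) i \<omega>) \<omega>) - \<lfloor>a (n j)\<rfloor> = fst (q i) \<and> cell X (label_z j (v (n j) i \<omega>)) = ?b i}"
      using lo elim(1) unfolding level_def
      by (intro arg_cong[where f = prob] Collect_cong conj_cong ball_cong refl) (smt (verit, best) int_nat_eq of_nat_add of_nat_eq_iff)
    finally show ?case .
  qed
  from Lim_transform_eventually[OF pattern_weight_limit[OF X q] this] show ?thesis unfolding R .
qed

theorem joint_convergence: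
  "sequence_converges_in_distribution
     M (\<lambda>j i \<omega>. (int (deg (n j) (v (n j) i \<omega>) \<omega>) - \<lfloor>a (n j)\<rfloor>, label_z j (v (n j) i \<omega>)))
     R (\<lambda>i \<omega>. (\<lfloor>P i \<omega> + \<epsilon>\<rfloor>, Z i \<omega>))"
  unfolding sequence_converges_in_distribution_def
proof
  fix K :: nat
  let ?D = "\<lambda>j i \<omega>. int (deg (n j) (v (n j) i \<omega>) \<omega>) - \<lfloor>a (n j)\<rfloor>" and ?Z = "\<lambda>j i \<omega>. label_z j (v (n j) i \<omega>)"
  \<comment> \<open>The ranks up to \<open>K\<close> are known to be measurable only once the tree
    has \<open>K\<close> vertices, so finitely many \<open>j\<close> are dropped first.\<close>
  have "eventually (\<lambda>j. K \<le> n j) sequentially" using n_lim unfolding filterlim_at_top by blast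
  then obtain j0 where j0: "\<And>j. j0 \<le> j \<Longrightarrow> K \<le> n j" unfolding eventually_sequentially by blast
  have vm: "v (n (j + j0)) i \<in> measurable M (count_space UNIV)" if "i \<in> {1..K}" for i j
    using j0[of "j + j0"] that by (intro ordering_measurable) auto
  have "converges_in_distribution (product_topology (\<lambda>_. euclidean) {1..K})
    M (\<lambda>j \<omega>. \<lambda>i\<in>{1..K}. (?D (j + j0) i \<omega>, ?Z (j + j0) i \<omega>)) R (\<lambda>\<omega>. \<lambda>i\<in>{1..K}. (\<lfloor>P i \<omega> + \<epsilon>\<rfloor>, Z i \<omega>))"
  proof (rule converges_if_patterns_converge[OF prob_space_axioms R.prob_space_axioms])
    fix i j assume i: "i \<in> {1..K}"
    have "(\<lambda>\<omega>. deg (n (j + j0)) (v (n (j + j0)) i \<omega>) \<omega>) \<in> measurable M (count_space UNIV)"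
      by (rule measurable_compose_countable[where f = "deg (n (j + j0))", OF deg_measurable vm[OF i]])
    thus "?D (j + j0) i \<in> measurable M (count_space UNIV)" by (rule measurable_compose) simp
    show "?Z (j + j0) i \<in> borel_measurable M" by (rule measurable_compose[OF vm[OF i]]) simp
  next
    fix i assume i: "i \<in> {1..K}"
    have [measurable]: "P i \<in> borel_measurable R" using P_measurable i by simp
    show "(\<lambda>\<omega>. \<lfloor>P i \<omega> + \<epsilon>\<rfloor>) \<in> measurable R (count_space UNIV)" by measurable
    show "Z i \<in> borel_measurable R" using Z_measurable i by simp
  next
    fix X and q :: "nat \<Rightarrow> int \<times> real set"
    assume X: "finite X" and q: "\<And>i. i \<in> {1..K} \<Longrightarrow> snd (q i) \<in> Pow X"
    from LIMSEQ_ignore_initial_segment[OF pattern_limit[where K = K and q = q, OF X q], where k = j0]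
    show "(\<lambda>j. prob {\<omega> \<in> space M. \<forall>i\<in>{1..K}. ?D (j + j0) i \<omega> = fst (q i) \<and> cell X (?Z (j + j0) i \<omega>) = snd (q i)})
       \<longlonglongrightarrow> R.prob {\<omega> \<in> space R. \<forall>i\<in>{1..K}. \<lfloor>P i \<omega> + \<epsilon>\<rfloor> = fst (q i) \<and> cell X (Z i \<omega>) = snd (q i)}" .
  qed
  thus "converges_in_distribution (product_topology (\<lambda>_. euclidean) {1..K})
    M (\<lambda>j \<omega>. \<lambda>i\<in>{1..K}. (?D j i \<omega>, ?Z j i \<omega>)) R (\<lambda>\<omega>. \<lambda>i\<in>{1..K}. (\<lfloor>P i \<omega> + \<epsilon>\<rfloor>, Z i \<omega>))"
    by (rule converges_in_distribution_offset[where X = "\<lambda>j \<omega>. \<lambda>i\<in>{1..K}. (?D j i \<omega>, ?Z j i \<omega>)"])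
qed

end

theorem theorem7p2:
  fixes M :: "'a measure" and W :: "nat \<Rightarrow> 'a \<Rightarrow> real" and pa :: "nat \<Rightarrow> 'a \<Rightarrow> nat"
    and v :: "nat \<Rightarrow> nat \<Rightarrow> 'a \<Rightarrow> nat"
    and \<alpha> \<beta> \<theta> \<mu> \<sigma>sq c \<epsilon> :: real and a :: "nat \<Rightarrow> real" and n :: "nat \<Rightarrow> nat"
    and R :: "'b measure" and PP :: "'b \<Rightarrow> real measure" and P Z :: "nat \<Rightarrow> 'b \<Rightarrow> real"
  assumes "\<alpha> > 0" and "\<beta> > 0"
    and "degree_ordered_wrt M (beta_distribution \<alpha> \<beta>) W pa v"
    and "\<theta> = 1 + (\<integral>w. w \<partial>beta_distribution \<alpha> \<beta>)"
    and "\<mu> = 1 - (\<theta> - 1) / (\<theta> * ln \<theta>)"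
    and "\<sigma>sq = 1 - (\<theta> - 1)\<^sup>2 / (\<theta>\<^sup>2 * ln \<theta>)"
    and "c = Gamma (\<alpha> + \<beta>) / Gamma \<alpha> * (1 - inverse \<theta>) powr (- \<beta>)"
    and "\<And>m. a m = log \<theta> (real m) - \<beta> * log \<theta> (log \<theta> (real m))"
    and "0 \<le> \<epsilon>" and "\<epsilon> \<le> 1"
    and "\<And>j. n j > 0" and "filterlim n at_top sequentially"
    and "(\<lambda>j. a (n j) - \<lfloor>a (n j)\<rfloor>) \<longlonglongrightarrow> \<epsilon>"
    and "prob_space R"
    and "poisson_point_process R (density lborel (\<lambda>x. ennreal (c * \<theta> powr (- x) * ln \<theta>))) PP"
    and "AE \<omega> in R. points_in_decreasing_order (PP \<omega>) (\<lambda>i. P i \<omega>)"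
    and "prob_space.indep_vars R (\<lambda>_. borel) Z {1..}"
    and "\<And>i. i \<ge> 1 \<Longrightarrow> distr R borel (Z i) = std_normal_distribution"
    and "prob_space.indep_var R
           (\<Pi>\<^sub>M i\<in>{1..}. borel) (\<lambda>\<omega>. \<lambda>i\<in>{1..}. P i \<omega>)
           (\<Pi>\<^sub>M i\<in>{1..}. borel) (\<lambda>\<omega>. \<lambda>i\<in>{1..}. Z i \<omega>)"
  shows "sequence_converges_in_distribution
           M (\<lambda>j i \<omega>. (int (in_degree (wrt_graph (\<lambda>m. pa m \<omega>) (n j)) (v (n j) i \<omega>)) - \<lfloor>a (n j)\<rfloor>,
                       (ln (real (v (n j) i \<omega>)) - \<mu> * ln (real (n j)))
                         / sqrt ((1 - \<sigma>sq) * ln (real (n j)))))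
           R (\<lambda>i \<omega>. (\<lfloor>P i \<omega> + \<epsilon>\<rfloor>, Z i \<omega>))"
proof -
  define lam where "lam = 1 / (\<theta> - 1)"
  interpret degree_ordered_wrt M "beta_distribution \<alpha> \<beta>" W pa v by fact
  interpret T: beta_tree_setting \<alpha> \<beta> \<theta> lam \<epsilon> a n
    by unfold_locales (fact assms lam_def)+
  have "(1 - inverse \<theta>) powr (- \<beta>) = (1 + lam) powr \<beta>"
    using T.lam(1) unfolding T.lam(5)[symmetric] by (simp add: powr_divide powr_minus inverse_eq_divide)
  hence c: "c = T.clim" unfolding assms(7) T.clim_def by simp
  interpret R: prob_space R by fact
  interpret beta_wrt_limit M W pa v \<alpha> \<beta> \<theta> lam \<epsilon> a n R PP P Z
    using assms(15-19) unfolding c by unfold_locales auto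
  show ?thesis
    using joint_convergence unfolding T.label_z_def in_degree_eq_deg assms(5,6) .
qed

end
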